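(* Let $\Gamma\subset\mathbb{R}^3$ be a (compact, connected) semialgebraic graph. Then $$K(\Gamma)\ge 1+b_1(\Gamma),$$ with equality if and only if $\Gamma$ is tight.
   Context: A semialgebraic graph is a compact connected one-dimensional semialgebraic set $\Gamma\subset\mathbb{R}^3$ together with a finite subset $V\subset\Gamma$ (the vertices) such that $\Gamma\setminus V$ is a finite disjoint union of real analytic, bounded semialgebraic arcs without self-intersections, each connecting two different points of $V$ (the open edges). Multiple edges between two vertices are allowed. $b_1(\Gamma)$ is the first Betti number. For $p\in\Gamma$, $\mathbf{N}_p\subset S^2$ is the finite set of all limits $\lim_k \frac{q_k-p}{|q_k-p|}$ with $q_k\in\Gamma\setminus\{p\}$, $q_k\to p$. For $u\in S^2$ let $h_u(x)=(u,x)$ (Euclidean inner product). A vector $u\in S^2$ is $\Gamma$-nondegenerate if the restriction of $h_u$ to each open edge has only nondegenerate critical points and $(u,\tau)\ne0$ for all $v\in V$, $\tau\in\mathbf{N}_v$; $\Delta_\Gamma\subset S^2$ is the (measure zero) set of vectors that are not $\Gamma$-nondegenerate. For nondegenerate $u$ and $p\in\Gamma$, $d^-_p(u)$ is the number of $q\in\Gamma$ with $|p-q|=\varepsilon$ and $h_u(q)<h_u(p)$, for all sufficiently small $\varepsilon>0$. Put $w(p,u)=1$ if $p$ is a local minimum of $h_u|_\Gamma$ and $w(p,u)=d^-_p(u)-1$ otherwise; let $w_\Gamma(u)=\sum_{p\in\Gamma}w(p,u)$ (only finitely many nonzero terms). The total curvature of $\Gamma$ is $K(\Gamma)=\frac1{4\pi}\int_{S^2}w_\Gamma(u)\,|d\sigma(u)|$,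 where $|d\sigma|$ is the Euclidean area density on $S^2$. The graph $\Gamma$ is tight if $w_\Gamma(u)=1+b_1(\Gamma)$ for all $u\in S^2\setminus\Delta_\Gamma$. *)

theory Defs
  imports "HOL-Analysis.Analysis" "HOL-Homology.Homology"
begin

inductive semialgebraic :: "'a::real_normed_vector set \<Rightarrow> bool" where
  pos: "real_polynomial_function f \<Longrightarrow> semialgebraic {x. f x > 0}"
| compl: "semialgebraic A \<Longrightarrow> semialgebraic (- A)"
| un: "semialgebraic A \<Longrightarrow> semialgebraic B \<Longrightarrow> semialgebraic (A \<union> B)"

definition real_analytic_on :: "(real \<Rightarrow> 'a::real_normed_vector) \<Rightarrow> real set \<Rightarrow> bool"
  (infixl \<open>(real'_analytic'_on)\<close> 50) where
  "f real_analytic_on S \<longleftrightarrow>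
     (\<forall>s\<in>S. \<exists>r>0. \<exists>a :: nat \<Rightarrow> 'a. \<forall>t. \<bar>t - s\<bar> < r \<longrightarrow> (\<lambda>n. (t - s) ^ n *\<^sub>R a n) sums f t)"

text \<open>An open edge is the interior \<open>g ` {0<..<1}\<close> of an arc \<open>g\<close>. The arc is a regular real
  analytic parametrisation on the open interval but only continuous at its end points;
  injectivity of \<open>g\<close> on the closed interval makes the two end points different.\<close>

definition edge_param :: "(real^3) set \<Rightarrow> (real \<Rightarrow> real^3) \<Rightarrow> (real^3) set \<Rightarrow> bool" where
  "edge_param V g e \<longleftrightarrow>
     arc g \<and> pathstart g \<in> V \<and> pathfinish g \<in> V \<and> e = g ` {0<..<1} \<and>
     g real_analytic_on {0<..<1} \<and> (\<forall>t\<in>{0<..<1}. vector_derivative g (at t) \<noteq> 0)"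

definition open_edge :: "(real^3) set \<Rightarrow> (real^3) set \<Rightarrow> bool" where
  "open_edge V e \<longleftrightarrow> semialgebraic e \<and> bounded e \<and> (\<exists>g. edge_param V g e)"

text \<open>\<open>E\<close> is the set of open edges; it is determined by \<open>\<Gamma>\<close> and \<open>V\<close>, being the set of
  components of \<open>\<Gamma> - V\<close>. For semialgebraic sets the small inductive dimension, \<open>dim_le\<close>,
  is the semialgebraic dimension.\<close>

definition semialgebraic_graph ::
  "(real^3) set \<Rightarrow> (real^3) set \<Rightarrow> (real^3) set set \<Rightarrow> bool" where
  "semialgebraic_graph \<Gamma> V E \<longleftrightarrow>
     semialgebraic \<Gamma> \<and> compact \<Gamma> \<and> connected \<Gamma> \<and>
     top_of_set \<Gamma> dim_le 1 \<and> \<not> top_of_set \<Gamma> dim_le 0 \<and>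
     finite V \<and> V \<subseteq> \<Gamma> \<and>
     finite E \<and> disjoint E \<and> \<Union>E = \<Gamma> - V \<and> (\<forall>e\<in>E. open_edge V e)"

text \<open>The rank of an abelian group is the largest size of a \<open>\<int>\<close>-linearly independent
  subset; it is only meaningful when these sizes are bounded.\<close>

definition int_independent :: "('a, 'b) monoid_scheme \<Rightarrow> 'a set \<Rightarrow> bool" where
  "int_independent G B \<longleftrightarrow>
     (\<forall>c :: 'a \<Rightarrow> int. finprod G (\<lambda>x. x [^]\<^bsub>G\<^esub> c x) B = \<one>\<^bsub>G\<^esub> \<longrightarrow> (\<forall>x\<in>B. c x = 0))"

definition group_rank :: "('a, 'b) monoid_scheme \<Rightarrow> nat" where
  "group_rank G = (GREATEST n. \<exists>B \<subseteq> carrier G. finite B \<and> card B = n \<and> int_independent G B)"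

definition first_betti :: "'a::topological_space set \<Rightarrow> nat" where
  "first_betti X = group_rank (homology_group 1 (top_of_set X))"

definition tangent_directions :: "(real^3) set \<Rightarrow> real^3 \<Rightarrow> (real^3) set" where
  "tangent_directions \<Gamma> p =
     {\<tau>. \<exists>q :: nat \<Rightarrow> real^3. (\<forall>k. q k \<in> \<Gamma> - {p}) \<and> q \<longlonglongrightarrow> p \<and>
        (\<lambda>k. (q k - p) /\<^sub>R norm (q k - p)) \<longlonglongrightarrow> \<tau>}"

text \<open>Nondegeneracy of the critical points of the height function on an edge does not depend
  on the choice of the regular parametrisation \<open>g\<close>.\<close>

definition nondegenerate ::
  "(real^3) set \<Rightarrow> (real^3) set \<Rightarrow> (real^3) set set \<Rightarrow> real^3 \<Rightarrow> bool" where
  "nondegenerate \<Gamma> V E u \<longleftrightarrow>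
     u \<in> sphere 0 1 \<and>
     (\<forall>e\<in>E. \<exists>g. edge_param V g e \<and>
        (\<forall>t\<in>{0<..<1}. deriv (\<lambda>s. u \<bullet> g s) t = 0 \<longrightarrow> deriv (deriv (\<lambda>s. u \<bullet> g s)) t \<noteq> 0)) \<and>
     (\<forall>v\<in>V. \<forall>\<tau>\<in>tangent_directions \<Gamma> v. u \<bullet> \<tau> \<noteq> 0)"

definition lower_degree :: "(real^3) set \<Rightarrow> real^3 \<Rightarrow> real^3 \<Rightarrow> nat" where
  "lower_degree \<Gamma> p u =
     (THE n. \<forall>\<^sub>F \<epsilon> in at_right 0.
        finite {q\<in>\<Gamma>. dist p q = \<epsilon> \<and> u \<bullet> q < u \<bullet> p} \<and>
        card {q\<in>\<Gamma>. dist p q = \<epsilon> \<and> u \<bullet> q < u \<bullet> p} = n)"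

definition weight :: "(real^3) set \<Rightarrow> real^3 \<Rightarrow> real^3 \<Rightarrow> int" where
  "weight \<Gamma> p u =
     (if \<exists>r>0. \<forall>q\<in>\<Gamma>. dist p q < r \<longrightarrow> u \<bullet> p \<le> u \<bullet> q then 1
      else int (lower_degree \<Gamma> p u) - 1)"

definition total_weight :: "(real^3) set \<Rightarrow> real^3 \<Rightarrow> int" where
  "total_weight \<Gamma> u = (\<Sum>p | p \<in> \<Gamma> \<and> weight \<Gamma> p u \<noteq> 0. weight \<Gamma> p u)"

text \<open>Euclidean area of a Borel set \<open>A\<close> of the unit sphere, obtained from Lebesgue measure in
  polar coordinates: it is three times the volume of the cone \<open>{r *\<^sub>R x | r x. 0 < r \<le> 1 \<and> x \<in> A}\<close>
  (as \<open>\<integral>\<^sub>0\<^sup>1 r\<^sup>2 dr = 1/3\<close>), where \<open>sgn x = x /\<^sub>R norm x\<close>.\<close>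

definition sphere_area :: "(real^3) measure" where
  "sphere_area =
     scale_measure 3
       (distr (restrict_space lborel (cball 0 1 - {0})) (restrict_space borel (sphere 0 1)) sgn)"

text \<open>The weight is only given for nondegenerate \<open>u\<close>, the degenerate ones being a null set.\<close>

definition total_curvature :: "(real^3) set \<Rightarrow> (real^3) set \<Rightarrow> (real^3) set set \<Rightarrow> real" where
  "total_curvature \<Gamma> V E =
     1 / (4 * pi) *
     (LINT u : {u. nondegenerate \<Gamma> V E u} | sphere_area. real_of_int (total_weight \<Gamma> u))"

definition tight :: "(real^3) set \<Rightarrow> (real^3) set \<Rightarrow> (real^3) set set \<Rightarrow> bool" where
  "tight \<Gamma> V E \<longleftrightarrow>
     (\<forall>u. nondegenerate \<Gamma> V E u \<longrightarrow> total_weight \<Gamma> u = 1 + int (first_betti \<Gamma>))"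

end

theory Submission
  imports Defs
begin

text \<open>Fix a nondegenerate direction \<open>u\<close> and let \<open>m(u)\<close> be the number of local minima of the height
  \<open>u \<bullet> p\<close> on the graph. Everything rests on the formula
  \<open>w(u) = 2 m(u) - 1 + b\<^sub>1\<close>, which is \<open>total_weight_minima\<close>. An interior point of an
  edge has weight 0 unless it is critical, and then it has weight 1: a minimum by convention, a maximum because its
  lower degree is 2. A vertex has weight \<open>d - 1\<close>, where \<open>d\<close> counts the edge ends that
  descend from it, with 2 added when \<open>d = 0\<close>, that is, when the vertex is a minimum. Along an edge the
  derivative of the height changes sign exactly at the critical points, upwards at minima and downwards at maxima. If
  \<open>a\<close> minima lie on the edge and \<open>c\<close> of its two ends descend, it therefore has
  \<open>2 a + 1 - c\<close> critical points (\<open>edge_count\<close>). On summing, the lower degrees cancel and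
  \<open>2 m(u) + |E| - |V|\<close> remains; attaching the edges one by one to a single vertex shows that
  \<open>|V| - |E| = 1 - b\<^sub>1\<close> (\<open>first_betti_graph\<close>).

  A continuous function on a compact set attains its minimum. Hence \<open>w(u) \<ge> 1 + b\<^sub>1\<close>, the
  difference being \<open>2 (m(u) - 1)\<close>, and the curvature exceeds \<open>1 + b\<^sub>1\<close> by the mean of
  this excess over the sphere. Three facts turn this into the theorem. The degenerate directions form a Borel null
  set, by Sard's theorem. On the other directions \<open>m\<close> is bounded. And \<open>m\<close> is lower
  semicontinuous there, because a strict local minimum survives a small rotation of the direction
  (\<open>card_minima_lower_semicontinuous\<close>); this makes the excess measurable, and it also settles the case of
  equality, since an excess at one nondegenerate direction forces an excess on a set of positive area around it.

  Semialgebraicity is what controls an edge near its end points, where its parametrisation is merely continuous, and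
  what bounds the number of critical points uniformly in \<open>u\<close>. Near most of its points, an edge fills the
  zero set of a polynomial. If two coordinates were algebraically independent on the edge, one could solve a
  polynomial equation for the third coordinate and the projection of the edge to a plane would contain a square, which
  is impossible for a differentiable curve (\<open>two_coordinates_dependent\<close>). So the polynomial functions on
  the edge are algebraic over the polynomials in one coordinate, and a polynomial that does not vanish on the whole
  edge has finitely many zeros there (\<open>polynomial_zeros_finite\<close>). Differentiating the algebraic relations
  yields a polynomial vector field tangent to the edge; up to a common factor, derivatives of polynomials along the
  edge are then polynomials (\<open>polynomial_derivation\<close>). This gives one-sided tangents and monotone
  distances at the vertices (\<open>start_behaviour\<close>), and an iteration of Rolle's theorem bounds the number of
  critical points (\<open>critical_points_bounded\<close>).\<close>

section \<open>Real analytic functions on the unit interval\<close>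

text \<open>Analyticity is phrased through formal power series so that sums, products and derivatives come from the calculus
  of \<open>has_fps_expansion\<close>.\<close>

definition analytic_ioo :: "(real \<Rightarrow> real) \<Rightarrow> bool" where
  "analytic_ioo f \<longleftrightarrow> (\<forall>s\<in>{0<..<1}. \<exists>F. (\<lambda>h. f (s + h)) has_fps_expansion F)"

text \<open>Dividing by the leading power of the variable leaves a continuous function that does not vanish at the
  origin.\<close>

lemma fps_expansion_nonzero_near:
  fixes f :: "real \<Rightarrow> real"
  assumes "f has_fps_expansion F" "F \<noteq> 0"
  shows "\<forall>\<^sub>F h in at 0. f h \<noteq> 0"
proof -
  let ?m = "subdegree F"
  let ?q = "\<lambda>x. if x = 0 then fps_nth F ?m else f x / x ^ ?m"
  have "?q has_fps_expansion fps_shift ?m F"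
    using has_fps_expansion_shift[OF assms(1), of ?m] by auto
  then have "continuous (at 0) ?q"
    using has_fps_expansion_imp_continuous by blast
  moreover have "?q 0 \<noteq> 0" using assms(2) by simp
  ultimately have "\<forall>\<^sub>F h in at 0. ?q h \<noteq> 0"
    by (intro tendsto_imp_eventually_ne[of ?q "?q 0"]) (auto simp only: isCont_def)
  moreover have "\<forall>\<^sub>F h in at 0. h \<noteq> (0::real)"
    by (simp add: eventually_at_filter)
  ultimately show ?thesis
    by eventually_elim auto
qed

lemma fps_expansion_zero_unique:
  fixes f :: "real \<Rightarrow> real"
  assumes "f has_fps_expansion F" "\<forall>\<^sub>F h in at 0. f h = 0"
  shows "F = 0"
proof (rule ccontr)
  assume "F \<noteq> 0"
  from fps_expansion_nonzero_near[OF assms(1) this] assms(2)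
  have "\<forall>\<^sub>F h in at (0::real). False" by eventually_elim auto
  then show False by simp
qed

lemma analytic_ioo_const: "analytic_ioo (\<lambda>t. c)"
  unfolding analytic_ioo_def using has_fps_expansion_const by blast

lemma analytic_ioo_add: "analytic_ioo f \<Longrightarrow> analytic_ioo g \<Longrightarrow> analytic_ioo (\<lambda>t. f t + g t)"
  unfolding analytic_ioo_def using has_fps_expansion_add by blast

lemma analytic_ioo_mult: "analytic_ioo f \<Longrightarrow> analytic_ioo g \<Longrightarrow> analytic_ioo (\<lambda>t. f t * g t)"
  unfolding analytic_ioo_def using has_fps_expansion_mult by blast

lemma analytic_ioo_sum: "finite I \<Longrightarrow> (\<And>i. i \<in> I \<Longrightarrow> analytic_ioo (f i)) \<Longrightarrow> analytic_ioo (\<lambda>t. \<Sum>i\<in>I. f i t)"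
  by (induction I rule: finite_induct) (auto intro: analytic_ioo_const analytic_ioo_add)

lemma fps_expansion_has_derivative:
  fixes f :: "real \<Rightarrow> real"
  assumes "(\<lambda>h. f (s + h)) has_fps_expansion F"
  shows "\<exists>d. (f has_real_derivative d) (at s)"
proof -
  have r: "fps_conv_radius F > 0" and ev: "\<forall>\<^sub>F h in nhds 0. eval_fps F h = f (s + h)"
    using assms by (auto simp: has_fps_expansion_def)
  have "(eval_fps F has_field_derivative eval_fps (fps_deriv F) 0) (at 0)"
    using r by (intro has_field_derivative_eval_fps) (auto simp: zero_ereal_def)
  then have "((\<lambda>h. f (s + h)) has_real_derivative eval_fps (fps_deriv F) 0) (at 0)"
    using DERIV_cong_ev[OF refl ev refl] by auto
  then show ?thesis using DERIV_shift[of f _ 0 s]  by (auto simp: add.commute)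
qed

lemma analytic_ioo_DERIV:
  assumes "analytic_ioo f" "t \<in> {0<..<1}"
  shows "(f has_real_derivative deriv f t) (at t)"
proof -
  obtain F where "(\<lambda>h. f (t + h)) has_fps_expansion F" using assms unfolding analytic_ioo_def by blast
  from fps_expansion_has_derivative[OF this] show ?thesis by (auto simp: DERIV_imp_deriv)
qed

lemma analytic_ioo_deriv:
  assumes "analytic_ioo f"
  shows "analytic_ioo (deriv f)"
  unfolding analytic_ioo_def
proof
  fix s :: real assume s: "s \<in> {0<..<1}"
  then obtain F where F: "(\<lambda>h. f (s + h)) has_fps_expansion F"
    using assms s unfolding analytic_ioo_def by blast
  then have r: "fps_conv_radius F > 0" and ev: "\<forall>\<^sub>F h in nhds 0. eval_fps F h = f (s + h)"
    by (auto simp: has_fps_expansion_def)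
  have "\<forall>\<^sub>F h in nhds (0::real). h \<in> eball 0 (fps_conv_radius F)"
    using r by (intro eventually_nhds_in_open) (auto simp: zero_ereal_def)
  moreover have "\<forall>\<^sub>F h in nhds 0. \<forall>\<^sub>F k in nhds h. eval_fps F k = f (s + k)"
    using ev by (simp add: eventually_eventually)
  ultimately have "\<forall>\<^sub>F h in nhds 0. eval_fps (fps_deriv F) h = deriv f (s + h)"
  proof eventually_elim
    case (elim h)
    have "(eval_fps F has_field_derivative eval_fps (fps_deriv F) h) (at h)"
      using elim(1) by (intro has_field_derivative_eval_fps) auto
    then have "((\<lambda>h. f (s + h)) has_real_derivative eval_fps (fps_deriv F) h) (at h)"
      using DERIV_cong_ev[OF refl elim(2) refl] by auto
    then have "(f has_real_derivative eval_fps (fps_deriv F) h) (at (s + h))"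
      using DERIV_shift[of f _ h s] by (auto simp: add.commute)
    then show ?case by (simp add: DERIV_imp_deriv)
  qed
  moreover have "fps_conv_radius (fps_deriv F) > 0"
    using r by (rule less_le_trans[OF _ fps_conv_radius_deriv])
  ultimately show "\<exists>F. (\<lambda>h. deriv f (s + h)) has_fps_expansion F"
    unfolding has_fps_expansion_def by blast
qed

lemma analytic_ioo_continuous_on: "analytic_ioo f \<Longrightarrow> continuous_on {0<..<1} f"
  using DERIV_isCont[OF analytic_ioo_DERIV] continuous_at_imp_continuous_on by blast

text \<open>The identity theorem: the interval is covered by the open set of points near which the function vanishes and the
  open set of points near which it has no other zero, and these are disjoint, so by connectedness one of them is
  everything.\<close>

lemma analytic_ioo_identity:
  assumes an: "analytic_ioo f"
  shows "(\<forall>t\<in>{0<..<1}. f t = 0) \<or> (\<forall>s\<in>{0<..<1}. \<forall>\<^sub>F t in at s. f t \<noteq> 0)"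
proof -
  define A where "A = {s. \<forall>\<^sub>F t in nhds s. f t = 0}"
  define B where "B = {s. \<forall>\<^sub>F t in at s. f t \<noteq> 0}"
  have oA: "open A"
  proof (subst open_subopen, rule ballI)
    fix x assume "x \<in> A"
    then obtain U where "open U" "x \<in> U" "\<forall>y\<in>U. f y = 0"
      unfolding A_def eventually_nhds by auto
    then show "\<exists>T. open T \<and> x \<in> T \<and> T \<subseteq> A"
      unfolding A_def eventually_nhds by (intro exI[of _ U]) auto
  qed
  have oB: "open B"
  proof (subst open_subopen, rule ballI)
    fix x assume "x \<in> B"
    then obtain U where U: "open U" "x \<in> U" "\<forall>y\<in>U. y \<noteq> x \<longrightarrow> f y \<noteq> 0"
      unfolding B_def eventually_at_topological by auto
    have "y \<in> B" if "y \<in> U" for y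
    proof (cases "y = x")
      case False
      then have "\<forall>z\<in>U - {x}. f z \<noteq> 0" "open (U - {x})" "y \<in> U - {x}" using U that by auto
      then show ?thesis unfolding B_def eventually_at_topological by blast
    qed (use \<open>x \<in> B\<close> in auto)
    then show "\<exists>T. open T \<and> x \<in> T \<and> T \<subseteq> B" using U by (intro exI[of _ U]) auto
  qed
  have cov: "{0<..<1} \<subseteq> A \<union> B"
  proof
    fix s :: real assume "s \<in> {0<..<1}"
    then obtain F where F: "(\<lambda>h. f (s + h)) has_fps_expansion F"
      using an unfolding analytic_ioo_def by blast
    show "s \<in> A \<union> B"
    proof (cases "F = 0")
      case True
      then have "\<forall>\<^sub>F h in nhds 0. f (s + h) = 0" using F by (auto simp: has_fps_expansion_def)
      then have "\<forall>\<^sub>F t in nhds s. f t = 0"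
        using eventually_filtermap[of _ "\<lambda>h. h + s" "nhds 0"] filtermap_nhds_shift[of "-s" 0]
        by (simp add: add.commute)
      then show ?thesis by (simp add: A_def)
    next
      case False
      have "\<forall>\<^sub>F h in at 0. f (s + h) \<noteq> 0" using fps_expansion_nonzero_near[OF F False] .
      then have "\<forall>\<^sub>F t in at s. f t \<noteq> 0" by (subst at_to_0) (simp add: eventually_filtermap add.commute)
      then show ?thesis by (simp add: B_def)
    qed
  qed
  have dis: "A \<inter> B \<inter> {0<..<1} = {}"
  proof -
    have False if "x \<in> A" "x \<in> B" for x
    proof -
      have "\<forall>\<^sub>F t in at x. f t = 0" using that(1) by (simp add: A_def eventually_nhds_conv_at)
      moreover have "\<forall>\<^sub>F t in at x. f t \<noteq> 0" using that(2) by (simp add: B_def)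
      ultimately have "\<forall>\<^sub>F t in at x. False" by eventually_elim auto
      then show False by simp
    qed
    then show ?thesis by auto
  qed
  have "A \<inter> {0<..<1} = {} \<or> B \<inter> {0<..<1} = {}"
    using connectedD[OF connected_Ioo oA oB dis cov] .
  then show ?thesis
  proof
    assume "A \<inter> {0<..<1} = {}" then show ?thesis using cov by (auto simp: B_def)
  next
    assume "B \<inter> {0<..<1} = {}" then have "{0<..<1} \<subseteq> A" using cov by auto
    then show ?thesis by (auto simp: A_def dest: eventually_nhds_x_imp_x)
  qed
qed

text \<open>All the functions are nonzero at every point close to \<open>1/2\<close>, except perhaps at \<open>1/2\<close>
  itself.\<close>

lemma analytic_ioo_common_nonzero:
  assumes "finite \<F>" "\<And>f. f \<in> \<F> \<Longrightarrow> analytic_ioo f" "\<And>f. f \<in> \<F> \<Longrightarrow> \<exists>t\<in>{0<..<1}. f t \<noteq> 0"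
  shows "\<exists>t\<in>{0<..<1}. \<forall>f\<in>\<F>. f t \<noteq> 0"
proof -
  have "\<forall>f\<in>\<F>. \<forall>\<^sub>F t in at (1/2). f t \<noteq> 0"
  proof
    fix f assume "f \<in> \<F>"
    with analytic_ioo_identity[of f] assms(2,3) show "\<forall>\<^sub>F t in at (1/2). f t \<noteq> 0" by fastforce
  qed
  then have 1: "\<forall>\<^sub>F t in at (1/2). \<forall>f\<in>\<F>. f t \<noteq> 0"
    using assms(1) by (simp add: eventually_ball_finite)
  have 2: "\<forall>\<^sub>F t in at (1/2). t \<in> {0<..<1::real}"
    by (rule eventually_at_in_open') auto
  from eventually_happens'[OF _ eventually_conj[OF 1 2]]  show ?thesis by auto
qed

lemma analytic_ioo_mult_eq_0:
  assumes "analytic_ioo f" "analytic_ioo g" "\<And>t. t \<in> {0<..<1} \<Longrightarrow> f t * g t = 0"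
  shows "(\<forall>t\<in>{0<..<1}. f t = 0) \<or> (\<forall>t\<in>{0<..<1}. g t = 0)"
proof (rule ccontr)
  assume "\<not> ?thesis"
  then have "\<exists>t\<in>{0<..<1}. \<forall>h\<in>{f,g}. h t \<noteq> 0"
    using assms(1,2) by (intro analytic_ioo_common_nonzero) auto
  then obtain t where "t \<in> {0<..<1}" "f t \<noteq> 0" "g t \<noteq> 0" by auto
  with assms(3)[of t] show False by simp
qed

lemma real_polynomial_function_nth: "real_polynomial_function (\<lambda>x::real^'n. x $ i)"
  by (intro real_polynomial_function.intros(1) bounded_linear_vec_nth)

lemma linear_functional_coordinates:
  fixes f :: "real^'n \<Rightarrow> real"
  assumes "bounded_linear f" shows "f x = (\<Sum>i\<in>UNIV. x $ i * f (axis i 1))"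
proof -
  have lin: "linear f" using assms by (rule bounded_linear.linear)
  have "f x = f (\<Sum>i\<in>UNIV. (x $ i) *\<^sub>R axis i 1)"
    by (metis (no_types, lifting) basis_expansion scalar_mult_eq_scaleR sum.cong)
  also have "\<dots> = (\<Sum>i\<in>UNIV. x $ i * f (axis i 1))"
    by (simp add: linear_sum[OF lin] linear_cmul[OF lin])
  finally show ?thesis .
qed

lemma analytic_ioo_polynomial:
  fixes g :: "real \<Rightarrow> real^'n"
  assumes g: "\<And>i. analytic_ioo (\<lambda>t. g t $ i)" and P: "real_polynomial_function P"
  shows "analytic_ioo (\<lambda>t. P (g t))"
  using P
proof induction
  case (linear f)
  have "(\<lambda>t. f (g t)) = (\<lambda>t. \<Sum>i\<in>UNIV. g t $ i * f (axis i 1))" by (rule ext) (rule linear_functional_coordinates[OF linear])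
  moreover have "analytic_ioo (\<lambda>t. \<Sum>i\<in>UNIV. g t $ i * f (axis i 1))"
    by (intro analytic_ioo_sum analytic_ioo_mult g analytic_ioo_const) auto
  ultimately show ?case by metis
qed (auto intro: analytic_ioo_const analytic_ioo_add analytic_ioo_mult)

section \<open>Polynomials in two and three variables\<close>

lemma real_polynomial_poly1:
  "real_polynomial_function (\<lambda>x::real^'n. poly q (x $ i))"
proof (induction q)
  case 0 show ?case using real_polynomial_function.intros(2)[of 0] by simp
next
  case (pCons a q)
  have "real_polynomial_function (\<lambda>x::real^'n. a + x $ i * poly q (x $ i))"
    by (intro real_polynomial_function.intros(3) real_polynomial_function.intros(4) real_polynomial_function_nth pCons.IH real_polynomial_function.intros(2)[of a])
  then show ?case by simp
qed

lemma real_polynomial_poly2: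
  "real_polynomial_function (\<lambda>x::real^'n. poly (poly q [:x $ j:]) (x $ i))"
proof (induction q)
  case 0 show ?case using real_polynomial_function.intros(2)[of 0] by simp
next
  case (pCons a q)
  have "real_polynomial_function (\<lambda>x::real^'n. poly a (x $ i) + x $ j * poly (poly q [:x $ j:]) (x $ i))"
    by (intro real_polynomial_function.intros(3) real_polynomial_function.intros(4) real_polynomial_function_nth pCons.IH real_polynomial_poly1)
  then show ?case by simp
qed

lemma real_polynomial_poly3:
  "real_polynomial_function (\<lambda>x::real^'n. poly (poly (poly q [:[:x $ k:]:]) [:x $ j:]) (x $ i))"
proof (induction q)
  case 0 show ?case using real_polynomial_function.intros(2)[of 0] by simp
next
  case (pCons a q)
  have "real_polynomial_function (\<lambda>x::real^'n. poly (poly a [:x $ j:]) (x $ i) + x $ k * poly (poly (poly q [:[:x $ k:]:]) [:x $ j:]) (x $ i))"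
    by (intro real_polynomial_function.intros(3) real_polynomial_function.intros(4) real_polynomial_function_nth pCons.IH real_polynomial_poly2)
  then show ?case by simp
qed

lemma UNIV_3_distinct:
  assumes "i \<noteq> j" "i \<noteq> k" "j \<noteq> (k::3)"
  shows "UNIV = {i,j,k}"
proof -
  have "card {i,j,k} = CARD(3)" using assms by simp
  then show ?thesis by (metis card_subset_eq finite top_greatest)
qed

text \<open>Polynomial functions of three variables are evaluated from nested univariate polynomials: the outermost variable
  is \<open>x $ k\<close>, then \<open>x $ j\<close>, and the innermost is \<open>x $ i\<close>. In this form the
  degree in the last variable, and division with respect to it, are available.\<close>

lemma real_polynomial_function_poly3:
  fixes P :: "real^3 \<Rightarrow> real"
  assumes ijk: "i \<noteq> j" "i \<noteq> k" "j \<noteq> (k::3)" and P: "real_polynomial_function P"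
  shows "\<exists>q. \<forall>x. P x = poly (poly (poly q [:[:x $ k:]:]) [:x $ j:]) (x $ i)"
  using P
proof induction
  case (linear f)
  have eq: "f x = x $ i * f (axis i 1) + x $ j * f (axis j 1) + x $ k * f (axis k 1)" for x
    using linear_functional_coordinates[OF linear, of x] ijk unfolding UNIV_3_distinct[OF ijk] by simp
  show ?case
    by (intro exI[of _ "[:[:[:0, f (axis i 1):], [:f (axis j 1):]:], [:[:f (axis k 1):]:]:]"] allI, subst eq)
       (simp add: algebra_simps)
next
  case (const c) show ?case by (intro exI[of _ "[:[:[:c:]:]:]"]) simp
next
  case (add f g) then obtain p q where
    "\<forall>x. f x = poly (poly (poly p [:[:x $ k:]:]) [:x $ j:]) (x $ i)"
    "\<forall>x. g x = poly (poly (poly q [:[:x $ k:]:]) [:x $ j:]) (x $ i)" by auto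
  then show ?case by (intro exI[of _ "p + q"]) simp
next
  case (mult f g) then obtain p q where
    "\<forall>x. f x = poly (poly (poly p [:[:x $ k:]:]) [:x $ j:]) (x $ i)"
    "\<forall>x. g x = poly (poly (poly q [:[:x $ k:]:]) [:x $ j:]) (x $ i)" by auto
  then show ?case by (intro exI[of _ "p * q"]) simp
qed

lemma DERIV_poly3_outer:
  "((\<lambda>z. poly (poly (poly f [:[:z:]:]) [:y:]) x) has_real_derivative
    poly (poly (poly (pderiv f) [:[:z:]:]) [:y:]) x) (at z)"
proof (induction f)
  case 0 show ?case by simp
next
  case (pCons a f)
  have "((\<lambda>z. poly (poly a [:y:]) x + z * poly (poly (poly f [:[:z:]:]) [:y:]) x) has_real_derivative
      0 + (z * poly (poly (poly (pderiv f) [:[:z:]:]) [:y:]) x + 1 * poly (poly (poly f [:[:z:]:]) [:y:]) x)) (at z)"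
    by (auto intro!: derivative_eq_intros pCons.IH)
  then show ?case by (simp add: pderiv_pCons algebra_simps)
qed

lemma DERIV_poly2:
  assumes "(x has_real_derivative x') (at t)" "(y has_real_derivative y') (at t)"
  shows "((\<lambda>t. poly (poly p [:y t:]) (x t)) has_real_derivative
    (poly (poly (map_poly pderiv p) [:y t:]) (x t) * x' + poly (poly (pderiv p) [:y t:]) (x t) * y')) (at t)"
proof (induction p)
  case 0 show ?case by simp
next
  case (pCons a p)
  have a: "((\<lambda>t. poly a (x t)) has_real_derivative poly (pderiv a) (x t) * x') (at t)"
    using DERIV_chain'[OF assms(1) poly_DERIV] by (simp add: mult.commute)
  have "((\<lambda>t. poly a (x t) + y t * poly (poly p [:y t:]) (x t)) has_real_derivative
     poly (pderiv a) (x t) * x' + (y t * (poly (poly (map_poly pderiv p) [:y t:]) (x t) * x' +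
        poly (poly (pderiv p) [:y t:]) (x t) * y') + y' * poly (poly p [:y t:]) (x t))) (at t)"
    by (intro DERIV_add DERIV_mult' a assms pCons.IH)
  then show ?case by (simp add: map_poly_pCons pderiv_pCons algebra_simps)
qed

text \<open>Pseudo-division multiplies the dividend by a power of the leading coefficient instead of dividing by it. It
  therefore never leaves a subring \<open>R\<close> that contains the coefficients of both polynomials.\<close>

lemma pseudo_division_subring:
  fixes R :: "'a::idom set" and p q :: "'a poly"
  assumes R0: "0 \<in> R" and R1: "1 \<in> R" and Radd: "\<And>a b. a \<in> R \<Longrightarrow> b \<in> R \<Longrightarrow> a + b \<in> R"
    and Rmul: "\<And>a b. a \<in> R \<Longrightarrow> b \<in> R \<Longrightarrow> a * b \<in> R" and Rneg: "\<And>a. a \<in> R \<Longrightarrow> - a \<in> R"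
    and q: "q \<noteq> 0" "\<And>n. Polynomial.coeff q n \<in> R" and p: "\<And>n. Polynomial.coeff p n \<in> R"
  shows "\<exists>k s r. Polynomial.smult (lead_coeff q ^ k) p = q * s + r \<and> (\<forall>n. Polynomial.coeff s n \<in> R) \<and>
            (\<forall>n. Polynomial.coeff r n \<in> R) \<and> (r = 0 \<or> Polynomial.degree r < Polynomial.degree q)"
  using p
proof (induction "if p = 0 then 0 else Suc (Polynomial.degree p)" arbitrary: p rule: less_induct)
  case less
  show ?case
  proof (cases "p = 0 \<or> Polynomial.degree p < Polynomial.degree q")
    case True
    then show ?thesis using less.prems R0
      by (intro exI[of _ 0] exI[of _ "0::'a poly"] exI[of _ p]) auto
  next
    case False
    define n where "n = Polynomial.degree p - Polynomial.degree q"
    define m where "m = Polynomial.monom (lead_coeff p) n"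
    define p' where "p' = Polynomial.smult (lead_coeff q) p - m * q"
    have deg: "Polynomial.degree p' \<le> Polynomial.degree p"
      unfolding p'_def m_def
    proof (intro degree_diff_le)
      show "Polynomial.degree (Polynomial.smult (lead_coeff q) p) \<le> Polynomial.degree p"
        by (rule degree_smult_le)
      have "Polynomial.degree (Polynomial.monom (lead_coeff p) n * q) \<le> n + Polynomial.degree q"
        using degree_mult_le[of "Polynomial.monom (lead_coeff p) n" q] degree_monom_le[of "lead_coeff p" n] by linarith
      then show "Polynomial.degree (Polynomial.monom (lead_coeff p) n * q) \<le> Polynomial.degree p"
        using False by (simp add: n_def)
    qed
    have "Polynomial.coeff p' (Polynomial.degree p) = 0"
      unfolding p'_def m_def using False by (simp add: n_def coeff_monom_mult)
    with deg have small: "p' = 0 \<or> Polynomial.degree p' < Polynomial.degree p" by (rule eq_zero_or_degree_less)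
    have mR: "Polynomial.coeff m i \<in> R" for i using less.prems R0 by (auto simp: m_def)
    have sumR: "(\<Sum>i\<in>I. f i) \<in> R" if "\<And>i. i \<in> I \<Longrightarrow> f i \<in> R" for f :: "nat \<Rightarrow> 'a" and I
      using that by (induction I rule: infinite_finite_induct) (auto simp: R0 Radd)
    have p'R: "Polynomial.coeff p' i \<in> R" for i
    proof -
      have "Polynomial.coeff (m * q) i \<in> R" unfolding Polynomial.coeff_mult by (intro sumR Rmul mR q)
      then have "lead_coeff q * Polynomial.coeff p i + - Polynomial.coeff (m * q) i \<in> R"
        by (intro Radd Rneg Rmul q less.prems)
      then show ?thesis by (simp add: p'_def)
    qed
    have "(if p' = 0 then 0 else Suc (Polynomial.degree p')) < (if p = 0 then 0 else Suc (Polynomial.degree p))"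
      using small False by auto
    from less.hyps[OF this p'R] obtain k s r where
      *: "Polynomial.smult (lead_coeff q ^ k) p' = q * s + r" "\<forall>n. Polynomial.coeff s n \<in> R" "\<forall>n. Polynomial.coeff r n \<in> R"
        "r = 0 \<or> Polynomial.degree r < Polynomial.degree q" by blast
    have lcR: "lead_coeff q ^ k \<in> R" by (induction k) (auto intro: R1 Rmul q)
    let ?s = "s + Polynomial.smult (lead_coeff q ^ k) m"
    have "Polynomial.smult (lead_coeff q ^ Suc k) p = q * ?s + r"
    proof -
      have "Polynomial.smult (lead_coeff q) p = p' + m * q" by (simp add: p'_def)
      then have "Polynomial.smult (lead_coeff q ^ Suc k) p = Polynomial.smult (lead_coeff q ^ k) (p' + m * q)"
        by (metis power_Suc2 smult_smult)
      then show ?thesis using *(1) by (simp add: smult_add_right algebra_simps)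
    qed
    moreover have "\<forall>n. Polynomial.coeff ?s n \<in> R" using *(2) mR lcR by (auto intro: Radd Rmul)
    ultimately show ?thesis using *(3,4) by blast
  qed
qed

text \<open>If \<open>y\<close> is algebraic over \<open>R\<close>, then every nonzero element of \<open>R[y]\<close> has a
  nonzero multiple in \<open>R\<close>; this is the ring form of the fact that inverses of algebraic elements are
  again polynomials in \<open>y\<close>. The multiple is found by a Euclidean descent. Among the polynomials whose
  value at \<open>y\<close> is a nonzero multiple of the given one, take \<open>q\<close> of least degree, and let
  \<open>f\<^sub>0\<close> be a relation of least degree. If \<open>q\<close> is not constant, then the remainder of
  \<open>f\<^sub>0\<close> by \<open>q\<close> is again such a multiple or yields a shorter relation.\<close>

lemma nonzero_divides_base_element:
  fixes R :: "'a::idom set" and y :: 'a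
  assumes R0: "0 \<in> R" and R1: "1 \<in> R" and Radd: "\<And>a b. a \<in> R \<Longrightarrow> b \<in> R \<Longrightarrow> a + b \<in> R"
    and Rmul: "\<And>a b. a \<in> R \<Longrightarrow> b \<in> R \<Longrightarrow> a * b \<in> R" and Rneg: "\<And>a. a \<in> R \<Longrightarrow> - a \<in> R"
    and f: "f \<noteq> 0" "\<And>n. Polynomial.coeff f n \<in> R" "poly f y = 0"
    and p: "\<And>n. Polynomial.coeff p n \<in> R" "poly p y \<noteq> 0"
  shows "\<exists>b. (\<forall>n. Polynomial.coeff b n \<in> R) \<and> poly p y * poly b y \<in> R - {0}"
proof -
  define S where "S = {q. \<forall>n. Polynomial.coeff q n \<in> R}"
  define A where "A = {q \<in> S. q \<noteq> 0 \<and> poly q y = 0}"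
  define Q where "Q = {q \<in> S. poly q y \<noteq> 0 \<and> (\<exists>b\<in>S. poly q y = poly p y * poly b y)}"
  have "f \<in> A" using f by (auto simp: A_def S_def)
  then obtain f0 where f0: "f0 \<in> A" and f0min: "\<And>h. h \<in> A \<Longrightarrow> Polynomial.degree f0 \<le> Polynomial.degree h"
    using ex_has_least_nat[of "\<lambda>h. h \<in> A" f Polynomial.degree] by blast
  have "1 \<in> S" using R0 R1 by (auto simp: S_def coeff_1)
  then have "\<exists>b\<in>S. poly p y = poly p y * poly b y" by (intro bexI[of _ 1]) auto
  then have "p \<in> Q" using p by (auto simp: Q_def S_def)
  then obtain q where q: "q \<in> Q" and qmin: "\<And>h. h \<in> Q \<Longrightarrow> Polynomial.degree q \<le> Polynomial.degree h"
    using ex_has_least_nat[of "\<lambda>h. h \<in> Q" p Polynomial.degree] by blast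
  obtain b where b: "b \<in> S" "poly q y = poly p y * poly b y" using q by (auto simp: Q_def)
  have q0: "q \<noteq> 0" "f0 \<noteq> 0" using q f0 by (auto simp: Q_def A_def)
  have sumR: "(\<Sum>i\<in>I. h i) \<in> R" if "\<And>i. i \<in> I \<Longrightarrow> h i \<in> R" for h :: "nat \<Rightarrow> 'a" and I
    using that by (induction I rule: infinite_finite_induct) (auto simp: R0 Radd)
  have Smul: "u * v \<in> S" if "u \<in> S" "v \<in> S" for u v
  proof -
    have "(\<Sum>i\<le>n. Polynomial.coeff u i * Polynomial.coeff v (n - i)) \<in> R" for n
      by (rule sumR, rule Rmul) (use that in \<open>auto simp: S_def\<close>)
    then show ?thesis by (simp add: S_def Polynomial.coeff_mult)
  qed
  have pdS: "\<exists>k s r. Polynomial.smult (lead_coeff v ^ k) u = v * s + r \<and> s \<in> S \<and> r \<in> S \<and>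
      (r = 0 \<or> Polynomial.degree r < Polynomial.degree v)" if "u \<in> S" "v \<in> S" "v \<noteq> 0" for u v
    using pseudo_division_subring[of R v u] R0 R1 Radd Rmul Rneg that unfolding S_def mem_Collect_eq by blast
  have Sneg: "- u \<in> S" if "u \<in> S" for u using that by (auto simp: S_def Rneg)
  have "Polynomial.degree q = 0"
  proof (rule ccontr)
    assume dq: "Polynomial.degree q \<noteq> 0"
    \<comment> \<open>Otherwise the remainder of \<open>q\<close> by the relation has the same value up to a constant and smaller degree.\<close>
    have qf: "Polynomial.degree q \<le> Polynomial.degree f0"
    proof (rule ccontr)
      assume lt: "\<not> Polynomial.degree q \<le> Polynomial.degree f0"
      obtain k s r where d: "Polynomial.smult (lead_coeff f0 ^ k) q = f0 * s + r" "s \<in> S" "r \<in> S"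
         "r = 0 \<or> Polynomial.degree r < Polynomial.degree f0"
        using pdS[of q f0] q0 f0 q unfolding A_def Q_def by blast
      let ?c = "lead_coeff f0 ^ k"
      have cR: "?c \<in> R" using f0 by (induction k) (auto simp: A_def S_def intro: R1 Rmul)
      have e: "?c * poly q y = poly r y"
        using arg_cong[OF d(1), of "\<lambda>u. poly u y"] f0 by (simp add: A_def)
      have "poly r y \<noteq> 0" using e q q0 by (auto simp: Q_def)
      moreover have "poly r y = poly p y * poly (Polynomial.smult ?c b) y" using e b by (simp add: mult_ac)
      moreover have "Polynomial.smult ?c b \<in> S" using b cR by (auto simp: S_def intro: Rmul)
      ultimately have "r \<in> Q" using d(3) unfolding Q_def by blast
      from qmin[OF this] d(4) lt \<open>poly r y \<noteq> 0\<close> show False by auto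
    qed
    obtain k s r where d: "Polynomial.smult (lead_coeff q ^ k) f0 = q * s + r" "s \<in> S" "r \<in> S"
         "r = 0 \<or> Polynomial.degree r < Polynomial.degree q"
      using pdS[of f0 q] q0 f0 q unfolding A_def Q_def by blast
    have e: "poly q y * poly s y + poly r y = 0"
      using arg_cong[OF d(1), of "\<lambda>u. poly u y"] f0 by (simp add: A_def)
    show False
    proof (cases "poly r y = 0")
      case False
      have "poly r y = poly p y * poly (- (b * s)) y" using e b by (simp add: algebra_simps eq_neg_iff_add_eq_0)
      moreover have "- (b * s) \<in> S" using d b Smul Sneg by blast
      ultimately have "r \<in> Q" using False d(3) unfolding Q_def by blast
      from qmin[OF this] d(4) False show False by auto
    next
      case True
      then have s0: "poly s y = 0" using e q by (auto simp: Q_def)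
      show False
      proof (cases "r = 0")
        case False
        then have "r \<in> A" using True d by (auto simp: A_def)
        from f0min[OF this] d(4) False qf show False by auto
      next
        case r0: True
        \<comment> \<open>Here \<open>q\<close> would be a factor of the relation, and the cofactor a relation of smaller degree.\<close>
        then have eq: "Polynomial.smult (lead_coeff q ^ k) f0 = q * s" using d by simp
        then have "s \<noteq> 0" using q0 by auto
        then have "s \<in> A" using s0 d by (auto simp: A_def)
        moreover have "Polynomial.degree f0 = Polynomial.degree q + Polynomial.degree s"
          using arg_cong[OF eq, of Polynomial.degree] q0 \<open>s \<noteq> 0\<close> by (simp add: degree_mult_eq)
        ultimately show False using f0min[of s] dq by auto
      qed
    qed
  qed
  then obtain d where "q = [:d:]" by (meson degree_eq_zeroE)
  then have "poly q y = d" "d \<in> R" using q by (auto simp: Q_def S_def dest: spec[of _ 0])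
  then show ?thesis using q b by (auto simp: Q_def S_def)
qed

section \<open>A semialgebraic analytic arc lies on an algebraic curve\<close>

text \<open>Membership in a semialgebraic set is decided by the signs of finitely many polynomials, as one sees along the
  construction of the set.\<close>

lemma semialgebraic_sign_conditions:
  assumes "semialgebraic A"
  shows "\<exists>\<F>. finite \<F> \<and> (\<forall>f\<in>\<F>. real_polynomial_function f) \<and>
    (\<forall>x y. (\<forall>f\<in>\<F>. sgn (f x) = sgn (f y)) \<longrightarrow> (x \<in> A \<longleftrightarrow> y \<in> A))"
  using assms
proof induction
  case (pos f)
  then show ?case by (intro exI[of _ "{f}"]) (auto simp: sgn_if split: if_splits)
next
  case (compl A)
  then show ?case by auto
next
  case (un A B)
  obtain F where F: "finite F" "\<forall>f\<in>F. real_polynomial_function f"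
    "\<forall>x y. (\<forall>f\<in>F. sgn (f x) = sgn (f y)) \<longrightarrow> (x \<in> A \<longleftrightarrow> y \<in> A)"
    using un.IH(1) by blast
  obtain G where G: "finite G" "\<forall>f\<in>G. real_polynomial_function f"
    "\<forall>x y. (\<forall>f\<in>G. sgn (f x) = sgn (f y)) \<longrightarrow> (x \<in> B \<longleftrightarrow> y \<in> B)"
    using un.IH(2) by blast
  have "\<forall>x y. (\<forall>f\<in>F \<union> G. sgn (f x) = sgn (f y)) \<longrightarrow> (x \<in> A \<union> B \<longleftrightarrow> y \<in> A \<union> B)"
  proof (intro allI impI)
    fix x y assume "\<forall>f\<in>F \<union> G. sgn (f x) = sgn (f y)"
    then have "x \<in> A \<longleftrightarrow> y \<in> A" "x \<in> B \<longleftrightarrow> y \<in> B" using F(3)[rule_format, of x y] G(3)[rule_format, of x y] by auto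
    then show "x \<in> A \<union> B \<longleftrightarrow> y \<in> A \<union> B" by auto
  qed
  then show ?case using F G by (intro exI[of _ "F \<union> G"]) auto
qed

lemma real_polynomial_function_isCont:
  fixes f :: "'a::euclidean_space \<Rightarrow> real"
  assumes "real_polynomial_function f" shows "isCont f x"
  using assms by (rule continuous_real_polymonial_function)

lemma real_polynomial_function_sum_squares:
  assumes "finite J" "\<And>f. f \<in> J \<Longrightarrow> real_polynomial_function f"
  shows "real_polynomial_function (\<lambda>x. \<Sum>f\<in>J. f x * f x)"
  using assms
proof (induction J rule: finite_induct)
  case empty then show ?case using real_polynomial_function.intros(2)[of 0] by simp
next
  case (insert f J)
  have "real_polynomial_function (\<lambda>x. f x * f x + (\<Sum>f\<in>J. f x * f x))"
    using insert by (intro real_polynomial_function.intros(3,4)) auto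
  then show ?case using insert by simp
qed

text \<open>The difference quotient at the zero has the sign of its limit \<open>l\<close>.\<close>

lemma simple_zero_signs:
  fixes k :: "real \<Rightarrow> real"
  assumes d: "(k has_real_derivative l) (at z)" "l \<noteq> 0" "k z = 0" and e: "\<epsilon> > 0"
  shows "\<exists>h>0. h < \<epsilon> \<and> sgn (k (z + h)) = sgn l \<and> sgn (k (z - h)) = - sgn l"
proof -
  have "((\<lambda>s. (k s - k z) / (s - z)) \<longlongrightarrow> l) (at z)" using d(1) by (simp add: has_field_derivative_iff)
  then have "((\<lambda>s. k s / (s - z) * l) \<longlongrightarrow> l * l) (at z)" using d(3) by (intro tendsto_mult) auto
  moreover have "l * l > 0" using d(2) not_real_square_gt_zero by blast
  ultimately have "\<forall>\<^sub>F s in at z. k s / (s - z) * l > 0" by (rule order_tendstoD(1))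
  then obtain r where r: "r > 0" "\<And>s. s \<noteq> z \<Longrightarrow> dist s z < r \<Longrightarrow> k s / (s - z) * l > 0"
    unfolding eventually_at by auto
  define h where "h = min r \<epsilon> / 2"
  have h: "h > 0" "h < r" "h < \<epsilon>" using r(1) e by (auto simp: h_def)
  have "k (z + h) / h * l > 0" "k (z - h) / (- h) * l > 0"
    using r(2)[of "z + h"] r(2)[of "z - h"] h by (auto simp: dist_real_def)
  then have "k (z + h) * l > 0" "k (z - h) * l < 0"
    using h(1) by (auto simp: zero_less_divide_iff divide_less_0_iff)
  then have "sgn (k (z + h)) = sgn l" "sgn (k (z - h)) = - sgn l"
    by (auto simp: sgn_if zero_less_mult_iff mult_less_0_iff)
  then show ?thesis using h by blast
qed

lemma dist_vector_3_less:
  fixes x p :: "real^3"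
  assumes "i \<noteq> j" "i \<noteq> k" "j \<noteq> (k::3)" "\<bar>x $ i - p $ i\<bar> < \<epsilon> / 3" "\<bar>x $ j - p $ j\<bar> < \<epsilon> / 3" "\<bar>x $ k - p $ k\<bar> < \<epsilon> / 3"
  shows "dist x p < \<epsilon>"
proof -
  have "dist x p \<le> (\<Sum>l\<in>UNIV. \<bar>(x - p) $ l\<bar>)" unfolding dist_norm by (rule norm_le_l1_cart)
  also have "\<dots> < \<epsilon>" unfolding UNIV_3_distinct[OF assms(1-3)] using assms by simp
  finally show ?thesis .
qed

locale semialgebraic_arc =
  fixes g :: "real \<Rightarrow> real^3"
  assumes analytic: "\<And>i. analytic_ioo (\<lambda>t. g t $ i)"
    and inj: "inj_on g {0<..<1}"
    and semialg: "semialgebraic (g ` {0<..<1})"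
begin

lemma analytic_polynomial: "real_polynomial_function P \<Longrightarrow> analytic_ioo (\<lambda>t. P (g t))"
  using analytic_ioo_polynomial[OF analytic] .

text \<open>Among the polynomials whose signs describe the arc, those vanishing on all of it are combined into one
  polynomial \<open>F\<close>, the sum of their squares. Near a point of the arc where none of the others vanishes,
  the signs of the others are constant, so that the zeros of \<open>F\<close> all lie on the arc. The exceptional
  points are the zeros of the finitely many functions in \<open>\<N>\<close>.\<close>

lemma polynomial_zero_set_near:
  "\<exists>F \<N>. real_polynomial_function F \<and> (\<forall>t\<in>{0<..<1}. F (g t) = 0) \<and>
    finite \<N> \<and> (\<forall>f\<in>\<N>. analytic_ioo f) \<and> (\<forall>f\<in>\<N>. \<exists>t\<in>{0<..<1}. f t \<noteq> 0) \<and>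
    (\<forall>t\<in>{0<..<1}. (\<forall>f\<in>\<N>. f t \<noteq> 0) \<longrightarrow>
       (\<exists>\<epsilon>>0. \<forall>x. dist x (g t) < \<epsilon> \<longrightarrow> F x = 0 \<longrightarrow> x \<in> g ` {0<..<1}))"
proof -
  obtain \<F> where \<F>0: "finite \<F>" "\<forall>f\<in>\<F>. real_polynomial_function f"
    "\<forall>x y. (\<forall>f\<in>\<F>. sgn (f x) = sgn (f y)) \<longrightarrow> (x \<in> g ` {0<..<1} \<longleftrightarrow> y \<in> g ` {0<..<1})"
    using semialgebraic_sign_conditions[OF semialg] by (elim exE conjE) (rule that)
  note \<F> = \<F>0(1) bspec[OF \<F>0(2)] \<F>0(3)[rule_format]
  define J where "J = {f \<in> \<F>. \<forall>t\<in>{0<..<1}. f (g t) = 0}"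
  define F where "F = (\<lambda>x. \<Sum>f\<in>J. f x * f x)"
  define \<N> where "\<N> = (\<lambda>f t. f (g t)) ` (\<F> - J)"
  have finJ: "finite J" using \<F>(1) by (auto simp: J_def)
  show ?thesis
  proof (intro exI[of _ F] exI[of _ \<N>] conjI ballI impI)
    show "real_polynomial_function F"
      unfolding F_def using finJ \<F>(2) by (intro real_polynomial_function_sum_squares) (auto simp: J_def)
    show "F (g t) = 0" if "t \<in> {0<..<1}" for t using that by (auto simp: F_def J_def)
    show "finite \<N>" using \<F>(1) by (simp add: \<N>_def)
    show "analytic_ioo f" if "f \<in> \<N>" for f using that \<F>(2) analytic_polynomial by (auto simp: \<N>_def)
    show "\<exists>t\<in>{0<..<1}. f t \<noteq> 0" if "f \<in> \<N>" for f using that by (auto simp: \<N>_def J_def)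
    show "\<exists>\<epsilon>>0. \<forall>x. dist x (g t) < \<epsilon> \<longrightarrow> F x = 0 \<longrightarrow> x \<in> g ` {0<..<1}"
      if t: "t \<in> {0<..<1}" and nz: "\<forall>f\<in>\<N>. f t \<noteq> 0" for t
    proof -
      have "\<forall>f\<in>\<F> - J. \<forall>\<^sub>F x in nhds (g t). sgn (f x) = sgn (f (g t))"
      proof
        fix f assume f: "f \<in> \<F> - J"
        then have ne: "f (g t) \<noteq> 0" using nz by (auto simp: \<N>_def)
        have "(f \<longlongrightarrow> f (g t)) (nhds (g t))"
          using real_polynomial_function_isCont[OF \<F>(2), of f "g t"] f
          by (simp add: isCont_def tendsto_at_iff_tendsto_nhds)
        then have "\<forall>\<^sub>F x in nhds (g t). dist (f x) (f (g t)) < \<bar>f (g t)\<bar>"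
          using ne by (simp add: tendsto_iff)
        then show "\<forall>\<^sub>F x in nhds (g t). sgn (f x) = sgn (f (g t))"
          by eventually_elim (auto simp: dist_real_def sgn_if split: if_splits)
      qed
      then have "\<forall>\<^sub>F x in nhds (g t). \<forall>f\<in>\<F> - J. sgn (f x) = sgn (f (g t))"
        using \<F>(1) by (simp add: eventually_ball_finite)
      then obtain \<epsilon> where \<epsilon>: "\<epsilon> > 0" "\<And>x. dist x (g t) < \<epsilon> \<Longrightarrow> \<forall>f\<in>\<F> - J. sgn (f x) = sgn (f (g t))"
        unfolding eventually_nhds_metric by blast
      have "x \<in> g ` {0<..<1}" if x: "dist x (g t) < \<epsilon>" and Fx: "F x = 0" for x
      proof -
        have "\<forall>f\<in>J. f x * f x = 0"
          using Fx finJ unfolding F_def by (subst (asm) sum_nonneg_eq_0_iff) auto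
        then have "sgn (f x) = sgn (f (g t))" if "f \<in> \<F>" for f
          using \<epsilon>(2)[OF x] that t by (cases "f \<in> J") (auto simp: J_def)
        then show ?thesis using \<F>(3)[of x "g t"] t by blast
      qed
      then show ?thesis using \<epsilon>(1) by blast
    qed
  qed
qed

text \<open>The projection is a differentiable image of an interval in the plane, hence a null set.\<close>

lemma projection_contains_no_box:
  assumes "\<delta> > 0" "\<And>x y. \<bar>x - a\<bar> < \<delta> \<Longrightarrow> \<bar>y - b\<bar> < \<delta> \<Longrightarrow> \<exists>t\<in>{0<..<1}. g t $ i = x \<and> g t $ j = y"
  shows False
proof -
  let ?h = "\<lambda>t. (g t $ i, g t $ j)"
  have "?h differentiable (at t within {0<..<1})" if "t \<in> {0<..<1}" for t
  proof -
    have "\<exists>D. ((\<lambda>t. g t $ k) has_derivative D) (at t within {0<..<1})" for k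
      using analytic_ioo_DERIV[OF analytic that, of k] has_derivative_at_withinI
      unfolding has_field_derivative_def by blast
    then show ?thesis unfolding differentiable_def using has_derivative_Pair by blast
  qed
  then have "?h differentiable_on {0<..<1}" by (simp add: differentiable_on_def)
  then have "negligible (?h ` {0<..<1})"
    by (rule negligible_differentiable_image_lowdim[rotated]) simp
  moreover have "{a - \<delta><..<a + \<delta>} \<times> {b - \<delta><..<b + \<delta>} \<subseteq> ?h ` {0<..<1}"
  proof clarify
    fix x y assume "x \<in> {a - \<delta><..<a + \<delta>}" "y \<in> {b - \<delta><..<b + \<delta>}"
    then have "\<bar>x - a\<bar> < \<delta>" "\<bar>y - b\<bar> < \<delta>" by (auto simp: abs_less_iff)
    from assms(2)[OF this] show "(x, y) \<in> ?h ` {0<..<1}" by (auto simp: image_iff)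
  qed
  ultimately have "negligible ({a - \<delta><..<a + \<delta>} \<times> {b - \<delta><..<b + \<delta>})"
    by (rule negligible_subset)
  moreover have "open ({a - \<delta><..<a + \<delta>} \<times> {b - \<delta><..<b + \<delta>})"
    by (intro open_Times open_greaterThanLessThan)
  moreover have "(a, b) \<in> {a - \<delta><..<a + \<delta>} \<times> {b - \<delta><..<b + \<delta>}" using assms(1) by auto
  ultimately show False using open_not_negligible by blast
qed

text \<open>Suppose that the coordinates \<open>i\<close> and \<open>j\<close> satisfy no polynomial relation on the arc,
  and consider the ideal of polynomials vanishing on it. If the ideal is zero, then so is the polynomial
  \<open>F\<close> of \<open>polynomial_zero_set_near\<close>, and the arc contains a ball. Otherwise choose
  \<open>f\<close> of least degree in the third variable among the nonzero members of the ideal. By independence its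
  leading coefficient \<open>c\<close> does not vanish identically on the arc, and by minimality neither does the
  derivative of \<open>f\<close> in the third variable. Pseudo-division shows that a power of \<open>c\<close> times
  \<open>F\<close> is a multiple of \<open>f\<close>. At a general point of the arc the third coordinate is thus a
  simple root of \<open>f\<close>, and such a root persists when the other two coordinates are moved: the intermediate
  value theorem produces zeros of \<open>F\<close>, that is points of the arc, over a whole square.\<close>

lemma two_coordinates_dependent:
  assumes ijk: "i \<noteq> j" "i \<noteq> k" "j \<noteq> (k::3)"
  shows "\<exists>p::real poly poly. p \<noteq> 0 \<and> (\<forall>t\<in>{0<..<1}. poly (poly p [:g t $ j:]) (g t $ i) = 0)"
proof (rule ccontr)
  assume "\<not> ?thesis"
  then have indep: "\<exists>t\<in>{0<..<1}. poly (poly p [:g t $ j:]) (g t $ i) \<noteq> 0" if "p \<noteq> 0" for p :: "real poly poly"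
    using that by blast
  define ev :: "real poly poly poly \<Rightarrow> real \<Rightarrow> real \<Rightarrow> real \<Rightarrow> real"
    where "ev = (\<lambda>f x y z. poly (poly (poly f [:[:z:]:]) [:y:]) x)"
  have ev_cont: "isCont (\<lambda>x::real^3. ev f (x $ i) (x $ j) (x $ k)) p" for f p
    unfolding ev_def by (intro real_polynomial_function_isCont real_polynomial_poly3)
  define I where "I = {f. \<forall>t\<in>{0<..<1}. ev f (g t $ i) (g t $ j) (g t $ k) = 0}"
  obtain F \<N> where F: "real_polynomial_function F" "\<forall>t\<in>{0<..<1}. F (g t) = 0"
    and \<N>0: "finite \<N>" "\<forall>f\<in>\<N>. analytic_ioo f" "\<forall>f\<in>\<N>. \<exists>t\<in>{0<..<1}. f t \<noteq> 0"
    and near0: "\<forall>t\<in>{0<..<1}. (\<forall>f\<in>\<N>. f t \<noteq> 0) \<longrightarrow>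
       (\<exists>\<epsilon>>0. \<forall>x. dist x (g t) < \<epsilon> \<longrightarrow> F x = 0 \<longrightarrow> x \<in> g ` {0<..<1})"
    using polynomial_zero_set_near by (elim exE conjE) (rule that)
  note \<N> = \<N>0(1) bspec[OF \<N>0(2)] bspec[OF \<N>0(3)]
  have near: "\<exists>\<epsilon>>0. \<forall>x. dist x (g t) < \<epsilon> \<longrightarrow> F x = 0 \<longrightarrow> x \<in> g ` {0<..<1}"
    if "t \<in> {0<..<1}" "\<And>f. f \<in> \<N> \<Longrightarrow> f t \<noteq> 0" for t
    using near0 that by simp
  obtain P where P: "\<And>x. F x = ev P (x $ i) (x $ j) (x $ k)"
    using real_polynomial_function_poly3[OF ijk F(1)] unfolding ev_def by blast
  have PI: "P \<in> I" using F(2) P by (auto simp: I_def)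
  define vec where "vec = (\<lambda>x y z. \<chi> l. if l = i then x else if l = j then y else (z::real))"
  have vec: "vec x y z $ i = x" "vec x y z $ j = y" "vec x y z $ k = z" for x y z
    using ijk by (auto simp: vec_def)
  show False
  proof (cases "\<forall>f\<in>I. f = 0")
    case True
    then have "P = 0" using PI by blast
    then have F0: "F x = 0" for x using P[of x] by (simp add: ev_def)
    obtain t where t: "t \<in> {0<..<1}" "\<And>f. f \<in> \<N> \<Longrightarrow> f t \<noteq> 0"
      using analytic_ioo_common_nonzero[OF \<N>] by blast
    then obtain \<epsilon> where \<epsilon>: "\<epsilon> > 0" "\<And>x. dist x (g t) < \<epsilon> \<Longrightarrow> x \<in> g ` {0<..<1}"
      using near[OF t(1)] F0 by auto
    show False
    proof (rule projection_contains_no_box[of "\<epsilon>/3" "g t $ i" "g t $ j" i j])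
      fix x y assume "\<bar>x - g t $ i\<bar> < \<epsilon> / 3" "\<bar>y - g t $ j\<bar> < \<epsilon> / 3"
      then have "dist (vec x y (g t $ k)) (g t) < \<epsilon>"
        using \<epsilon>(1) by (intro dist_vector_3_less[OF ijk]) (simp_all add: vec)
      from \<epsilon>(2)[OF this] obtain s where "s \<in> {0<..<1}" "g s = vec x y (g t $ k)" by auto
      then show "\<exists>t\<in>{0<..<1}. g t $ i = x \<and> g t $ j = y" by (intro bexI[of _ s]) (auto simp: vec)
    qed (use \<epsilon> in auto)
  next
    case False
    then obtain f0 where f0: "f0 \<in> I" "f0 \<noteq> 0" by auto
    obtain f where f: "f \<in> I" "f \<noteq> 0" and fmin: "\<And>h. h \<in> I \<Longrightarrow> h \<noteq> 0 \<Longrightarrow> Polynomial.degree f \<le> Polynomial.degree h"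
      using ex_has_least_nat[of "\<lambda>h. h \<in> I \<and> h \<noteq> 0" f0 Polynomial.degree] f0 by blast
    define c where "c = lead_coeff f"
    have "c \<noteq> 0" using f by (simp add: c_def)
    have degf: "Polynomial.degree f \<noteq> 0"
    proof
      assume "Polynomial.degree f = 0"
      then obtain q where q: "f = [:q:]" by (meson degree_eq_zeroE)
      then show False using indep[of q] f by (auto simp: I_def ev_def)
    qed
    have pd: "pderiv f \<noteq> 0" "Polynomial.degree (pderiv f) < Polynomial.degree f"
      using degf by (auto simp: pderiv_eq_0_iff degree_pderiv)
    then have pdI: "pderiv f \<notin> I" using fmin[of "pderiv f"] by auto
    obtain m s r where d: "Polynomial.smult (c ^ m) P = f * s + r" "r = 0 \<or> Polynomial.degree r < Polynomial.degree f"
      using pseudo_division_subring[of UNIV f P] f(2) unfolding c_def by auto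
    have evd: "poly (poly (c ^ m) [:y:]) x * ev P x y z = ev f x y z * ev s x y z + ev r x y z" for x y z
      using arg_cong[OF d(1), of "\<lambda>q. ev q x y z"] by (simp add: ev_def)
    have "r \<in> I" unfolding I_def
    proof (clarify)
      fix t :: real assume "t \<in> {0<..<1}"
      then show "ev r (g t $ i) (g t $ j) (g t $ k) = 0"
        using evd[of "g t $ j" "g t $ i" "g t $ k"] PI f(1) by (auto simp: I_def)
    qed
    then have "r = 0" using fmin[of r] d(2) by linarith
    define \<N>' where "\<N>' = {\<lambda>t. poly (poly c [:g t $ j:]) (g t $ i), \<lambda>t. ev (pderiv f) (g t $ i) (g t $ j) (g t $ k)} \<union> \<N>"
    have "\<exists>t\<in>{0<..<1}. \<forall>f\<in>\<N>'. f t \<noteq> 0"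
    proof (rule analytic_ioo_common_nonzero)
      show "finite \<N>'" using \<N> by (simp add: \<N>'_def)
      show "analytic_ioo f" if "f \<in> \<N>'" for f
        using that \<N>(2) analytic_polynomial[OF real_polynomial_poly2] analytic_polynomial[OF real_polynomial_poly3]
        by (auto simp: \<N>'_def ev_def)
      show "\<exists>t\<in>{0<..<1}. f t \<noteq> 0" if "f \<in> \<N>'" for f
        using that \<N>(3) indep[OF \<open>c \<noteq> 0\<close>] pdI by (auto simp: \<N>'_def I_def)
    qed
    then obtain t where t: "t \<in> {0<..<1}" "\<And>h. h \<in> \<N>' \<Longrightarrow> h t \<noteq> 0" by blast
    define a b e where "a = g t $ i" and "b = g t $ j" and "e = g t $ k"
    obtain \<epsilon> where \<epsilon>: "\<epsilon> > 0" "\<And>x. dist x (g t) < \<epsilon> \<Longrightarrow> F x = 0 \<Longrightarrow> x \<in> g ` {0<..<1}"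
      using near[OF t(1)] t(2) by (auto simp: \<N>'_def)
    have nz: "poly (poly c [:b:]) a \<noteq> 0" "ev (pderiv f) a b e \<noteq> 0"
      using t(2) by (auto simp: \<N>'_def a_def b_def e_def)
    have fz: "ev f a b e = 0" using f t(1) by (auto simp: I_def a_def b_def e_def)
    obtain z1 z2 where z: "\<bar>z1 - e\<bar> < \<epsilon>/3" "\<bar>z2 - e\<bar> < \<epsilon>/3" "ev f a b z1 < 0" "ev f a b z2 > 0"
    proof -
      obtain h where h: "h > 0" "h < \<epsilon>/3" "sgn (ev f a b (e + h)) = sgn (ev (pderiv f) a b e)"
        "sgn (ev f a b (e - h)) = - sgn (ev (pderiv f) a b e)"
        using simple_zero_signs[of "\<lambda>z. ev f a b z" "ev (pderiv f) a b e" e "\<epsilon>/3"] DERIV_poly3_outer[of f b a e] nz fz \<epsilon>(1)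
        unfolding ev_def by auto
      show thesis
      proof (cases "ev (pderiv f) a b e > 0")
        case True
        then show thesis using h by (intro that[of "e - h" "e + h"]) (auto simp: sgn_1_pos sgn_1_neg)
      next
        case False
        then have "ev (pderiv f) a b e < 0" using nz(2) by simp
        then show thesis using h by (intro that[of "e + h" "e - h"]) (auto simp: sgn_1_pos sgn_1_neg)
      qed
    qed
    have c1: "((\<lambda>(x,y). ev f x y z) \<longlongrightarrow> ev f a b z) (nhds (a,b))" for z
    proof -
      have "isCont (\<lambda>q. ev f (fst q) (snd q) z) (a,b)"
      proof -
        have "continuous (at (a,b)) (\<lambda>q. vec (fst q) (snd q) z)"
          unfolding isCont_def by (rule vec_tendstoI) (auto simp: vec_def intro!: tendsto_eq_intros)
        from isCont_o2[OF this, of "\<lambda>x. ev f (x $ i) (x $ j) (x $ k)"]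
        show ?thesis using ev_cont by (simp add: vec)
      qed
      then show ?thesis using tendsto_at_iff_tendsto_nhds[of "\<lambda>q. ev f (fst q) (snd q) z" "(a,b)"]
        by (simp add: isCont_def case_prod_beta')
    qed
    have c2: "((\<lambda>(x,y). poly (poly c [:y:]) x) \<longlongrightarrow> poly (poly c [:b:]) a) (nhds (a,b))"
    proof -
      have "isCont (\<lambda>q. poly (poly c [:snd q:]) (fst q)) (a,b)"
      proof -
        have "continuous (at (a,b)) (\<lambda>q. vec (fst q) (snd q) 0)"
          unfolding isCont_def by (rule vec_tendstoI) (auto simp: vec_def intro!: tendsto_eq_intros)
        from isCont_o2[OF this, of "\<lambda>x. poly (poly c [:x $ j:]) (x $ i)"]
        show ?thesis using real_polynomial_function_isCont[OF real_polynomial_poly2, where x = "vec a b 0"] by (simp add: vec)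
      qed
      then show ?thesis using tendsto_at_iff_tendsto_nhds[of "\<lambda>q. poly (poly c [:snd q:]) (fst q)" "(a,b)"]
        by (simp add: isCont_def case_prod_beta')
    qed
    have "\<forall>\<^sub>F q in nhds (a,b). (case q of (x,y) \<Rightarrow> ev f x y z1) < 0 \<and> (case q of (x,y) \<Rightarrow> ev f x y z2) > 0 \<and>
        (case q of (x,y) \<Rightarrow> poly (poly c [:y:]) x) \<noteq> 0"
      by (intro eventually_conj order_tendstoD(2)[OF c1 z(3)] order_tendstoD(1)[OF c1 z(4)] tendsto_imp_eventually_ne[OF c2 nz(1)])
    \<comment> \<open>Over the square of this size, \<open>f\<close> still changes sign between \<open>z1\<close> and \<open>z2\<close>.\<close>
    then obtain \<delta> where \<delta>: "\<delta> > 0" "\<And>x y. dist (x,y) (a,b) < \<delta> \<Longrightarrow> ev f x y z1 < 0 \<and> ev f x y z2 > 0 \<and> poly (poly c [:y:]) x \<noteq> 0"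
      unfolding eventually_nhds_metric by auto
    show False
    proof (rule projection_contains_no_box[of "min (\<epsilon>/3) (\<delta>/2)" a b i j])
      fix x y assume xy: "\<bar>x - a\<bar> < min (\<epsilon>/3) (\<delta>/2)" "\<bar>y - b\<bar> < min (\<epsilon>/3) (\<delta>/2)"
      have "dist (x,y) (a,b) \<le> \<bar>x - a\<bar> + \<bar>y - b\<bar>"
        by (simp add: dist_Pair_Pair dist_real_def sqrt_sum_squares_le_sum_abs)
      then have *: "ev f x y z1 < 0" "ev f x y z2 > 0" "poly (poly c [:y:]) x \<noteq> 0"
        using \<delta>(2)[of x y] xy by auto
      have cont: "continuous_on S (\<lambda>z. ev f x y z)" for S
        using DERIV_isCont[OF DERIV_poly3_outer[of f y x]] unfolding ev_def
        by (simp add: continuous_at_imp_continuous_on)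
      have "\<exists>z. \<bar>z - e\<bar> < \<epsilon>/3 \<and> ev f x y z = 0"
      proof (cases "z1 \<le> z2")
        case True
        then obtain w where "z1 \<le> w" "w \<le> z2" "ev f x y w = 0"
          using IVT'[of "\<lambda>z. ev f x y z" z1 0 z2] * cont by auto
        then have "\<bar>w - e\<bar> < \<epsilon>/3" using z(1,2) by linarith
        with \<open>ev f x y w = 0\<close> show ?thesis by blast
      next
        case False
        then obtain w where "z2 \<le> w" "w \<le> z1" "ev f x y w = 0"
          using IVT2'[of "\<lambda>z. ev f x y z" z1 0 z2] * cont by auto
        then have "\<bar>w - e\<bar> < \<epsilon>/3" using z(1,2) by linarith
        with \<open>ev f x y w = 0\<close> show ?thesis by blast
      qed
      then obtain w where w: "\<bar>w - e\<bar> < \<epsilon>/3" "ev f x y w = 0" by blast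
      have "F (vec x y w) = 0"
        using evd[of y x w] w(2) *(3) \<open>r = 0\<close> by (simp add: P vec ev_def)
      moreover have "dist (vec x y w) (g t) < \<epsilon>"
        using xy w by (intro dist_vector_3_less[OF ijk]) (simp_all add: vec a_def b_def e_def)
      ultimately have "vec x y w \<in> g ` {0<..<1}" using \<epsilon>(2) by blast
      then obtain s where "s \<in> {0<..<1}" "g s = vec x y w" by (metis imageE)
      then show "\<exists>t\<in>{0<..<1}. g t $ i = x \<and> g t $ j = y" by (intro bexI[of _ s]) (auto simp: vec)
    qed (use \<epsilon> \<delta> in auto)
  qed
qed

end

section \<open>Polynomials have finitely many zeros on a semialgebraic arc\<close>

context semialgebraic_arc
begin

text \<open>Since the base point \<open>1/2\<close> lies in the interval, the expansion there determines a polynomial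
  function on the whole arc. Working with power series makes the polynomial functions on the arc a subset of an
  integral domain.\<close>

definition expands :: "(real^3 \<Rightarrow> real) \<Rightarrow> real fps \<Rightarrow> bool" where
  "expands P F \<longleftrightarrow> real_polynomial_function P \<and> (\<lambda>h. P (g (1/2 + h))) has_fps_expansion F"

lemma expands_exists:
  assumes "real_polynomial_function P" obtains F where "expands P F"
proof -
  have "(1/2::real) \<in> {0<..<1}" by simp
  then obtain F where "(\<lambda>h. P (g (1/2 + h))) has_fps_expansion F"
    using analytic_polynomial[OF assms] unfolding analytic_ioo_def by blast
  then show thesis using assms that unfolding expands_def by blast
qed

lemma expands_const: "expands (\<lambda>x. c) (fps_const c)"
  unfolding expands_def using real_polynomial_function.intros(2) has_fps_expansion_const by blast

lemma expands_add: "expands P F \<Longrightarrow> expands Q G \<Longrightarrow> expands (\<lambda>x. P x + Q x) (F + G)"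
  unfolding expands_def using real_polynomial_function.intros(3) has_fps_expansion_add by blast

lemma expands_mult: "expands P F \<Longrightarrow> expands Q G \<Longrightarrow> expands (\<lambda>x. P x * Q x) (F * G)"
  unfolding expands_def using real_polynomial_function.intros(4) has_fps_expansion_mult by blast

text \<open>The identity theorem: vanishing near \<open>1/2\<close> means vanishing on the whole arc.\<close>

lemma expands_0_iff:
  assumes "expands P F" shows "F = 0 \<longleftrightarrow> (\<forall>t\<in>{0<..<1}. P (g t) = 0)"
proof
  assume F: "F = 0"
  have "\<forall>\<^sub>F h in nhds 0. P (g (1/2 + h)) = 0"
    using assms F by (simp add: expands_def has_fps_expansion_def)
  then have "\<forall>\<^sub>F h in at 0. P (g (h + 1/2)) = 0"
    unfolding eventually_nhds_conv_at by (simp add: add.commute)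
  then have *: "\<forall>\<^sub>F t in at (1/2). P (g t) = 0"
    by (subst at_to_0) (simp add: eventually_filtermap)
  have half: "(1/2::real) \<in> {0<..<1}" by simp
  have "\<not> (\<forall>s\<in>{0<..<1}. \<forall>\<^sub>F t in at s. P (g t) \<noteq> 0)"
  proof
    assume "\<forall>s\<in>{0<..<1}. \<forall>\<^sub>F t in at s. P (g t) \<noteq> 0"
    from bspec[OF this half] * have "\<forall>\<^sub>F t in at (1/2::real). False" by eventually_elim auto
    then show False by simp
  qed
  then show "\<forall>t\<in>{0<..<1}. P (g t) = 0"
    using analytic_ioo_identity[OF analytic_polynomial, of P] assms by (auto simp: expands_def)
next
  assume z: "\<forall>t\<in>{0<..<1}. P (g t) = 0"
  have "\<forall>\<^sub>F h in at 0. 1/2 + h \<in> {0<..<1::real}"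
  proof -
    have "((\<lambda>h. 1/2 + h) \<longlongrightarrow> 1/2 + 0) (at (0::real))" by (intro tendsto_intros)
    then show ?thesis by (rule topological_tendstoD) auto
  qed
  then have "\<forall>\<^sub>F h in at 0. P (g (1/2 + h)) = 0"
    by eventually_elim (use z in blast)
  then show "F = 0" using fps_expansion_zero_unique assms unfolding expands_def by blast
qed

lemma expands_poly:
  assumes R: "\<And>a. a \<in> R \<Longrightarrow> \<exists>A. expands A a" and Y: "expands Y y" and b: "\<forall>n. Polynomial.coeff b n \<in> R"
  shows "\<exists>B. expands B (poly b y)"
  using b
proof (induction b)
  case 0 show ?case using expands_const[of 0] by auto
next
  case (pCons a b)
  obtain A where A: "expands A a" using R pCons.prems[rule_format, of 0] by auto
  have "\<forall>n. Polynomial.coeff b n \<in> R" using pCons.prems[rule_format, of "Suc _"] by simp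
  then obtain B where "expands B (poly b y)" using pCons.IH by blast
  then show ?case using expands_add[OF A expands_mult[OF Y]] by auto
qed

lemma nonconstant_coordinate: "\<exists>i. \<forall>c. \<exists>t\<in>{0<..<1}. g t $ i \<noteq> c"
proof (rule ccontr)
  assume "\<not> ?thesis"
  then have "\<forall>i. \<exists>c. \<forall>t\<in>{0<..<1}. g t $ i = c" by blast
  then obtain c where "\<forall>i. \<forall>t\<in>{0<..<1}. g t $ i = c i" by (rule choice[THEN exE])
  then have c: "g t $ i = c i" if "t \<in> {0<..<1}" for i t using that by blast
  have "g (1/2) = g (1/3)" by (simp add: vec_eq_iff c)
  then show False using inj by (auto dest: inj_onD)
qed

text \<open>The values of a coordinate form an interval, and a finite interval is a point.\<close>

lemma polynomial_in_coordinate_nonzero: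
  assumes nc: "\<And>c. \<exists>t\<in>{0<..<1}. g t $ i \<noteq> c" and "a \<noteq> 0"
  shows "\<exists>t\<in>{0<..<1}. poly a (g t $ i) \<noteq> 0"
proof (rule ccontr)
  assume "\<not> ?thesis"
  then have "(\<lambda>t. g t $ i) ` {0<..<1} \<subseteq> {x. poly a x = 0}" by auto
  then have fin: "finite ((\<lambda>t. g t $ i) ` {0<..<1})"
    using poly_roots_finite[OF \<open>a \<noteq> 0\<close>] finite_subset by blast
  have "connected ((\<lambda>t. g t $ i) ` {0<..<1})"
    by (intro connected_continuous_image analytic_ioo_continuous_on analytic connected_Ioo)
  then obtain c where "(\<lambda>t. g t $ i) ` {0<..<1} \<subseteq> {c}"
    using fin connected_finite_iff_sing by fastforce
  then show False using nc[of c] by auto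
qed

text \<open>A relation \<open>p\<close> between the two coordinates becomes trivial for \<open>x $ i = c\<close> only if it
  is divisible by \<open>x $ i - c\<close>. As that factor does not vanish on the whole arc, it can be cancelled, so a
  relation of least degree has no such factor.\<close>

lemma coordinate_value_bound:
  assumes ijk: "i \<noteq> j" "i \<noteq> k" "j \<noteq> (k::3)" and nc: "\<And>c. \<exists>t\<in>{0<..<1}. g t $ i \<noteq> c"
  shows "\<exists>A. finite A \<and> (\<forall>t\<in>{0<..<1}. g t $ i = c \<longrightarrow> g t $ j \<in> A)"
proof -
  let ?I = "\<lambda>p::real poly poly. p \<noteq> 0 \<and> (\<forall>t\<in>{0<..<1}. poly (poly p [:g t $ i:]) (g t $ j) = 0)"
  obtain p0 where "?I p0" using two_coordinates_dependent[of j i k] ijk by blast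
  then obtain p where p: "?I p" and pmin: "\<And>q. ?I q \<Longrightarrow> Polynomial.degree p \<le> Polynomial.degree q"
    using ex_has_least_nat[of ?I p0 Polynomial.degree] by blast
  have "poly p [:c:] \<noteq> 0"
  proof
    assume "poly p [:c:] = 0"
    then obtain q where q: "p = [:- [:c:], 1:] * q" unfolding poly_eq_0_iff_dvd dvd_def by blast
    then have "q \<noteq> 0" using p by auto
    have pq: "poly (poly p [:x:]) y = (x + - c) * poly (poly q [:x:]) y" for x y
      unfolding q by (simp add: algebra_simps)
    have "(\<forall>t\<in>{0<..<1}. g t $ i + - c = 0) \<or> (\<forall>t\<in>{0<..<1}. poly (poly q [:g t $ i:]) (g t $ j) = 0)"
    proof (rule analytic_ioo_mult_eq_0)
      show "analytic_ioo (\<lambda>t. g t $ i + - c)" by (intro analytic_ioo_add analytic analytic_ioo_const)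
      show "analytic_ioo (\<lambda>t. poly (poly q [:g t $ i:]) (g t $ j))"
        using analytic_polynomial[OF real_polynomial_poly2] by simp
      show "(g t $ i + - c) * poly (poly q [:g t $ i:]) (g t $ j) = 0" if "t \<in> {0<..<1}" for t
        using p that pq by simp
    qed
    then have "?I q" using nc[of c] \<open>q \<noteq> 0\<close> by auto
    moreover have "Polynomial.degree p = 1 + Polynomial.degree q"
      unfolding q using \<open>q \<noteq> 0\<close> by (subst degree_mult_eq) auto
    ultimately show False using pmin[of q] by simp
  qed
  then have "finite {y. poly (poly p [:c:]) y = 0}" by (rule poly_roots_finite)
  then show ?thesis using p by (intro exI[of _ "{y. poly (poly p [:c:]) y = 0}"]) auto
qed

text \<open>On the fibre the two other coordinates take finitely many values, and the arc is injective.\<close>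

lemma coordinate_fibre_finite:
  assumes ijk: "i \<noteq> j" "i \<noteq> k" "j \<noteq> (k::3)" and nc: "\<And>c. \<exists>t\<in>{0<..<1}. g t $ i \<noteq> c"
  shows "finite {t\<in>{0<..<1}. g t $ i = c}"
proof -
  obtain A where A: "finite A" "\<forall>t\<in>{0<..<1}. g t $ i = c \<longrightarrow> g t $ j \<in> A"
    using coordinate_value_bound[OF ijk nc] by blast
  obtain B where B: "finite B" "\<forall>t\<in>{0<..<1}. g t $ i = c \<longrightarrow> g t $ k \<in> B"
    using coordinate_value_bound[of i k j, OF ijk(2,1) not_sym[OF ijk(3)] nc] by blast
  let ?S = "{t\<in>{0<..<1}. g t $ i = c}" and ?h = "\<lambda>t. (g t $ j, g t $ k)"
  have "inj_on ?h ?S"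
  proof (rule inj_onI)
    fix s t assume s: "s \<in> ?S" and t: "t \<in> ?S" and "?h s = ?h t"
    then have "g s $ l = g t $ l" if "l \<in> {i,j,k}" for l using that by auto
    then have "g s = g t" unfolding vec_eq_iff UNIV_3_distinct[OF ijk, symmetric] by simp
    then show "s = t" using s t inj by (auto dest: inj_onD)
  qed
  moreover have "?h ` ?S \<subseteq> A \<times> B" using A B by auto
  then have "finite (?h ` ?S)" using finite_subset finite_cartesian_product[OF A(1) B(1)] by blast
  ultimately show ?thesis using finite_imageD by blast
qed

text \<open>Let \<open>R0\<close> be the ring of expansions of polynomials in the coordinate \<open>i\<close>, and let
  \<open>R1\<close> and \<open>R2\<close> arise from it by adjoining the coordinate \<open>j\<close> and then
  \<open>k\<close>, so that \<open>R2\<close> consists of the expansions of all polynomials. Both coordinates are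
  algebraic over \<open>R0\<close>. Two applications of \<open>nonzero_divides_base_element\<close> bring a nonzero
  element of \<open>R2\<close> down to \<open>R1\<close> and then to \<open>R0\<close>.\<close>

lemma polynomial_multiple_in_coordinate:
  assumes ijk: "i \<noteq> j" "i \<noteq> k" "j \<noteq> (k::3)" and nc: "\<And>c. \<exists>t\<in>{0<..<1}. g t $ i \<noteq> c"
    and P: "real_polynomial_function P" "\<exists>t\<in>{0<..<1}. P (g t) \<noteq> 0"
  shows "\<exists>Q a. a \<noteq> 0 \<and> (\<forall>t\<in>{0<..<1}. P (g t) * Q (g t) = poly a (g t $ i))"
proof -
  define R0 where "R0 = {F. \<exists>a. expands (\<lambda>x. poly a (x $ i)) F}"
  have R0: "0 \<in> R0" "1 \<in> R0" "\<And>a b. a \<in> R0 \<Longrightarrow> b \<in> R0 \<Longrightarrow> a + b \<in> R0"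
    "\<And>a b. a \<in> R0 \<Longrightarrow> b \<in> R0 \<Longrightarrow> a * b \<in> R0" "\<And>a. a \<in> R0 \<Longrightarrow> - a \<in> R0"
  proof -
    have c: "fps_const c \<in> R0" for c
      unfolding R0_def using expands_const[of c] by (auto intro!: exI[of _ "[:c:]"])
    show "0 \<in> R0" "1 \<in> R0" using c[of 0] c[of 1] by simp_all
    show "a + b \<in> R0" if ab: "a \<in> R0" "b \<in> R0" for a b
    proof -
      from ab obtain p q where "expands (\<lambda>x. poly p (x $ i)) a" "expands (\<lambda>x. poly q (x $ i)) b" by (auto simp: R0_def)
      from expands_add[OF this] show ?thesis unfolding R0_def by (auto intro!: exI[of _ "p + q"])
    qed
    show m: "a * b \<in> R0" if ab: "a \<in> R0" "b \<in> R0" for a b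
    proof -
      from ab obtain p q where "expands (\<lambda>x. poly p (x $ i)) a" "expands (\<lambda>x. poly q (x $ i)) b" by (auto simp: R0_def)
      from expands_mult[OF this] show ?thesis unfolding R0_def by (auto intro!: exI[of _ "p * q"])
    qed
    show "- a \<in> R0" if "a \<in> R0" for a
      using m[OF c[of "-1"] that] by (simp add: fps_const_neg[symmetric] del: fps_const_neg)
  qed
  define G where "G = (\<lambda>l. SOME F. expands (\<lambda>x. x $ l) F)"
  have G: "expands (\<lambda>x. x $ l) (G l)" for l
    unfolding G_def by (rule someI_ex) (use expands_exists[OF real_polynomial_function_nth] in blast)
  define R1 where "R1 = {poly b (G j) | b. \<forall>n. Polynomial.coeff b n \<in> R0}"
  define R2 where "R2 = {poly b (G k) | b. \<forall>n. Polynomial.coeff b n \<in> R1}"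
  have ring: "0 \<in> S' \<and> 1 \<in> S' \<and> S \<subseteq> S' \<and> y \<in> S' \<and> (\<forall>a\<in>S'. \<forall>b\<in>S'. a + b \<in> S' \<and> a * b \<in> S') \<and> (\<forall>a\<in>S'. - a \<in> S')"
    if S: "0 \<in> S" "1 \<in> S" "\<And>a b. a \<in> S \<Longrightarrow> b \<in> S \<Longrightarrow> a + b \<in> S"
    "\<And>a b. a \<in> S \<Longrightarrow> b \<in> S \<Longrightarrow> a * b \<in> S" "\<And>a. a \<in> S \<Longrightarrow> - a \<in> S"
    and S': "S' = {poly b y | b. \<forall>n. Polynomial.coeff b n \<in> S}" for S S' :: "real fps set" and y
  proof -
    have sum: "(\<Sum>i\<in>I. h i) \<in> S" if "\<And>i. i \<in> I \<Longrightarrow> h i \<in> S" for h :: "nat \<Rightarrow> real fps" and I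
      using that by (induction I rule: infinite_finite_induct) (auto simp: S)
    have c: "S \<subseteq> S'"
    proof
      fix a assume "a \<in> S"
      then have "\<forall>n. Polynomial.coeff [:a:] n \<in> S" using S(1) by (auto simp: coeff_pCons split: nat.splits)
      then show "a \<in> S'" unfolding S' by (auto intro!: exI[of _ "[:a:]"])
    qed
    have "\<forall>n. Polynomial.coeff [:0, 1:] n \<in> S" using S by (auto simp: coeff_pCons split: nat.splits)
    then have "y \<in> S'" unfolding S' by (auto intro!: exI[of _ "[:0, 1:]"])
    moreover have "a + b \<in> S' \<and> a * b \<in> S'" if "a \<in> S'" "b \<in> S'" for a b
    proof -
      obtain p q where p: "a = poly p y" "\<forall>n. Polynomial.coeff p n \<in> S" and q: "b = poly q y" "\<forall>n. Polynomial.coeff q n \<in> S"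
        using \<open>a \<in> S'\<close> \<open>b \<in> S'\<close> unfolding S' by blast
      have "\<forall>n. Polynomial.coeff (p + q) n \<in> S" using p q S by simp
      moreover have "\<forall>n. Polynomial.coeff (p * q) n \<in> S"
        unfolding Polynomial.coeff_mult by (intro allI sum S(4)) (use p q in auto)
      moreover have "a + b = poly (p + q) y" "a * b = poly (p * q) y" using p q by simp_all
      ultimately show ?thesis unfolding S' by blast
    qed
    moreover have "- a \<in> S'" if a: "a \<in> S'" for a
    proof -
      obtain p where p: "a = poly p y" "\<forall>n. Polynomial.coeff p n \<in> S" using a unfolding S' by blast
      then have "\<forall>n. Polynomial.coeff (- p) n \<in> S" "- a = poly (- p) y" using S(5) by simp_all
      then show ?thesis unfolding S' by blast
    qed
    ultimately show ?thesis using c S(1,2) by blast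
  qed
  have R1: "0 \<in> R1" "1 \<in> R1" "R0 \<subseteq> R1" "G j \<in> R1" "\<And>a b. a \<in> R1 \<Longrightarrow> b \<in> R1 \<Longrightarrow> a + b \<in> R1"
    "\<And>a b. a \<in> R1 \<Longrightarrow> b \<in> R1 \<Longrightarrow> a * b \<in> R1" "\<And>a. a \<in> R1 \<Longrightarrow> - a \<in> R1"
    using ring[OF R0 R1_def] by blast+
  have R2: "R1 \<subseteq> R2" "G k \<in> R2" "\<And>a b. a \<in> R2 \<Longrightarrow> b \<in> R2 \<Longrightarrow> a + b \<in> R2"
    "\<And>a b. a \<in> R2 \<Longrightarrow> b \<in> R2 \<Longrightarrow> a * b \<in> R2"
    using ring[OF R1(1,2,5,6,7) R2_def] by blast+
  have G_R2: "G l \<in> R2" for l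
  proof -
    have "G i \<in> R0" unfolding R0_def using G[of i] by (auto intro!: exI[of _ "[:0, 1:]"])
    then have "G l \<in> R2" if "l \<in> {i, j, k}" using that R1 R2 by auto
    then show ?thesis using UNIV_3_distinct[OF ijk] by blast
  qed
  have const_R2: "fps_const c \<in> R2" for c
  proof -
    have "fps_const c \<in> R0" unfolding R0_def using expands_const[of c] by (auto intro!: exI[of _ "[:c:]"])
    then show ?thesis using R1(3) R2(1) by blast
  qed
  have in_R2: "\<exists>F\<in>R2. expands P F" if "real_polynomial_function P" for P
    using that
  proof induction
    case (linear f)
    have eq: "f x = f (axis i 1) * x $ i + (f (axis j 1) * x $ j + f (axis k 1) * x $ k)" for x
      using linear_functional_coordinates[OF linear, of x] ijk unfolding UNIV_3_distinct[OF ijk] by (simp add: mult.commute)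
    have "expands (\<lambda>x. f (axis i 1) * x $ i + (f (axis j 1) * x $ j + f (axis k 1) * x $ k))
       (fps_const (f (axis i 1)) * G i + (fps_const (f (axis j 1)) * G j + fps_const (f (axis k 1)) * G k))"
      by (intro expands_add expands_mult expands_const G)
    moreover have "(\<lambda>x. f (axis i 1) * x $ i + (f (axis j 1) * x $ j + f (axis k 1) * x $ k)) = f"
      by (rule ext) (rule eq[symmetric])
    ultimately show ?case
      using R2(3,4) const_R2 G_R2
      by (intro bexI[of _ "fps_const (f (axis i 1)) * G i + (fps_const (f (axis j 1)) * G j + fps_const (f (axis k 1)) * G k)"])
         (simp_all only: )
  next
    case (const c) show ?case using expands_const const_R2 by blast
  next
    case (add p q) then show ?case using expands_add R2(3) by blast
  next
    case (mult p q) then show ?case using expands_mult R2(4) by blast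
  qed
  have R1_exp: "\<exists>B. expands B (poly b (G j))" if "\<forall>n. Polynomial.coeff b n \<in> R0" for b
    by (rule expands_poly[OF _ G that]) (auto simp: R0_def)
  have R2_exp: "\<exists>B. expands B (poly b (G k))" if "\<forall>n. Polynomial.coeff b n \<in> R1" for b
    by (rule expands_poly[OF _ G that]) (use R1_exp in \<open>auto simp: R1_def\<close>)
  \<comment> \<open>the relation over the base ring for a second coordinate\<close>
  have alg: "\<exists>f. f \<noteq> 0 \<and> (\<forall>n. Polynomial.coeff f n \<in> R0) \<and> poly f (G l) = 0" if l: "i \<noteq> l" "i \<noteq> m" "l \<noteq> m" for l m
  proof -
    obtain p :: "real poly poly" where p: "p \<noteq> 0" "\<forall>t\<in>{0<..<1}. poly (poly p [:g t $ l:]) (g t $ i) = 0"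
      using two_coordinates_dependent[OF l] by blast
    define \<phi> where "\<phi> = (\<lambda>a. poly (map_poly fps_const a) (G i))"
    have \<phi>: "expands (\<lambda>x. poly a (x $ i)) (\<phi> a)" for a
    proof (induction a)
      case 0 show ?case using expands_const[of 0] by (simp add: \<phi>_def)
    next
      case (pCons c a)
      then show ?case using expands_add[OF expands_const[of c] expands_mult[OF G[of i] pCons.IH]]
        by (simp add: \<phi>_def map_poly_pCons)
    qed
    have \<phi>0: "\<phi> a = 0 \<longleftrightarrow> a = 0" for a
      using expands_0_iff[OF \<phi>[of a]] polynomial_in_coordinate_nonzero[of i a] nc by (auto simp: \<phi>_def)
    have "expands (\<lambda>x. poly (poly q [:x $ l:]) (x $ i)) (poly (map_poly \<phi> q) (G l))" for q
    proof (induction q)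
      case 0 show ?case using expands_const[of 0] by simp
    next
      case (pCons c q)
      show ?case using expands_add[OF \<phi>[of c] expands_mult[OF G[of l] pCons.IH]]
        using \<phi>0 by (simp add: map_poly_pCons)
    qed
    then have "poly (map_poly \<phi> p) (G l) = 0" using expands_0_iff p(2) by blast
    moreover have "map_poly \<phi> p \<noteq> 0" using p(1) \<phi>0 by (simp add: map_poly_eq_0_iff)
    moreover have "\<forall>n. Polynomial.coeff (map_poly \<phi> p) n \<in> R0"
      using \<phi>0[of 0] \<phi> unfolding R0_def by (auto simp: coeff_map_poly)
    ultimately show ?thesis by blast
  qed
  obtain F where F: "F \<in> R2" "expands P F" using in_R2[OF P(1)] by blast
  have "F \<noteq> 0" using expands_0_iff[OF F(2)] P(2) by blast
  obtain p where p: "F = poly p (G k)" "\<forall>n. Polynomial.coeff p n \<in> R1" using F(1) unfolding R2_def by blast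
  obtain fk where fk: "fk \<noteq> 0" "\<forall>n. Polynomial.coeff fk n \<in> R0" "poly fk (G k) = 0"
    using alg[of k j] ijk by blast
  obtain fj where fj: "fj \<noteq> 0" "\<forall>n. Polynomial.coeff fj n \<in> R0" "poly fj (G j) = 0"
    using alg[of j k] ijk by blast
  have "\<exists>b. (\<forall>n. Polynomial.coeff b n \<in> R1) \<and> poly p (G k) * poly b (G k) \<in> R1 - {0}"
    by (rule nonzero_divides_base_element[where f = fk])
       (use R1 fk p \<open>F \<noteq> 0\<close> in auto)
  then obtain b where b: "\<forall>n. Polynomial.coeff b n \<in> R1" "F * poly b (G k) \<in> R1 - {0}" using p(1) by blast
  obtain c where c: "F * poly b (G k) = poly c (G j)" "\<forall>n. Polynomial.coeff c n \<in> R0" using b(2) unfolding R1_def by blast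
  have "\<exists>d. (\<forall>n. Polynomial.coeff d n \<in> R0) \<and> poly c (G j) * poly d (G j) \<in> R0 - {0}"
    by (rule nonzero_divides_base_element[where f = fj])
       (use R0 fj c b(2) in auto)
  then obtain d where d: "\<forall>n. Polynomial.coeff d n \<in> R0" "F * poly b (G k) * poly d (G j) \<in> R0 - {0}" using c(1) by auto
  obtain a where a: "expands (\<lambda>x. poly a (x $ i)) (F * poly b (G k) * poly d (G j))" using d(2) unfolding R0_def by blast
  obtain B D where B: "expands B (poly b (G k))" and D: "expands D (poly d (G j))"
    using R2_exp[OF b(1)] R1_exp[OF d(1)] by blast
  have "a \<noteq> 0" using expands_0_iff[OF a] d(2) by auto
  have "expands (\<lambda>x. P x * B x * D x) (F * poly b (G k) * poly d (G j))"
    by (intro expands_mult F B D)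
  from expands_add[OF this expands_mult[OF expands_const[of "-1"] a]]
  have "expands (\<lambda>x. P x * B x * D x + -1 * poly a (x $ i)) 0"
    by (simp add: fps_const_neg[symmetric] del: fps_const_neg)
  from expands_0_iff[OF this] have "\<forall>t\<in>{0<..<1}. P (g t) * (B (g t) * D (g t)) = poly a (g t $ i)"
    by (auto simp: mult.assoc)
  then show ?thesis using \<open>a \<noteq> 0\<close> by (intro exI[of _ "\<lambda>x. B x * D x"] exI[of _ a]) auto
qed

lemma ex_distinct_3: "\<exists>j k. i \<noteq> j \<and> i \<noteq> k \<and> j \<noteq> (k::3)"
proof -
  consider "i = 1" | "i = 2" | "i = 3" using exhaust_3 by blast
  then show ?thesis
  proof cases
    case 1 then show ?thesis by (intro exI[of _ 2] exI[of _ 3]) simp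
  next
    case 2 then show ?thesis by (intro exI[of _ 1] exI[of _ 3]) simp
  next
    case 3 then show ?thesis by (intro exI[of _ 1] exI[of _ 2]) simp
  qed
qed

text \<open>A multiple of the polynomial is a nonzero polynomial in a single nonconstant coordinate; the latter has finitely
  many roots, and each of them is attained finitely often.\<close>

theorem polynomial_zeros_finite:
  assumes P: "real_polynomial_function P"
  shows "(\<forall>t\<in>{0<..<1}. P (g t) = 0) \<or> finite {t\<in>{0<..<1}. P (g t) = 0}"
proof (rule disjCI)
  assume "\<not> finite {t\<in>{0<..<1}. P (g t) = 0}"
  show "\<forall>t\<in>{0<..<1}. P (g t) = 0"
  proof (rule ccontr)
    assume nz: "\<not> ?thesis"
    obtain i where nc: "\<And>c. \<exists>t\<in>{0<..<1}. g t $ i \<noteq> c" using nonconstant_coordinate by blast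
    obtain j k where ijk: "i \<noteq> j" "i \<noteq> k" "j \<noteq> (k::3)" using ex_distinct_3 by blast
    obtain Q a where a: "a \<noteq> 0" "\<forall>t\<in>{0<..<1}. P (g t) * Q (g t) = poly a (g t $ i)"
      using polynomial_multiple_in_coordinate[OF ijk nc P] nz by blast
    have "{t\<in>{0<..<1}. P (g t) = 0} \<subseteq> (\<Union>c\<in>{x. poly a x = 0}. {t\<in>{0<..<1}. g t $ i = c})"
      using a(2) by force
    moreover have "finite \<dots>"
      using coordinate_fibre_finite[OF ijk nc] poly_roots_finite[OF a(1)] by blast
    ultimately show False using finite_subset \<open>\<not> finite _\<close> by blast
  qed
qed

end

section \<open>Tangents and critical points on a semialgebraic arc\<close>

lemma has_vector_derivative_vecI:
  fixes g :: "real \<Rightarrow> real^'n"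
  assumes "\<And>i. ((\<lambda>t. g t $ i) has_real_derivative d $ i) (at t)"
  shows "(g has_vector_derivative d) (at t)"
  unfolding has_vector_derivative_def
proof (subst has_derivative_componentwise_within, intro ballI)
  fix b :: "real^'n" assume "b \<in> Basis"
  then obtain i where b: "b = axis i 1" by (auto simp: Basis_vec_def)
  show "((\<lambda>t. g t \<bullet> b) has_derivative (\<lambda>x. (x *\<^sub>R d) \<bullet> b)) (at t)"
    using assms[of i] unfolding b has_field_derivative_def by (simp add: inner_axis mult_commute_abs)
qed

text \<open>Counting the elements of \<open>Y\<close> below a point embeds \<open>S\<close> into
  \<open>{0..card Y}\<close>.\<close>

lemma card_le_separated:
  fixes S Y :: "real set"
  assumes Y: "finite Y" and sep: "\<And>s t. s \<in> S \<Longrightarrow> t \<in> S \<Longrightarrow> s < t \<Longrightarrow> \<exists>y\<in>Y. s < y \<and> y < t"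
  shows "finite S \<and> card S \<le> card Y + 1"
proof -
  let ?f = "\<lambda>s. card {y\<in>Y. y < s}"
  have lt: "?f s < ?f t" if "s \<in> S" "t \<in> S" "s < t" for s t
  proof (rule psubset_card_mono)
    show "finite {y\<in>Y. y < t}" using Y by simp
    from sep[OF that] obtain y where "y \<in> Y" "s < y" "y < t" by blast
    have "{y\<in>Y. y < s} \<subseteq> {y\<in>Y. y < t}" using \<open>s < t\<close> by auto
    moreover have "y \<in> {y\<in>Y. y < t}" "y \<notin> {y\<in>Y. y < s}" using \<open>y \<in> Y\<close> \<open>s < y\<close> \<open>y < t\<close> by auto
    ultimately show "{y\<in>Y. y < s} \<subset> {y\<in>Y. y < t}" by blast
  qed
  have inj: "inj_on ?f S"
  proof (rule inj_onI)
    fix s t assume "s \<in> S" "t \<in> S" "?f s = ?f t"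
    then show "s = t" using lt[of s t] lt[of t s] by (cases s t rule: linorder_cases) auto
  qed
  have sub: "?f ` S \<subseteq> {..card Y}" using Y by (auto intro: card_mono)
  then have "finite (?f ` S)" using finite_subset by blast
  then have "finite S" using inj finite_imageD by blast
  moreover have "card S \<le> card Y + 1"
    using card_inj_on_le[OF inj sub] by simp
  ultimately show ?thesis by blast
qed

locale regular_semialgebraic_arc = semialgebraic_arc +
  assumes regular: "\<And>t. t \<in> {0<..<1} \<Longrightarrow> vector_derivative g (at t) \<noteq> 0"
begin

lemma velocity:
  assumes "t \<in> {0<..<1}"
  shows "(g has_vector_derivative (\<chi> i. deriv (\<lambda>t. g t $ i) t)) (at t)"
  by (rule has_vector_derivative_vecI) (use analytic_ioo_DERIV[OF analytic assms] in simp)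

text \<open>Differentiate a relation of least degree in \<open>x $ j\<close> along the arc: its partial derivative in
  \<open>x $ j\<close> has smaller degree and is nonzero, so it cannot vanish identically on the arc.\<close>

lemma nondegenerate_relation:
  assumes ijk: "i \<noteq> j" "i \<noteq> k" "j \<noteq> (k::3)" and nc: "\<And>c. \<exists>t\<in>{0<..<1}. g t $ i \<noteq> c"
  shows "\<exists>A B. real_polynomial_function A \<and> real_polynomial_function B \<and> (\<exists>t\<in>{0<..<1}. B (g t) \<noteq> 0) \<and>
    (\<forall>t\<in>{0<..<1}. A (g t) * deriv (\<lambda>t. g t $ i) t + B (g t) * deriv (\<lambda>t. g t $ j) t = 0)"
proof -
  let ?I = "\<lambda>p::real poly poly. p \<noteq> 0 \<and> (\<forall>t\<in>{0<..<1}. poly (poly p [:g t $ j:]) (g t $ i) = 0)"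
  obtain p0 where "?I p0" using two_coordinates_dependent[OF ijk] by blast
  then obtain p where p: "?I p" and pmin: "\<And>q. ?I q \<Longrightarrow> Polynomial.degree p \<le> Polynomial.degree q"
    using ex_has_least_nat[of ?I p0 Polynomial.degree] by blast
  have deg: "Polynomial.degree p \<noteq> 0"
  proof
    assume "Polynomial.degree p = 0"
    then obtain q where q: "p = [:q:]" by (meson degree_eq_zeroE)
    then have "q \<noteq> 0" "\<forall>t\<in>{0<..<1}. poly q (g t $ i) = 0" using p by auto
    then show False using polynomial_in_coordinate_nonzero[OF nc] by blast
  qed
  have "pderiv p \<noteq> 0" "Polynomial.degree (pderiv p) < Polynomial.degree p"
    using deg by (auto simp: pderiv_eq_0_iff degree_pderiv)
  then have nz: "\<exists>t\<in>{0<..<1}. poly (poly (pderiv p) [:g t $ j:]) (g t $ i) \<noteq> 0"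
    using pmin[of "pderiv p"] by auto
  have rel: "poly (poly (map_poly pderiv p) [:g t $ j:]) (g t $ i) * deriv (\<lambda>t. g t $ i) t +
      poly (poly (pderiv p) [:g t $ j:]) (g t $ i) * deriv (\<lambda>t. g t $ j) t = 0" if t: "t \<in> {0<..<1}" for t
  proof -
    have "((\<lambda>t. poly (poly p [:g t $ j:]) (g t $ i)) has_real_derivative
        poly (poly (map_poly pderiv p) [:g t $ j:]) (g t $ i) * deriv (\<lambda>t. g t $ i) t +
      poly (poly (pderiv p) [:g t $ j:]) (g t $ i) * deriv (\<lambda>t. g t $ j) t) (at t)"
      by (intro DERIV_poly2 analytic_ioo_DERIV analytic t)
    moreover have "\<forall>\<^sub>F s in nhds t. s \<in> {0<..<1}"
      using t by (intro eventually_nhds_in_open) auto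
    then have ev: "\<forall>\<^sub>F s in nhds t. poly (poly p [:g s $ j:]) (g s $ i) = 0"
      by eventually_elim (use p in auto)
    ultimately have "((\<lambda>t. 0) has_real_derivative
        poly (poly (map_poly pderiv p) [:g t $ j:]) (g t $ i) * deriv (\<lambda>t. g t $ i) t +
      poly (poly (pderiv p) [:g t $ j:]) (g t $ i) * deriv (\<lambda>t. g t $ j) t) (at t)"
      using DERIV_cong_ev[OF refl ev refl] by blast
    then show ?thesis using DERIV_unique DERIV_const by blast
  qed
  have "real_polynomial_function (\<lambda>x::real^3. poly (poly (map_poly pderiv p) [:x $ j:]) (x $ i))"
     "real_polynomial_function (\<lambda>x::real^3. poly (poly (pderiv p) [:x $ j:]) (x $ i))"
    by (rule real_polynomial_poly2)+
  then show ?thesis using nz rel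
    by (intro exI[of _ "\<lambda>x. poly (poly (map_poly pderiv p) [:x $ j:]) (x $ i)"]
          exI[of _ "\<lambda>x. poly (poly (pderiv p) [:x $ j:]) (x $ i)"]) simp
qed

text \<open>The relations for the pairs \<open>i, j\<close> and \<open>i, k\<close> determine the velocity up to a factor;
  clearing denominators makes its direction polynomial. Only the zeros of the common denominator are lost.\<close>

lemma polynomial_tangent_field:
  "\<exists>T \<mu> Z. finite Z \<and> (\<forall>i. real_polynomial_function (\<lambda>x. T x $ i)) \<and>
    (\<forall>t\<in>{0<..<1} - Z. \<mu> t \<noteq> 0 \<and> (g has_vector_derivative \<mu> t *\<^sub>R T (g t)) (at t))"
proof -
  obtain i where nc: "\<And>c. \<exists>t\<in>{0<..<1}. g t $ i \<noteq> c" using nonconstant_coordinate by blast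
  obtain j k where ijk: "i \<noteq> j" "i \<noteq> k" "j \<noteq> (k::3)" using ex_distinct_3 by blast
  obtain A B where A: "real_polynomial_function A" and B: "real_polynomial_function B" "\<exists>t\<in>{0<..<1}. B (g t) \<noteq> 0"
    and AB: "\<forall>t\<in>{0<..<1}. A (g t) * deriv (\<lambda>t. g t $ i) t + B (g t) * deriv (\<lambda>t. g t $ j) t = 0"
    using nondegenerate_relation[OF ijk nc] by blast
  obtain C D where C: "real_polynomial_function C" and D: "real_polynomial_function D" "\<exists>t\<in>{0<..<1}. D (g t) \<noteq> 0"
    and CD: "\<forall>t\<in>{0<..<1}. C (g t) * deriv (\<lambda>t. g t $ i) t + D (g t) * deriv (\<lambda>t. g t $ k) t = 0"
    using nondegenerate_relation[of i k j, OF ijk(2,1) not_sym[OF ijk(3)] nc] by blast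
  define T :: "real^3 \<Rightarrow> real^3" where
    "T x = (\<chi> l. if l = i then B x * D x else if l = j then -1 * (A x * D x) else -1 * (B x * C x))" for x
  have T: "T x $ i = B x * D x" "T x $ j = -1 * (A x * D x)" "T x $ k = -1 * (B x * C x)" for x
    using ijk by (auto simp: T_def)
  define Z where "Z = {t\<in>{0<..<1}. B (g t) * D (g t) = 0}"
  have "\<exists>t\<in>{0<..<1}. \<forall>f\<in>{\<lambda>t. B (g t), \<lambda>t. D (g t)}. f t \<noteq> 0"
    by (rule analytic_ioo_common_nonzero) (use B D analytic_polynomial in auto)
  then have nz: "\<exists>t\<in>{0<..<1}. B (g t) * D (g t) \<noteq> 0" by auto
  have BD: "real_polynomial_function (\<lambda>x. B x * D x)" using B D real_polynomial_function.intros(4) by blast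
  have finZ: "finite Z" unfolding Z_def using polynomial_zeros_finite[OF BD] nz by auto
  define \<mu> where "\<mu> t = deriv (\<lambda>t. g t $ i) t / (B (g t) * D (g t))" for t
  show ?thesis
  proof (intro exI[of _ T] exI[of _ \<mu>] exI[of _ Z] conjI allI ballI)
    show "finite Z" by (rule finZ)
    fix l
    consider "l = i" | "l = j" | "l = k" using UNIV_3_distinct[OF ijk] by blast
    then show "real_polynomial_function (\<lambda>x. T x $ l)"
      by cases (simp_all only: T, (intro real_polynomial_function.intros(4) real_polynomial_function.intros(2)[of "-1"] A B C D)+)
  next
    fix t assume t: "t \<in> {0<..<1} - Z"
    then have bd: "B (g t) \<noteq> 0" "D (g t) \<noteq> 0" by (auto simp: Z_def)
    have e: "\<mu> t * (T (g t) $ l) = deriv (\<lambda>t. g t $ l) t" for l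
    proof -
      have ab: "B (g t) * deriv (\<lambda>t. g t $ j) t = - (A (g t) * deriv (\<lambda>t. g t $ i) t)"
        and cd: "D (g t) * deriv (\<lambda>t. g t $ k) t = - (C (g t) * deriv (\<lambda>t. g t $ i) t)"
        using AB CD t by (auto simp: add_eq_0_iff2)
      consider "l = i" | "l = j" | "l = k" using UNIV_3_distinct[OF ijk] by blast
      then show ?thesis
      proof cases
        case 1 then show ?thesis using bd by (simp add: T \<mu>_def)
      next
        case 2 then show ?thesis using bd ab by (simp add: T \<mu>_def field_simps)
      next
        case 3 then show ?thesis using bd cd by (simp add: T \<mu>_def field_simps)
      qed
    qed
    have "(\<chi> l. deriv (\<lambda>t. g t $ l) t) = \<mu> t *\<^sub>R T (g t)" by (simp add: vec_eq_iff e)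
    then show d: "(g has_vector_derivative \<mu> t *\<^sub>R T (g t)) (at t)" using velocity[of t] t by auto
    show "\<mu> t \<noteq> 0"
    proof
      assume "\<mu> t = 0"
      then have "vector_derivative g (at t) = 0" using d vector_derivative_at by fastforce
      then show False using regular t by auto
    qed
  qed
qed

text \<open>The derivation along the field \<open>T\<close> maps polynomials to polynomials.\<close>

lemma polynomial_derivation:
  "\<exists>T \<mu> Z. finite Z \<and> (\<forall>i. real_polynomial_function (\<lambda>x. T x $ i)) \<and>
    (\<forall>t\<in>{0<..<1} - Z. \<mu> t \<noteq> 0 \<and> (g has_vector_derivative \<mu> t *\<^sub>R T (g t)) (at t)) \<and>
    (\<forall>P. real_polynomial_function P \<longrightarrow> (\<exists>Q. real_polynomial_function Q \<and>
       (\<forall>t\<in>{0<..<1} - Z. ((\<lambda>t. P (g t)) has_real_derivative \<mu> t * Q (g t)) (at t))))"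
proof -
  obtain T \<mu> Z where Z: "finite Z" and T: "\<forall>i. real_polynomial_function (\<lambda>x. T x $ i)"
    and d: "\<forall>t\<in>{0<..<1} - Z. \<mu> t \<noteq> 0 \<and> (g has_vector_derivative \<mu> t *\<^sub>R T (g t)) (at t)"
    using polynomial_tangent_field by blast
  have "\<exists>Q. real_polynomial_function Q \<and>
       (\<forall>t\<in>{0<..<1} - Z. ((\<lambda>t. P (g t)) has_real_derivative \<mu> t * Q (g t)) (at t))"
    if "real_polynomial_function P" for P
    using that
  proof induction
    case (linear f)
    have "real_polynomial_function (\<lambda>x. f (T x))"
    proof -
      have "real_polynomial_function (\<lambda>x. \<Sum>i\<in>(UNIV::3 set). T x $ i * f (axis i 1))"
        unfolding sum_3 by (intro real_polynomial_function.intros(2,3,4) T[rule_format])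
      moreover have "(\<lambda>x. f (T x)) = (\<lambda>x. \<Sum>i\<in>UNIV. T x $ i * f (axis i 1))" by (rule ext) (rule linear_functional_coordinates[OF linear])
      ultimately show ?thesis by metis
    qed
    moreover have "((\<lambda>t. f (g t)) has_real_derivative \<mu> t * f (T (g t))) (at t)" if "t \<in> {0<..<1} - Z" for t
    proof -
      have "(g has_derivative (\<lambda>h. h *\<^sub>R \<mu> t *\<^sub>R T (g t))) (at t)"
        using d that unfolding has_vector_derivative_def by blast
      from bounded_linear.has_derivative[OF linear this]
      show ?thesis unfolding has_field_derivative_def
        by (rule has_derivative_eq_rhs) (auto simp: fun_eq_iff linear_cmul[OF bounded_linear.linear[OF linear]])
    qed
    ultimately show ?case by blast
  next
    case (const c)
    have "\<forall>t\<in>{0<..<1} - Z. ((\<lambda>t. c) has_real_derivative \<mu> t * 0) (at t)" by simp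
    then show ?case using real_polynomial_function.intros(2)[of 0] by blast
  next
    case (add p q)
    then obtain P Q where PQ: "real_polynomial_function P" "real_polynomial_function Q"
      "\<forall>t\<in>{0<..<1} - Z. ((\<lambda>t. p (g t)) has_real_derivative \<mu> t * P (g t)) (at t)"
      "\<forall>t\<in>{0<..<1} - Z. ((\<lambda>t. q (g t)) has_real_derivative \<mu> t * Q (g t)) (at t)" by blast
    have "real_polynomial_function (\<lambda>x. P x + Q x)" using PQ real_polynomial_function.intros(3) by blast
    moreover have "((\<lambda>t. p (g t) + q (g t)) has_real_derivative \<mu> t * (P (g t) + Q (g t))) (at t)" if "t \<in> {0<..<1} - Z" for t
      using DERIV_add[OF bspec[OF PQ(3) that] bspec[OF PQ(4) that]] by (simp add: algebra_simps)
    ultimately show ?case by (intro exI[of _ "\<lambda>x. P x + Q x"]) blast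
  next
    case (mult p q)
    then obtain P Q where PQ: "real_polynomial_function P" "real_polynomial_function Q"
      "\<forall>t\<in>{0<..<1} - Z. ((\<lambda>t. p (g t)) has_real_derivative \<mu> t * P (g t)) (at t)"
      "\<forall>t\<in>{0<..<1} - Z. ((\<lambda>t. q (g t)) has_real_derivative \<mu> t * Q (g t)) (at t)" by blast
    have "real_polynomial_function (\<lambda>x. p x * Q x + P x * q x)"
      using PQ mult.hyps by (intro real_polynomial_function.intros(3,4))
    moreover have "((\<lambda>t. p (g t) * q (g t)) has_real_derivative \<mu> t * (p (g t) * Q (g t) + P (g t) * q (g t))) (at t)" if "t \<in> {0<..<1} - Z" for t
      using DERIV_mult'[OF bspec[OF PQ(3) that] bspec[OF PQ(4) that]] by (simp add: algebra_simps)
    ultimately show ?case by (intro exI[of _ "\<lambda>x. p x * Q x + P x * q x"]) blast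
  qed
  then show ?thesis using Z T d by blast
qed

lemma real_polynomial_function_linear_combination:
  assumes "finite I" "\<And>i. i \<in> I \<Longrightarrow> real_polynomial_function (P i)"
  shows "real_polynomial_function (\<lambda>x. \<Sum>i\<in>I. c i * P i x)"
  using assms
proof (induction I rule: finite_induct)
  case empty then show ?case using real_polynomial_function.intros(2)[of 0] by simp
next
  case (insert i I)
  have "real_polynomial_function (\<lambda>x. c i * P i x + (\<Sum>i\<in>I. c i * P i x))"
    using insert by (intro real_polynomial_function.intros(2-4)) auto
  then show ?case using insert by simp
qed

text \<open>Induction on the number of terms, as for Descartes' rule. Divide the combination by \<open>P a\<close> and
  differentiate: up to the nonvanishing factor \<open>\<mu> / (P a)\<^sup>2\<close> the derivative is a combination of
  one term less, with the Wronskians \<open>X i\<close> of \<open>P i\<close> and \<open>P a\<close> in place of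
  \<open>P i\<close>. These are the same for all \<open>c\<close>, hence the bound is uniform. By Rolle's theorem, two
  zeros of the combination enclose a zero of the shorter one or one of the finitely many excluded points.\<close>

lemma linear_combination_zeros_bounded:
  assumes "finite I" "\<And>i. i \<in> I \<Longrightarrow> real_polynomial_function (P i)"
  shows "\<exists>N. \<forall>c. (\<forall>t\<in>{0<..<1}. (\<Sum>i\<in>I. c i * P i (g t)) = 0) \<or>
    (finite {t\<in>{0<..<1}. (\<Sum>i\<in>I. c i * P i (g t)) = 0} \<and> card {t\<in>{0<..<1}. (\<Sum>i\<in>I. c i * P i (g t)) = 0} \<le> N)"
  using assms
proof (induction I arbitrary: P rule: finite_induct)
  case empty then show ?case by simp
next
  case (insert a I)
  obtain \<mu> Z where Z: "finite Z" and \<mu>: "\<forall>t\<in>{0<..<1} - Z. \<mu> t \<noteq> 0"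
    and der: "\<forall>P. real_polynomial_function P \<longrightarrow> (\<exists>Q. real_polynomial_function Q \<and>
       (\<forall>t\<in>{0<..<1} - Z. ((\<lambda>t. P (g t)) has_real_derivative \<mu> t * Q (g t)) (at t)))"
    using polynomial_derivation by blast
  show ?case
  proof (cases "\<forall>t\<in>{0<..<1}. P a (g t) = 0")
    case True
    obtain N where N: "\<forall>c. (\<forall>t\<in>{0<..<1}. (\<Sum>i\<in>I. c i * P i (g t)) = 0) \<or>
    (finite {t\<in>{0<..<1}. (\<Sum>i\<in>I. c i * P i (g t)) = 0} \<and> card {t\<in>{0<..<1}. (\<Sum>i\<in>I. c i * P i (g t)) = 0} \<le> N)"
      using insert.IH[of P] insert.prems by blast
    have "(\<Sum>i\<in>insert a I. c i * P i (g t)) = (\<Sum>i\<in>I. c i * P i (g t))" if "t \<in> {0<..<1}" for c t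
      using insert.hyps True that by simp
    then have "(\<forall>t\<in>{0<..<1}. (\<Sum>i\<in>insert a I. c i * P i (g t)) = 0) = (\<forall>t\<in>{0<..<1}. (\<Sum>i\<in>I. c i * P i (g t)) = 0)"
      "{t\<in>{0<..<1}. (\<Sum>i\<in>insert a I. c i * P i (g t)) = 0} = {t\<in>{0<..<1}. (\<Sum>i\<in>I. c i * P i (g t)) = 0}" for c
      by auto
    then show ?thesis using N by (intro exI[of _ N]) simp
  next
    case False
    have Pa: "real_polynomial_function (P a)" using insert.prems by simp
    define W where "W = Z \<union> {t\<in>{0<..<1}. P a (g t) = 0}"
    have W: "finite W" using Z polynomial_zeros_finite[OF Pa] False by (auto simp: W_def)
    have "\<forall>i\<in>insert a I. \<exists>Q. real_polynomial_function Q \<and>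
       (\<forall>t\<in>{0<..<1} - Z. ((\<lambda>t. P i (g t)) has_real_derivative \<mu> t * Q (g t)) (at t))"
      using der insert.prems by blast
    then obtain Q where Q: "\<forall>i\<in>insert a I. real_polynomial_function (Q i) \<and>
       (\<forall>t\<in>{0<..<1} - Z. ((\<lambda>t. P i (g t)) has_real_derivative \<mu> t * Q i (g t)) (at t))"
      by (rule bchoice[THEN exE])
    define X where "X = (\<lambda>i x. Q i x * P a x + -1 * (P i x * Q a x))"
    have X: "real_polynomial_function (X i)" if "i \<in> I" for i
      unfolding X_def using that Q insert.prems by (intro real_polynomial_function.intros(2-4)) auto
    obtain N where N: "\<forall>c. (\<forall>t\<in>{0<..<1}. (\<Sum>i\<in>I. c i * X i (g t)) = 0) \<or>
    (finite {t\<in>{0<..<1}. (\<Sum>i\<in>I. c i * X i (g t)) = 0} \<and> card {t\<in>{0<..<1}. (\<Sum>i\<in>I. c i * X i (g t)) = 0} \<le> N)"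
      using insert.IH[of X] X by blast
    show ?thesis
    proof (intro exI[of _ "N + card W + 1 + card W"] allI)
      fix c
      define \<phi> where "\<phi> t = (\<Sum>i\<in>insert a I. c i * P i (g t))" for t
      define \<psi> where "\<psi> t = (\<Sum>i\<in>I. c i * X i (g t))" for t
      define q where "q t = \<phi> t / P a (g t)" for t
      have q: "(q has_real_derivative \<mu> t * \<psi> t / (P a (g t))\<^sup>2) (at t)" if t: "t \<in> {0<..<1} - W" for t
      proof -
        have tz: "t \<in> {0<..<1} - Z" "P a (g t) \<noteq> 0" using t by (auto simp: W_def)
        have d: "((\<lambda>t. P i (g t)) has_real_derivative \<mu> t * Q i (g t)) (at t)" if "i \<in> insert a I" for i
          using Q tz that by blast
        have "(\<phi> has_real_derivative (\<Sum>i\<in>insert a I. c i * (\<mu> t * Q i (g t)))) (at t)"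
          unfolding \<phi>_def by (intro DERIV_sum DERIV_cmult d)
        from DERIV_divide[OF this d[of a] tz(2)]
        have "(q has_real_derivative ((\<Sum>i\<in>insert a I. c i * (\<mu> t * Q i (g t))) * P a (g t) - \<phi> t * (\<mu> t * Q a (g t))) / (P a (g t) * P a (g t))) (at t)"
          unfolding q_def by simp
        moreover have "(\<Sum>i\<in>insert a I. c i * (\<mu> t * Q i (g t))) * P a (g t) - \<phi> t * (\<mu> t * Q a (g t)) = \<mu> t * \<psi> t"
        proof -
          have "\<mu> t * \<psi> t = (\<Sum>i\<in>I. c i * (\<mu> t * Q i (g t)) * P a (g t) - c i * P i (g t) * (\<mu> t * Q a (g t)))"
            unfolding \<psi>_def X_def sum_distrib_left by (intro sum.cong) (auto simp: algebra_simps)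
          also have "\<dots> = (\<Sum>i\<in>I. c i * (\<mu> t * Q i (g t))) * P a (g t) - (\<Sum>i\<in>I. c i * P i (g t)) * (\<mu> t * Q a (g t))"
            by (simp add: sum_subtractf sum_distrib_right)
          finally show ?thesis using insert.hyps unfolding \<phi>_def by (simp add: algebra_simps)
        qed
        ultimately show ?thesis by (simp add: power2_eq_square)
      qed
      have op: "open ({0<..<1} - W)" using W by (intro open_Diff finite_imp_closed) auto
      let ?S = "{t\<in>{0<..<1}. \<phi> t = 0}"
      have alt: "(\<forall>t\<in>{0<..<1}. \<phi> t = 0) \<or> finite ?S"
        unfolding \<phi>_def using insert.hyps insert.prems
        by (intro polynomial_zeros_finite[OF real_polynomial_function_linear_combination]) auto
      have "(\<forall>t\<in>{0<..<1}. \<phi> t = 0) \<or> (finite ?S \<and> card ?S \<le> N + card W + 1 + card W)"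
      proof (rule disjCI)
        assume nf: "\<not> (finite ?S \<and> card ?S \<le> N + card W + 1 + card W)"
        show "\<forall>t\<in>{0<..<1}. \<phi> t = 0"
        proof (rule ccontr)
          assume nz: "\<not> (\<forall>t\<in>{0<..<1}. \<phi> t = 0)"
          then have finS: "finite ?S" using alt by blast
          have "card (?S - W) \<le> N + card W + 1"
          \<comment> \<open>If the shorter combination vanishes identically, the quotient is locally constant, and a zero would spread to an interval.\<close>
          proof (cases "\<forall>t\<in>{0<..<1}. \<psi> t = 0")
            case True
            have "?S - W = {}"
            proof (rule ccontr)
              assume "?S - W \<noteq> {}"
              then obtain z where z: "z \<in> {0<..<1} - W" "\<phi> z = 0" by auto
              obtain e where e: "e > 0" "{z - e<..<z + e} \<subseteq> {0<..<1} - W"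
                using op[unfolded open_contains_ball, rule_format, OF z(1)]
                unfolding ball_eq_greaterThanLessThan by (elim exE conjE) (rule that)
              have "\<phi> t = 0" if t: "t \<in> {z - e<..<z + e}" for t
              proof -
                have "q t = q z"
                proof (rule DERIV_isconst3[where f = q and x = t and y = z and a = "z - e" and b = "z + e"])
                  fix s assume "s \<in> {z - e<..<z + e}"
                  then have "s \<in> {0<..<1} - W" using e(2) by blast
                  from q[OF this] show "DERIV q s :> 0" using True \<open>s \<in> {0<..<1} - W\<close> by simp
                qed (use e(1) t in auto)
                moreover have "P a (g t) \<noteq> 0" using t e(2) by (auto simp: W_def)
                ultimately show ?thesis using z(2) by (auto simp: q_def)
              qed
              then have "{z - e<..<z + e} \<subseteq> ?S" using e(2) by auto
              then have "finite {z - e<..<z + e}" using finS finite_subset by blast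
              then show False using e(1) infinite_Ioo[of "z - e" "z + e"] by simp
            qed
            then show ?thesis by (metis card.empty zero_le)
          next
            case False
            let ?Y = "{t\<in>{0<..<1}. \<psi> t = 0}"
            have Y: "finite ?Y" "card ?Y \<le> N" using N False unfolding \<psi>_def by blast+
            have "card (?S - W) \<le> card (?Y \<union> W) + 1"
            proof (rule card_le_separated[THEN conjunct2])
              show "finite (?Y \<union> W)" using Y W by simp
              fix s t assume s: "s \<in> ?S - W" and t: "t \<in> ?S - W" and st: "s < t"
              show "\<exists>y\<in>?Y \<union> W. s < y \<and> y < t"
              proof (cases "\<exists>y\<in>W. s < y \<and> y < t")
                case False
                then have sub: "r \<in> {0<..<1} - W" if "s \<le> r" "r \<le> t" for r
                  using that s t by (cases "r = s \<or> r = t") auto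
                have "\<exists>z. s < z \<and> z < t \<and> DERIV q z :> 0"
                proof (rule Rolle[OF st])
                  show "q s = q t" using s t by (simp add: q_def)
                  show "continuous_on {s..t} q"
                    using q sub by (meson DERIV_isCont atLeastAtMost_iff continuous_at_imp_continuous_on)
                  show "q differentiable (at x)" if "s < x" "x < t" for x
                    using q[OF sub[of x]] that real_differentiable_def by auto
                qed
                then obtain z where z: "s < z" "z < t" "DERIV q z :> 0" by blast
                have zW: "z \<in> {0<..<1} - W" using sub[of z] z by simp
                then have "\<mu> z * \<psi> z / (P a (g z))\<^sup>2 = 0" using q[OF zW] z(3) DERIV_unique by blast
                then have "\<psi> z = 0" using zW \<mu> by (auto simp: W_def)
                then show ?thesis using z zW by auto
              qed blast
            qed
            also have "card (?Y \<union> W) \<le> N + card W" using card_Un_le[of ?Y W] Y(2) by linarith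
            finally show ?thesis by simp
          qed
          moreover have "card ?S \<le> card (?S - W) + card W"
          proof -
            have "card ?S \<le> card ((?S - W) \<union> W)" using finS W by (intro card_mono) auto
            also have "\<dots> \<le> card (?S - W) + card W" by (rule card_Un_le)
            finally show ?thesis .
          qed
          ultimately show False using nf finS by linarith
        qed
      qed
      then show "(\<forall>t\<in>{0<..<1}. (\<Sum>i\<in>insert a I. c i * P i (g t)) = 0) \<or>
        (finite {t\<in>{0<..<1}. (\<Sum>i\<in>insert a I. c i * P i (g t)) = 0} \<and> card {t\<in>{0<..<1}. (\<Sum>i\<in>insert a I. c i * P i (g t)) = 0} \<le> N + card W + 1 + card W)"
        unfolding \<phi>_def .
    qed
  qed
qed

end

lemma finite_avoid_right_0:
  fixes Z :: "real set" assumes "finite Z"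
  shows "\<exists>\<delta>>0. \<delta> < 1 \<and> (\<forall>t. 0 < t \<and> t < \<delta> \<longrightarrow> t \<notin> Z)"
proof -
  let ?S = "insert (1/2) {z\<in>Z. z > 0}"
  have fin: "finite ?S" using assms by simp
  have "Min ?S \<in> ?S" by (rule Min_in[OF fin]) simp
  then have "Min ?S > 0" by auto
  moreover have le: "Min ?S \<le> z" if "z \<in> ?S" for z using Min_le[OF fin that] .
  moreover have "Min ?S < 1" using le[of "1/2"] by simp
  moreover have "t \<notin> Z" if "0 < t \<and> t < Min ?S" for t
    using le[of t] that by auto
  ultimately show ?thesis by blast
qed

lemma strict_mono_bounded_tendsto_right:
  fixes f :: "real \<Rightarrow> real"
  assumes "\<delta> > 0" and mono: "\<And>s t. 0 < s \<Longrightarrow> s \<le> t \<Longrightarrow> t < \<delta> \<Longrightarrow> f s \<le> f t"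
    and bd: "\<And>t. 0 < t \<Longrightarrow> t < \<delta> \<Longrightarrow> - B \<le> f t"
  shows "\<exists>l. (f \<longlongrightarrow> l) (at_right 0)"
proof -
  let ?L = "Inf (f ` {0<..<\<delta>})"
  have bb: "bdd_below (f ` {0<..<\<delta>})" using bd by (intro bdd_belowI[of _ "- B"]) auto
  have ne: "f ` {0<..<\<delta>} \<noteq> {}" using assms(1) by auto
  have ev: "\<forall>\<^sub>F t in at_right 0. t \<in> {0<..<r}" if "r > 0" for r :: real
    using that eventually_at_right_less[of 0] by (auto simp: eventually_at_right_field)
  have "(f \<longlongrightarrow> ?L) (at_right 0)"
  proof (rule order_tendstoI)
    fix a assume "a < ?L"
    have low: "?L \<le> f t" if "t \<in> {0<..<\<delta>}" for t using that bb by (intro cInf_lower) auto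
    show "\<forall>\<^sub>F t in at_right 0. a < f t"
    proof (rule eventually_mono[OF ev[OF assms(1)]])
      fix t assume "t \<in> {0<..<\<delta>}"
      from low[OF this] \<open>a < ?L\<close> show "a < f t" by linarith
    qed
  next
    fix a assume "?L < a"
    then obtain x where x: "x \<in> {0<..<\<delta>}" "f x < a" using cInf_lessD[OF ne, of a] by blast
    then have "\<forall>\<^sub>F t in at_right 0. t \<in> {0<..<x}" using ev[of x] by simp
    then show "\<forall>\<^sub>F t in at_right 0. f t < a"
    proof eventually_elim
      case (elim t)
      then have "f t \<le> f x" using x by (intro mono) auto
      then show ?case using x(2) by simp
    qed
  qed
  then show ?thesis by blast
qed

text \<open>By Rolle's theorem a function whose derivative has no zero is injective, hence monotone.\<close>

lemma bounded_tendsto_right_if_derivative: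
  fixes f :: "real \<Rightarrow> real"
  assumes \<delta>: "\<delta> > 0" and d: "\<And>t. 0 < t \<Longrightarrow> t < \<delta> \<Longrightarrow> (f has_real_derivative f' t) (at t)"
    and alt: "(\<forall>t. 0 < t \<and> t < \<delta> \<longrightarrow> f' t = 0) \<or> (\<forall>t. 0 < t \<and> t < \<delta> \<longrightarrow> f' t \<noteq> 0)"
    and bd: "\<And>t. 0 < t \<Longrightarrow> t < \<delta> \<Longrightarrow> \<bar>f t\<bar> \<le> B"
  shows "\<exists>l. (f \<longlongrightarrow> l) (at_right 0)"
  using alt
proof
  assume z: "\<forall>t. 0 < t \<and> t < \<delta> \<longrightarrow> f' t = 0"
  have "f t = f (\<delta>/2)" if "0 < t" "t < \<delta>" for t
  proof (rule DERIV_isconst3[where f = f and x = t and y = "\<delta>/2" and a = 0 and b = \<delta>])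
    fix s assume "s \<in> {0<..<\<delta>}"
    then show "DERIV f s :> 0" using d[of s] z by auto
  qed (use that \<delta> in auto)
  then have "\<forall>\<^sub>F t in at_right 0. f t = f (\<delta>/2)"
    unfolding eventually_at_right_field using \<delta> by blast
  then show ?thesis using tendsto_eventually by blast
next
  assume nz: "\<forall>t. 0 < t \<and> t < \<delta> \<longrightarrow> f' t \<noteq> 0"
  have cont: "continuous_on {0<..<\<delta>} f"
    using d by (intro continuous_at_imp_continuous_on ballI) (auto intro: DERIV_isCont)
  have inj: "inj_on f {0<..<\<delta>}"
  proof (rule linorder_inj_onI')
    fix s t assume st: "s \<in> {0<..<\<delta>}" "t \<in> {0<..<\<delta>}" "s < t"
    show "f s \<noteq> f t"
    proof
      assume "f s = f t"
      have "\<exists>z. s < z \<and> z < t \<and> DERIV f z :> 0"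
      proof (rule Rolle[OF st(3) \<open>f s = f t\<close>])
        show "continuous_on {s..t} f" using cont by (rule continuous_on_subset) (use st in auto)
        show "f differentiable (at x)" if "s < x" "x < t" for x
          using d[of x] that st real_differentiable_def by auto
      qed
      then obtain z where z: "s < z" "z < t" "DERIV f z :> 0" by blast
      then have "0 < z" "z < \<delta>" using st by auto
      then show False using d[of z] z(3) DERIV_unique nz by blast
    qed
  qed
  have "is_interval {0<..<\<delta>}" by simp
  from injective_eq_monotone_map[OF this cont] inj
  have "strict_mono_on {0<..<\<delta>} f \<or> strict_antimono_on {0<..<\<delta>} f" by simp
  then show ?thesis
  proof
    assume m: "strict_mono_on {0<..<\<delta>} f"
    show ?thesis
    proof (rule strict_mono_bounded_tendsto_right[OF \<delta>])
      show "f s \<le> f t" if "0 < s" "s \<le> t" "t < \<delta>" for s t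
        using monotone_onD[OF m, of s t] that by (cases "s = t") (auto simp: less_imp_le)
      show "- B \<le> f t" if "0 < t" "t < \<delta>" for t using bd[OF that] by linarith
    qed
  next
    assume m: "strict_antimono_on {0<..<\<delta>} f"
    have "\<exists>l. ((\<lambda>t. - f t) \<longlongrightarrow> l) (at_right 0)"
    proof (rule strict_mono_bounded_tendsto_right[OF \<delta>])
      show "- f s \<le> - f t" if "0 < s" "s \<le> t" "t < \<delta>" for s t
        using monotone_onD[OF m, of s t] that by (cases "s = t") (auto simp: less_imp_le)
      show "- B \<le> - f t" if "0 < t" "t < \<delta>" for t using bd[OF that] by linarith
    qed
    then show ?thesis using tendsto_minus_cancel_left by blast
  qed
qed

context regular_semialgebraic_arc
begin

lemma analytic_height: "analytic_ioo (\<lambda>t. u \<bullet> g t)"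
  by (rule analytic_polynomial[OF real_polynomial_function.intros(1)[OF bounded_linear_inner_right]])

text \<open>Off a finite set, the derivative of the height is a factor times a linear combination, with the coordinates of
  \<open>u\<close> as coefficients, of the three fixed polynomials that make up the tangent field.\<close>

lemma critical_points_bounded:
  "\<exists>N. \<forall>u. (\<forall>t\<in>{0<..<1}. deriv (\<lambda>s. u \<bullet> g s) t = 0) \<or>
     (finite {t\<in>{0<..<1}. deriv (\<lambda>s. u \<bullet> g s) t = 0} \<and> card {t\<in>{0<..<1}. deriv (\<lambda>s. u \<bullet> g s) t = 0} \<le> N)"
proof -
  obtain T \<mu> Z where Z: "finite Z" and T: "\<forall>i. real_polynomial_function (\<lambda>x. T x $ i)"
    and d: "\<forall>t\<in>{0<..<1} - Z. \<mu> t \<noteq> 0 \<and> (g has_vector_derivative \<mu> t *\<^sub>R T (g t)) (at t)"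
    using polynomial_tangent_field by blast
  have "\<exists>N. \<forall>c. (\<forall>t\<in>{0<..<1}. (\<Sum>i\<in>UNIV. c i * T (g t) $ i) = 0) \<or>
    (finite {t\<in>{0<..<1}. (\<Sum>i\<in>UNIV. c i * T (g t) $ i) = 0} \<and> card {t\<in>{0<..<1}. (\<Sum>i\<in>UNIV. c i * T (g t) $ i) = 0} \<le> N)"
    by (rule linear_combination_zeros_bounded[where P = "\<lambda>i x. T x $ i"]) (use T in auto)
  then obtain N where N: "\<And>c. (\<forall>t\<in>{0<..<1}. (\<Sum>i\<in>UNIV. c i * T (g t) $ i) = 0) \<or>
    (finite {t\<in>{0<..<1}. (\<Sum>i\<in>UNIV. c i * T (g t) $ i) = 0} \<and> card {t\<in>{0<..<1}. (\<Sum>i\<in>UNIV. c i * T (g t) $ i) = 0} \<le> N)"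
    by blast
  have dh: "deriv (\<lambda>s. u \<bullet> g s) t = \<mu> t * (\<Sum>i\<in>UNIV. u $ i * T (g t) $ i)" if "t \<in> {0<..<1} - Z" for u t
  proof -
    have "((\<lambda>s. u \<bullet> g s) has_vector_derivative u \<bullet> (\<mu> t *\<^sub>R T (g t))) (at t)"
      using d that by (intro bounded_linear.has_vector_derivative[OF bounded_linear_inner_right]) auto
    then have "deriv (\<lambda>s. u \<bullet> g s) t = u \<bullet> (\<mu> t *\<^sub>R T (g t))"
      by (simp add: has_real_derivative_iff_has_vector_derivative[symmetric] DERIV_imp_deriv)
    moreover have "u \<bullet> (\<mu> t *\<^sub>R T (g t)) = \<mu> t * (\<Sum>i\<in>UNIV. u $ i * T (g t) $ i)"
      unfolding inner_scaleR_right by (simp add: inner_vec_def)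
    ultimately show ?thesis by simp
  qed
  show ?thesis
  proof (intro exI[of _ "N + card Z"] allI)
    fix u :: "real^3"
    let ?S = "{t\<in>{0<..<1}. deriv (\<lambda>s. u \<bullet> g s) t = 0}"
    let ?Y = "{t\<in>{0<..<1}. (\<Sum>i\<in>UNIV. u $ i * T (g t) $ i) = 0}"
    show "(\<forall>t\<in>{0<..<1}. deriv (\<lambda>s. u \<bullet> g s) t = 0) \<or> (finite ?S \<and> card ?S \<le> N + card Z)"
    proof (cases "\<forall>t\<in>{0<..<1}. (\<Sum>i\<in>UNIV. u $ i * T (g t) $ i) = 0")
      case True
      then have z: "deriv (\<lambda>s. u \<bullet> g s) t = 0" if "t \<in> {0<..<1} - Z" for t using dh[OF that] that by simp
      \<comment> \<open>The derivative vanishes off \<open>Z\<close>, hence everywhere by analyticity; it is tested at \<open>1/2\<close>.\<close>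
      have op: "open ({0<..<1} - (Z - {1/2}))" using Z by (intro open_Diff finite_imp_closed) auto
      have "\<not> (\<forall>s\<in>{0<..<1}. \<forall>\<^sub>F t in at s. deriv (\<lambda>s. u \<bullet> g s) t \<noteq> 0)"
      proof
        assume a: "\<forall>s\<in>{0<..<1}. \<forall>\<^sub>F t in at s. deriv (\<lambda>s. u \<bullet> g s) t \<noteq> 0"
        have "\<forall>\<^sub>F t in at (1/2). deriv (\<lambda>s. u \<bullet> g s) t \<noteq> 0" by (rule bspec[OF a]) simp
        moreover have "\<forall>\<^sub>F t in at (1/2). t \<in> {0<..<1} - (Z - {1/2})" by (rule eventually_at_in_open'[OF op]) auto
        moreover have "\<forall>\<^sub>F t in at (1/2). t \<noteq> (1/2::real)" by (simp add: eventually_at_filter)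
        ultimately have "\<forall>\<^sub>F t in at (1/2::real). False"
          by eventually_elim (use z in auto)
        then show False by simp
      qed
      then show ?thesis using analytic_ioo_identity[OF analytic_ioo_deriv[OF analytic_height]] by blast
    next
      case False
      then have Y: "finite ?Y" "card ?Y \<le> N" using N[of "\<lambda>i. u $ i"] by blast+
      have sub: "?S \<subseteq> ?Y \<union> Z"
      proof
        fix t assume t: "t \<in> ?S"
        show "t \<in> ?Y \<union> Z" using t dh[of t u] d by (cases "t \<in> Z") auto
      qed
      then have "finite ?S" using Y Z finite_subset by blast
      moreover have "card ?S \<le> card (?Y \<union> Z)" using sub Y Z by (intro card_mono) auto
      ultimately show ?thesis using card_Un_le[of ?Y Z] Y(2) by linarith
    qed
  qed
qed

text \<open>The squared distance \<open>P\<close> from \<open>v\<close> and the components of the secant direction,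
  \<open>A i / sqrt P\<close>, have derivatives that are polynomials on the arc up to nonvanishing factors. Close to
  the start these derivatives vanish identically or not at all, so the functions are monotone there, and the bounded
  secant directions converge. That the distance increases follows since it tends to 0.\<close>

lemma start_behaviour:
  assumes lim: "(g \<longlongrightarrow> v) (at_right 0)" and v: "v \<notin> g ` {0<..<1}"
  shows start_distance_increasing: "\<exists>\<delta>>0. \<delta> < 1 \<and> (\<forall>s t. 0 < s \<and> s < t \<and> t < \<delta> \<longrightarrow> dist v (g s) < dist v (g t))" (is ?thesis1)
    and start_direction: "\<exists>\<tau>. norm \<tau> = 1 \<and> ((\<lambda>t. (g t - v) /\<^sub>R norm (g t - v)) \<longlongrightarrow> \<tau>) (at_right 0)" (is ?thesis2)
proof -
  obtain \<mu> Z where Z: "finite Z" and \<mu>: "\<forall>t\<in>{0<..<1} - Z. \<mu> t \<noteq> 0"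
    and der: "\<forall>P. real_polynomial_function P \<longrightarrow> (\<exists>Q. real_polynomial_function Q \<and>
       (\<forall>t\<in>{0<..<1} - Z. ((\<lambda>t. P (g t)) has_real_derivative \<mu> t * Q (g t)) (at t)))"
    using polynomial_derivation by blast
  define A where "A = (\<lambda>i x. x $ i + - (v $ i))"
  define P where "P = (\<lambda>x. \<Sum>i\<in>UNIV. A i x * A i x)"
  have A: "real_polynomial_function (A i)" for i
    unfolding A_def by (intro real_polynomial_function.intros(2,3) real_polynomial_function_nth)
  have P: "real_polynomial_function P"
    unfolding P_def sum_3 by (intro real_polynomial_function.intros(3,4) A)
  have Pn: "P x = (norm (x - v))\<^sup>2" for x
    unfolding P_def A_def power2_norm_eq_inner inner_vec_def by simp
  obtain Q where Q: "real_polynomial_function Q"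
      "\<forall>t\<in>{0<..<1} - Z. ((\<lambda>t. P (g t)) has_real_derivative \<mu> t * Q (g t)) (at t)" using der P by blast
  have alt: "\<exists>\<delta>>0. \<delta> < 1 \<and> (\<forall>t. 0 < t \<and> t < \<delta> \<longrightarrow> t \<notin> Z) \<and>
      ((\<forall>t. 0 < t \<and> t < \<delta> \<longrightarrow> R (g t) = 0) \<or> (\<forall>t. 0 < t \<and> t < \<delta> \<longrightarrow> R (g t) \<noteq> 0))"
    if R: "real_polynomial_function R" for R
  proof (cases "\<forall>t\<in>{0<..<1}. R (g t) = 0")
    case True
    obtain \<delta> where "\<delta> > 0" "\<delta> < 1" "\<forall>t. 0 < t \<and> t < \<delta> \<longrightarrow> t \<notin> Z" using finite_avoid_right_0[OF Z] by blast
    then show ?thesis using True by (intro exI[of _ \<delta>]) auto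
  next
    case False
    then have "finite (Z \<union> {t\<in>{0<..<1}. R (g t) = 0})" using polynomial_zeros_finite[OF R] Z by auto
    from finite_avoid_right_0[OF this] show ?thesis
    proof (elim exE conjE)
      fix \<delta> :: real assume "\<delta> > 0" "\<delta> < 1" "\<forall>t. 0 < t \<and> t < \<delta> \<longrightarrow> t \<notin> Z \<union> {t\<in>{0<..<1}. R (g t) = 0}"
      then show ?thesis by (intro exI[of _ \<delta>]) auto
    qed
  qed
  have pos: "P (g t) > 0" if "t \<in> {0<..<1}" for t
    using v that by (force simp: Pn)
  have limP: "((\<lambda>t. P (g t)) \<longlongrightarrow> 0) (at_right 0)"
    unfolding Pn by (rule tendsto_eq_intros lim refl)+ simp
  show ?thesis1
  proof -
    obtain \<delta> where \<delta>: "\<delta> > 0" "\<delta> < 1" "\<And>t. 0 < t \<Longrightarrow> t < \<delta> \<Longrightarrow> t \<notin> Z"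
      and alt: "(\<forall>t. 0 < t \<and> t < \<delta> \<longrightarrow> Q (g t) = 0) \<or> (\<forall>t. 0 < t \<and> t < \<delta> \<longrightarrow> Q (g t) \<noteq> 0)"
      using alt[OF Q(1)] by blast
    have D: "((\<lambda>t. P (g t)) has_real_derivative \<mu> t * Q (g t)) (at t)" "\<mu> t \<noteq> 0" if "0 < t" "t < \<delta>" for t
      using Q(2) \<mu> \<delta> that by auto
    have cont: "continuous_on {s..t} (\<lambda>t. P (g t))" if "0 < s" "t < \<delta>" for s t
      using that by (intro continuous_at_imp_continuous_on ballI DERIV_isCont[OF D(1)]) auto
    have "P (g s) < P (g t)" if st: "0 < s" "s < t" "t < \<delta>" for s t
    proof (rule ccontr)
      assume ge: "\<not> P (g s) < P (g t)"
      have pt: "P (g t) > 0" using pos[of t] st \<delta> by auto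
      have "\<forall>\<^sub>F r in at_right 0. P (g r) < P (g t)" using order_tendstoD(2)[OF limP pt] .
      moreover have "\<forall>\<^sub>F r in at_right 0. r < s"
        using st(1) by (auto simp: eventually_at_right_field intro: exI[of _ s])
      moreover have "\<forall>\<^sub>F r in at_right (0::real). 0 < r" by (rule eventually_at_right_less)
      ultimately have "\<forall>\<^sub>F r in at_right 0. 0 < r \<and> r < s \<and> P (g r) < P (g t)" by eventually_elim auto
      then obtain r where r: "0 < r" "r < s" "P (g r) < P (g t)"
        using eventually_happens' trivial_limit_at_right_real by blast
      \<comment> \<open>A point \<open>r\<close> nearer to the start is closer to \<open>v\<close> than \<open>g t\<close>; the distance would take the same value twice.\<close>
      from alt show False
      proof
        assume z: "\<forall>t. 0 < t \<and> t < \<delta> \<longrightarrow> Q (g t) = 0"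
        have "P (g r) = P (g t)"
        proof (rule DERIV_isconst3[where f = "\<lambda>t. P (g t)" and x = r and y = t and a = 0 and b = \<delta>])
          fix q assume "q \<in> {0<..<\<delta>}"
          then show "DERIV (\<lambda>t. P (g t)) q :> 0" using D[of q] z by auto
        qed (use r st \<delta> in auto)
        then show False using r by simp
      next
        assume nz: "\<forall>t. 0 < t \<and> t < \<delta> \<longrightarrow> Q (g t) \<noteq> 0"
        have "\<exists>x. r \<le> x \<and> x \<le> s \<and> P (g x) = P (g t)"
          by (rule IVT') (use r st ge cont[of r s] in auto)
        then obtain x where x: "r \<le> x" "x \<le> s" "P (g x) = P (g t)" by blast
        have "\<exists>z. x < z \<and> z < t \<and> DERIV (\<lambda>t. P (g t)) z :> 0"
        proof (rule Rolle)
          show "x < t" using x st by simp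
          show "P (g x) = P (g t)" using x by simp
          show "continuous_on {x..t} (\<lambda>t. P (g t))" using cont[of x t] x r st by simp
          show "(\<lambda>t. P (g t)) differentiable (at y)" if "x < y" "y < t" for y
            using D(1)[of y] that x r st real_differentiable_def by auto
        qed
        then obtain z where z: "x < z" "z < t" "DERIV (\<lambda>t. P (g t)) z :> 0" by blast
        then have zz: "0 < z" "z < \<delta>" using x r st by auto
        from D[OF this] z(3) have "\<mu> z * Q (g z) = 0" using DERIV_unique by blast
        then show False using D(2)[OF zz] nz zz by auto
      qed
    qed
    then have "dist v (g s) < dist v (g t)" if "0 < s" "s < t" "t < \<delta>" for s t
      using that unfolding Pn dist_norm norm_minus_commute[of v] by (meson norm_ge_zero power2_less_imp_less)
    then show ?thesis using \<delta> by blast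
  qed
  have comp: "\<exists>l. ((\<lambda>t. A i (g t) / sqrt (P (g t))) \<longlongrightarrow> l) (at_right 0)" for i
  proof -
    obtain B where B: "real_polynomial_function B"
      "\<forall>t\<in>{0<..<1} - Z. ((\<lambda>t. A i (g t)) has_real_derivative \<mu> t * B (g t)) (at t)" using der A by blast
    define R where "R = (\<lambda>x. 2 * (B x * P x) + -1 * (A i x * Q x))"
    have R: "real_polynomial_function R" unfolding R_def
      by (intro real_polynomial_function.intros(2-4) A B P Q)
    obtain \<delta> where \<delta>: "\<delta> > 0" "\<delta> < 1" "\<And>t. 0 < t \<Longrightarrow> t < \<delta> \<Longrightarrow> t \<notin> Z"
      and alt: "(\<forall>t. 0 < t \<and> t < \<delta> \<longrightarrow> R (g t) = 0) \<or> (\<forall>t. 0 < t \<and> t < \<delta> \<longrightarrow> R (g t) \<noteq> 0)"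
      using alt[OF R] by blast
    let ?f' = "\<lambda>t. \<mu> t * R (g t) / (2 * P (g t) * sqrt (P (g t)))"
    show ?thesis
    proof (rule bounded_tendsto_right_if_derivative[OF \<delta>(1), where f' = ?f' and B = 1])
      fix t assume t: "0 < t" "t < \<delta>"
      then have t': "t \<in> {0<..<1} - Z" using \<delta> by auto
      have p: "P (g t) > 0" using pos t' by auto
      have s: "((\<lambda>t. sqrt (P (g t))) has_real_derivative inverse (sqrt (P (g t))) / 2 * (\<mu> t * Q (g t))) (at t)"
        using DERIV_chain2[OF DERIV_real_sqrt[OF p] bspec[OF Q(2) t']] by simp
      have "((\<lambda>t. A i (g t) / sqrt (P (g t))) has_real_derivative
          (\<mu> t * B (g t) * sqrt (P (g t)) - A i (g t) * (inverse (sqrt (P (g t))) / 2 * (\<mu> t * Q (g t)))) / (sqrt (P (g t)) * sqrt (P (g t)))) (at t)"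
        using p by (intro DERIV_divide s bspec[OF B(2) t']) auto
      moreover have "(\<mu> t * B (g t) * sqrt (P (g t)) - A i (g t) * (inverse (sqrt (P (g t))) / 2 * (\<mu> t * Q (g t)))) / (sqrt (P (g t)) * sqrt (P (g t))) = ?f' t"
      proof -
        define w where "w = sqrt (P (g t))"
        have w: "w > 0" "P (g t) = w * w" using p by (auto simp: w_def)
        show ?thesis unfolding R_def w_def[symmetric] w(2) using w(1) by (simp add: field_simps)
      qed
      ultimately show "((\<lambda>t. A i (g t) / sqrt (P (g t))) has_real_derivative ?f' t) (at t)" by simp
      have "\<bar>A i (g t)\<bar> \<le> norm (g t - v)"
        unfolding A_def using component_le_norm_cart[of "g t - v" i] by simp
      then show "\<bar>A i (g t) / sqrt (P (g t))\<bar> \<le> 1" using p by (simp add: Pn divide_le_eq_1)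
    next
      have "?f' t = 0 \<longleftrightarrow> R (g t) = 0" if "0 < t" "t < \<delta>" for t
        using that \<mu> \<delta> pos[of t] by auto
      then show "(\<forall>t. 0 < t \<and> t < \<delta> \<longrightarrow> ?f' t = 0) \<or> (\<forall>t. 0 < t \<and> t < \<delta> \<longrightarrow> ?f' t \<noteq> 0)"
        using alt by blast
    qed
  qed
  then obtain l where l: "\<And>i. ((\<lambda>t. A i (g t) / sqrt (P (g t))) \<longlongrightarrow> l i) (at_right 0)" by metis
  define \<tau> where "\<tau> = (\<chi> i. l i)"
  have \<tau>: "((\<lambda>t. (g t - v) /\<^sub>R norm (g t - v)) \<longlongrightarrow> \<tau>) (at_right 0)"
  proof (rule vec_tendstoI)
    fix i show "((\<lambda>t. ((g t - v) /\<^sub>R norm (g t - v)) $ i) \<longlongrightarrow> \<tau> $ i) (at_right 0)"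
      using l[of i] by (simp add: \<tau>_def A_def Pn divide_inverse mult.commute)
  qed
  have "\<forall>\<^sub>F t in at_right 0. t \<in> {0<..<1::real}"
    by (auto simp: eventually_at_right_field intro: exI[of _ 1])
  then have "\<forall>\<^sub>F t in at_right 0. norm ((g t - v) /\<^sub>R norm (g t - v)) = 1"
  proof eventually_elim
    case (elim t)
    then have "g t \<noteq> v" using v by blast
    then show ?case by simp
  qed
  then have "((\<lambda>t. norm ((g t - v) /\<^sub>R norm (g t - v))) \<longlongrightarrow> 1) (at_right 0)" by (rule tendsto_eventually)
  then have "norm \<tau> = 1" using tendsto_unique[OF trivial_limit_at_right_real tendsto_norm[OF \<tau>]] by blast
  then show ?thesis2 using \<tau> by blast
qed

end

section \<open>Edges\<close>

lemma real_analytic_on_imp_analytic_ioo: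
  assumes "g real_analytic_on {0<..<1}"
  shows "analytic_ioo (\<lambda>t. (g t :: real^'n) $ i)"
  unfolding analytic_ioo_def
proof
  fix s :: real assume "s \<in> {0<..<1}"
  then obtain r a where r: "r > 0" and a: "\<And>t. \<bar>t - s\<bar> < r \<Longrightarrow> (\<lambda>n. (t - s) ^ n *\<^sub>R a n) sums g t"
    using assms unfolding real_analytic_on_def by blast
  have "(\<lambda>h. g (s + h) $ i) has_fps_expansion Abs_fps (\<lambda>n. a n $ i)"
  proof (rule has_fps_expansionI)
    have "\<forall>\<^sub>F h in nhds (0::real). h \<in> ball 0 r" using r by (intro eventually_nhds_in_open) auto
    then show "\<forall>\<^sub>F h in nhds 0. (\<lambda>n. fps_nth (Abs_fps (\<lambda>n. a n $ i)) n * h ^ n) sums (g (s + h) $ i)"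
    proof eventually_elim
      case (elim h)
      then have "(\<lambda>n. h ^ n *\<^sub>R a n) sums g (s + h)" using a[of "s + h"] by simp
      from bounded_linear.sums[OF bounded_linear_vec_nth this, of i]
      show ?case by (simp add: mult.commute)
    qed
  qed
  then show "\<exists>F. (\<lambda>h. g (s + h) $ i) has_fps_expansion F" by blast
qed

lemma real_analytic_on_reverse:
  assumes "g real_analytic_on {0<..<1}"
  shows "reversepath g real_analytic_on {0<..<1}"
  unfolding real_analytic_on_def
proof
  fix s :: real assume "s \<in> {0<..<1}"
  then have "1 - s \<in> {0<..<1}" by auto
  then obtain r a where r: "r > 0" and a: "\<And>t. \<bar>t - (1 - s)\<bar> < r \<Longrightarrow> (\<lambda>n. (t - (1 - s)) ^ n *\<^sub>R a n) sums g t"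
    using assms unfolding real_analytic_on_def by blast
  have S: "(\<lambda>n. (t - s) ^ n *\<^sub>R ((-1) ^ n *\<^sub>R a n)) sums reversepath g t" if "\<bar>t - s\<bar> < r" for t
  proof -
    have "\<bar>(1 - t) - (1 - s)\<bar> < r" using that by linarith
    from a[OF this] have "(\<lambda>n. (s - t) ^ n *\<^sub>R a n) sums reversepath g t" by (simp add: reversepath_def)
    moreover have "(s - t) ^ n = (t - s) ^ n * (-1) ^ n" for n
      by (metis minus_diff_eq mult.commute mult_minus1 power_mult_distrib)
    ultimately show ?thesis by simp
  qed
  show "\<exists>r>0. \<exists>a. \<forall>t. \<bar>t - s\<bar> < r \<longrightarrow> (\<lambda>n. (t - s) ^ n *\<^sub>R a n) sums reversepath g t"
    by (intro exI[of _ r] conjI r exI[of _ "\<lambda>n. (-1) ^ n *\<^sub>R a n"] allI impI S)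
qed

lemma image_reversepath_ioo: "reversepath g ` {0<..<1} = g ` {0<..<1}"
proof -
  have "(\<lambda>t. 1 - t) ` {0<..<1::real} = {0<..<1}"
  proof
    show "{0<..<1::real} \<subseteq> (\<lambda>t. 1 - t) ` {0<..<1}"
    proof
      fix t :: real assume "t \<in> {0<..<1}"
      then show "t \<in> (\<lambda>t. 1 - t) ` {0<..<1}" by (intro image_eqI[of _ _ "1 - t"]) auto
    qed
  qed auto
  then show ?thesis unfolding reversepath_def by (metis image_image)
qed

lemma edge_param_arc:
  assumes "edge_param V g e" "semialgebraic e"
  shows "regular_semialgebraic_arc g"
proof
  show "analytic_ioo (\<lambda>t. g t $ i)" for i
    using assms real_analytic_on_imp_analytic_ioo by (auto simp: edge_param_def)
  have "inj_on g {0..1}" using assms by (auto simp: edge_param_def arc_def)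
  then show "inj_on g {0<..<1}" by (rule inj_on_subset) auto
  show "semialgebraic (g ` {0<..<1})" using assms by (simp add: edge_param_def)
  show "vector_derivative g (at t) \<noteq> 0" if "t \<in> {0<..<1}" for t using assms that by (auto simp: edge_param_def)
qed

lemma edge_param_reversepath:
  assumes e: "edge_param V g e" and sa: "semialgebraic e"
  shows "edge_param V (reversepath g) e"
proof -
  interpret regular_semialgebraic_arc g by (rule edge_param_arc[OF assms])
  have "vector_derivative (reversepath g) (at t) \<noteq> 0" if t: "t \<in> {0<..<1}" for t
  proof -
    have t': "1 - t \<in> {0<..<1}" using t by auto
    have d: "(g has_vector_derivative vector_derivative g (at (1 - t))) (at (1 - t))"
      using velocity[OF t'] vector_derivative_works differentiableI_vector by blast
    have "((\<lambda>t. 1 - t) has_real_derivative -1) (at t)" by (auto intro!: derivative_eq_intros)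
    from vector_diff_chain_at[OF this[unfolded has_real_derivative_iff_has_vector_derivative], of g] d
    have "(reversepath g has_vector_derivative - vector_derivative g (at (1 - t))) (at t)"
      by (simp add: o_def reversepath_def)
    then have "vector_derivative (reversepath g) (at t) = - vector_derivative g (at (1 - t))"
      by (rule vector_derivative_at)
    then show ?thesis using regular[OF t'] by simp
  qed
  then show ?thesis using e real_analytic_on_reverse[of g] image_reversepath_ioo[of g]
    unfolding edge_param_def by (simp add: arc_reversepath)
qed

section \<open>The rank of a free abelian group\<close>

text \<open>A group isomorphic to \<open>\<int>\<^sup>n\<close>, expressed by coordinates. The integer vectors of length
  \<open>n\<close> are the sequences that vanish from index \<open>n\<close> on, so that \<open>n\<close> need not be
  a type.\<close>

definition free_rank :: "('a, 'b) monoid_scheme \<Rightarrow> nat \<Rightarrow> bool" where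
  "free_rank G n \<longleftrightarrow> comm_group G \<and>
    (\<exists>\<phi> :: 'a \<Rightarrow> nat \<Rightarrow> int. bij_betw \<phi> (carrier G) {f. \<forall>i\<ge>n. f i = 0} \<and>
       (\<forall>x\<in>carrier G. \<forall>y\<in>carrier G. \<forall>i. \<phi> (x \<otimes>\<^bsub>G\<^esub> y) i = \<phi> x i + \<phi> y i))"

lemma free_rank_trivial_group:
  assumes "comm_group G" "trivial_group G" shows "free_rank G 0"
proof -
  have c: "carrier G = {\<one>\<^bsub>G\<^esub>}" using assms(2) by (simp add: trivial_group_def)
  interpret comm_group G by fact
  have e: "{f::nat \<Rightarrow> int. \<forall>i\<ge>0. f i = 0} = {\<lambda>i. 0}" by auto
  have "bij_betw (\<lambda>x i. 0::int) (carrier G) {f::nat \<Rightarrow> int. \<forall>i\<ge>0. f i = 0}"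
    unfolding c e by (simp add: bij_betw_def)
  then show ?thesis unfolding free_rank_def using assms(1) by (intro conjI exI[of _ "\<lambda>x i. 0"]) auto
qed

lemma free_rank_iso:
  assumes "comm_group G" "G \<cong> H" "free_rank H n" shows "free_rank G n"
proof -
  obtain f where f: "f \<in> Group.iso G H" using assms(2) unfolding is_iso_def by blast
  obtain \<phi> :: "_ \<Rightarrow> nat \<Rightarrow> int" where \<phi>: "bij_betw \<phi> (carrier H) {f. \<forall>i\<ge>n. f i = 0}"
    "\<forall>x\<in>carrier H. \<forall>y\<in>carrier H. \<forall>i. \<phi> (x \<otimes>\<^bsub>H\<^esub> y) i = \<phi> x i + \<phi> y i"
    using assms(3) unfolding free_rank_def by blast
  have bij: "bij_betw f (carrier G) (carrier H)" and hom: "f \<in> hom G H" using f by (auto simp: iso_def)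
  have "bij_betw (\<phi> \<circ> f) (carrier G) {f. \<forall>i\<ge>n. f i = 0}" using bij_betw_trans[OF bij \<phi>(1)] .
  moreover have "(\<phi> \<circ> f) (x \<otimes>\<^bsub>G\<^esub> y) i = (\<phi> \<circ> f) x i + (\<phi> \<circ> f) y i" if "x \<in> carrier G" "y \<in> carrier G" for x y i
    using hom that \<phi>(2) by (simp add: hom_mult hom_in_carrier)
  ultimately show ?thesis unfolding free_rank_def using assms(1) by blast
qed

lemma free_rank_times_integers:
  assumes G: "free_rank G n" shows "free_rank (G \<times>\<times> integer_group) (Suc n)"
proof -
  obtain \<phi> :: "_ \<Rightarrow> nat \<Rightarrow> int" where bij: "bij_betw \<phi> (carrier G) {f. \<forall>i\<ge>n. f i = 0}"
    and add: "\<forall>x\<in>carrier G. \<forall>y\<in>carrier G. \<forall>i. \<phi> (x \<otimes>\<^bsub>G\<^esub> y) i = \<phi> x i + \<phi> y i"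
    using assms unfolding free_rank_def by blast
  let ?\<psi> = "\<lambda>(x, z::int). (\<phi> x)(n := z)"
  have z: "\<phi> x i = 0" if "x \<in> carrier G" "i \<ge> n" for x i
    using bij that unfolding bij_betw_def by auto
  have "bij_betw ?\<psi> (carrier (G \<times>\<times> integer_group)) {f. \<forall>i\<ge>Suc n. f i = 0}"
    unfolding bij_betw_def
  proof
    show "inj_on ?\<psi> (carrier (G \<times>\<times> integer_group))"
    proof (rule inj_onI, clarify)
      fix x a y b assume xy: "(x, a) \<in> carrier (G \<times>\<times> integer_group)" "(y, b) \<in> carrier (G \<times>\<times> integer_group)"
        and eq: "(\<phi> x)(n := a) = (\<phi> y)(n := b)"
      have "a = b" using fun_cong[OF eq, of n] by simp
      have "\<phi> x i = \<phi> y i" for i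
        using fun_cong[OF eq, of i] z[of x i] z[of y i] xy by (cases "i = n") (auto simp: DirProd_def)
      then have "\<phi> x = \<phi> y" by blast
      then show "x = y \<and> a = b" using bij xy \<open>a = b\<close> by (auto simp: bij_betw_def inj_on_def DirProd_def)
    qed
    show "?\<psi> ` carrier (G \<times>\<times> integer_group) = {f. \<forall>i\<ge>Suc n. f i = 0}"
    proof
      show "?\<psi> ` carrier (G \<times>\<times> integer_group) \<subseteq> {f. \<forall>i\<ge>Suc n. f i = 0}"
        using z by (auto simp: DirProd_def)
      show "{f. \<forall>i\<ge>Suc n. f i = 0} \<subseteq> ?\<psi> ` carrier (G \<times>\<times> integer_group)"
      proof
        fix f :: "nat \<Rightarrow> int" assume f: "f \<in> {f. \<forall>i\<ge>Suc n. f i = 0}"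
        then have "f(n := 0) \<in> {f. \<forall>i\<ge>n. f i = 0}" by (auto simp: Suc_le_eq)
        then have "f(n := 0) \<in> \<phi> ` carrier G" using bij unfolding bij_betw_def by (simp only:)
        then obtain x where x: "f(n := 0) = \<phi> x" "x \<in> carrier G" by (rule imageE)
        have "?\<psi> (x, f n) = f" unfolding prod.case x(1)[symmetric] by (rule ext) simp
        then show "f \<in> ?\<psi> ` carrier (G \<times>\<times> integer_group)"
          using x(2) by (intro image_eqI[of _ _ "(x, f n)"]) (auto simp: DirProd_def)
      qed
    qed
  qed
  moreover have "\<forall>x\<in>carrier (G \<times>\<times> integer_group). \<forall>y\<in>carrier (G \<times>\<times> integer_group). \<forall>i.
      ?\<psi> (x \<otimes>\<^bsub>G \<times>\<times> integer_group\<^esub> y) i = ?\<psi> x i + ?\<psi> y i"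
    using add by (auto simp: DirProd_def)
  moreover have "comm_group (G \<times>\<times> integer_group)"
  proof -
    have cg: "comm_group G" using assms by (simp add: free_rank_def)
    have "group (G \<times>\<times> integer_group)" using DirProd_group cg comm_group_def group_integer_group by blast
    then show ?thesis
    proof (rule group.group_comm_groupI)
      fix x y assume "x \<in> carrier (G \<times>\<times> integer_group)" "y \<in> carrier (G \<times>\<times> integer_group)"
      then show "x \<otimes>\<^bsub>G \<times>\<times> integer_group\<^esub> y = y \<otimes>\<^bsub>G \<times>\<times> integer_group\<^esub> x"
        using cg by (auto simp: DirProd_def comm_group_def intro!: comm_monoid.m_comm)
    qed
  qed
  ultimately show ?thesis unfolding free_rank_def by blast
qed

text \<open>Gaussian elimination without division: the vector \<open>v b\<close> with nonzero last entry serves as pivot,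
  and the others are scaled by that entry before its multiples are subtracted.\<close>

lemma integer_relation_exists:
  fixes v :: "'a \<Rightarrow> nat \<Rightarrow> int"
  assumes "finite B" "n < card B"
  shows "\<exists>c. (\<exists>x\<in>B. c x \<noteq> 0) \<and> (\<forall>i<n. (\<Sum>x\<in>B. c x * v x i) = 0)"
  using assms
proof (induction n arbitrary: B v)
  case 0
  then have "B \<noteq> {}" by auto
  then show ?case by (intro exI[of _ "\<lambda>_. 1"]) auto
next
  case (Suc n)
  show ?case
  proof (cases "\<forall>x\<in>B. v x n = 0")
    case True
    have "n < card B" using Suc.prems by simp
    from Suc.IH[OF Suc.prems(1) this] obtain c where "\<exists>x\<in>B. c x \<noteq> 0" "\<forall>i<n. (\<Sum>x\<in>B. c x * v x i) = 0" by blast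
    then show ?thesis using True by (intro exI[of _ c]) (auto simp: less_Suc_eq)
  next
    case False
    then obtain b where b: "b \<in> B" "v b n \<noteq> 0" by blast
    let ?B = "B - {b}"
    have fin: "finite ?B" and card: "n < card ?B" using Suc.prems b by auto
    from Suc.IH[OF fin card, of "\<lambda>x i. v b n * v x i - v x n * v b i"] obtain c where
      c: "\<exists>x\<in>?B. c x \<noteq> 0" "\<forall>i<n. (\<Sum>x\<in>?B. c x * (v b n * v x i - v x n * v b i)) = 0" by blast
    define d where "d x = (if x = b then - (\<Sum>x\<in>?B. c x * v x n) else v b n * c x)" for x
    have "(\<Sum>x\<in>B. d x * v x i) = (\<Sum>x\<in>?B. c x * (v b n * v x i - v x n * v b i))" for i
    proof -
      have "(\<Sum>x\<in>B. d x * v x i) = d b * v b i + (\<Sum>x\<in>?B. d x * v x i)"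
        using b Suc.prems by (simp add: sum.remove)
      also have "(\<Sum>x\<in>?B. d x * v x i) = (\<Sum>x\<in>?B. v b n * c x * v x i)"
        by (intro sum.cong) (auto simp: d_def)
      also have "d b * v b i = - (\<Sum>x\<in>?B. c x * v x n * v b i)" by (simp add: d_def sum_distrib_right)
      finally show ?thesis by (simp add: sum_subtractf[symmetric] algebra_simps)
    qed
    then have "\<forall>i<Suc n. (\<Sum>x\<in>B. d x * v x i) = 0" using c(2) by (auto simp: less_Suc_eq algebra_simps)
    moreover have "\<exists>x\<in>B. d x \<noteq> 0" using c(1) b by (auto simp: d_def)
    ultimately show ?thesis by blast
  qed
qed

text \<open>In coordinates \<open>int_independent\<close> is linear independence over the integers. The unit vectors are
  independent, and more than \<open>n\<close> vectors are not.\<close>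

lemma group_rank_free_rank:
  assumes "free_rank G n" shows "group_rank G = n"
proof -
  obtain \<phi> :: "_ \<Rightarrow> nat \<Rightarrow> int" where bij: "bij_betw \<phi> (carrier G) {f. \<forall>i\<ge>n. f i = 0}"
    and add0: "\<forall>x\<in>carrier G. \<forall>y\<in>carrier G. \<forall>i. \<phi> (x \<otimes>\<^bsub>G\<^esub> y) i = \<phi> x i + \<phi> y i"
    using assms unfolding free_rank_def by blast
  interpret comm_group G using assms by (simp add: free_rank_def)
  have add: "\<phi> (x \<otimes>\<^bsub>G\<^esub> y) i = \<phi> x i + \<phi> y i" if "x \<in> carrier G" "y \<in> carrier G" for x y i
    using add0 that by blast
  have one: "\<phi> \<one>\<^bsub>G\<^esub> i = 0" for i using add[of "\<one>\<^bsub>G\<^esub>" "\<one>\<^bsub>G\<^esub>" i] by simp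
  have zero: "\<phi> x i = 0" if "x \<in> carrier G" "i \<ge> n" for x i using bij that unfolding bij_betw_def by auto
  have inv: "\<phi> (inv\<^bsub>G\<^esub> x) i = - \<phi> x i" if "x \<in> carrier G" for x i
    using add[of "inv\<^bsub>G\<^esub> x" x i] one[of i] that by simp
  have npow: "\<phi> (x [^]\<^bsub>G\<^esub> k) i = int k * \<phi> x i" if "x \<in> carrier G" for x i and k :: nat
    by (induction k) (use that in \<open>auto simp: one add algebra_simps\<close>)
  have ipow: "\<phi> (x [^]\<^bsub>G\<^esub> k) i = k * \<phi> x i" if "x \<in> carrier G" for x i and k :: int
  proof (cases "k < 0")
    case True
    have "\<phi> (x [^]\<^bsub>G\<^esub> k) i = \<phi> (inv\<^bsub>G\<^esub> (x [^]\<^bsub>G\<^esub> nat (- k))) i" using True by (simp only: int_pow_def2 if_True)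
    also have "\<dots> = - (int (nat (- k)) * \<phi> x i)" by (simp only: inv[OF nat_pow_closed[OF that]] npow[OF that])
    finally show ?thesis using True by simp
  next
    case False
    have "\<phi> (x [^]\<^bsub>G\<^esub> k) i = \<phi> (x [^]\<^bsub>G\<^esub> nat k) i" using False by (simp only: int_pow_def2 if_False)
    also have "\<dots> = int (nat k) * \<phi> x i" by (rule npow[OF that])
    finally show ?thesis using False by simp
  qed
  have fp: "\<phi> (finprod G (\<lambda>x. x [^]\<^bsub>G\<^esub> c x) B) i = (\<Sum>x\<in>B. c x * \<phi> x i)"
    if "finite B" "B \<subseteq> carrier G" for B i and c :: "_ \<Rightarrow> int"
    using that
  proof (induction B rule: finite_induct)
    case empty then show ?case by (simp add: one)
  next
    case (insert b B)
    then have "finprod G (\<lambda>x. x [^]\<^bsub>G\<^esub> c x) (insert b B) = b [^]\<^bsub>G\<^esub> c b \<otimes>\<^bsub>G\<^esub> finprod G (\<lambda>x. x [^]\<^bsub>G\<^esub> c x) B"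
      by (intro finprod_insert) auto
    moreover have "finprod G (\<lambda>x. x [^]\<^bsub>G\<^esub> c x) B \<in> carrier G"
      using insert.prems by (intro finprod_closed) auto
    ultimately show ?case using insert by (simp add: add ipow)
  qed
  have ker: "x = \<one>\<^bsub>G\<^esub> \<longleftrightarrow> (\<forall>i<n. \<phi> x i = 0)" if "x \<in> carrier G" for x
  proof
    assume "\<forall>i<n. \<phi> x i = 0"
    then have "\<phi> x = \<phi> \<one>\<^bsub>G\<^esub>" using zero[OF that] one by (metis ext not_le)
    then show "x = \<one>\<^bsub>G\<^esub>" using bij that by (auto simp: bij_betw_def dest: inj_onD)
  qed (simp add: one)
  have indep: "int_independent G B \<longleftrightarrow> (\<forall>c. (\<forall>i<n. (\<Sum>x\<in>B. c x * \<phi> x i) = 0) \<longrightarrow> (\<forall>x\<in>B. c x = 0))"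
    if B: "finite B" "B \<subseteq> carrier G" for B
  proof -
    have "finprod G (\<lambda>x. x [^]\<^bsub>G\<^esub> c x) B = \<one>\<^bsub>G\<^esub> \<longleftrightarrow> (\<forall>i<n. (\<Sum>x\<in>B. c x * \<phi> x i) = 0)" for c :: "_ \<Rightarrow> int"
    proof -
      have "finprod G (\<lambda>x. x [^]\<^bsub>G\<^esub> c x) B \<in> carrier G" using B by (intro finprod_closed) auto
      from ker[OF this] show ?thesis by (simp add: fp[OF B])
    qed
    then show ?thesis unfolding int_independent_def by simp
  qed
  show ?thesis unfolding group_rank_def
  proof (rule Greatest_equality)
    define \<delta> where "\<delta> j i = (if i = j then 1 else 0 :: int)" for j i :: nat
    define e where "e j = inv_into (carrier G) \<phi> (\<delta> j)" for j
    have im: "\<delta> j \<in> \<phi> ` carrier G" if "j < n" for j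
      using bij that unfolding bij_betw_def by (auto simp: \<delta>_def)
    have e: "e j \<in> carrier G" "\<phi> (e j) = \<delta> j" if "j < n" for j
      unfolding e_def using im[OF that] by (auto intro: inv_into_into f_inv_into_f)
    have inj: "inj_on e {..<n}"
    proof (rule inj_onI)
      fix j k assume "j \<in> {..<n}" "k \<in> {..<n}" "e j = e k"
      then have "\<delta> j = \<delta> k" using e(2) by (metis lessThan_iff)
      from fun_cong[OF this, of j] show "j = k" by (auto simp: \<delta>_def split: if_splits)
    qed
    have sub: "e ` {..<n} \<subseteq> carrier G" using e by auto
    have "int_independent G (e ` {..<n})"
      unfolding indep[OF finite_imageI[OF finite_lessThan] sub]
    proof (intro allI impI ballI)
      fix c x assume c: "\<forall>i<n. (\<Sum>x\<in>e ` {..<n}. c x * \<phi> x i) = 0" and "x \<in> e ` {..<n}"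
      then obtain j where j: "j < n" "x = e j" by auto
      have "(\<Sum>x\<in>e ` {..<n}. c x * \<phi> x j) = (\<Sum>k<n. c (e k) * \<delta> k j)"
        unfolding sum.reindex[OF inj] by (intro sum.cong) (auto simp: e)
      also have "\<dots> = (\<Sum>k<n. if k = j then c (e k) else 0)" by (intro sum.cong) (auto simp: \<delta>_def)
      also have "\<dots> = c (e j)" using j by simp
      finally show "c x = 0" using c j by auto
    qed
    then show "\<exists>B\<subseteq>carrier G. finite B \<and> card B = n \<and> int_independent G B"
      using sub card_image[OF inj] by (intro exI[of _ "e ` {..<n}"]) auto
  next
    fix m assume "\<exists>B\<subseteq>carrier G. finite B \<and> card B = m \<and> int_independent G B"
    then obtain B where B: "B \<subseteq> carrier G" "finite B" "card B = m" "int_independent G B" by blast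
    show "m \<le> n"
    proof (rule ccontr)
      assume "\<not> m \<le> n"
      then have "n < card B" using B by simp
      from integer_relation_exists[OF B(2) this, of \<phi>] B indep[OF B(2,1)] show False by blast
    qed
  qed
qed

section \<open>Attaching an arc\<close>

locale arc_attached =
  fixes X Y :: "'a::euclidean_space set" and g :: "real \<Rightarrow> 'a"
  assumes arc: "arc g" and closed_X: "closed X" and Y: "Y = X \<union> path_image g"
begin

definition param :: "'a \<Rightarrow> real" where "param = inv_into {0..1} g"

lemma inj: "inj_on g {0..1}" using arc by (simp add: arc_def)
lemma param: "t \<in> {0..1} \<Longrightarrow> param (g t) = t" by (simp add: param_def inv_into_f_f inj)
lemma g_param: "y \<in> path_image g \<Longrightarrow> g (param y) = y" by (simp add: param_def path_image_def f_inv_into_f)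
lemma param_in: "y \<in> path_image g \<Longrightarrow> param y \<in> {0..1}" unfolding param_def path_image_def by (rule inv_into_into)
lemma continuous_g: "continuous_on {0..1} g" using arc by (simp add: arc_def path_def)
lemma continuous_param: "continuous_on (path_image g) param"
proof -
  have "continuous_on (g ` {0..1}) param"
    by (rule continuous_on_inv[OF continuous_g]) (auto simp: param)
  then show ?thesis by (simp add: path_image_def)
qed
lemma path_image_diff: "y \<in> Y - X \<Longrightarrow> y \<in> path_image g" using Y by auto

text \<open>Homotopies on \<open>X\<close> and on the parameter interval fit together as both pieces are closed.\<close>

lemma glue_continuous:
  fixes f1 :: "real \<Rightarrow> 'a \<Rightarrow> 'b::topological_space" and f2 :: "real \<Rightarrow> real \<Rightarrow> 'b"
  assumes f1: "continuous_on ({0..1} \<times> X) (\<lambda>(s, y). f1 s y)"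
    and f2: "continuous_on ({0..1} \<times> {0..1}) (\<lambda>(s, t). f2 s t)"
    and agree: "\<And>s t. s \<in> {0..1} \<Longrightarrow> t \<in> {0..1} \<Longrightarrow> g t \<in> X \<Longrightarrow> f1 s (g t) = f2 s t"
  shows "continuous_on ({0..1} \<times> Y) (\<lambda>(s, y). if y \<in> X then f1 s y else f2 s (param y))"
proof -
  have "continuous_on ({0..1} \<times> X \<union> {0..1} \<times> path_image g)
     (\<lambda>p. if snd p \<in> X then (\<lambda>(s, y). f1 s y) p else (\<lambda>(s, y). f2 s (param y)) p)"
  proof (rule continuous_on_cases)
    show "closed ({0..1::real} \<times> X)" using closed_X by (intro closed_Times) auto
    show "closed ({0..1::real} \<times> path_image g)"
      using arc by (intro closed_Times closed_path_image arc_imp_path) auto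
    show "continuous_on ({0..1} \<times> X) (\<lambda>(s, y). f1 s y)" by fact
    have "continuous_on ({0..1} \<times> path_image g) (\<lambda>p. (fst p, param (snd p)))"
      by (intro continuous_intros continuous_on_compose2[OF continuous_param]) auto
    moreover have "(\<lambda>p. (fst p, param (snd p))) ` ({0..1} \<times> path_image g) \<subseteq> {0..1} \<times> {0..1}"
      using param_in by fastforce
    ultimately have "continuous_on ({0..1} \<times> path_image g) (\<lambda>p. (\<lambda>(s, t). f2 s t) (fst p, param (snd p)))"
      by (rule continuous_on_compose2[OF f2])
    then show "continuous_on ({0..1} \<times> path_image g) (\<lambda>(s, y). f2 s (param y))"
      by (simp add: case_prod_beta')
    show "\<forall>p. p \<in> {0..1} \<times> X \<and> snd p \<notin> X \<or> p \<in> {0..1} \<times> path_image g \<and> snd p \<in> X \<longrightarrow>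
        (case p of (s, y) \<Rightarrow> f1 s y) = (case p of (s, y) \<Rightarrow> f2 s (param y))"
    proof (intro allI impI)
      fix p :: "real \<times> 'a" assume "p \<in> {0..1} \<times> X \<and> snd p \<notin> X \<or> p \<in> {0..1} \<times> path_image g \<and> snd p \<in> X"
      then have p: "fst p \<in> {0..1}" "snd p \<in> path_image g" "snd p \<in> X" by auto
      have "g (param (snd p)) \<in> X" using g_param[OF p(2)] p(3) by simp
      from agree[OF p(1) param_in[OF p(2)] this] show "(case p of (s, y) \<Rightarrow> f1 s y) = (case p of (s, y) \<Rightarrow> f2 s (param y))"
        by (simp add: g_param[OF p(2)] p(3) case_prod_beta')
    qed
  qed
  moreover have "(\<lambda>p. if snd p \<in> X then (\<lambda>(s, y). f1 s y) p else (\<lambda>(s, y). f2 s (param y)) p) =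
      (\<lambda>(s, y). if y \<in> X then f1 s y else f2 s (param y))"
    by (rule ext) (auto split: prod.splits)
  ultimately show ?thesis unfolding Y by (simp only: Sigma_Un_distrib2)
qed

text \<open>A homotopy \<open>f2\<close> of the parameter interval, ending at the identity and fixing the parameters of the
  points in \<open>X\<close>, moves the arc and leaves \<open>X\<close> in place. The predicate \<open>P\<close>
  records subspaces that are to be preserved, which is what relative homology asks for.\<close>

lemma homotopic_glue:
  fixes f2 :: "real \<Rightarrow> real \<Rightarrow> real"
  assumes f2: "continuous_on ({0..1} \<times> {0..1}) (\<lambda>(s, t). f2 s t)"
    and im: "\<And>s t. s \<in> {0..1} \<Longrightarrow> t \<in> {0..1} \<Longrightarrow> f2 s t \<in> {0..1}"
    and fixed: "\<And>s t. s \<in> {0..1} \<Longrightarrow> t \<in> {0..1} \<Longrightarrow> g t \<in> X \<Longrightarrow> f2 s t = t"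
    and one: "\<And>t. t \<in> {0..1} \<Longrightarrow> f2 1 t = t"
    and P: "\<And>h k. (\<And>x. x \<in> Y \<Longrightarrow> h x = k x) \<Longrightarrow> (P h \<longleftrightarrow> P k)"
    and PH: "\<And>s. s \<in> {0..1} \<Longrightarrow> P (\<lambda>y. if y \<in> X then y else g (f2 s (param y)))"
  shows "homotopic_with P (top_of_set Y) (top_of_set Y) (\<lambda>y. if y \<in> X then y else g (f2 0 (param y))) id"
proof (subst homotopic_with)
  show "P h \<longleftrightarrow> P k" if "\<And>x. x \<in> topspace (top_of_set Y) \<Longrightarrow> h x = k x" for h k
    by (rule P) (use that in simp)
  let ?H = "\<lambda>(s, y). if y \<in> X then y else g (f2 s (param y))"
  have "continuous_on ({0..1} \<times> Y) ?H"
  proof (rule glue_continuous)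
    show "continuous_on ({0..1} \<times> X) (\<lambda>(s::real, y). y)" by (simp add: case_prod_beta' continuous_on_snd continuous_on_id)
    show "continuous_on ({0..1} \<times> {0..1}) (\<lambda>(s, t). g (f2 s t))"
    proof -
      have "(\<lambda>(s, t). f2 s t) ` ({0..1} \<times> {0..1}) \<subseteq> {0..1}" using im by fast
      from continuous_on_compose2[OF continuous_g f2 this] show ?thesis by (simp add: case_prod_beta')
    qed
    show "g t = g (f2 s t)" if "s \<in> {0..1}" "t \<in> {0..1}" "g t \<in> X" for s t using fixed that by simp
  qed
  moreover have "?H ` ({0..1} \<times> Y) \<subseteq> Y"
    using im param_in path_image_diff unfolding Y path_image_def by auto
  ultimately have "continuous_map (prod_topology (top_of_set {0..1}) (top_of_set Y)) (top_of_set Y) ?H"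
    by (simp add: prod_topology_subtopology_eu image_subset_iff_funcset)
  note cm = this
  show "\<exists>h. continuous_map (prod_topology (top_of_set {0..1::real}) (top_of_set Y)) (top_of_set Y) h \<and>
       (\<forall>x\<in>topspace (top_of_set Y). h (0, x) = (if x \<in> X then x else g (f2 0 (param x)))) \<and>
       (\<forall>x\<in>topspace (top_of_set Y). h (1, x) = id x) \<and> (\<forall>t\<in>{0..1}. P (\<lambda>x. h (t, x)))"
  proof (intro exI[of _ ?H] conjI ballI cm)
    fix x assume x: "x \<in> topspace (top_of_set Y)"
    show "?H (1, x) = id x"
    proof (cases "x \<in> X")
      case False
      then have "x \<in> path_image g" using x path_image_diff by simp
      from one[OF param_in[OF this]] g_param[OF this] False show ?thesis by simp
    qed simp
  next
    fix s :: real assume "s \<in> {0..1}"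
    from PH[OF this] show "P (\<lambda>x. ?H (s, x))" by simp
  qed simp_all
qed

text \<open>An arc that touches \<open>X\<close> only with its start is pulled back into \<open>X\<close> by scaling the
  parameter to 0.\<close>

lemma homology_whisker:
  assumes X: "path_image g \<inter> X = {pathstart g}"
  shows "homology_group p (top_of_set Y) \<cong> homology_group p (top_of_set X)"
proof -
  define f2 where "f2 s t = s * t" for s t :: real
  have X0: "t = 0" if "t \<in> {0..1}" "g t \<in> X" for t
  proof -
    have "g t = g 0" using X that unfolding path_image_def pathstart_def by blast
    then show ?thesis using inj that by (auto dest: inj_onD)
  qed
  have h: "homotopic_with (\<lambda>h. True) (top_of_set Y) (top_of_set Y) (\<lambda>y. if y \<in> X then y else g (f2 0 (param y))) id"
  proof (rule homotopic_glue)
    show "continuous_on ({0..1} \<times> {0..1}) (\<lambda>(s, t). f2 s t)"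
      unfolding f2_def case_prod_beta' by (intro continuous_intros)
    show "f2 s t \<in> {0..1}" if "s \<in> {0..1}" "t \<in> {0..1}" for s t
      using that by (auto simp: f2_def mult_le_one)
    show "f2 s t = t" if "s \<in> {0..1}" "t \<in> {0..1}" "g t \<in> X" for s t using X0[OF that(2,3)] by (simp add: f2_def)
  qed (auto simp: f2_def)
  have g0: "g 0 \<in> X" using X by (auto simp: pathstart_def)
  have "retraction_maps (top_of_set Y) (top_of_set X) (\<lambda>y. if y \<in> X then y else g (f2 0 (param y))) id"
    unfolding retraction_maps_def
  proof (intro conjI ballI)
    show "continuous_map (top_of_set Y) (top_of_set X) (\<lambda>y. if y \<in> X then y else g (f2 0 (param y)))"
      using homotopic_with_imp_continuous_maps[OF h] g0 by (auto simp: f2_def)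
    show "continuous_map (top_of_set X) (top_of_set Y) id" using Y by auto
  qed auto
  from deformation_retract_imp_isomorphic_homology_groups[OF this h] show ?thesis .
qed

text \<open>A path in \<open>X\<close> between the end points provides a retraction of \<open>Y\<close> onto
  \<open>X\<close>, so the homology of \<open>Y\<close> splits as that of \<open>X\<close> times the homology of the
  pair. The latter is that of an interval relative to its two ends: thicken \<open>X\<close> along the arc, excise
  \<open>X\<close>, and use that the open arc is contractible. What remains is the reduced homology of a space
  homotopy equivalent to two points.\<close>

lemma homology_loop:
  assumes X: "path_image g \<inter> X = {pathstart g, pathfinish g}" and pc: "path_connected X"
  shows "homology_group 1 (top_of_set Y) \<cong> homology_group 1 (top_of_set X) \<times>\<times> integer_group"
proof -
  have ends: "g 0 \<in> X" "g 1 \<in> X" using X by (auto simp: pathstart_def pathfinish_def)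
  have X01: "t = 0 \<or> t = 1" if "t \<in> {0..1}" "g t \<in> X" for t
  proof -
    have "g t \<in> {g 0, g 1}" using X that unfolding path_image_def pathstart_def pathfinish_def by blast
    then show ?thesis using inj that by (auto dest: inj_onD)
  qed
  have XY: "X \<subseteq> Y" "path_image g \<subseteq> Y" using Y by auto
  have clY: "closed (path_image g)" using arc by (intro closed_path_image arc_imp_path)
  \<comment> \<open>a path in \<open>X\<close> between the end points turns the arc into a retraction\<close>
  obtain p where p: "path p" "path_image p \<subseteq> X" "pathstart p = g 0" "pathfinish p = g 1"
    using pc ends unfolding path_connected_def by blast
  let ?r = "\<lambda>y. if y \<in> X then y else p (param y)"
  have "continuous_on ({0..1} \<times> Y) (\<lambda>(s::real, y). if y \<in> X then y else p (param y))"
  proof (rule glue_continuous)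
    show "continuous_on ({0..1} \<times> X) (\<lambda>(s::real, y). y)" by (simp add: case_prod_beta' continuous_on_snd continuous_on_id)
    have "continuous_on {0..1} p" using p(1) by (simp add: path_def)
    then show "continuous_on ({0..1} \<times> {0..1}) (\<lambda>(s::real, t). p t)"
      unfolding case_prod_beta' by (rule continuous_on_compose2) (auto intro: continuous_intros)
    show "g t = p t" if "t \<in> {0..1}" "g t \<in> X" for t
      using X01[OF that] p(3,4) by (auto simp: pathstart_def pathfinish_def)
  qed
  then have "continuous_on Y (\<lambda>y. (\<lambda>(s::real, y). if y \<in> X then y else p (param y)) (0, y))"
    by (rule continuous_on_compose2) (auto intro: continuous_intros)
  then have "continuous_on Y ?r" by simp
  moreover have "?r ` Y \<subseteq> X"
  proof
    fix z assume "z \<in> ?r ` Y"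
    then obtain y where y: "y \<in> Y" "z = ?r y" by blast
    show "z \<in> X"
    proof (cases "y \<in> X")
      case False
      then have "param y \<in> {0..1}" using y param_in path_image_diff by blast
      then have "p (param y) \<in> path_image p" by (simp add: path_image_def)
      then show ?thesis using p(2) y False by auto
    qed (use y in simp)
  qed
  ultimately have cr: "continuous_map (top_of_set Y) (top_of_set X) ?r"
    by (simp only: continuous_map_subtopology_eu image_subset_iff_funcset)
  have sX: "subtopology (top_of_set Y) X = top_of_set X"
    using XY by (simp add: subtopology_subtopology Int_absorb1)
  have retract: "X retract_of_space top_of_set Y"
    unfolding retract_of_space_def sX using XY by (intro conjI exI[of _ ?r] cr) auto
  have 1: "homology_group 1 (top_of_set Y) \<cong> homology_group 1 (top_of_set X) \<times>\<times> relative_homology_group 1 (top_of_set Y) X"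
    using isomorphic_group_homology_group_prod_retract[of X "top_of_set Y" 1] retract sX by simp
  \<comment> \<open>thicken \<open>X\<close> by the two outer quarters of the arc\<close>
  define I :: "real set" where "I = {0..1/4} \<union> {3/4..1}"
  have I01: "I \<subseteq> {0..1}" by (auto simp: I_def)
  define U where "U = X \<union> g ` I"
  have UY: "U \<subseteq> Y" using I01 Y by (auto simp: U_def path_image_def)
  \<comment> \<open>At \<open>s = 0\<close> this stretches the middle half of the interval over all of it and sends the outer quarters to the ends.\<close>
  define f2 where "f2 s t = s * t + (1 - s) * max 0 (min 1 (2 * t - 1/2))" for s t :: real
  have clamp: "max 0 (min 1 (2 * t - 1/2)) \<in> {0..1}" for t :: real by auto
  have f2_in: "f2 s t \<in> {0..1}" if "s \<in> {0..1}" "t \<in> {0..1}" for s t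
  proof -
    have "convex {0..1::real}" by (rule convex_real_interval)
    from convexD[OF this that(2) clamp[of t], of s "1 - s"] that(1) show ?thesis by (simp add: f2_def)
  qed
  have f2_I: "f2 s t \<in> I" if "s \<in> {0..1}" "t \<in> I" for s t
  proof -
    from that(2) consider "t \<in> {0..1/4}" | "t \<in> {3/4..1}" by (auto simp: I_def)
    then show ?thesis
    proof cases
      case 1
      then have "f2 s t = s * t" by (simp add: f2_def)
      moreover have "0 \<le> s * t" "s * t \<le> 1 * t" using that(1) 1 mult_right_mono[of s 1 t] by auto
      ultimately show ?thesis using 1 by (auto simp: I_def)
    next
      case 2
      then have "f2 s t = s * t + (1 - s)" by (simp add: f2_def)
      then have "1 - f2 s t = s * (1 - t)" by (simp add: algebra_simps)
      moreover have "0 \<le> s * (1 - t)" "s * (1 - t) \<le> 1 * (1 - t)" using that(1) 2 mult_right_mono[of s 1 "1 - t"] by auto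
      ultimately show ?thesis using 2 by (auto simp: I_def)
    qed
  qed
  let ?H = "\<lambda>s y. if y \<in> X then y else g (f2 s (param y))"
  have U_param: "param y \<in> I" if "y \<in> U - X" for y
    using that I01 param unfolding U_def by auto
  have hom: "homotopic_with P (top_of_set Y) (top_of_set Y) (?H 0) id"
    if P: "\<And>h k. (\<And>x. x \<in> Y \<Longrightarrow> h x = k x) \<Longrightarrow> (P h \<longleftrightarrow> P k)" and PH: "\<And>s. s \<in> {0..1} \<Longrightarrow> P (?H s)" for P
  proof (rule homotopic_glue[where ?f2.0 = f2 and P = P])
    show "P h \<longleftrightarrow> P k" if "\<And>x. x \<in> Y \<Longrightarrow> h x = k x" for h k by (rule P) (rule that)
    show "P (?H s)" if "s \<in> {0..1}" for s by (rule PH[OF that])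
    show "continuous_on ({0..1} \<times> {0..1}) (\<lambda>(s, t). f2 s t)"
      unfolding f2_def case_prod_beta' by (intro continuous_intros)
    show "f2 s t = t" if "s \<in> {0..1}" "t \<in> {0..1}" "g t \<in> X" for s t using X01[OF that(2,3)] by (auto simp: f2_def)
  qed (use f2_in in \<open>auto simp: f2_def\<close>)
  have HU: "?H s \<in> U \<rightarrow> U" if "s \<in> {0..1}" for s
  proof
    fix y assume y: "y \<in> U"
    show "?H s y \<in> U"
    proof (cases "y \<in> X")
      case False
      then show ?thesis using f2_I[OF that U_param[of y]] y by (auto simp: U_def)
    qed (use y in simp)
  qed
  have H0U: "?H 0 \<in> U \<rightarrow> X"
  proof
    fix y assume y: "y \<in> U"
    show "?H 0 y \<in> X"
    proof (cases "y \<in> X")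
      case False
      then have "param y \<in> I" using U_param y by auto
      then have "f2 0 (param y) \<in> {0, 1}" by (auto simp: I_def f2_def)
      then show ?thesis using ends by auto
    qed simp
  qed
  have 2: "relative_homology_group 1 (top_of_set Y) X \<cong> relative_homology_group 1 (top_of_set Y) U"
  proof (rule homotopy_equivalent_space_imp_isomorphic_relative_homology_groups[where f = id and g = "?H 0"])
    show "id \<in> X \<rightarrow> U" by (auto simp: U_def)
    show "?H 0 \<in> U \<rightarrow> X" by (rule H0U)
    have "homotopic_with (\<lambda>h. h \<in> X \<rightarrow> X) (top_of_set Y) (top_of_set Y) (?H 0) id"
      by (rule hom) (use XY in \<open>auto simp: Pi_iff subset_iff\<close>)
    then show "homotopic_with (\<lambda>h. h \<in> X \<rightarrow> X) (top_of_set Y) (top_of_set Y) (?H 0 \<circ> id) id" by simp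
    have "homotopic_with (\<lambda>h. h \<in> U \<rightarrow> U) (top_of_set Y) (top_of_set Y) (?H 0) id"
    proof (rule hom)
      show "(h \<in> U \<rightarrow> U) = (k \<in> U \<rightarrow> U)" if "\<And>x. x \<in> Y \<Longrightarrow> h x = k x" for h k :: "'a \<Rightarrow> 'a"
        using that UY by (auto simp: Pi_iff subset_iff)
    qed (rule HU)
    then show hU: "homotopic_with (\<lambda>h. h \<in> U \<rightarrow> U) (top_of_set Y) (top_of_set Y) (id \<circ> ?H 0) id" by simp
    then show "continuous_map (top_of_set Y) (top_of_set Y) (?H 0)"
      using homotopic_with_imp_continuous_maps by fastforce
  qed simp
  \<comment> \<open>excise \<open>X\<close>\<close>
  define A where "A = g ` {0<..<1}"
  define K :: "real set" where "K = {0<..1/4} \<union> {3/4..<1}"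
  have K01: "K \<subseteq> {0<..<1}" by (auto simp: K_def)
  have YX: "Y - X = A"
  proof
    show "Y - X \<subseteq> A"
    proof
      fix y assume y: "y \<in> Y - X"
      then have "param y \<in> {0..1}" "g (param y) = y" using path_image_diff param_in g_param by blast+
      moreover have "param y \<noteq> 0" "param y \<noteq> 1" using calculation(2) y ends by auto
      ultimately show "y \<in> A" unfolding A_def by (intro image_eqI[of _ _ "param y"]) auto
    qed
    show "A \<subseteq> Y - X"
    proof
      fix y assume "y \<in> A"
      then obtain t where t: "t \<in> {0<..<1}" "y = g t" by (auto simp: A_def)
      then show "y \<in> Y - X" using X01[of t] XY(2) by (auto simp: path_image_def)
    qed
  qed
  have UX: "U - X = g ` K"
  proof
    show "U - X \<subseteq> g ` K"
    proof
      fix y assume y: "y \<in> U - X"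
      then obtain t where t: "t \<in> I" "y = g t" by (auto simp: U_def)
      then have "t \<noteq> 0" "t \<noteq> 1" using y ends by auto
      then show "y \<in> g ` K" using t by (auto simp: I_def K_def)
    qed
    show "g ` K \<subseteq> U - X"
    proof
      fix y assume "y \<in> g ` K"
      then obtain t where t: "t \<in> K" "y = g t" by auto
      then have "t \<in> I" "t \<in> {0<..<1}" by (auto simp: I_def K_def)
      then show "y \<in> U - X" using X01[of t] t by (auto simp: U_def)
    qed
  qed
  have "top_of_set Y closure_of X \<subseteq> top_of_set Y interior_of U"
  proof -
    have "closedin (top_of_set Y) X" using closed_X XY by (simp add: closed_subset)
    then have "top_of_set Y closure_of X = X" by (simp add: closure_of_closedin)
    moreover have "X \<subseteq> top_of_set Y interior_of U"
    proof -
      let ?C = "g ` {1/4..3/4}"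
      have "compact ?C" by (intro compact_continuous_image continuous_on_subset[OF continuous_g]) auto
      then have "openin (top_of_set Y) (Y - ?C)"
        by (metis Diff_eq compact_imp_closed open_Compl openin_open_Int)
      moreover have "Y - ?C \<subseteq> U"
      proof
        fix y assume y: "y \<in> Y - ?C"
        show "y \<in> U"
        proof (cases "y \<in> X")
          case False
          then have t: "param y \<in> {0..1}" "g (param y) = y" using y path_image_diff param_in g_param by blast+
          then have "param y \<notin> {1/4..3/4}" using y by (metis DiffD2 imageI)
          then have "param y \<in> I" using t by (auto simp: I_def)
          then show ?thesis using t(2) unfolding U_def by (metis UnI2 imageI)
        qed (simp add: U_def)
      qed
      ultimately have "Y - ?C \<subseteq> top_of_set Y interior_of U" by (rule interior_of_maximal[rotated])
      moreover have "X \<subseteq> Y - ?C"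
      proof
        fix x assume x: "x \<in> X"
        have "x \<notin> ?C"
        proof
          assume "x \<in> ?C"
          then obtain t where "t \<in> {1/4..3/4}" "x = g t" by blast
          then show False using X01[of t] x by auto
        qed
        then show "x \<in> Y - ?C" using x XY(1) by blast
      qed
      ultimately show ?thesis by blast
    qed
    ultimately show ?thesis by simp
  qed
  from homology_excision_axiom[OF this UY, of 1]
  have "relative_homology_group 1 (subtopology (top_of_set Y) (Y - X)) (U - X) \<cong> relative_homology_group 1 (subtopology (top_of_set Y) Y) U"
    by (rule is_isoI)
  then have 3: "relative_homology_group 1 (top_of_set A) (g ` K) \<cong> relative_homology_group 1 (top_of_set Y) U"
  proof -
    have "Y \<inter> A = A" using YX by blast
    then show ?thesis using \<open>relative_homology_group 1 (subtopology (top_of_set Y) (Y - X)) (U - X) \<cong> _\<close>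
      by (simp add: YX UX subtopology_subtopology)
  qed
  \<comment> \<open>what is left is an interval relative to its two ends\<close>
  have hom_g: "homeomorphism S (g ` S) g param" if "S \<subseteq> {0..1}" for S
    unfolding homeomorphism_def
  proof (intro conjI ballI)
    show "continuous_on S g" using continuous_g that by (rule continuous_on_subset)
    have "g ` S \<subseteq> path_image g" using that by (auto simp: path_image_def)
    then show "continuous_on (g ` S) param" using continuous_param continuous_on_subset by blast
    show "param (g x) = x" if "x \<in> S" for x using that \<open>S \<subseteq> {0..1}\<close> param by blast
    then show "param ` g ` S = S" by force
    show "g (param y) = y" if "y \<in> g ` S" for y using that \<open>S \<subseteq> {0..1}\<close> param by auto
  qed simp
  have "A homeomorphic {0<..<1::real}"
    using hom_g[of "{0<..<1}"] unfolding A_def homeomorphic_def by (metis greaterThanLessThan_subseteq_atLeastAtMost_iff homeomorphic_def homeomorphic_sym order_refl)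
  then have "contractible A" using homeomorphic_contractible convex_imp_contractible by (metis convex_real_interval(8) homeomorphic_sym)
  moreover have "topspace (top_of_set A) \<inter> g ` K \<noteq> {}"
  proof -
    have "(1/4::real) \<in> K" "(1/4::real) \<in> {0<..<1}" by (auto simp: K_def)
    then have "g (1/4) \<in> A \<inter> g ` K" by (simp add: A_def)
    then show ?thesis by auto
  qed
  ultimately have 4: "relative_homology_group 1 (top_of_set A) (g ` K) \<cong> reduced_homology_group 0 (subtopology (top_of_set A) (g ` K))"
    using isomorphic_group_relative_homology_of_contractible[of "top_of_set A" "g ` K" 1] by simp
  have KA: "subtopology (top_of_set A) (g ` K) = top_of_set (g ` K)"
    using K01 by (auto simp: A_def subtopology_subtopology intro!: arg_cong[where f = "subtopology _"])
  have "homeomorphism K (g ` K) g param" using K01 by (intro hom_g) auto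
  then have "top_of_set (g ` K) homeomorphic_space top_of_set K"
    unfolding homeomorphic_space_def homeomorphic_maps_def homeomorphism_def
    by (intro exI[of _ param] exI[of _ g]) auto
  then have 5: "reduced_homology_group 0 (top_of_set (g ` K)) \<cong> reduced_homology_group 0 (top_of_set K)"
    by (rule homeomorphic_space_imp_isomorphic_reduced_homology_groups)
  let ?\<rho> = "\<lambda>t::real. if t \<le> 1/2 then 1/4 else (3/4::real)"
  have "top_of_set K homotopy_equivalent_space top_of_set {1/4, 3/4::real}"
  proof (rule deformation_retraction_imp_homotopy_equivalent_space)
    have "continuous_on ({..1/4} \<union> {3/4..}) ?\<rho>"
      by (rule continuous_on_cases) (auto intro: continuous_on_const)
    then have c: "continuous_on K ?\<rho>" by (rule continuous_on_subset) (auto simp: K_def)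
    show "homotopic_with (\<lambda>x. True) (top_of_set K) (top_of_set K) (id \<circ> ?\<rho>) id"
      unfolding id_comp
    proof (rule homotopic_with_linear)
      show "closed_segment (?\<rho> x) (id x) \<subseteq> K" if "x \<in> K" for x
        using that by (auto simp: K_def closed_segment_eq_real_ivl)
    qed (use c in auto)
    show "retraction_maps (top_of_set K) (top_of_set {1/4, 3/4}) ?\<rho> id"
      using c by (auto simp: retraction_maps_def K_def)
  qed
  then have 6: "reduced_homology_group 0 (top_of_set K) \<cong> reduced_homology_group 0 (top_of_set {1/4, 3/4::real})"
    by (rule homotopy_equivalent_space_imp_isomorphic_reduced_homology_groups)
  have 7: "reduced_homology_group 0 (top_of_set {1/4, 3/4::real}) \<cong> homology_group 0 (top_of_set {1/4::real})"
    by (rule reduced_homology_group_pair) (auto simp: Hausdorff_imp_t1_space)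
  have 8: "homology_group 0 (top_of_set {1/4::real}) \<cong> integer_group"
    by (rule isomorphic_integer_zeroth_homology_group) auto
  have "relative_homology_group 1 (top_of_set Y) X \<cong> relative_homology_group 1 (top_of_set A) (g ` K)"
    using iso_trans[OF 2 group.iso_sym[OF _ 3]] by simp
  also have "\<dots> \<cong> reduced_homology_group 0 (top_of_set (g ` K))" using 4 KA by simp
  also note 5 also note 6 also note 7 also note 8
  finally have "relative_homology_group 1 (top_of_set Y) X \<cong> integer_group" .
  then have "homology_group 1 (top_of_set X) \<times>\<times> relative_homology_group 1 (top_of_set Y) X \<cong> homology_group 1 (top_of_set X) \<times>\<times> integer_group"
    by (intro group.DirProd_iso_trans iso_refl) auto
  then show ?thesis using 1 iso_trans by blast
qed

end

section \<open>The first homology group of a graph\<close>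

locale embedded_graph =
  fixes \<Gamma> V :: "'a::euclidean_space set" and E :: "'a set set" and \<gamma> :: "'a set \<Rightarrow> real \<Rightarrow> 'a"
  assumes connected: "connected \<Gamma>" and nonempty: "\<Gamma> \<noteq> {}"
    and finite_V: "finite V" and V_sub: "V \<subseteq> \<Gamma>" and finite_E: "finite E"
    and disjoint_E: "disjoint E" and Union_E: "\<Union>E = \<Gamma> - V"
    and arc: "\<And>e. e \<in> E \<Longrightarrow> arc (\<gamma> e)"
    and start: "\<And>e. e \<in> E \<Longrightarrow> pathstart (\<gamma> e) \<in> V" and finish: "\<And>e. e \<in> E \<Longrightarrow> pathfinish (\<gamma> e) \<in> V"
    and edge: "\<And>e. e \<in> E \<Longrightarrow> e = \<gamma> e ` {0<..<1}"
begin

lemma path_image_edge: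
  assumes "e \<in> E" shows "path_image (\<gamma> e) = e \<union> {pathstart (\<gamma> e), pathfinish (\<gamma> e)}"
proof -
  have eq: "{0..1::real} = {0<..<1} \<union> {0, 1}" by auto
  have "path_image (\<gamma> e) = \<gamma> e ` {0<..<1} \<union> {\<gamma> e 0, \<gamma> e 1}"
    unfolding path_image_def by (simp only: eq image_Un image_insert image_empty)
  then show ?thesis
    unfolding pathstart_def pathfinish_def by (simp only: edge[OF assms, symmetric])
qed

lemma edge_V: "e \<in> E \<Longrightarrow> e \<inter> V = {}" using Union_E by blast

lemma edge_nonempty:
  assumes "e \<in> E" shows "e \<noteq> {}"
proof -
  have "\<gamma> e (1/2) \<in> \<gamma> e ` {0<..<1}" by simp
  then have "\<gamma> e (1/2) \<in> e" by (simp only: edge[OF assms, symmetric])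
  then show ?thesis by blast
qed

lemma edge_disjoint: "e \<in> E \<Longrightarrow> e' \<in> E \<Longrightarrow> e \<noteq> e' \<Longrightarrow> e \<inter> e' = {}"
  using disjoint_E by (auto simp: disjoint_def)

text \<open>Path connectedness is included so that an arc attached at both ends always closes a loop.\<close>

definition subgraph :: "'a set \<Rightarrow> 'a set set \<Rightarrow> bool" where
  "subgraph W F \<longleftrightarrow> W \<subseteq> V \<and> W \<noteq> {} \<and> F \<subseteq> E \<and>
     (\<forall>e\<in>F. pathstart (\<gamma> e) \<in> W \<and> pathfinish (\<gamma> e) \<in> W) \<and> path_connected (W \<union> \<Union>F)"

lemma carrier_eq:
  assumes "W \<subseteq> V" "F \<subseteq> E" "\<And>e. e \<in> F \<Longrightarrow> pathstart (\<gamma> e) \<in> W \<and> pathfinish (\<gamma> e) \<in> W"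
  shows "W \<union> \<Union>F = W \<union> (\<Union>e\<in>F. path_image (\<gamma> e))"
proof -
  have p: "path_image (\<gamma> e) = e \<union> {pathstart (\<gamma> e), pathfinish (\<gamma> e)}" if "e \<in> F" for e
    using path_image_edge assms(2) that by blast
  have "(\<Union>e\<in>F. path_image (\<gamma> e)) = (\<Union>e\<in>F. e \<union> {pathstart (\<gamma> e), pathfinish (\<gamma> e)})"
    using p by simp
  also have "W \<union> \<dots> = W \<union> \<Union>F" using assms(3) by auto
  finally show ?thesis by simp
qed

lemma closed_carrier:
  assumes "W \<subseteq> V" "F \<subseteq> E" "\<And>e. e \<in> F \<Longrightarrow> pathstart (\<gamma> e) \<in> W \<and> pathfinish (\<gamma> e) \<in> W"
  shows "closed (W \<union> \<Union>F)"
proof -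
  have "finite W" "finite F" using assms finite_V finite_E finite_subset by blast+
  moreover have "closed (path_image (\<gamma> e))" if "e \<in> F" for e
    using arc that assms(2) by (intro closed_path_image arc_imp_path) auto
  ultimately have "closed (\<Union>e\<in>F. path_image (\<gamma> e))" by (intro closed_UN) auto
  from closed_Un[OF finite_imp_closed[OF \<open>finite W\<close>] this]
  show ?thesis by (subst carrier_eq[OF assms])
qed

lemma V_nonempty: "V \<noteq> {}"
proof
  assume "V = {}"
  then have "E = {}" using start by blast
  then show False using Union_E nonempty \<open>V = {}\<close> by auto
qed

text \<open>If no remaining edge touches the subgraph, then the subgraph and the union of the other vertices and edges are
  disjoint closed sets covering the connected \<open>\<Gamma>\<close>.\<close>

lemma subgraph_maximal:
  assumes sg: "subgraph W F" and max: "\<And>e. e \<in> E - F \<Longrightarrow> pathstart (\<gamma> e) \<notin> W \<and> pathfinish (\<gamma> e) \<notin> W"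
  shows "W = V \<and> F = E"
proof -
  let ?A = "W \<union> \<Union>F" and ?B = "(V - W) \<union> \<Union>(E - F)"
  have "closed ?A" using sg by (intro closed_carrier) (auto simp: subgraph_def)
  moreover have "closed ?B" using max start finish by (intro closed_carrier) auto
  moreover have "?A \<inter> ?B = {}"
  proof -
    have "W \<inter> \<Union>(E - F) = {}" "\<Union>F \<inter> (V - W) = {}" using edge_V sg unfolding subgraph_def by blast+
    moreover have "\<Union>F \<inter> \<Union>(E - F) = {}"
    proof -
      have "e \<inter> e' = {}" if "e \<in> F" "e' \<in> E - F" for e e'
        using that sg edge_disjoint[of e e'] unfolding subgraph_def by blast
      then show ?thesis by blast
    qed
    ultimately show ?thesis by blast
  qed
  moreover have AB: "\<Gamma> = ?A \<union> ?B"
  proof -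
    have "\<Gamma> = V \<union> \<Union>E" using Union_E V_sub by blast
    moreover have "\<Union>E = \<Union>F \<union> \<Union>(E - F)" using sg unfolding subgraph_def by blast
    ultimately show ?thesis using sg unfolding subgraph_def by blast
  qed
  ultimately have "\<Gamma> \<inter> ?A = {} \<or> \<Gamma> \<inter> ?B = {}"
    using connected unfolding connected_closed by blast
  moreover have "\<Gamma> \<inter> ?A \<noteq> {}" using AB sg by (auto simp: subgraph_def)
  ultimately have "?B = {}" using AB by blast
  then have "V - W = {}" "\<Union>(E - F) = {}" by auto
  moreover have "E - F = {}" using calculation(2) edge_nonempty by blast
  ultimately show ?thesis using sg by (auto simp: subgraph_def)
qed

text \<open>Grow the subgraph by an edge that touches it. If only one end lies in the subgraph, one edge and one vertex are
  added and homology does not change; if both ends do, one edge and one generator are added. The balance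
  \<open>n + |W| = |F| + 1\<close> survives either way.\<close>

lemma subgraph_homology:
  assumes "subgraph W F" "free_rank (homology_group 1 (top_of_set (W \<union> \<Union>F))) n" "n + card W = card F + 1"
  shows "\<exists>n. free_rank (homology_group 1 (top_of_set \<Gamma>)) n \<and> n + card V = card E + 1"
  using assms
proof (induction "card (E - F)" arbitrary: W F n rule: less_induct)
  case less
  let ?X = "W \<union> \<Union>F"
  have W: "W \<subseteq> V" "W \<noteq> {}" and F: "F \<subseteq> E" and Fends: "\<And>e. e \<in> F \<Longrightarrow> pathstart (\<gamma> e) \<in> W \<and> pathfinish (\<gamma> e) \<in> W"
    and pc: "path_connected ?X" using less.prems(1) by (auto simp: subgraph_def)
  have cl: "closed ?X" by (rule closed_carrier[OF W(1) F Fends])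
  show ?case
  proof (cases "\<forall>e\<in>E - F. pathstart (\<gamma> e) \<notin> W \<and> pathfinish (\<gamma> e) \<notin> W")
    case True
    then have "W = V \<and> F = E" using subgraph_maximal[OF less.prems(1)] by blast
    moreover from this have "V \<union> \<Union>E = \<Gamma>" using Union_E V_sub by blast
    ultimately show ?thesis using less.prems by auto
  next
    case False
    then obtain e where e: "e \<in> E" "e \<notin> F" and touch: "pathstart (\<gamma> e) \<in> W \<or> pathfinish (\<gamma> e) \<in> W" by blast
    define h where "h = (if pathstart (\<gamma> e) \<in> W then \<gamma> e else reversepath (\<gamma> e))"
    have h: "arc h" "path_image h = path_image (\<gamma> e)" "pathstart h \<in> W" "{pathstart h, pathfinish h} = {pathstart (\<gamma> e), pathfinish (\<gamma> e)}"
      "pathfinish h \<in> V"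
      using arc[OF e(1)] touch start[OF e(1)] finish[OF e(1)] by (auto simp: h_def arc_reversepath)
    have pi: "path_image h = e \<union> {pathstart h, pathfinish h}" using path_image_edge[OF e(1)] h by simp
    have eF: "e \<inter> \<Union>F = {}"
    proof -
      have "e \<inter> e' = {}" if "e' \<in> F" for e' using edge_disjoint[OF e(1), of e'] that F e(2) by blast
      then show ?thesis by blast
    qed
    have VF: "V \<inter> \<Union>F = {}" using edge_V F by blast
    have eX: "e \<inter> ?X = {}" using eF edge_V[OF e(1)] W(1) by blast
    interpret arc_attached ?X "?X \<union> path_image h" h
      using h(1) cl by unfold_locales auto
    let ?W = "insert (pathfinish h) W" and ?F = "insert e F"
    have eq: "?X \<union> path_image h = ?W \<union> \<Union>?F" using pi h(3) by auto
    have pcY: "path_connected (?X \<union> path_image h)"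
      using h(3) by (intro path_connected_Un pc path_connected_path_image arc_imp_path h(1)) auto
    have eW: "{pathstart (\<gamma> e), pathfinish (\<gamma> e)} \<subseteq> ?W" unfolding h(4)[symmetric] using h(3) by blast
    have sg: "subgraph ?W ?F" unfolding subgraph_def
    proof (intro conjI ballI)
      show "pathstart (\<gamma> e') \<in> ?W" "pathfinish (\<gamma> e') \<in> ?W" if "e' \<in> ?F" for e'
        using that Fends[of e'] eW by auto
      show "path_connected (?W \<union> \<Union>?F)" using pcY eq by simp
    qed (use W F e h in auto)
    have finF: "finite F" "finite W" using F W finite_E finite_V finite_subset by blast+
    have less': "card (E - ?F) < card (E - F)"
      using e finite_E by (intro psubset_card_mono) auto
    show ?thesis
    proof (cases "pathfinish h \<in> W")
      case True
      have "path_image h \<inter> ?X = {pathstart h, pathfinish h}" using pi eX True h(3) by auto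
      from homology_loop[OF this pc] have iso: "homology_group 1 (top_of_set (?X \<union> path_image h)) \<cong> homology_group 1 (top_of_set ?X) \<times>\<times> integer_group" .
      have "free_rank (homology_group 1 (top_of_set (?W \<union> \<Union>?F))) (Suc n)"
        unfolding eq[symmetric]
        by (rule free_rank_iso[OF abelian_homology_group iso free_rank_times_integers[OF less.prems(2)]])
      moreover have "Suc n + card ?W = card ?F + 1"
        using less.prems(3) True e(2) finF by (simp add: insert_absorb)
      ultimately show ?thesis using less.hyps[OF less' sg] by blast
    next
      case False
      then have "pathfinish h \<notin> ?X" using h(5) VF by blast
      then have "path_image h \<inter> ?X = {pathstart h}" using pi eX h(3) by auto
      from homology_whisker[OF this] have iso: "homology_group 1 (top_of_set (?X \<union> path_image h)) \<cong> homology_group 1 (top_of_set ?X)" .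
      have "free_rank (homology_group 1 (top_of_set (?W \<union> \<Union>?F))) n"
        unfolding eq[symmetric]
        by (rule free_rank_iso[OF abelian_homology_group iso less.prems(2)])
      moreover have "n + card ?W = card ?F + 1"
        using less.prems(3) False e(2) finF by simp
      ultimately show ?thesis using less.hyps[OF less' sg] by blast
    qed
  qed
qed

theorem first_betti_graph: "first_betti \<Gamma> + card V = card E + 1"
proof -
  obtain v where v: "v \<in> V" using V_nonempty by blast
  have "subgraph {v} {}" using v by (simp add: subgraph_def)
  moreover have "free_rank (homology_group 1 (top_of_set ({v} \<union> \<Union>{}))) 0"
    by (rule free_rank_trivial_group[OF abelian_homology_group homology_dimension_axiom[of _ v]]) auto
  ultimately obtain n where n: "free_rank (homology_group 1 (top_of_set \<Gamma>)) n" "n + card V = card E + 1"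
    using subgraph_homology[of "{v}" "{}" 0] by auto
  show ?thesis using group_rank_free_rank[OF n(1)] n(2) by (simp add: first_betti_def)
qed

end

section \<open>Second order behaviour on an edge\<close>

lemma analytic_ioo_first_order:
  assumes "analytic_ioo f" "t \<in> {0<..<1}"
  shows "((\<lambda>s. (f s - f t) / (s - t)) \<longlongrightarrow> deriv f t) (at t)"
  using analytic_ioo_DERIV[OF assms] by (simp add: has_field_derivative_iff)

lemma analytic_ioo_second_order:
  assumes f: "analytic_ioo f" "t \<in> {0<..<1}" and z: "deriv f t = 0"
  shows "((\<lambda>s. (f s - f t) / (s - t)\<^sup>2) \<longlongrightarrow> deriv (deriv f) t / 2) (at t)"
proof -
  have ev: "\<forall>\<^sub>F s in at t. s \<in> {0<..<1::real}" by (rule eventually_at_in_open') (use f in auto)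
  have ne: "\<forall>\<^sub>F s in at t. s \<noteq> t" by (simp add: eventually_at_filter)
  show ?thesis
  proof (rule lhopital[where f' = "deriv f" and g' = "\<lambda>s. 2 * (s - t)"])
    have "isCont f t" by (rule DERIV_isCont[OF analytic_ioo_DERIV[OF f]])
    then have "((\<lambda>s. f s - f t) \<longlongrightarrow> f t - f t) (at t)" by (intro tendsto_intros) (simp add: isCont_def)
    then show "((\<lambda>s. f s - f t) \<longlongrightarrow> 0) (at t)" by simp
    have "((\<lambda>s. (s - t)\<^sup>2) \<longlongrightarrow> (t - t)\<^sup>2) (at t)" by (intro tendsto_intros)
    then show "((\<lambda>s. (s - t)\<^sup>2) \<longlongrightarrow> 0) (at t)" by simp
    show "\<forall>\<^sub>F s in at t. (s - t)\<^sup>2 \<noteq> 0" "\<forall>\<^sub>F s in at t. 2 * (s - t) \<noteq> 0"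
      using ne by (eventually_elim; simp)+
    show "\<forall>\<^sub>F s in at t. ((\<lambda>s. f s - f t) has_real_derivative deriv f s) (at s)"
      using ev by eventually_elim (auto intro!: derivative_eq_intros analytic_ioo_DERIV[OF f(1)])
    show "\<forall>\<^sub>F s in at t. ((\<lambda>s. (s - t)\<^sup>2) has_real_derivative 2 * (s - t)) (at s)"
      by (intro always_eventually allI) (auto intro!: derivative_eq_intros)
    have "((\<lambda>s. (deriv f s - deriv f t) / (s - t)) \<longlongrightarrow> deriv (deriv f) t) (at t)"
      by (rule analytic_ioo_first_order[OF analytic_ioo_deriv[OF f(1)] f(2)])
    then have "((\<lambda>s. ((deriv f s - deriv f t) / (s - t)) / 2) \<longlongrightarrow> deriv (deriv f) t / 2) (at t)"
      by (rule tendsto_divide) auto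
    then show "((\<lambda>s. deriv f s / (2 * (s - t))) \<longlongrightarrow> deriv (deriv f) t / 2) (at t)"
      using z by (simp add: mult.commute)
  qed
qed

context regular_semialgebraic_arc
begin

definition vel :: "real \<Rightarrow> real^3" where "vel t = (\<chi> i. deriv (\<lambda>s. g s $ i) t)"
definition acc :: "real \<Rightarrow> real^3" where "acc t = (\<chi> i. deriv (deriv (\<lambda>s. g s $ i)) t)"

lemma has_vel: "t \<in> {0<..<1} \<Longrightarrow> (g has_vector_derivative vel t) (at t)"
  unfolding vel_def by (rule velocity)

lemma has_acc: "t \<in> {0<..<1} \<Longrightarrow> (vel has_vector_derivative acc t) (at t)"
  by (rule has_vector_derivative_vecI)
     (use analytic_ioo_DERIV[OF analytic_ioo_deriv[OF analytic]] in \<open>simp add: vel_def acc_def\<close>)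

lemma vel_nonzero: "t \<in> {0<..<1} \<Longrightarrow> vel t \<noteq> 0"
  using regular[of t] vector_derivative_at[OF has_vel[of t]] by simp

lemma deriv_height: "t \<in> {0<..<1} \<Longrightarrow> deriv (\<lambda>s. u \<bullet> g s) t = u \<bullet> vel t"
  using bounded_linear.has_vector_derivative[OF bounded_linear_inner_right has_vel, of t u]
  by (simp add: has_real_derivative_iff_has_vector_derivative[symmetric] DERIV_imp_deriv)

lemma deriv2_height:
  assumes t: "t \<in> {0<..<1}" shows "deriv (deriv (\<lambda>s. u \<bullet> g s)) t = u \<bullet> acc t"
proof -
  have "((\<lambda>s. u \<bullet> vel s) has_real_derivative u \<bullet> acc t) (at t)"
    using bounded_linear.has_vector_derivative[OF bounded_linear_inner_right has_acc[OF t], of u]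
    by (simp add: has_real_derivative_iff_has_vector_derivative[symmetric])
  moreover have "\<forall>\<^sub>F s in nhds t. s \<in> {0<..<1::real}" by (rule eventually_nhds_in_open) (use t in auto)
  then have "\<forall>\<^sub>F s in nhds t. deriv (\<lambda>s. u \<bullet> g s) s = u \<bullet> vel s" by eventually_elim (rule deriv_height)
  ultimately have "(deriv (\<lambda>s. u \<bullet> g s) has_real_derivative u \<bullet> acc t) (at t)"
    by (subst DERIV_cong_ev[OF refl _ refl])
  then show ?thesis by (rule DERIV_imp_deriv)
qed

lemma isCont_vel: "t \<in> {0<..<1} \<Longrightarrow> isCont vel t"
  using has_acc has_vector_derivative_continuous by blast

lemma isCont_acc: assumes "t \<in> {0<..<1}" shows "isCont acc t"
proof -
  have "isCont (\<lambda>s. acc s $ i) t" for i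
    unfolding acc_def using analytic_ioo_DERIV[OF analytic_ioo_deriv[OF analytic_ioo_deriv[OF analytic]] assms, of i]
    by (auto dest: DERIV_isCont)
  then show ?thesis unfolding isCont_def by (intro vec_tendstoI)
qed

lemma isCont_g: "t \<in> {0<..<1} \<Longrightarrow> isCont g t"
  using has_vel has_vector_derivative_continuous by blast

lemma secant_limit:
  assumes t: "t \<in> {0<..<1}"
  shows "((\<lambda>s. (g s - g t) /\<^sub>R (s - t)) \<longlongrightarrow> vel t) (at t)"
proof (rule vec_tendstoI)
  fix i
  show "((\<lambda>s. ((g s - g t) /\<^sub>R (s - t)) $ i) \<longlongrightarrow> vel t $ i) (at t)"
    using analytic_ioo_first_order[OF analytic t, of i] by (simp add: vel_def divide_inverse mult.commute)
qed

text \<open>The derivative of the squared distance has the sign of the inner product of the secant with the velocity, which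
  tends to \<open>|vel t|\<^sup>2 > 0\<close> after division by \<open>s - t\<close>.\<close>

lemma interior_distance_increasing:
  assumes t: "t \<in> {0<..<1}"
  shows "\<exists>\<delta>>0. t + \<delta> < 1 \<and> (\<forall>r s. 0 \<le> r \<and> r < s \<and> s \<le> \<delta> \<longrightarrow> dist (g t) (g (t + r)) < dist (g t) (g (t + s)))"
proof -
  have "((\<lambda>s. ((g s - g t) /\<^sub>R (s - t)) \<bullet> vel s) \<longlongrightarrow> vel t \<bullet> vel t) (at t)"
    using isCont_vel[OF t] by (intro tendsto_inner secant_limit[OF t]) (simp add: isCont_def)
  moreover have "vel t \<bullet> vel t > 0" using vel_nonzero[OF t] by simp
  ultimately have "\<forall>\<^sub>F s in at t. ((g s - g t) /\<^sub>R (s - t)) \<bullet> vel s > 0" by (rule order_tendstoD(1))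
  then obtain d where d: "d > 0" "\<And>s. s \<noteq> t \<Longrightarrow> dist s t < d \<Longrightarrow> ((g s - g t) /\<^sub>R (s - t)) \<bullet> vel s > 0"
    unfolding eventually_at by auto
  define \<delta> where "\<delta> = min (d/2) ((1 - t)/2)"
  have "\<delta> \<le> d/2" "\<delta> \<le> (1 - t)/2" unfolding \<delta>_def by (rule min.cobounded1, rule min.cobounded2)
  then have \<delta>: "\<delta> > 0" "\<delta> < d" "t + \<delta> < 1" using d(1) t by (auto simp: \<delta>_def field_simps)
  define f where "f = (\<lambda>s. (g s - g t) \<bullet> (g s - g t))"
  have df: "(f has_real_derivative 2 * ((g s - g t) \<bullet> vel s)) (at s)" if "s \<in> {0<..<1}" for s
  proof -
    have "((\<lambda>s. g s - g t) has_vector_derivative vel s - 0) (at s)"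
      by (intro has_vector_derivative_diff has_vel that has_vector_derivative_const)
    then have "((\<lambda>s. g s - g t) has_derivative (\<lambda>x. x *\<^sub>R vel s)) (at s)"
      by (simp add: has_vector_derivative_def)
    from has_derivative_inner[OF this this]
    have "(f has_derivative (*) (2 * ((g s - g t) \<bullet> vel s))) (at s)"
      unfolding f_def by (rule has_derivative_eq_rhs) (auto simp: fun_eq_iff inner_commute)
    then show "(f has_real_derivative 2 * ((g s - g t) \<bullet> vel s)) (at s)"
      unfolding has_field_derivative_def .
  qed
  have "f (t + r) < f (t + s)" if rs: "0 \<le> r" "r < s" "s \<le> \<delta>" for r s
  proof (rule DERIV_pos_imp_increasing_open[where f = f and a = "t + r" and b = "t + s"])
    show "t + r < t + s" using rs by simp
    show "\<exists>y. DERIV f x :> y \<and> y > 0" if x: "t + r < x" "x < t + s" for x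
    proof -
      have xt: "x > t" "dist x t < d" "x \<in> {0<..<1}" using x rs \<delta> t by (auto simp: dist_real_def)
      have "0 < ((g x - g t) /\<^sub>R (x - t)) \<bullet> vel x" using d(2)[of x] xt by simp
      then have "0 < inverse (x - t) * ((g x - g t) \<bullet> vel x)" by simp
      then have "(g x - g t) \<bullet> vel x > 0" using xt(1) by (simp add: zero_less_mult_iff)
      then show ?thesis using df[OF xt(3)] by (intro exI[of _ "2 * ((g x - g t) \<bullet> vel x)"]) simp
    qed
    show "continuous_on {t + r..t + s} f"
      using rs \<delta> t by (intro continuous_at_imp_continuous_on ballI DERIV_isCont[OF df]) auto
  qed
  then have "dist (g t) (g (t + r)) < dist (g t) (g (t + s))" if "0 \<le> r" "r < s" "s \<le> \<delta>" for r s
  proof -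
    have "f s = (dist (g t) (g s))\<^sup>2" for s
      by (simp add: f_def dist_norm power2_norm_eq_inner[symmetric] norm_minus_commute)
    then show ?thesis using \<open>\<And>r s. 0 \<le> r \<Longrightarrow> r < s \<Longrightarrow> s \<le> \<delta> \<Longrightarrow> f (t + r) < f (t + s)\<close>[OF that]
      by (simp add: power2_less_imp_less)
  qed
  then show ?thesis using \<delta> by blast
qed

lemma quotient_limit:
  assumes t: "t \<in> {0<..<1}"
  shows "((\<lambda>s. (norm (g s - g t))\<^sup>2 / (s - t)\<^sup>2) \<longlongrightarrow> (norm (vel t))\<^sup>2) (at t)"
proof -
  have "((\<lambda>s. (norm ((g s - g t) /\<^sub>R (s - t)))\<^sup>2) \<longlongrightarrow> (norm (vel t))\<^sup>2) (at t)"
    by (intro tendsto_power tendsto_norm secant_limit t)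
  then show ?thesis by (simp add: power_mult_distrib power_divide divide_inverse mult.commute power_inverse)
qed

text \<open>The height difference is compared with the squared distance instead of the squared parameter difference. The two
  differ by a factor with positive limit, but the quotient on the right refers to points of the curve only.\<close>

lemma degenerate_iff_quotient:
  assumes t: "t \<in> {0<..<1}"
  shows "(u \<bullet> vel t = 0 \<and> u \<bullet> acc t = 0) \<longleftrightarrow>
     ((\<lambda>s. (u \<bullet> (g s - g t)) / (norm (g s - g t))\<^sup>2) \<longlongrightarrow> 0) (at t)" (is "?L \<longleftrightarrow> (?q \<longlongrightarrow> 0) _")
proof -
  let ?h = "\<lambda>s. u \<bullet> g s"
  note an = analytic_height[of u]
  have ne: "\<forall>\<^sub>F s in at t. s \<noteq> t" by (simp add: eventually_at_filter)
  have ev: "\<forall>\<^sub>F s in at t. s \<in> {0<..<1::real}" by (rule eventually_at_in_open') (use t in auto)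
  have gne: "\<forall>\<^sub>F s in at t. norm (g s - g t) \<noteq> 0"
    using ne ev by eventually_elim (use inj t in \<open>auto dest: inj_onD\<close>)
  have Q: "((\<lambda>s. (norm (g s - g t))\<^sup>2 / (s - t)\<^sup>2) \<longlongrightarrow> (norm (vel t))\<^sup>2) (at t)" by (rule quotient_limit[OF t])
  show ?thesis
  proof
    assume L: ?L
    then have "((\<lambda>s. (?h s - ?h t) / (s - t)\<^sup>2) \<longlongrightarrow> 0) (at t)"
      using analytic_ioo_second_order[OF an t] by (simp add: deriv_height[OF t] deriv2_height[OF t])
    from tendsto_divide[OF this Q] have "((\<lambda>s. ((?h s - ?h t) / (s - t)\<^sup>2) / ((norm (g s - g t))\<^sup>2 / (s - t)\<^sup>2)) \<longlongrightarrow> 0) (at t)"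
      using vel_nonzero[OF t] by simp
    moreover have "\<forall>\<^sub>F s in at t. ((?h s - ?h t) / (s - t)\<^sup>2) / ((norm (g s - g t))\<^sup>2 / (s - t)\<^sup>2) = ?q s"
      using ne by eventually_elim (simp add: inner_diff_right)
    ultimately show "(?q \<longlongrightarrow> 0) (at t)" by (rule Lim_transform_eventually)
  next
    assume "(?q \<longlongrightarrow> 0) (at t)"
    from tendsto_mult[OF this Q] have "((\<lambda>s. ?q s * ((norm (g s - g t))\<^sup>2 / (s - t)\<^sup>2)) \<longlongrightarrow> 0) (at t)" by simp
    moreover have "\<forall>\<^sub>F s in at t. ?q s * ((norm (g s - g t))\<^sup>2 / (s - t)\<^sup>2) = (?h s - ?h t) / (s - t)\<^sup>2"
      using gne by eventually_elim (simp add: inner_diff_right)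
    ultimately have z: "((\<lambda>s. (?h s - ?h t) / (s - t)\<^sup>2) \<longlongrightarrow> 0) (at t)" by (rule Lim_transform_eventually)
    have "((\<lambda>s. (?h s - ?h t) / (s - t)\<^sup>2 * (s - t)) \<longlongrightarrow> 0 * (t - t)) (at t)" by (intro tendsto_mult z tendsto_intros)
    moreover have "\<forall>\<^sub>F s in at t. (?h s - ?h t) / (s - t)\<^sup>2 * (s - t) = (?h s - ?h t) / (s - t)"
      using ne by eventually_elim (simp add: power2_eq_square)
    ultimately have "((\<lambda>s. (?h s - ?h t) / (s - t)) \<longlongrightarrow> 0) (at t)" by (simp add: Lim_transform_eventually)
    then have 1: "u \<bullet> vel t = 0"
      using analytic_ioo_first_order[OF an t] tendsto_unique[OF at_neq_bot] deriv_height[OF t, of u] by metis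
    then have "((\<lambda>s. (?h s - ?h t) / (s - t)\<^sup>2) \<longlongrightarrow> u \<bullet> acc t / 2) (at t)"
      using analytic_ioo_second_order[OF an t] by (simp add: deriv_height[OF t] deriv2_height[OF t])
    from tendsto_unique[OF at_neq_bot this z] have "u \<bullet> acc t = 0" by simp
    with 1 show ?L by simp
  qed
qed

end

text \<open>Two parametrisations differ by a continuous change of parameter. The quotient can be transported along it,
  without any statement about derivatives of the parameter change.\<close>

lemma degenerate_intrinsic:
  assumes g: "edge_param V g e" "edge_param V g' e" and e: "semialgebraic e"
    and t: "t \<in> {0<..<1}" "t' \<in> {0<..<1}" "g t = g' t'"
    and d: "((\<lambda>s. (u \<bullet> (g s - g t)) / (norm (g s - g t))\<^sup>2) \<longlongrightarrow> 0) (at t)"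
  shows "((\<lambda>s. (u \<bullet> (g' s - g' t')) / (norm (g' s - g' t'))\<^sup>2) \<longlongrightarrow> 0) (at t')"
proof -
  interpret g: regular_semialgebraic_arc g by (rule edge_param_arc[OF g(1) e])
  interpret g': regular_semialgebraic_arc g' by (rule edge_param_arc[OF g(2) e])
  have arc: "arc g" and eg: "e = g ` {0<..<1}" "e = g' ` {0<..<1}" using g by (auto simp: edge_param_def)
  obtain k where k: "homeomorphism {0..1} (path_image g) g k" using homeomorphism_arc[OF arc] by blast
  define \<phi> where "\<phi> = (\<lambda>s. k (g' s))"
  have in_pi: "g' s \<in> path_image g" if "s \<in> {0<..<1}" for s
  proof -
    have "g' s \<in> g ` {0<..<1}" using that eg by (metis imageI)
    then show ?thesis unfolding path_image_def by (rule rev_subsetD) (intro image_mono, auto)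
  qed
  have g\<phi>: "g (\<phi> s) = g' s" if "s \<in> {0<..<1}" for s
    using homeomorphism_apply2[OF k in_pi[OF that]] by (simp add: \<phi>_def)
  have \<phi>t: "\<phi> t' = t" using homeomorphism_apply1[OF k, of t] t by (simp add: \<phi>_def)
  have cont: "continuous_on {0<..<1} \<phi>" unfolding \<phi>_def
  proof (rule continuous_on_compose2[OF homeomorphism_cont2[OF k]])
    show "continuous_on {0<..<1} g'" using g'.isCont_g continuous_at_imp_continuous_on by blast
  qed (use in_pi in auto)
  have "isCont \<phi> t'" using cont t(2) by (simp add: continuous_on_eq_continuous_at)
  then have lim: "(\<phi> \<longlongrightarrow> t) (at t')" using \<phi>t by (simp add: isCont_def)
  have ev: "\<forall>\<^sub>F s in at t'. s \<in> {0<..<1::real}" by (rule eventually_at_in_open') (use t in auto)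
  have ne: "\<forall>\<^sub>F s in at t'. s \<noteq> t'" by (simp add: eventually_at_filter)
  have "\<forall>\<^sub>F s in at t'. \<phi> s \<noteq> t"
    using ev ne
  proof eventually_elim
    case (elim s)
    show ?case
    proof
      assume "\<phi> s = t"
      then have "g' s = g' t'" using g\<phi>[OF elim(1)] t(3) by simp
      then show False using g'.inj elim t(2) by (auto dest: inj_onD)
    qed
  qed
  with lim have "filterlim \<phi> (at t) (at t')" by (simp add: filterlim_at)
  from filterlim_compose[OF d this]
  have "((\<lambda>s. (u \<bullet> (g (\<phi> s) - g t)) / (norm (g (\<phi> s) - g t))\<^sup>2) \<longlongrightarrow> 0) (at t')" .
  moreover have "\<forall>\<^sub>F s in at t'. (u \<bullet> (g (\<phi> s) - g t)) / (norm (g (\<phi> s) - g t))\<^sup>2 = (u \<bullet> (g' s - g' t')) / (norm (g' s - g' t'))\<^sup>2"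
    using ev by eventually_elim (simp add: g\<phi> t(3))
  ultimately show ?thesis by (rule Lim_transform_eventually)
qed

section \<open>Stars\<close>

text \<open>The local conical structure of the graph at \<open>p\<close>: near \<open>p\<close> the set is the union of the
  branches \<open>\<beta> b\<close>, which share only \<open>p\<close> and move away from it monotonically. Every
  small sphere around \<open>p\<close> then meets each branch exactly once.\<close>

definition star :: "(real^3) set \<Rightarrow> real^3 \<Rightarrow> 'b set \<Rightarrow> ('b \<Rightarrow> real \<Rightarrow> real^3) \<Rightarrow> real \<Rightarrow> bool" where
  "star \<Gamma> p B \<beta> \<delta> \<longleftrightarrow> finite B \<and> \<delta> > 0 \<and>
     (\<forall>b\<in>B. continuous_on {0..\<delta>} (\<beta> b) \<and> \<beta> b 0 = p \<and> \<beta> b ` {0..\<delta>} \<subseteq> \<Gamma> \<and>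
        (\<forall>s t. 0 \<le> s \<and> s < t \<and> t \<le> \<delta> \<longrightarrow> dist p (\<beta> b s) < dist p (\<beta> b t))) \<and>
     (\<forall>b\<in>B. \<forall>b'\<in>B. b \<noteq> b' \<longrightarrow> \<beta> b ` {0<..\<delta>} \<inter> \<beta> b' ` {0<..\<delta>} = {}) \<and>
     (\<exists>r>0. \<forall>q\<in>\<Gamma>. dist p q < r \<longrightarrow> q = p \<or> (\<exists>b\<in>B. q \<in> \<beta> b ` {0<..\<delta>}))"

lemma starD:
  assumes "star \<Gamma> p B \<beta> \<delta>"
  shows "finite B" "\<delta> > 0" "\<And>b. b \<in> B \<Longrightarrow> continuous_on {0..\<delta>} (\<beta> b)" "\<And>b. b \<in> B \<Longrightarrow> \<beta> b 0 = p"
    "\<And>b. b \<in> B \<Longrightarrow> \<beta> b ` {0..\<delta>} \<subseteq> \<Gamma>"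
    "\<And>b s t. b \<in> B \<Longrightarrow> 0 \<le> s \<Longrightarrow> s < t \<Longrightarrow> t \<le> \<delta> \<Longrightarrow> dist p (\<beta> b s) < dist p (\<beta> b t)"
    "\<And>b b'. b \<in> B \<Longrightarrow> b' \<in> B \<Longrightarrow> b \<noteq> b' \<Longrightarrow> \<beta> b ` {0<..\<delta>} \<inter> \<beta> b' ` {0<..\<delta>} = {}"
    "\<exists>r>0. \<forall>q\<in>\<Gamma>. dist p q < r \<longrightarrow> q = p \<or> (\<exists>b\<in>B. q \<in> \<beta> b ` {0<..\<delta>})"
  using assms unfolding star_def by simp_all

text \<open>Points of a branch beyond \<open>\<delta>'\<close> are farther from \<open>p\<close> than its point at
  \<open>\<delta>'\<close>, so a smaller neighbourhood of \<open>p\<close> avoids them.\<close>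

lemma star_shrink:
  assumes s: "star \<Gamma> p B \<beta> \<delta>" and \<delta>': "0 < \<delta>'" "\<delta>' \<le> \<delta>"
  shows "star \<Gamma> p B \<beta> \<delta>'"
proof -
  note B = starD(1)[OF s] and mono = starD(6)[OF s] and b0 = starD(4)[OF s]
  obtain r where r: "r > 0" "\<And>q. q \<in> \<Gamma> \<Longrightarrow> dist p q < r \<Longrightarrow> q = p \<or> (\<exists>b\<in>B. q \<in> \<beta> b ` {0<..\<delta>})"
    using starD(8)[OF s] by blast
  let ?R = "insert r ((\<lambda>b. dist p (\<beta> b \<delta>')) ` B)"
  have fin: "finite ?R" using B by simp
  have pos: "Min ?R > 0"
  proof -
    have "dist p (\<beta> b \<delta>') > 0" if "b \<in> B" for b using mono[OF that, of 0 \<delta>'] \<delta>' b0[OF that] by simp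
    then show ?thesis using fin r(1) by (subst Min_gr_iff) auto
  qed
  have "q = p \<or> (\<exists>b\<in>B. q \<in> \<beta> b ` {0<..\<delta>'})" if q: "q \<in> \<Gamma>" "dist p q < Min ?R" for q
  proof -
    have "dist p q < r" using q(2) fin by simp
    from r(2)[OF q(1) this] show ?thesis
    proof
      assume "\<exists>b\<in>B. q \<in> \<beta> b ` {0<..\<delta>}"
      then obtain b t where b: "b \<in> B" "t \<in> {0<..\<delta>}" "q = \<beta> b t" by blast
      have "dist p q < dist p (\<beta> b \<delta>')" using q(2) fin b(1) by simp
      then have "\<not> \<delta>' < t" using mono[OF b(1), of \<delta>' t] b \<delta>' by auto
      then have "q \<in> \<beta> b ` {0<..\<delta>'}" using b(2,3) by (intro image_eqI[of _ _ t]) auto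
      then show ?thesis using b(1) by blast
    qed simp
  qed
  then have nb: "\<exists>r>0. \<forall>q\<in>\<Gamma>. dist p q < r \<longrightarrow> q = p \<or> (\<exists>b\<in>B. q \<in> \<beta> b ` {0<..\<delta>'})" using pos by blast
  have sub: "{0..\<delta>'} \<subseteq> {0..\<delta>}" "{0<..\<delta>'} \<subseteq> {0<..\<delta>}" using \<delta>' by auto
  have C: "continuous_on {0..\<delta>'} (\<beta> b) \<and> \<beta> b 0 = p \<and> \<beta> b ` {0..\<delta>'} \<subseteq> \<Gamma> \<and>
        (\<forall>s t. 0 \<le> s \<and> s < t \<and> t \<le> \<delta>' \<longrightarrow> dist p (\<beta> b s) < dist p (\<beta> b t))" if "b \<in> B" for b
  proof (intro conjI allI impI)
    show "continuous_on {0..\<delta>'} (\<beta> b)" using starD(3)[OF s that] sub(1) by (rule continuous_on_subset)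
    show "\<beta> b ` {0..\<delta>'} \<subseteq> \<Gamma>" using starD(5)[OF s that] sub(1) by blast
    show "dist p (\<beta> b r) < dist p (\<beta> b t)" if "0 \<le> r \<and> r < t \<and> t \<le> \<delta>'" for r t
      using mono[OF \<open>b \<in> B\<close>, of r t] that \<delta>' by auto
  qed (rule b0[OF that])
  have dj: "\<beta> b ` {0<..\<delta>'} \<inter> \<beta> b' ` {0<..\<delta>'} = {}" if "b \<in> B" "b' \<in> B" "b \<noteq> b'" for b b'
  proof -
    have "\<beta> b ` {0<..\<delta>} \<inter> \<beta> b' ` {0<..\<delta>} = {}" using starD(7)[OF s] that by blast
    then show ?thesis using image_mono[OF sub(2), of "\<beta> b"] image_mono[OF sub(2), of "\<beta> b'"] by blast
  qed
  show ?thesis unfolding star_def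
    by (intro conjI B \<delta>'(1) nb ballI impI dj C[THEN conjunct1] C[THEN conjunct2, THEN conjunct1]
        C[THEN conjunct2, THEN conjunct2, THEN conjunct1] C[THEN conjunct2, THEN conjunct2, THEN conjunct2])
qed

text \<open>Once each branch lies strictly below or strictly above \<open>p\<close>, a small sphere meets the part of the
  graph below \<open>p\<close> exactly once for every descending branch.\<close>

lemma star_height:
  assumes s: "star \<Gamma> p B \<beta> \<delta>" and "p \<in> \<Gamma>"
    and down: "\<And>b t. b \<in> D \<Longrightarrow> t \<in> {0<..\<delta>} \<Longrightarrow> u \<bullet> \<beta> b t < u \<bullet> p" and DB: "D \<subseteq> B"
    and up: "\<And>b t. b \<in> B - D \<Longrightarrow> t \<in> {0<..\<delta>} \<Longrightarrow> u \<bullet> p < u \<bullet> \<beta> b t"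
  shows star_lower_degree: "lower_degree \<Gamma> p u = card D"
    and star_local_min: "(\<exists>r>0. \<forall>q\<in>\<Gamma>. dist p q < r \<longrightarrow> u \<bullet> p \<le> u \<bullet> q) \<longleftrightarrow> D = {}"
    and star_strict_local_min: "D = {} \<Longrightarrow> \<exists>r>0. \<forall>q\<in>\<Gamma>. dist p q < r \<longrightarrow> q \<noteq> p \<longrightarrow> u \<bullet> p < u \<bullet> q"
proof -
  note \<delta> = starD(2)[OF s] and B = starD(1)[OF s] and mono = starD(6)[OF s] and b0 = starD(4)[OF s] and cont = starD(3)[OF s]
  have in\<Gamma>: "\<beta> b t \<in> \<Gamma>" if "b \<in> B" "t \<in> {0..\<delta>}" for b t using starD(5)[OF s that(1)] that(2) by blast
  have dis: "b = b'" if "b \<in> B" "b' \<in> B" "t \<in> {0<..\<delta>}" "t' \<in> {0<..\<delta>}" "\<beta> b t = \<beta> b' t'" for b b' t t'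
  proof (rule ccontr)
    assume "b \<noteq> b'"
    then have "\<beta> b ` {0<..\<delta>} \<inter> \<beta> b' ` {0<..\<delta>} = {}" using starD(7)[OF s] that by blast
    moreover have "\<beta> b t \<in> \<beta> b ` {0<..\<delta>}" using that(3) by (rule imageI)
    moreover have "\<beta> b t \<in> \<beta> b' ` {0<..\<delta>}" unfolding that(5) using that(4) by (rule imageI)
    ultimately show False by blast
  qed
  obtain r where r: "r > 0" "\<And>q. q \<in> \<Gamma> \<Longrightarrow> dist p q < r \<Longrightarrow> q = p \<or> (\<exists>b\<in>B. q \<in> \<beta> b ` {0<..\<delta>})"
    using starD(8)[OF s] by blast
  let ?R = "insert r ((\<lambda>b. dist p (\<beta> b \<delta>)) ` B)"
  have finR: "finite ?R" using B by simp
  have bpos: "dist p (\<beta> b \<delta>) > 0" if "b \<in> B" for b using mono[OF that, of 0 \<delta>] \<delta> b0[OF that] by simp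
  have pos: "Min ?R > 0" using finR r(1) bpos by (subst Min_gr_iff) auto
  have level: "finite {q\<in>\<Gamma>. dist p q = \<epsilon> \<and> u \<bullet> q < u \<bullet> p} \<and> card {q\<in>\<Gamma>. dist p q = \<epsilon> \<and> u \<bullet> q < u \<bullet> p} = card D"
    if \<epsilon>: "0 < \<epsilon>" "\<epsilon> < Min ?R" for \<epsilon>
  proof -
    have "\<exists>t. t \<in> {0<..\<delta>} \<and> dist p (\<beta> b t) = \<epsilon>" if b: "b \<in> B" for b
    proof -
      have "\<exists>t\<ge>0. t \<le> \<delta> \<and> dist p (\<beta> b t) = \<epsilon>"
      proof (rule IVT')
        show "dist p (\<beta> b 0) \<le> \<epsilon>" using \<epsilon> b0[OF b] by simp
        show "\<epsilon> \<le> dist p (\<beta> b \<delta>)" using \<epsilon>(2) finR b by (simp add: less_imp_le)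
        show "continuous_on {0..\<delta>} (\<lambda>t. dist p (\<beta> b t))" by (intro continuous_intros cont b)
      qed (use \<delta> in simp)
      then obtain t where "t \<ge> 0" "t \<le> \<delta>" "dist p (\<beta> b t) = \<epsilon>" by blast
      moreover have "t \<noteq> 0" using calculation b0[OF b] \<epsilon>(1) by auto
      ultimately show ?thesis by (intro exI[of _ t]) auto
    qed
    then have "\<forall>b\<in>B. \<exists>t. t \<in> {0<..\<delta>} \<and> dist p (\<beta> b t) = \<epsilon>" by blast
    then obtain T where T: "\<forall>b\<in>B. T b \<in> {0<..\<delta>} \<and> dist p (\<beta> b (T b)) = \<epsilon>" by (rule bchoice[THEN exE])
    have uniq: "t = T b" if "b \<in> B" "t \<in> {0<..\<delta>}" "dist p (\<beta> b t) = \<epsilon>" for b t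
      using mono[OF that(1), of t "T b"] mono[OF that(1), of "T b" t] T that
      by (cases t "T b" rule: linorder_cases) auto
    have eq: "{q\<in>\<Gamma>. dist p q = \<epsilon> \<and> u \<bullet> q < u \<bullet> p} = (\<lambda>b. \<beta> b (T b)) ` D"
    proof (intro equalityI subsetI)
      fix q assume "q \<in> {q\<in>\<Gamma>. dist p q = \<epsilon> \<and> u \<bullet> q < u \<bullet> p}"
      then have q: "q \<in> \<Gamma>" "dist p q = \<epsilon>" "u \<bullet> q < u \<bullet> p" by auto
      have "dist p q < r" using q(2) \<epsilon>(2) finR by simp
      then obtain b t where b: "b \<in> B" "t \<in> {0<..\<delta>}" "q = \<beta> b t" using r(2)[OF q(1)] q(2) \<epsilon>(1) by auto
      have "b \<in> D" using up[of b t] b q(3) by force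
      moreover have "t = T b" using uniq b q(2) by blast
      ultimately show "q \<in> (\<lambda>b. \<beta> b (T b)) ` D" using b by blast
    next
      fix q assume "q \<in> (\<lambda>b. \<beta> b (T b)) ` D"
      then obtain b where b: "b \<in> D" "q = \<beta> b (T b)" by blast
      then have "b \<in> B" using DB by blast
      then show "q \<in> {q\<in>\<Gamma>. dist p q = \<epsilon> \<and> u \<bullet> q < u \<bullet> p}"
        using T down[OF b(1), of "T b"] in\<Gamma>[of b "T b"] b(2) by auto
    qed
    have "inj_on (\<lambda>b. \<beta> b (T b)) D"
      using dis T DB by (intro inj_onI) blast
    then show ?thesis unfolding eq using finite_subset[OF DB B] by (simp add: card_image)
  qed
  have ev: "\<forall>\<^sub>F \<epsilon> in at_right 0. finite {q\<in>\<Gamma>. dist p q = \<epsilon> \<and> u \<bullet> q < u \<bullet> p} \<and> card {q\<in>\<Gamma>. dist p q = \<epsilon> \<and> u \<bullet> q < u \<bullet> p} = card D"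
    unfolding eventually_at_right_field using level pos by blast
  show "lower_degree \<Gamma> p u = card D" unfolding lower_degree_def
  proof (rule the_equality)
    fix n assume "\<forall>\<^sub>F \<epsilon> in at_right 0. finite {q\<in>\<Gamma>. dist p q = \<epsilon> \<and> u \<bullet> q < u \<bullet> p} \<and> card {q\<in>\<Gamma>. dist p q = \<epsilon> \<and> u \<bullet> q < u \<bullet> p} = n"
    with ev have "\<forall>\<^sub>F \<epsilon> in at_right (0::real). n = card D" by eventually_elim auto
    then show "n = card D" by simp
  qed (rule ev)
  have strict: "\<exists>r>0. \<forall>q\<in>\<Gamma>. dist p q < r \<longrightarrow> q \<noteq> p \<longrightarrow> u \<bullet> p < u \<bullet> q" if "D = {}"
  proof (intro exI[of _ r] conjI r(1) ballI impI)
    fix q assume "q \<in> \<Gamma>" "dist p q < r" "q \<noteq> p"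
    then obtain b t where "b \<in> B" "t \<in> {0<..\<delta>}" "q = \<beta> b t" using r(2)[of q] by blast
    then show "u \<bullet> p < u \<bullet> q" using up[of b t] that by blast
  qed
  then show "D = {} \<Longrightarrow> \<exists>r>0. \<forall>q\<in>\<Gamma>. dist p q < r \<longrightarrow> q \<noteq> p \<longrightarrow> u \<bullet> p < u \<bullet> q" .
  show "(\<exists>r>0. \<forall>q\<in>\<Gamma>. dist p q < r \<longrightarrow> u \<bullet> p \<le> u \<bullet> q) \<longleftrightarrow> D = {}"
  proof
    assume "D = {}"
    from strict[OF this] obtain r where r: "r > 0" "\<forall>q\<in>\<Gamma>. dist p q < r \<longrightarrow> q \<noteq> p \<longrightarrow> u \<bullet> p < u \<bullet> q" by blast
    have "u \<bullet> p \<le> u \<bullet> q" if "q \<in> \<Gamma>" "dist p q < r" for q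
      using r(2) that by (cases "q = p") (auto intro: less_imp_le)
    then show "\<exists>r>0. \<forall>q\<in>\<Gamma>. dist p q < r \<longrightarrow> u \<bullet> p \<le> u \<bullet> q" using r(1) by blast
  next
    assume "\<exists>r>0. \<forall>q\<in>\<Gamma>. dist p q < r \<longrightarrow> u \<bullet> p \<le> u \<bullet> q"
    then obtain r' where r': "r' > 0" "\<And>q. q \<in> \<Gamma> \<Longrightarrow> dist p q < r' \<Longrightarrow> u \<bullet> p \<le> u \<bullet> q" by blast
    let ?\<epsilon> = "min (Min ?R) r' / 2"
    have \<epsilon>: "0 < ?\<epsilon>" "?\<epsilon> < Min ?R" "?\<epsilon> < r'" using pos r'(1) by auto
    have "\<not> u \<bullet> q < u \<bullet> p" if "q \<in> \<Gamma>" "dist p q = ?\<epsilon>" for q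
      using r'(2)[OF that(1)] that(2) \<epsilon>(3) by linarith
    then have "{q\<in>\<Gamma>. dist p q = ?\<epsilon> \<and> u \<bullet> q < u \<bullet> p} = {}" by blast
    then have "card D = 0" using level[OF \<epsilon>(1,2)] by (simp only: card.empty)
    then show "D = {}" using finite_subset[OF DB B] by simp
  qed
qed

section \<open>The graph near its points\<close>

lemma finite_uniform_positive:
  fixes P :: "'a \<Rightarrow> real \<Rightarrow> bool"
  assumes "finite S" "\<And>x. x \<in> S \<Longrightarrow> \<exists>\<delta>>0. P x \<delta>"
    and mono: "\<And>x \<delta> \<delta>'. x \<in> S \<Longrightarrow> P x \<delta> \<Longrightarrow> 0 < \<delta>' \<Longrightarrow> \<delta>' \<le> \<delta> \<Longrightarrow> P x \<delta>'"
  shows "\<exists>\<delta>>0. \<forall>x\<in>S. P x \<delta>"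
  using assms
proof (induction S rule: finite_induct)
  case empty then show ?case by (intro exI[of _ 1]) simp
next
  case (insert x S)
  obtain d where d: "d > 0" "P x d" using insert.prems(1)[of x] by auto
  have "\<exists>\<delta>>0. \<forall>y\<in>S. P y \<delta>"
  proof (rule insert.IH)
    show "\<exists>\<delta>>0. P y \<delta>" if "y \<in> S" for y by (rule insert.prems(1)) (use that in simp)
    show "P y \<delta>'" if "y \<in> S" "P y \<delta>" "0 < \<delta>'" "\<delta>' \<le> \<delta>" for y \<delta> \<delta>'
      by (rule insert.prems(2)[OF _ that(2-4)]) (use that(1) in simp)
  qed
  then obtain d' where d': "d' > 0" "\<forall>y\<in>S. P y d'" by blast
  have "P y (min d d')" if "y \<in> insert x S" for y
  proof (cases "y = x")
    case True then show ?thesis using insert.prems(2)[of x d "min d d'"] d d' by simp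
  next
    case False then show ?thesis using insert.prems(2)[of y d' "min d d'"] d d' that by simp
  qed
  then show ?case using d d' by (intro exI[of _ "min d d'"]) simp
qed

lemma closed_avoid:
  fixes K :: "'a::metric_space set"
  assumes "closed K" "p \<notin> K" shows "\<exists>r>0. \<forall>q. dist p q < r \<longrightarrow> q \<notin> K"
proof -
  have "open (- K)" "p \<in> - K" using assms by auto
  then obtain r where "r > 0" "ball p r \<subseteq> - K" unfolding open_contains_ball by blast
  then show ?thesis by (intro exI[of _ r]) auto
qed

locale semialg_graph =
  fixes \<Gamma> V :: "(real^3) set" and E :: "(real^3) set set" and \<gamma> :: "(real^3) set \<Rightarrow> real \<Rightarrow> real^3"
  assumes graph: "semialgebraic_graph \<Gamma> V E" and param: "\<And>e. e \<in> E \<Longrightarrow> edge_param V (\<gamma> e) e"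
begin

lemma semialgebraic_edge: "e \<in> E \<Longrightarrow> semialgebraic e"
  using graph by (auto simp: semialgebraic_graph_def open_edge_def)

lemma \<Gamma>_nonempty: "\<Gamma> \<noteq> {}"
proof
  assume "\<Gamma> = {}"
  then have "top_of_set \<Gamma> dim_le -1" by (simp add: dimension_le_eq_empty)
  then have "top_of_set \<Gamma> dim_le 0" by (rule dimension_le_mono) simp
  then show False using graph by (simp add: semialgebraic_graph_def)
qed

sublocale embedded_graph \<Gamma> V E \<gamma>
proof
  show "connected \<Gamma>" "finite V" "V \<subseteq> \<Gamma>" "finite E" "disjoint E" "\<Union>E = \<Gamma> - V"
    using graph by (auto simp: semialgebraic_graph_def)
  show "arc (\<gamma> e)" "pathstart (\<gamma> e) \<in> V" "pathfinish (\<gamma> e) \<in> V" "e = \<gamma> e ` {0<..<1}" if "e \<in> E" for e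
    using param[OF that] by (simp_all add: edge_param_def)
qed (rule \<Gamma>_nonempty)

text \<open>Each edge has two ends. The flag selects one of them: \<open>half (e, b)\<close> runs along the edge starting
  from that end, so that statements about starting points cover both ends.\<close>

definition half :: "(real^3) set \<times> bool \<Rightarrow> real \<Rightarrow> real^3" where
  "half x = (if snd x then reversepath (\<gamma> (fst x)) else \<gamma> (fst x))"

lemma half_param: "fst x \<in> E \<Longrightarrow> edge_param V (half x) (fst x)"
  using param[of "fst x"] edge_param_reversepath[OF param semialgebraic_edge, of "fst x"] by (simp add: half_def)

lemma half_arc: "fst x \<in> E \<Longrightarrow> regular_semialgebraic_arc (half x)"
  by (rule edge_param_arc[OF half_param semialgebraic_edge])

lemma half_edge: "fst x \<in> E \<Longrightarrow> half x ` {0<..<1} = fst x"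
  using half_param[of x] by (simp add: edge_param_def)

lemma half_in_edge: "fst x \<in> E \<Longrightarrow> t \<in> {0<..<1} \<Longrightarrow> half x t \<in> fst x"
  using half_edge by blast

lemma half_0_V: "fst x \<in> E \<Longrightarrow> half x 0 \<in> V"
  using half_param[of x] by (simp add: edge_param_def pathstart_def)

lemma edge_sub: "e \<in> E \<Longrightarrow> e \<subseteq> \<Gamma> - V"
  using Union_E by blast

lemma half_continuous: "fst x \<in> E \<Longrightarrow> continuous_on {0..1} (half x)"
  using half_param[of x] by (simp add: edge_param_def arc_def path_def)

lemma half_inj: "fst x \<in> E \<Longrightarrow> inj_on (half x) {0..1}"
  using half_param[of x] by (simp add: edge_param_def arc_def)

lemma half_tendsto_0:
  assumes "fst x \<in> E" shows "(half x \<longlongrightarrow> half x 0) (at_right 0)"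
proof -
  have "(half x \<longlongrightarrow> half x 0) (at 0 within {0..1})"
    using half_continuous[OF assms] by (auto simp: continuous_on_def)
  then show ?thesis by (simp add: at_within_Icc_at_right)
qed

definition direction :: "(real^3) set \<times> bool \<Rightarrow> real^3" where
  "direction x = (SOME \<tau>. norm \<tau> = 1 \<and> ((\<lambda>t. (half x t - half x 0) /\<^sub>R norm (half x t - half x 0)) \<longlongrightarrow> \<tau>) (at_right 0))"

lemma direction:
  assumes "fst x \<in> E"
  shows "norm (direction x) = 1" "((\<lambda>t. (half x t - half x 0) /\<^sub>R norm (half x t - half x 0)) \<longlongrightarrow> direction x) (at_right 0)"
proof -
  interpret regular_semialgebraic_arc "half x" by (rule half_arc[OF assms])
  have "half x 0 \<notin> half x ` {0<..<1}" using half_0_V[OF assms] edge_sub[OF assms] half_edge[OF assms] by blast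
  from start_direction[OF half_tendsto_0[OF assms] this]
  have "norm (direction x) = 1 \<and> ((\<lambda>t. (half x t - half x 0) /\<^sub>R norm (half x t - half x 0)) \<longlongrightarrow> direction x) (at_right 0)"
    unfolding direction_def by (rule someI_ex)
  then show "norm (direction x) = 1" "((\<lambda>t. (half x t - half x 0) /\<^sub>R norm (half x t - half x 0)) \<longlongrightarrow> direction x) (at_right 0)"
    by auto
qed

definition halves :: "real^3 \<Rightarrow> ((real^3) set \<times> bool) set" where
  "halves v = {x. fst x \<in> E \<and> half x 0 = v}"

lemma finite_halves: "finite (halves v)"
proof (rule finite_subset)
  show "halves v \<subseteq> E \<times> UNIV" by (auto simp: halves_def)
  show "finite (E \<times> (UNIV::bool set))" using finite_E by simp
qed

text \<open>The branches at a vertex are the half edges starting there. What is left of the graph, namely the other vertices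
  and the edges with short pieces at \<open>v\<close> removed, is closed and omits \<open>v\<close>.\<close>

lemma vertex_star:
  assumes v: "v \<in> V"
  shows "\<exists>\<delta>>0. \<delta> < 1/2 \<and> star \<Gamma> v (halves v) half \<delta>"
proof -
  have "\<exists>\<delta>>0. \<delta> < 1/2 \<and> (\<forall>s t. 0 < s \<and> s < t \<and> t < \<delta> \<longrightarrow> dist v (half x s) < dist v (half x t))" if "x \<in> halves v" for x
  proof -
    have x: "fst x \<in> E" "half x 0 = v" using that by (auto simp: halves_def)
    interpret regular_semialgebraic_arc "half x" by (rule half_arc[OF x(1)])
    have "half x 0 \<notin> half x ` {0<..<1}" using half_0_V[OF x(1)] edge_sub[OF x(1)] half_edge[OF x(1)] by blast
    from start_distance_increasing[OF half_tendsto_0[OF x(1)] this] obtain \<delta> where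
      \<delta>: "\<delta> > 0" "\<forall>s t. 0 < s \<and> s < t \<and> t < \<delta> \<longrightarrow> dist v (half x s) < dist v (half x t)" unfolding x(2) by blast
    then show ?thesis by (intro exI[of _ "min \<delta> (1/3)"]) auto
  qed
  then have "\<exists>\<delta>>0. \<forall>x\<in>halves v. \<delta> < 1/2 \<and> (\<forall>s t. 0 < s \<and> s < t \<and> t < \<delta> \<longrightarrow> dist v (half x s) < dist v (half x t))"
    by (rule finite_uniform_positive[OF finite_halves]) auto
  then obtain \<delta>0 where \<delta>0: "\<delta>0 > 0"
    "\<forall>x\<in>halves v. (\<forall>s t. 0 < s \<and> s < t \<and> t < \<delta>0 \<longrightarrow> dist v (half x s) < dist v (half x t))" by blast
  \<comment> \<open>Being less than \<open>1/2\<close>, the two ends of one edge do not overlap.\<close>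
  define \<delta> where "\<delta> = min (\<delta>0/2) (1/3)"
  have "\<delta> \<le> \<delta>0/2" "\<delta> \<le> 1/3" "\<delta> > 0" using \<delta>0(1) unfolding \<delta>_def by (auto simp: min_def)
  then have \<delta>: "\<delta> > 0" "\<delta> < 1/2" "\<delta> < \<delta>0" using \<delta>0(1) by linarith+
  define a where "a e = (if \<gamma> e 0 = v then \<delta> else 0)" for e
  define b where "b e = (if \<gamma> e 1 = v then 1 - \<delta> else 1)" for e
  define K where "K = (V - {v}) \<union> (\<Union>e\<in>E. \<gamma> e ` {a e..b e})"
  have ab: "0 \<le> a e" "b e \<le> 1" for e using \<delta> by (auto simp: a_def b_def)
  have cont\<gamma>: "continuous_on {0..1} (\<gamma> e)" and inj\<gamma>: "inj_on (\<gamma> e) {0..1}" if "e \<in> E" for e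
    using arc[OF that] by (auto simp: arc_def path_def)
  have "closed (\<gamma> e ` {a e..b e})" if "e \<in> E" for e
    using ab[of e] by (intro compact_imp_closed compact_continuous_image continuous_on_subset[OF cont\<gamma>[OF that]]) auto
  then have "closed (\<Union>e\<in>E. \<gamma> e ` {a e..b e})" using finite_E by (intro closed_UN) auto
  moreover have "closed (V - {v})" using finite_V by (intro finite_imp_closed) auto
  ultimately have clK: "closed K" unfolding K_def by (rule closed_Un[rotated])
  have "v \<notin> K"
  proof
    assume "v \<in> K"
    then obtain e t where e: "e \<in> E" "t \<in> {a e..b e}" "v = \<gamma> e t" unfolding K_def by blast
    have t: "t \<in> {0..1}" using e(2) ab[of e] by auto
    have "t \<notin> {0<..<1}" using edge[OF e(1)] edge_V[OF e(1)] v e(3) by blast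
    then consider "t = 0" | "t = 1" using t by fastforce
    then show False
      using e \<delta> by cases (auto simp: a_def b_def)
  qed
  from closed_avoid[OF clK this] obtain r where r: "r > 0" "\<And>q. dist v q < r \<Longrightarrow> q \<notin> K" by blast
  have "star \<Gamma> v (halves v) half \<delta>"
    unfolding star_def
  proof (intro conjI ballI allI impI)
    show "finite (halves v)" by (rule finite_halves)
    show "\<delta> > 0" by fact
    fix x assume "x \<in> halves v"
    then have x: "fst x \<in> E" "half x 0 = v" by (auto simp: halves_def)
    show "continuous_on {0..\<delta>} (half x)" using half_continuous[OF x(1)] by (rule continuous_on_subset) (use \<delta> in auto)
    show "half x 0 = v" by fact
    show "half x ` {0..\<delta>} \<subseteq> \<Gamma>"
    proof
      fix q assume "q \<in> half x ` {0..\<delta>}"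
      then obtain t where t: "t \<in> {0..\<delta>}" "q = half x t" by blast
      show "q \<in> \<Gamma>"
      proof (cases "t = 0")
        case True then show ?thesis using t x v V_sub by auto
      next
        case False
        then have "q \<in> fst x" using t \<delta> half_in_edge[OF x(1), of t] by auto
        then show ?thesis using edge_sub[OF x(1)] by blast
      qed
    qed
    show "dist v (half x s) < dist v (half x t)" if "0 \<le> s \<and> s < t \<and> t \<le> \<delta>" for s t
    proof (cases "s = 0")
      case True
      have "half x t \<in> fst x" using that \<delta> half_in_edge[OF x(1), of t] by auto
      then have "half x t \<noteq> v" using edge_sub[OF x(1)] v by blast
      then show ?thesis using True x by simp
    next
      case False
      then show ?thesis using \<delta>0(2) \<open>x \<in> halves v\<close> that \<delta> by auto
    qed
  next
    fix x y assume "x \<in> halves v" "y \<in> halves v" "x \<noteq> y"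
    then have x: "fst x \<in> E" and y: "fst y \<in> E" by (auto simp: halves_def)
    have sub: "{0<..\<delta>} \<subseteq> {0<..<1}" using \<delta> by auto
    show "half x ` {0<..\<delta>} \<inter> half y ` {0<..\<delta>} = {}"
    proof (cases "fst x = fst y")
      case False
      then have "fst x \<inter> fst y = {}" using edge_disjoint x y by blast
      moreover have "half x ` {0<..\<delta>} \<subseteq> fst x" by (rule order_trans[OF image_mono[OF sub] eq_refl[OF half_edge[OF x]]])
      moreover have "half y ` {0<..\<delta>} \<subseteq> fst y" by (rule order_trans[OF image_mono[OF sub] eq_refl[OF half_edge[OF y]]])
      ultimately show ?thesis by blast
    next
      case True
      then have s: "snd x \<noteq> snd y" using \<open>x \<noteq> y\<close> by (simp add: prod_eq_iff)
      have "half x s \<noteq> half y t" if "s \<in> {0<..\<delta>}" "t \<in> {0<..\<delta>}" for s t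
      proof
        assume eq: "half x s = half y t"
        let ?e = "fst x"
        have "half y t = half x (1 - t)" using s True by (cases "snd x") (auto simp: half_def reversepath_def)
        then have "half x s = half x (1 - t)" using eq by simp
        moreover have "s \<in> {0..1}" "1 - t \<in> {0..1}" using that \<delta> by auto
        ultimately have "s = 1 - t" using half_inj[OF x] by (auto dest: inj_onD)
        then show False using that \<delta> by auto
      qed
      then show ?thesis by blast
    qed
  next
    show "\<exists>r>0. \<forall>q\<in>\<Gamma>. dist v q < r \<longrightarrow> q = v \<or> (\<exists>x\<in>halves v. q \<in> half x ` {0<..\<delta>})"
    proof (intro exI[of _ r] conjI r(1) ballI impI)
      fix q assume q: "q \<in> \<Gamma>" "dist v q < r"
      have qK: "q \<notin> K" by (rule r(2)[OF q(2)])
      show "q = v \<or> (\<exists>x\<in>halves v. q \<in> half x ` {0<..\<delta>})"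
      proof (cases "q \<in> V")
        case True then show ?thesis using qK by (auto simp: K_def)
      next
        case False
        then obtain e where e: "e \<in> E" "q \<in> e" using q(1) Union_E by blast
        then obtain t where t: "t \<in> {0<..<1}" "q = \<gamma> e t" using edge[OF e(1)] by blast
        then have "t \<notin> {a e..b e}" using qK e(1) by (auto simp: K_def)
        then have "t < a e \<or> t > b e" by auto
        then show ?thesis
        proof
          assume "t < a e"
          then have *: "\<gamma> e 0 = v" "t < \<delta>" using t by (auto simp: a_def split: if_splits)
          then have "(e, False) \<in> halves v" "q \<in> half (e, False) ` {0<..\<delta>}"
            using e t by (auto simp: halves_def half_def)
          then show ?thesis by blast
        next
          assume "t > b e"
          then have *: "\<gamma> e 1 = v" "1 - t < \<delta>" using t by (auto simp: b_def split: if_splits)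
          then have "(e, True) \<in> halves v" using e by (auto simp: halves_def half_def reversepath_def)
          moreover have "q = half (e, True) (1 - t)" using t by (simp add: half_def reversepath_def)
          moreover have "1 - t \<in> {0<..\<delta>}" using * t by auto
          ultimately show ?thesis by blast
        qed
      qed
    qed
  qed
  then show ?thesis using \<delta> by blast
qed

text \<open>The two directions in which an edge leaves its point \<open>\<gamma> e t\<close>, with the flag as in
  \<open>half\<close>.\<close>

definition branch :: "real \<Rightarrow> (real^3) set \<times> bool \<Rightarrow> real \<Rightarrow> real^3" where
  "branch t x s = half x ((if snd x then 1 - t else t) + s)"

lemma branch_eq: "branch t (e, False) s = \<gamma> e (t + s)" "branch t (e, True) s = \<gamma> e (t - s)"
  by (simp_all add: branch_def half_def reversepath_def algebra_simps)

text \<open>As at a vertex: the rest of the graph is a closed set omitting the point.\<close>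

lemma interior_star:
  assumes e: "e \<in> E" and t: "t \<in> {0<..<1}"
  shows "\<exists>\<delta>>0. \<delta> < t \<and> \<delta> < 1 - t \<and> star \<Gamma> (\<gamma> e t) {(e, False), (e, True)} (branch t) \<delta>"
proof -
  let ?p = "\<gamma> e t"
  have dd: "\<exists>\<delta>>0. \<forall>r s. 0 \<le> r \<and> r < s \<and> s \<le> \<delta> \<longrightarrow> dist ?p (branch t x r) < dist ?p (branch t x s)"
    if x: "x \<in> {(e, False), (e, True)}" for x
  proof -
    have fx: "fst x \<in> E" using x e by auto
    interpret regular_semialgebraic_arc "half x" by (rule half_arc[OF fx])
    have t': "(if snd x then 1 - t else t) \<in> {0<..<1}" using t by auto
    have p: "half x (if snd x then 1 - t else t) = ?p" using x by (auto simp: half_def reversepath_def)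
    from interior_distance_increasing[OF t'] show ?thesis unfolding p branch_def by blast
  qed
  have "\<exists>\<delta>>0. \<forall>x\<in>{(e, False), (e, True)}. \<forall>r s. 0 \<le> r \<and> r < s \<and> s \<le> \<delta> \<longrightarrow> dist ?p (branch t x r) < dist ?p (branch t x s)"
    by (rule finite_uniform_positive[OF _ dd]) auto
  then obtain \<delta>0 where \<delta>0: "\<delta>0 > 0"
    "\<forall>x\<in>{(e, False), (e, True)}. \<forall>r s. 0 \<le> r \<and> r < s \<and> s \<le> \<delta>0 \<longrightarrow> dist ?p (branch t x r) < dist ?p (branch t x s)" by blast
  define \<delta> where "\<delta> = min \<delta>0 (min (t/2) ((1 - t)/2))"
  have "\<delta> \<le> \<delta>0" "\<delta> \<le> t/2" "\<delta> \<le> (1 - t)/2" "\<delta> > 0" using \<delta>0(1) t unfolding \<delta>_def by (auto simp: min_def)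
  then have \<delta>: "\<delta> > 0" "\<delta> \<le> \<delta>0" "\<delta> < t" "\<delta> < 1 - t" using t by auto
  have cont\<gamma>: "continuous_on {0..1} (\<gamma> e)" and inj\<gamma>: "inj_on (\<gamma> e) {0..1}"
    using arc[OF e] by (auto simp: arc_def path_def)
  define K where "K = V \<union> (\<Union>e'\<in>E - {e}. path_image (\<gamma> e')) \<union> (\<gamma> e ` {0..t - \<delta>} \<union> \<gamma> e ` {t + \<delta>..1})"
  have "closed (\<gamma> e ` {0..t - \<delta>})" "closed (\<gamma> e ` {t + \<delta>..1})"
    using \<delta> t by (intro compact_imp_closed compact_continuous_image continuous_on_subset[OF cont\<gamma>]; auto)+
  moreover have "closed (\<Union>e'\<in>E - {e}. path_image (\<gamma> e'))"
    using finite_E arc by (intro closed_UN closed_path_image arc_imp_path ballI) auto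
  moreover have "closed V" by (rule finite_imp_closed[OF finite_V])
  ultimately have clK: "closed K" unfolding K_def by (intro closed_Un)
  have pe: "?p \<in> e" using edge[OF e] t by blast
  have "?p \<notin> K"
  proof
    assume "?p \<in> K"
    moreover have "?p \<notin> V" using edge_V[OF e] pe by blast
    moreover have "?p \<notin> path_image (\<gamma> e')" if "e' \<in> E - {e}" for e'
    proof -
      have "e' \<in> E" "e' \<noteq> e" using that by auto
      then show ?thesis using path_image_edge[of e'] edge_disjoint[OF e, of e'] pe start finish \<open>?p \<notin> V\<close> by auto
    qed
    ultimately obtain s where s: "s \<in> {0..t - \<delta>} \<union> {t + \<delta>..1}" "?p = \<gamma> e s" unfolding K_def by blast
    then have "t = s" using inj_onD[OF inj\<gamma> s(2)] t \<delta> by auto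
    then show False using s(1) \<delta> by auto
  qed
  from closed_avoid[OF clK this] obtain r where r: "r > 0" "\<And>q. dist ?p q < r \<Longrightarrow> q \<notin> K" by blast
  have br_in: "branch t x s \<in> e" if "x \<in> {(e, False), (e, True)}" "s \<in> {0..\<delta>}" for x s
  proof -
    have "t + s \<in> {0<..<1}" "t - s \<in> {0<..<1}" using that \<delta> t by auto
    then have "\<gamma> e (t + s) \<in> \<gamma> e ` {0<..<1}" "\<gamma> e (t - s) \<in> \<gamma> e ` {0<..<1}" by blast+
    then show ?thesis using that(1) edge[OF e] by (auto simp: branch_eq)
  qed
  have "star \<Gamma> ?p {(e, False), (e, True)} (branch t) \<delta>"
    unfolding star_def
  proof (intro conjI ballI allI impI)
    show "finite {(e, False), (e, True)}" by simp
    show "\<delta> > 0" by fact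
    fix x assume x: "x \<in> {(e, False), (e, True)}"
    have "continuous_on {0..\<delta>} (\<lambda>s. \<gamma> e (t + s))" "continuous_on {0..\<delta>} (\<lambda>s. \<gamma> e (t - s))"
      using \<delta> t by (intro continuous_on_compose2[OF cont\<gamma>] continuous_intros; auto)+
    then show "continuous_on {0..\<delta>} (branch t x)" using x by (auto simp: branch_eq[abs_def])
    show "branch t x 0 = ?p" using x by (auto simp: branch_eq)
    show "branch t x ` {0..\<delta>} \<subseteq> \<Gamma>" using br_in[OF x] edge_sub[OF e] by blast
    show "dist ?p (branch t x r) < dist ?p (branch t x s)" if "0 \<le> r \<and> r < s \<and> s \<le> \<delta>" for r s
      using \<delta>0(2) x that \<delta>(2) by auto
  next
    fix x y assume x: "x \<in> {(e, False), (e, True)}" and y: "y \<in> {(e, False), (e, True)}" and "x \<noteq> y"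
    have "\<gamma> e (t + r) \<noteq> \<gamma> e (t - s)" if "r \<in> {0<..\<delta>}" "s \<in> {0<..\<delta>}" for r s
    proof
      assume "\<gamma> e (t + r) = \<gamma> e (t - s)"
      then have "t + r = t - s" by (rule inj_onD[OF inj\<gamma>]) (use that \<delta> t in auto)
      then show False using that by auto
    qed
    then have "(\<lambda>s. \<gamma> e (t + s)) ` {0<..\<delta>} \<inter> (\<lambda>s. \<gamma> e (t - s)) ` {0<..\<delta>} = {}" by blast
    then have *: "branch t (e, False) ` {0<..\<delta>} \<inter> branch t (e, True) ` {0<..\<delta>} = {}" by (simp only: branch_eq[abs_def])
    then show "branch t x ` {0<..\<delta>} \<inter> branch t y ` {0<..\<delta>} = {}"
      using x y \<open>x \<noteq> y\<close> by auto
  next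
    show "\<exists>r>0. \<forall>q\<in>\<Gamma>. dist ?p q < r \<longrightarrow> q = ?p \<or> (\<exists>x\<in>{(e, False), (e, True)}. q \<in> branch t x ` {0<..\<delta>})"
    proof (intro exI[of _ r] conjI r(1) ballI impI)
      fix q assume q: "q \<in> \<Gamma>" "dist ?p q < r"
      have qK: "q \<notin> K" by (rule r(2)[OF q(2)])
      then have "q \<notin> V" by (auto simp: K_def)
      then obtain e' where e': "e' \<in> E" "q \<in> e'" using q(1) Union_E by blast
      have "e' = e"
      proof (rule ccontr)
        assume "e' \<noteq> e"
        then have "path_image (\<gamma> e') \<subseteq> K" using e'(1) by (auto simp: K_def)
        then show False using qK path_image_edge[OF e'(1)] e'(2) by blast
      qed
      then obtain s where s: "s \<in> {0<..<1}" "q = \<gamma> e s" using edge[OF e] e'(2) by blast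
      have "\<gamma> e ` {0..t - \<delta>} \<subseteq> K" "\<gamma> e ` {t + \<delta>..1} \<subseteq> K" by (auto simp: K_def)
      then have "s \<notin> {0..t - \<delta>}" "s \<notin> {t + \<delta>..1}" using qK s(2) by blast+
      then have st: "t - \<delta> < s" "s < t + \<delta>" using s by auto
      consider "s = t" | "s > t" | "s < t" by linarith
      then show "q = ?p \<or> (\<exists>x\<in>{(e, False), (e, True)}. q \<in> branch t x ` {0<..\<delta>})"
      proof cases
        case 1 then show ?thesis using s by simp
      next
        case 2
        then have "q = branch t (e, False) (s - t)" "s - t \<in> {0<..\<delta>}" using st s by (auto simp: branch_eq)
        then show ?thesis by blast
      next
        case 3
        then have "q = branch t (e, True) (t - s)" "t - s \<in> {0<..\<delta>}" using st s by (auto simp: branch_eq)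
        then show ?thesis by blast
      qed
    qed
  qed
  then show ?thesis using \<delta> by blast
qed

end

section \<open>Sign changes\<close>

lemma sgn_constant_no_zero:
  fixes k :: "real \<Rightarrow> real"
  assumes "x \<le> y" "continuous_on {x..y} k" "\<And>z. x \<le> z \<Longrightarrow> z \<le> y \<Longrightarrow> k z \<noteq> 0"
  shows "sgn (k x) = sgn (k y)"
proof (rule ccontr)
  assume ne: "sgn (k x) \<noteq> sgn (k y)"
  have "k x \<noteq> 0" "k y \<noteq> 0" using assms by auto
  then consider "k x < 0" "k y > 0" | "k x > 0" "k y < 0" using ne by (auto simp: sgn_if split: if_splits)
  then show False
  proof cases
    case 1
    then obtain z where "x \<le> z" "z \<le> y" "k z = 0" using IVT'[of k x 0 y] assms by auto
    then show False using assms(3) by blast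
  next
    case 2
    then obtain z where "x \<le> z" "z \<le> y" "k z = 0" using IVT2'[of k y 0 x] assms by auto
    then show False using assms(3) by blast
  qed
qed

lemma sgn_quotient: "a / b * c > 0 \<Longrightarrow> sgn a = sgn c * sgn (b::real)"
  by (auto simp: sgn_if zero_less_mult_iff zero_less_divide_iff divide_less_0_iff mult_less_0_iff)

text \<open>At a zero with derivative \<open>l z\<close> the sign of the function jumps by \<open>2 * sgn (l z)\<close>, and
  between zeros it is constant. The induction removes the last zero.\<close>

lemma sgn_jump_sum:
  fixes k l :: "real \<Rightarrow> real"
  assumes "x < y" "continuous_on {x..y} k" "k x \<noteq> 0" "k y \<noteq> 0"
    and fin: "finite {z\<in>{x<..<y}. k z = 0}"
    and d: "\<And>z. x < z \<Longrightarrow> z < y \<Longrightarrow> k z = 0 \<Longrightarrow> (k has_real_derivative l z) (at z) \<and> l z \<noteq> 0"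
  shows "sgn (k y) - sgn (k x) = 2 * (\<Sum>z\<in>{z\<in>{x<..<y}. k z = 0}. sgn (l z))"
  using assms
proof (induction "card {z\<in>{x<..<y}. k z = 0}" arbitrary: y rule: less_induct)
  case less
  let ?Z = "{z\<in>{x<..<y}. k z = 0}"
  show ?case
  proof (cases "?Z = {}")
    case True
    have "sgn (k x) = sgn (k y)"
    proof (rule sgn_constant_no_zero[where k = k and x = x and y = y])
      show "k z \<noteq> 0" if "x \<le> z" "z \<le> y" for z
        using that True less.prems(3,4) by (cases "z = x \<or> z = y") auto
    qed (use less.prems in auto)
    then show ?thesis by (simp only: True sum.empty)
  next
    case False
    define c where "c = Max ?Z"
    have cZ: "c \<in> ?Z" unfolding c_def by (rule Max_in[OF less.prems(5) False])
    have cmax: "z \<le> c" if "z \<in> ?Z" for z unfolding c_def using Max_ge[OF less.prems(5) that] .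
    define m where "m = Max (insert x (?Z - {c}))"
    have finm: "finite (insert x (?Z - {c}))" using less.prems(5) by simp
    have mS: "m \<in> insert x (?Z - {c})" unfolding m_def by (rule Max_in[OF finm]) simp
    have mmax: "z \<le> m" if "z \<in> insert x (?Z - {c})" for z unfolding m_def using Max_ge[OF finm that] .
    have mc: "m < c"
    proof (cases "m = x")
      case False
      then have "m \<in> ?Z" "m \<noteq> c" using mS by auto
      then show ?thesis using cmax[of m] by simp
    qed (use cZ in simp)
    have xm: "x \<le> m" using mmax by simp
    have cy: "c < y" "k c = 0" "x < c" using cZ by auto
    have nz1: "k z \<noteq> 0" if "m < z" "z < c" for z
      using mmax[of z] that xm cy by auto
    have nz2: "k z \<noteq> 0" if "c < z" "z \<le> y" for z
      using cmax[of z] that less.prems(4) cy by (cases "z = y") auto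
    define \<epsilon> where "\<epsilon> = min (c - m) (y - c)"
    have "\<epsilon> > 0" using mc cy by (simp add: \<epsilon>_def)
    obtain h where h: "h > 0" "h < \<epsilon>" "sgn (k (c + h)) = sgn (l c)" "sgn (k (c - h)) = - sgn (l c)"
      using simple_zero_signs[of k "l c" c \<epsilon>] less.prems(6)[of c] cy \<open>\<epsilon> > 0\<close> by blast
    have hm: "m < c - h" "c + h < y" using h(2) by (auto simp: \<epsilon>_def)
    have R: "sgn (k (c + h)) = sgn (k y)"
    proof (rule sgn_constant_no_zero[where k = k and x = "c + h" and y = y])
      show "continuous_on {c + h..y} k" using less.prems(2) by (rule continuous_on_subset) (use h cy in auto)
      show "k z \<noteq> 0" if "c + h \<le> z" "z \<le> y" for z using nz2[of z] that h(1) by auto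
    qed (use hm in simp)
    have Zeq: "{z\<in>{x<..<c - h}. k z = 0} = ?Z - {c}"
    proof (intro equalityI subsetI)
      fix z assume "z \<in> ?Z - {c}"
      then show "z \<in> {z\<in>{x<..<c - h}. k z = 0}" using mmax[of z] hm by auto
    qed (use h cy in auto)
    have L: "sgn (k (c - h)) - sgn (k x) = 2 * (\<Sum>z\<in>{z\<in>{x<..<c - h}. k z = 0}. sgn (l z))"
    proof (rule less.hyps)
      show "card {z\<in>{x<..<c - h}. k z = 0} < card ?Z"
        unfolding Zeq using cZ less.prems(5) by (rule card_Diff1_less[rotated])
      show "x < c - h" using hm xm by simp
      show "continuous_on {x..c - h} k" using less.prems(2) by (rule continuous_on_subset) (use h cy in auto)
      show "k x \<noteq> 0" by fact
      show "k (c - h) \<noteq> 0" using nz1[of "c - h"] hm h(1) by simp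
      show "finite {z\<in>{x<..<c - h}. k z = 0}" unfolding Zeq using less.prems(5) by simp
      show "(k has_real_derivative l z) (at z) \<and> l z \<noteq> 0" if "x < z" "z < c - h" "k z = 0" for z
        using less.prems(6)[of z] that h(1) cy by simp
    qed
    have "(\<Sum>z\<in>?Z. sgn (l z)) = sgn (l c) + (\<Sum>z\<in>?Z - {c}. sgn (l z))"
      by (rule sum.remove[OF less.prems(5) cZ])
    then show ?thesis using L R h(3,4) unfolding Zeq by simp
  qed
qed

section \<open>Weights\<close>

context semialg_graph
begin

abbreviation "vel e \<equiv> regular_semialgebraic_arc.vel (\<gamma> e)"
abbreviation "acc e \<equiv> regular_semialgebraic_arc.acc (\<gamma> e)"

lemma \<gamma>_arc: "e \<in> E \<Longrightarrow> regular_semialgebraic_arc (\<gamma> e)"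
  using half_arc[of "(e, False)"] by (simp add: half_def)

text \<open>Nondegeneracy in terms of the fixed parametrisations \<open>\<gamma>\<close> and of the finitely many directions
  of the half edges.\<close>

definition good :: "real^3 \<Rightarrow> bool" where
  "good u \<longleftrightarrow> u \<in> sphere 0 1 \<and> (\<forall>e\<in>E. \<forall>t\<in>{0<..<1}. u \<bullet> vel e t = 0 \<longrightarrow> u \<bullet> acc e t \<noteq> 0) \<and>
     (\<forall>x. fst x \<in> E \<longrightarrow> u \<bullet> direction x \<noteq> 0)"

lemma direction_tangent:
  assumes x: "fst x \<in> E" shows "direction x \<in> tangent_directions \<Gamma> (half x 0)"
proof -
  define s where "s = (\<lambda>k::nat. inverse (real (Suc (Suc k))))"
  have s01: "s k \<in> {0<..<1}" for k by (simp add: s_def inverse_less_1_iff)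
  have L: "s \<longlonglongrightarrow> 0" unfolding s_def using LIMSEQ_inverse_real_of_nat LIMSEQ_Suc by blast
  have "s k \<in> {0<..} \<and> s k \<noteq> 0" for k using s01[of k] by auto
  then have "\<forall>\<^sub>F k in sequentially. s k \<in> {0<..} \<and> s k \<noteq> 0" by (intro always_eventually allI)
  with L have fl: "filterlim s (at_right 0) sequentially" unfolding filterlim_at by blast
  let ?q = "\<lambda>k. half x (s k)"
  have "?q k \<in> \<Gamma> - {half x 0}" for k
    using half_in_edge[OF x s01[of k]] edge_sub[OF x] half_0_V[OF x] by auto
  moreover have "?q \<longlonglongrightarrow> half x 0" by (rule filterlim_compose[OF half_tendsto_0[OF x] fl])
  moreover have "(\<lambda>k. (?q k - half x 0) /\<^sub>R norm (?q k - half x 0)) \<longlonglongrightarrow> direction x"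
    by (rule filterlim_compose[OF direction(2)[OF x] fl])
  ultimately show ?thesis unfolding tangent_directions_def
    by (intro CollectI exI[of _ ?q] conjI allI)
qed

text \<open>A sequence converging to \<open>v\<close> eventually runs in the star of \<open>v\<close>, where short secants
  are uniformly close to the direction of their branch. A limit of secants therefore has distance 0 from the finite
  set of directions.\<close>

lemma tangent_directions_vertex:
  assumes v: "v \<in> V" shows "tangent_directions \<Gamma> v = direction ` halves v"
proof
  show "direction ` halves v \<subseteq> tangent_directions \<Gamma> v"
    using direction_tangent by (auto simp: halves_def)
  show "tangent_directions \<Gamma> v \<subseteq> direction ` halves v"
  proof
    fix \<tau> assume "\<tau> \<in> tangent_directions \<Gamma> v"
    then obtain q where q: "\<And>k. q k \<in> \<Gamma> - {v}" "q \<longlonglongrightarrow> v" "(\<lambda>k::nat. (q k - v) /\<^sub>R norm (q k - v)) \<longlonglongrightarrow> \<tau>"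
      unfolding tangent_directions_def by blast
    show "\<tau> \<in> direction ` halves v"
    proof (rule ccontr)
      assume no: "\<tau> \<notin> direction ` halves v"
      have "closed (direction ` halves v)" using finite_halves by (intro finite_imp_closed finite_imageI)
      from closed_avoid[OF this no] obtain \<epsilon> where \<epsilon>: "\<epsilon> > 0" "\<And>\<sigma>. dist \<tau> \<sigma> < \<epsilon> \<Longrightarrow> \<sigma> \<notin> direction ` halves v" by blast
      let ?P = "\<lambda>x \<eta>. \<forall>t. 0 < t \<and> t \<le> \<eta> \<longrightarrow> dist ((half x t - half x 0) /\<^sub>R norm (half x t - half x 0)) (direction x) < \<epsilon>/2"
      have "\<exists>\<eta>>0. ?P x \<eta>" if "x \<in> halves v" for x
      proof -
        have "fst x \<in> E" using that by (simp add: halves_def)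
        from tendstoD[OF direction(2)[OF this], of "\<epsilon>/2"] \<epsilon>(1) obtain b where "b > 0"
          "\<forall>t>0. t < b \<longrightarrow> dist ((half x t - half x 0) /\<^sub>R norm (half x t - half x 0)) (direction x) < \<epsilon>/2"
          unfolding eventually_at_right_field by auto
        then show ?thesis by (intro exI[of _ "b/2"]) auto
      qed
      then have "\<exists>\<eta>>0. \<forall>x\<in>halves v. ?P x \<eta>"
        by (rule finite_uniform_positive[OF finite_halves]) auto
      then obtain \<eta> where \<eta>: "\<eta> > 0" "\<forall>x\<in>halves v. ?P x \<eta>" by blast
      obtain \<delta> where \<delta>: "\<delta> > 0" "star \<Gamma> v (halves v) half \<delta>" using vertex_star[OF v] by blast
      have "star \<Gamma> v (halves v) half (min \<delta> \<eta>)" by (rule star_shrink[OF \<delta>(2)]) (use \<delta> \<eta> in auto)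
      from starD(8)[OF this] obtain r where r: "r > 0"
        "\<And>p. p \<in> \<Gamma> \<Longrightarrow> dist v p < r \<Longrightarrow> p = v \<or> (\<exists>x\<in>halves v. p \<in> half x ` {0<..min \<delta> \<eta>})" by blast
      have "\<forall>\<^sub>F k in sequentially. dist (q k) v < r" using tendstoD[OF q(2) r(1)] .
      moreover have "\<forall>\<^sub>F k in sequentially. dist ((q k - v) /\<^sub>R norm (q k - v)) \<tau> < \<epsilon>/2"
        using tendstoD[OF q(3), of "\<epsilon>/2"] \<epsilon>(1) by simp
      ultimately have "\<forall>\<^sub>F k in sequentially. dist (q k) v < r \<and> dist ((q k - v) /\<^sub>R norm (q k - v)) \<tau> < \<epsilon>/2"
        by (rule eventually_conj)
      then obtain k where k: "dist (q k) v < r" "dist ((q k - v) /\<^sub>R norm (q k - v)) \<tau> < \<epsilon>/2"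
        using eventually_happens' sequentially_bot by blast
      obtain x t where x: "x \<in> halves v" "t \<in> {0<..min \<delta> \<eta>}" "q k = half x t"
        using r(2)[of "q k"] k(1) q(1)[of k] by (auto simp: dist_commute)
      have "half x 0 = v" using x(1) by (simp add: halves_def)
      then have "dist ((q k - v) /\<^sub>R norm (q k - v)) (direction x) < \<epsilon>/2" using \<eta>(2) x by auto
      then have "dist \<tau> (direction x) < \<epsilon>" using k(2) by (metis dist_commute dist_triangle_half_r)
      then show False using \<epsilon>(2) x(1) by blast
    qed
  qed
qed

text \<open>Degenerate critical points are recognised by a quotient that refers to points of the edge only, so one
  parametrisation without such points may be exchanged for another.\<close>

lemma nondegenerate_iff_good: "nondegenerate \<Gamma> V E u \<longleftrightarrow> good u"
proof -
  have dirs: "(\<forall>v\<in>V. \<forall>\<tau>\<in>tangent_directions \<Gamma> v. u \<bullet> \<tau> \<noteq> 0) \<longleftrightarrow> (\<forall>x. fst x \<in> E \<longrightarrow> u \<bullet> direction x \<noteq> 0)"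
  proof
    assume a: "\<forall>v\<in>V. \<forall>\<tau>\<in>tangent_directions \<Gamma> v. u \<bullet> \<tau> \<noteq> 0"
    show "\<forall>x. fst x \<in> E \<longrightarrow> u \<bullet> direction x \<noteq> 0" using a half_0_V direction_tangent by blast
  next
    assume a: "\<forall>x. fst x \<in> E \<longrightarrow> u \<bullet> direction x \<noteq> 0"
    show "\<forall>v\<in>V. \<forall>\<tau>\<in>tangent_directions \<Gamma> v. u \<bullet> \<tau> \<noteq> 0"
      using a by (auto simp: tangent_directions_vertex halves_def)
  qed
  have morse: "(\<exists>g. edge_param V g e \<and> (\<forall>t\<in>{0<..<1}. deriv (\<lambda>s. u \<bullet> g s) t = 0 \<longrightarrow> deriv (deriv (\<lambda>s. u \<bullet> g s)) t \<noteq> 0))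
      \<longleftrightarrow> (\<forall>t\<in>{0<..<1}. u \<bullet> vel e t = 0 \<longrightarrow> u \<bullet> acc e t \<noteq> 0)" (is "?L \<longleftrightarrow> ?R") if e: "e \<in> E" for e
  proof -
    interpret G: regular_semialgebraic_arc "\<gamma> e" by (rule \<gamma>_arc[OF e])
    show ?thesis
    proof
      assume ?L
      then obtain g where g: "edge_param V g e"
        "\<forall>t\<in>{0<..<1}. deriv (\<lambda>s. u \<bullet> g s) t = 0 \<longrightarrow> deriv (deriv (\<lambda>s. u \<bullet> g s)) t \<noteq> 0" by blast
      interpret g: regular_semialgebraic_arc g by (rule edge_param_arc[OF g(1) semialgebraic_edge[OF e]])
      show ?R
      proof (intro ballI impI notI)
        fix t assume t: "t \<in> {0<..<1}" and z: "u \<bullet> vel e t = 0" "u \<bullet> acc e t = 0"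
        have "\<gamma> e t \<in> e" using half_in_edge[of "(e, False)" t] e t by (simp add: half_def)
        moreover have "e = g ` {0<..<1}" using g(1) by (simp add: edge_param_def)
        ultimately obtain t' where t': "t' \<in> {0<..<1}" "\<gamma> e t = g t'" by blast
        have "((\<lambda>s. (u \<bullet> (\<gamma> e s - \<gamma> e t)) / (norm (\<gamma> e s - \<gamma> e t))\<^sup>2) \<longlongrightarrow> 0) (at t)"
          using G.degenerate_iff_quotient[OF t] z by blast
        from degenerate_intrinsic[OF param[OF e] g(1) semialgebraic_edge[OF e] t t' this]
        have "u \<bullet> g.vel t' = 0 \<and> u \<bullet> g.acc t' = 0" using g.degenerate_iff_quotient[OF t'(1)] by blast
        then show False using g(2) t'(1) g.deriv_height[OF t'(1), of u] g.deriv2_height[OF t'(1), of u] by auto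
      qed
    next
      assume ?R
      then show ?L using param[OF e] G.deriv_height G.deriv2_height by (intro exI[of _ "\<gamma> e"]) auto
    qed
  qed
  show ?thesis unfolding nondegenerate_def good_def dirs using morse by blast
qed

definition descending :: "real^3 \<Rightarrow> ((real^3) set \<times> bool) set" where
  "descending u = {x. fst x \<in> E \<and> u \<bullet> direction x < 0}"

text \<open>The height difference along a secant, divided by the length of the secant, tends to
  \<open>u \<bullet> direction x\<close>.\<close>

lemma half_height_sign:
  assumes x: "fst x \<in> E" and u: "u \<bullet> direction x \<noteq> 0"
  shows "\<exists>\<delta>>0. \<forall>t. 0 < t \<and> t \<le> \<delta> \<longrightarrow> sgn (u \<bullet> half x t - u \<bullet> half x 0) = sgn (u \<bullet> direction x)"
proof -
  let ?c = "u \<bullet> direction x"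
  have "((\<lambda>t. (u \<bullet> ((half x t - half x 0) /\<^sub>R norm (half x t - half x 0))) * ?c) \<longlongrightarrow> ?c * ?c) (at_right 0)"
    by (intro tendsto_mult tendsto_inner tendsto_const direction(2)[OF x])
  moreover have "?c * ?c > 0" using u not_real_square_gt_zero by blast
  ultimately have "\<forall>\<^sub>F t in at_right 0. (u \<bullet> ((half x t - half x 0) /\<^sub>R norm (half x t - half x 0))) * ?c > 0"
    by (rule order_tendstoD(1))
  then obtain b where b: "b > 0" "\<And>t. 0 < t \<Longrightarrow> t < b \<Longrightarrow> (u \<bullet> ((half x t - half x 0) /\<^sub>R norm (half x t - half x 0))) * ?c > 0"
    unfolding eventually_at_right_field by auto
  have "sgn (u \<bullet> half x t - u \<bullet> half x 0) = sgn ?c" if "0 < t \<and> t \<le> b/2" for t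
  proof -
    have "inverse (norm (half x t - half x 0)) * (u \<bullet> (half x t - half x 0)) * ?c > 0"
      using b(2)[of t] that b(1) by simp
    then have "(u \<bullet> (half x t - half x 0)) * ?c > 0"
      using norm_ge_zero[of "half x t - half x 0"] by (auto simp: zero_less_mult_iff mult.assoc dest: less_not_sym)
    then show ?thesis by (auto simp: inner_diff_right zero_less_mult_iff sgn_if)
  qed
  then show ?thesis using b(1) by (intro exI[of _ "b/2"]) auto
qed

lemma vertex_height:
  assumes u: "good u" and v: "v \<in> V"
  shows vertex_lower_degree: "lower_degree \<Gamma> v u = card (halves v \<inter> descending u)"
    and vertex_local_min: "(\<exists>r>0. \<forall>q\<in>\<Gamma>. dist v q < r \<longrightarrow> u \<bullet> v \<le> u \<bullet> q) \<longleftrightarrow> halves v \<inter> descending u = {}"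
    and vertex_strict: "halves v \<inter> descending u = {} \<Longrightarrow> \<exists>r>0. \<forall>q\<in>\<Gamma>. dist v q < r \<longrightarrow> q \<noteq> v \<longrightarrow> u \<bullet> v < u \<bullet> q"
proof -
  let ?P = "\<lambda>x \<delta>. \<forall>t. 0 < t \<and> t \<le> \<delta> \<longrightarrow> sgn (u \<bullet> half x t - u \<bullet> half x 0) = sgn (u \<bullet> direction x)"
  have "\<exists>\<delta>>0. \<forall>x\<in>halves v. ?P x \<delta>"
  proof (rule finite_uniform_positive[OF finite_halves])
    show "\<exists>\<delta>>0. ?P x \<delta>" if "x \<in> halves v" for x
    proof (rule half_height_sign)
      show "fst x \<in> E" using that unfolding halves_def by blast
      then show "u \<bullet> direction x \<noteq> 0" using u unfolding good_def by blast
    qed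
  qed auto
  then obtain \<eta> where \<eta>: "\<eta> > 0" "\<forall>x\<in>halves v. ?P x \<eta>" by blast
  obtain \<delta> where \<delta>: "\<delta> > 0" "star \<Gamma> v (halves v) half \<delta>" using vertex_star[OF v] by blast
  have st: "star \<Gamma> v (halves v) half (min \<delta> \<eta>)" by (rule star_shrink[OF \<delta>(2)]) (use \<delta> \<eta> in auto)
  have v\<Gamma>: "v \<in> \<Gamma>" using v V_sub by blast
  have sg: "sgn (u \<bullet> half x t - u \<bullet> v) = sgn (u \<bullet> direction x)" if "x \<in> halves v" "t \<in> {0<..min \<delta> \<eta>}" for x t
  proof -
    have "half x 0 = v" using that(1) by (simp add: halves_def)
    with bspec[OF \<eta>(2) that(1)] that(2) show ?thesis by auto
  qed
  have down: "u \<bullet> half x t < u \<bullet> v" if "x \<in> halves v \<inter> descending u" "t \<in> {0<..min \<delta> \<eta>}" for x t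
    using sg[of x t] that by (auto simp: descending_def sgn_if split: if_splits)
  have up: "u \<bullet> v < u \<bullet> half x t" if "x \<in> halves v - halves v \<inter> descending u" "t \<in> {0<..min \<delta> \<eta>}" for x t
  proof -
    have "u \<bullet> direction x \<noteq> 0" using that u unfolding halves_def good_def by blast
    then have "u \<bullet> direction x > 0" using that by (auto simp: descending_def halves_def)
    then show ?thesis using sg[of x t] that by (auto simp: sgn_if split: if_splits)
  qed
  show "lower_degree \<Gamma> v u = card (halves v \<inter> descending u)"
    by (rule star_lower_degree[OF st v\<Gamma> down _ up]) auto
  show "(\<exists>r>0. \<forall>q\<in>\<Gamma>. dist v q < r \<longrightarrow> u \<bullet> v \<le> u \<bullet> q) \<longleftrightarrow> halves v \<inter> descending u = {}"
    by (rule star_local_min[OF st v\<Gamma> down _ up]) auto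
  show "halves v \<inter> descending u = {} \<Longrightarrow> \<exists>r>0. \<forall>q\<in>\<Gamma>. dist v q < r \<longrightarrow> q \<noteq> v \<longrightarrow> u \<bullet> v < u \<bullet> q"
    by (rule star_strict_local_min[OF st v\<Gamma> down _ up]) auto
qed

text \<open>Both regular and critical points of the height are covered: \<open>n = 1\<close> with the first derivative as
  \<open>c\<close>, and \<open>n = 2\<close> with half the second derivative. For odd \<open>n\<close> the two
  branches lie on different sides of the level of \<open>\<gamma> e t\<close>, for even \<open>n\<close> on the same
  side.\<close>

lemma interior_height:
  assumes e: "e \<in> E" and t: "t \<in> {0<..<1}" and n: "n \<in> {1, 2::nat}" and c: "c \<noteq> 0"
    and lim: "((\<lambda>s. (u \<bullet> \<gamma> e s - u \<bullet> \<gamma> e t) / (s - t) ^ n) \<longlongrightarrow> c) (at t)"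
  shows "lower_degree \<Gamma> (\<gamma> e t) u = (if n = 1 then 1 else if c < 0 then 2 else 0)"
    and "(\<exists>r>0. \<forall>q\<in>\<Gamma>. dist (\<gamma> e t) q < r \<longrightarrow> u \<bullet> \<gamma> e t \<le> u \<bullet> q) \<longleftrightarrow> n = 2 \<and> c > 0"
    and "n = 2 \<Longrightarrow> c > 0 \<Longrightarrow> \<exists>r>0. \<forall>q\<in>\<Gamma>. dist (\<gamma> e t) q < r \<longrightarrow> q \<noteq> \<gamma> e t \<longrightarrow> u \<bullet> \<gamma> e t < u \<bullet> q"
proof -
  let ?p = "\<gamma> e t"
  have "((\<lambda>s. (u \<bullet> \<gamma> e s - u \<bullet> ?p) / (s - t) ^ n * c) \<longlongrightarrow> c * c) (at t)"
    by (intro tendsto_mult lim tendsto_const)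
  moreover have "c * c > 0" using c not_real_square_gt_zero by blast
  ultimately have "\<forall>\<^sub>F s in at t. (u \<bullet> \<gamma> e s - u \<bullet> ?p) / (s - t) ^ n * c > 0" by (rule order_tendstoD(1))
  then obtain \<eta> where \<eta>: "\<eta> > 0" "\<And>s. s \<noteq> t \<Longrightarrow> dist s t < \<eta> \<Longrightarrow> (u \<bullet> \<gamma> e s - u \<bullet> ?p) / (s - t) ^ n * c > 0"
    unfolding eventually_at by auto
  have sg: "sgn (u \<bullet> \<gamma> e s - u \<bullet> ?p) = sgn c * sgn ((s - t) ^ n)" if "s \<noteq> t" "dist s t < \<eta>" for s
    by (rule sgn_quotient[OF \<eta>(2)[OF that]])
  obtain \<delta> where \<delta>: "\<delta> > 0" "star \<Gamma> ?p {(e, False), (e, True)} (branch t) \<delta>" using interior_star[OF e t] by blast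
  define \<theta> where "\<theta> = min \<delta> (\<eta>/2)"
  have \<theta>: "\<theta> > 0" "\<theta> \<le> \<delta>" "\<theta> < \<eta>" using \<delta>(1) \<eta>(1) by (auto simp: \<theta>_def)
  have st: "star \<Gamma> ?p {(e, False), (e, True)} (branch t) \<theta>" by (rule star_shrink[OF \<delta>(2) \<theta>(1,2)])
  have p\<Gamma>: "?p \<in> \<Gamma>" using half_in_edge[of "(e, False)" t] e t edge_sub[OF e] by (auto simp: half_def)
  define D where "D = (if n = 1 then (if c < 0 then {(e, False)} else {(e, True)}) else if c < 0 then {(e, False), (e, True)} else {})"
  have F: "sgn (u \<bullet> branch t (e, False) s - u \<bullet> ?p) = sgn c" if "s \<in> {0<..\<theta>}" for s
    using sg[of "t + s"] that \<theta> by (auto simp: branch_eq dist_real_def)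
  have T: "sgn (u \<bullet> branch t (e, True) s - u \<bullet> ?p) = (if n = 1 then - sgn c else sgn c)" if "s \<in> {0<..\<theta>}" for s
    using sg[of "t - s"] that \<theta> n by (auto simp: branch_eq dist_real_def sgn_mult)
  have down: "u \<bullet> branch t x s < u \<bullet> ?p" if "x \<in> D" "s \<in> {0<..\<theta>}" for x s
    using F[OF that(2)] T[OF that(2)] that(1) c n by (auto simp: D_def sgn_if split: if_splits)
  have up: "u \<bullet> ?p < u \<bullet> branch t x s" if "x \<in> {(e, False), (e, True)} - D" "s \<in> {0<..\<theta>}" for x s
    using F[OF that(2)] T[OF that(2)] that(1) c n by (auto simp: D_def sgn_if split: if_splits)
  have DB: "D \<subseteq> {(e, False), (e, True)}" by (auto simp: D_def)
  note L = star_lower_degree[OF st p\<Gamma> down DB up] and M = star_local_min[OF st p\<Gamma> down DB up]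
    and S = star_strict_local_min[OF st p\<Gamma> down DB up]
  show "lower_degree \<Gamma> ?p u = (if n = 1 then 1 else if c < 0 then 2 else 0)"
    using L by (simp add: D_def)
  show "(\<exists>r>0. \<forall>q\<in>\<Gamma>. dist ?p q < r \<longrightarrow> u \<bullet> ?p \<le> u \<bullet> q) \<longleftrightarrow> n = 2 \<and> c > 0"
    using M n c by (auto simp: D_def split: if_splits)
  show "\<exists>r>0. \<forall>q\<in>\<Gamma>. dist ?p q < r \<longrightarrow> q \<noteq> ?p \<longrightarrow> u \<bullet> ?p < u \<bullet> q" if "n = 2" "c > 0"
    by (rule S) (use that in \<open>simp_all add: D_def\<close>)
qed

end

section \<open>Critical points and local minima\<close>

lemma (in regular_semialgebraic_arc) DERIV_height_vel:
  assumes "t \<in> {0<..<1}" shows "((\<lambda>s. u \<bullet> g s) has_real_derivative u \<bullet> vel t) (at t)"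
  using bounded_linear.has_vector_derivative[OF bounded_linear_inner_right has_vel[OF assms], of u]
  by (simp add: has_real_derivative_iff_has_vector_derivative[symmetric])

lemma (in regular_semialgebraic_arc) DERIV_vel_acc:
  assumes "t \<in> {0<..<1}" shows "((\<lambda>s. u \<bullet> vel s) has_real_derivative u \<bullet> acc t) (at t)"
  using bounded_linear.has_vector_derivative[OF bounded_linear_inner_right has_acc[OF assms], of u]
  by (simp add: has_real_derivative_iff_has_vector_derivative[symmetric])

lemma sgn_transfer_nonzero: "sgn a = sgn b \<Longrightarrow> b \<noteq> 0 \<Longrightarrow> a \<noteq> (0::real)"
  by (auto simp: sgn_if split: if_splits)

context semialg_graph
begin

definition crit :: "(real^3) set \<Rightarrow> real^3 \<Rightarrow> real set" where
  "crit e u = {t\<in>{0<..<1}. u \<bullet> vel e t = 0}"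

definition minima :: "real^3 \<Rightarrow> (real^3) set" where
  "minima u = {p\<in>\<Gamma>. \<exists>r>0. \<forall>q\<in>\<Gamma>. dist p q < r \<longrightarrow> u \<bullet> p \<le> u \<bullet> q}"

lemma half_height_sign':
  assumes u: "good u" and x: "fst x \<in> E"
  shows "\<exists>\<delta>>0. \<forall>t. 0 < t \<and> t \<le> \<delta> \<longrightarrow> sgn (u \<bullet> half x t - u \<bullet> half x 0) = sgn (u \<bullet> direction x)"
  by (rule half_height_sign[OF x]) (use u x in \<open>unfold good_def, blast\<close>)

text \<open>The exceptional case of \<open>critical_points_bounded\<close>, a height that is constant along the edge,
  contradicts the sign of the height at the start of a half edge.\<close>

lemma half_critical_bounded:
  assumes x: "fst x \<in> E"
  shows "\<exists>N. \<forall>u. good u \<longrightarrow> finite {t\<in>{0<..<1}. u \<bullet> regular_semialgebraic_arc.vel (half x) t = 0} \<and>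
     card {t\<in>{0<..<1}. u \<bullet> regular_semialgebraic_arc.vel (half x) t = 0} \<le> N"
proof -
  interpret G: regular_semialgebraic_arc "half x" by (rule half_arc[OF x])
  have eq: "{t\<in>{0<..<1}. deriv (\<lambda>s. u \<bullet> half x s) t = 0} = {t\<in>{0<..<1}. u \<bullet> G.vel t = 0}" for u
    using G.deriv_height by auto
  obtain N where N: "\<And>u. (\<forall>t\<in>{0<..<1}. deriv (\<lambda>s. u \<bullet> half x s) t = 0) \<or>
     (finite {t\<in>{0<..<1}. u \<bullet> G.vel t = 0} \<and> card {t\<in>{0<..<1}. u \<bullet> G.vel t = 0} \<le> N)"
    using G.critical_points_bounded unfolding eq by blast
  have "finite {t\<in>{0<..<1}. u \<bullet> G.vel t = 0} \<and> card {t\<in>{0<..<1}. u \<bullet> G.vel t = 0} \<le> N" if u: "good u" for u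
  proof (rule ccontr)
    assume "\<not> ?thesis"
    then have z: "\<forall>t\<in>{0<..<1}. u \<bullet> G.vel t = 0" using N[of u] G.deriv_height by auto
    obtain \<delta> where \<delta>: "\<delta> > 0" "\<forall>t. 0 < t \<and> t \<le> \<delta> \<longrightarrow> sgn (u \<bullet> half x t - u \<bullet> half x 0) = sgn (u \<bullet> direction x)"
      using half_height_sign'[OF u x] by blast
    define b where "b = min \<delta> (1/2)"
    have b: "0 < b" "b \<le> \<delta>" "b < 1" using \<delta>(1) by (auto simp: b_def)
    have "u \<bullet> half x b = u \<bullet> half x 0"
    proof (rule DERIV_isconst_end[OF b(1)])
      show "continuous_on {0..b} (\<lambda>t. u \<bullet> half x t)"
        using b by (intro continuous_intros continuous_on_subset[OF half_continuous[OF x]]) auto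
      show "DERIV (\<lambda>t. u \<bullet> half x t) t :> 0" if "0 < t" "t < b" for t
        using G.DERIV_height_vel[of t u] z that b(3) by auto
    qed
    then have "sgn (u \<bullet> direction x) = 0" using \<delta>(2)[rule_format, of b] b by simp
    moreover have "u \<bullet> direction x \<noteq> 0" using u x unfolding good_def by blast
    ultimately show False by (simp add: sgn_0_0)
  qed
  then show ?thesis by blast
qed

text \<open>Before the first critical point the derivative has one sign. The height is monotone there, so this is the sign
  of the height difference, which is that of \<open>u \<bullet> direction x\<close>.\<close>

lemma half_velocity_sign:
  assumes u: "good u" and x: "fst x \<in> E"
  shows "\<exists>\<eta>>0. \<eta> < 1 \<and> (\<forall>s. 0 < s \<and> s < \<eta> \<longrightarrow> sgn (u \<bullet> regular_semialgebraic_arc.vel (half x) s) = sgn (u \<bullet> direction x))"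
proof -
  interpret G: regular_semialgebraic_arc "half x" by (rule half_arc[OF x])
  have "finite {t\<in>{0<..<1}. u \<bullet> G.vel t = 0}" using half_critical_bounded[OF x] u by blast
  from finite_avoid_right_0[OF this] obtain \<eta> where \<eta>: "\<eta> > 0" "\<eta> < 1"
    "\<forall>t. 0 < t \<and> t < \<eta> \<longrightarrow> t \<notin> {t\<in>{0<..<1}. u \<bullet> G.vel t = 0}" by blast
  have nz: "u \<bullet> G.vel t \<noteq> 0" if "0 < t" "t < \<eta>" for t using \<eta> that by auto
  obtain \<delta> where \<delta>: "\<delta> > 0" "\<forall>t. 0 < t \<and> t \<le> \<delta> \<longrightarrow> sgn (u \<bullet> half x t - u \<bullet> half x 0) = sgn (u \<bullet> direction x)"
    using half_height_sign'[OF u x] by blast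
  have cont: "continuous_on {a..b} (\<lambda>t. u \<bullet> G.vel t)" if "0 < a" "b < 1" for a b
    using that by (intro continuous_at_imp_continuous_on ballI DERIV_isCont[OF G.DERIV_vel_acc]) auto
  have same: "sgn (u \<bullet> G.vel r) = sgn (u \<bullet> G.vel s)" if "0 < r" "r \<le> s" "s < \<eta>" for r s
    by (rule sgn_constant_no_zero[where k = "\<lambda>t. u \<bullet> G.vel t" and x = r and y = s])
       (use that nz cont[of r s] \<eta>(2) in auto)
  have "sgn (u \<bullet> G.vel s) = sgn (u \<bullet> direction x)" if s: "0 < s" "s < \<eta>" for s
  proof -
    define b where "b = min s \<delta>"
    have b: "0 < b" "b \<le> s" "b \<le> \<delta>" using s \<delta> by (auto simp: b_def)
    have c: "continuous_on {0..b} (\<lambda>t. u \<bullet> half x t)"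
      using b s \<eta> by (intro continuous_intros continuous_on_subset[OF half_continuous[OF x]]) auto
    have d: "((\<lambda>t. u \<bullet> half x t) has_real_derivative u \<bullet> G.vel t) (at t)" "sgn (u \<bullet> G.vel t) = sgn (u \<bullet> G.vel s)" if "0 < t" "t < b" for t
      using G.DERIV_height_vel[of t u] same[of t s] that b s \<eta> by auto
    have "sgn (u \<bullet> half x b - u \<bullet> half x 0) = sgn (u \<bullet> G.vel s)"
    proof (cases "u \<bullet> G.vel s > 0")
      case True
      have "u \<bullet> half x 0 < u \<bullet> half x b"
      proof (rule DERIV_pos_imp_increasing_open[where f = "\<lambda>t. u \<bullet> half x t" and a = 0 and b = b, OF b(1) _ c])
        fix t assume t: "0 < t" "t < b"
        have "u \<bullet> G.vel t > 0" using d(2)[OF t] True by (simp add: sgn_1_pos)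
        then show "\<exists>y. DERIV (\<lambda>t. u \<bullet> half x t) t :> y \<and> y > 0" using d(1)[OF t] by blast
      qed
      then show ?thesis using True by simp
    next
      case False
      then have neg: "u \<bullet> G.vel s < 0" using nz[OF s] by simp
      have "u \<bullet> half x 0 > u \<bullet> half x b"
      proof (rule DERIV_neg_imp_decreasing_open[where f = "\<lambda>t. u \<bullet> half x t" and a = 0 and b = b, OF b(1) _ c])
        fix t assume t: "0 < t" "t < b"
        have "u \<bullet> G.vel t < 0" using d(2)[OF t] neg by (simp add: sgn_1_neg)
        then show "\<exists>y. DERIV (\<lambda>t. u \<bullet> half x t) t :> y \<and> y < 0" using d(1)[OF t] by blast
      qed
      then show ?thesis using neg by simp
    qed
    then show ?thesis using \<delta>(2)[rule_format, of b] b by simp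
  qed
  then show ?thesis using \<eta> by blast
qed

lemma half_F: "half (e, False) = \<gamma> e" by (simp add: half_def)

lemma crit_finite: "good u \<Longrightarrow> e \<in> E \<Longrightarrow> finite (crit e u)"
  using half_critical_bounded[of "(e, False)"] unfolding crit_def half_F by auto

lemma crit_bounded: "\<exists>N. \<forall>u. good u \<longrightarrow> (\<forall>e\<in>E. card (crit e u) \<le> N)"
proof -
  have "\<forall>e\<in>E. \<exists>N. \<forall>u. good u \<longrightarrow> card (crit e u) \<le> N"
  proof
    fix e assume "e \<in> E"
    then have "fst (e, False) \<in> E" by simp
    from half_critical_bounded[OF this] show "\<exists>N. \<forall>u. good u \<longrightarrow> card (crit e u) \<le> N"
      unfolding crit_def half_F by blast
  qed
  then obtain N where N: "\<forall>e\<in>E. \<forall>u. good u \<longrightarrow> card (crit e u) \<le> N e" by (rule bchoice[THEN exE])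
  have "card (crit e u) \<le> (\<Sum>e\<in>E. N e)" if "good u" "e \<in> E" for u e
  proof -
    have "card (crit e u) \<le> N e" using N that by blast
    also have "\<dots> \<le> (\<Sum>e\<in>E. N e)" using that(2) finite_E by (intro member_le_sum) auto
    finally show ?thesis .
  qed
  then show ?thesis by blast
qed

lemma reverse_velocity:
  assumes e: "e \<in> E" and s: "s \<in> {0<..<1}"
  shows "regular_semialgebraic_arc.vel (half (e, True)) s = - vel e (1 - s)"
proof -
  interpret G: regular_semialgebraic_arc "\<gamma> e" by (rule \<gamma>_arc[OF e])
  interpret H: regular_semialgebraic_arc "half (e, True)" by (rule half_arc) (use e in simp)
  have s': "1 - s \<in> {0<..<1}" using s by auto
  have "((\<lambda>t. 1 - t) has_real_derivative -1) (at s)" by (auto intro!: derivative_eq_intros)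
  from vector_diff_chain_at[OF this[unfolded has_real_derivative_iff_has_vector_derivative] G.has_vel[OF s']]
  have "(half (e, True) has_vector_derivative - vel e (1 - s)) (at s)"
    by (simp add: o_def half_def reversepath_def)
  then show ?thesis using H.has_vel[OF s] vector_derivative_unique_at by blast
qed

text \<open>The signs of the second derivative add up to the number of minima minus the number of maxima on the edge. Twice
  each sign is a jump of the sign of the first derivative, which starts as
  \<open>sgn (u \<bullet> direction (e, False))\<close> and, because the other end is traversed backwards, finishes as
  \<open>- sgn (u \<bullet> direction (e, True))\<close>.\<close>

lemma edge_count:
  assumes u: "good u" and e: "e \<in> E"
  shows "2 * (\<Sum>t\<in>crit e u. sgn (u \<bullet> acc e t)) = - sgn (u \<bullet> direction (e, True)) - sgn (u \<bullet> direction (e, False))"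
proof -
  interpret G: regular_semialgebraic_arc "\<gamma> e" by (rule \<gamma>_arc[OF e])
  let ?k = "\<lambda>t. u \<bullet> vel e t"
  obtain \<eta> where \<eta>: "\<eta> > 0" "\<eta> < 1" "\<And>s. 0 < s \<Longrightarrow> s < \<eta> \<Longrightarrow> sgn (?k s) = sgn (u \<bullet> direction (e, False))"
    using half_velocity_sign[OF u, of "(e, False)"] e unfolding half_F by auto
  obtain \<theta> where \<theta>: "\<theta> > 0" "\<theta> < 1" "\<And>s. 0 < s \<Longrightarrow> s < \<theta> \<Longrightarrow> sgn (u \<bullet> regular_semialgebraic_arc.vel (half (e, True)) s) = sgn (u \<bullet> direction (e, True))"
    using half_velocity_sign[OF u, of "(e, True)"] e by auto
  have nz: "u \<bullet> direction (e, b) \<noteq> 0" for b using u e unfolding good_def by auto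
  have L: "sgn (?k s) = sgn (u \<bullet> direction (e, False))" "?k s \<noteq> 0" if "0 < s" "s < \<eta>" for s
  proof -
    show "sgn (?k s) = sgn (u \<bullet> direction (e, False))" by (rule \<eta>(3)[OF that])
    then show "?k s \<noteq> 0" using nz[of False] by (rule sgn_transfer_nonzero)
  qed
  have R: "sgn (?k s) = - sgn (u \<bullet> direction (e, True))" "?k s \<noteq> 0" if "1 - \<theta> < s" "s < 1" for s
  proof -
    have "1 - s \<in> {0<..<1}" using that \<theta> by auto
    from reverse_velocity[OF e this] have "u \<bullet> regular_semialgebraic_arc.vel (half (e, True)) (1 - s) = - ?k s" by simp
    then have "sgn (- ?k s) = sgn (u \<bullet> direction (e, True))" using \<theta>(3)[of "1 - s"] that by simp
    then show "sgn (?k s) = - sgn (u \<bullet> direction (e, True))" by (simp add: sgn_minus)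
    then have "sgn (?k s) = sgn (- (u \<bullet> direction (e, True)))" by (simp add: sgn_minus)
    then show "?k s \<noteq> 0" by (rule sgn_transfer_nonzero) (use nz[of True] in simp)
  qed
  define x where "x = min \<eta> (1/2) / 2"
  define y where "y = 1 - min \<theta> (1/2) / 2"
  have x: "0 < x" "x < \<eta>" "x < 1/2" using \<eta>(1) by (auto simp: x_def)
  have y: "1/2 < y" "1 - \<theta> < y" "y < 1" using \<theta>(1) by (auto simp: y_def min_def)
  have Z: "{z\<in>{x<..<y}. ?k z = 0} = crit e u"
  proof (intro equalityI subsetI)
    fix z assume z: "z \<in> crit e u"
    then have z': "0 < z" "z < 1" "?k z = 0" by (auto simp: crit_def)
    have "\<not> z < \<eta>" using L(2)[of z] z' by blast
    moreover have "\<not> 1 - \<theta> < z" using R(2)[of z] z' by blast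
    ultimately show "z \<in> {z\<in>{x<..<y}. ?k z = 0}" using x y z' by auto
  qed (use x y in \<open>auto simp: crit_def\<close>)
  have "sgn (?k y) - sgn (?k x) = 2 * (\<Sum>z\<in>{z\<in>{x<..<y}. ?k z = 0}. sgn (u \<bullet> acc e z))"
  proof (rule sgn_jump_sum)
    show "x < y" using x y by simp
    show "continuous_on {x..y} ?k"
      using x y by (intro continuous_at_imp_continuous_on ballI DERIV_isCont[OF G.DERIV_vel_acc]) auto
    show "?k x \<noteq> 0" using L(2) x by blast
    show "?k y \<noteq> 0" using R(2) y by blast
    show "finite {z\<in>{x<..<y}. ?k z = 0}" unfolding Z by (rule crit_finite[OF u e])
    show "(?k has_real_derivative u \<bullet> acc e z) (at z) \<and> u \<bullet> acc e z \<noteq> 0" if "x < z" "z < y" "?k z = 0" for z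
      using G.DERIV_vel_acc[of z u] u e that x y unfolding good_def by auto
  qed
  then show ?thesis unfolding Z using L(1)[OF x(1,2)] R(1)[OF y(2,3)] by simp
qed

lemma interior_noncritical:
  assumes u: "good u" and e: "e \<in> E" and t: "t \<in> {0<..<1}" "t \<notin> crit e u"
  shows "weight \<Gamma> (\<gamma> e t) u = 0" "\<gamma> e t \<notin> minima u"
proof -
  interpret G: regular_semialgebraic_arc "\<gamma> e" by (rule \<gamma>_arc[OF e])
  have c: "u \<bullet> vel e t \<noteq> 0" using t by (auto simp: crit_def)
  have "((\<lambda>s. (u \<bullet> \<gamma> e s - u \<bullet> \<gamma> e t) / (s - t) ^ 1) \<longlongrightarrow> u \<bullet> vel e t) (at t)"
    using analytic_ioo_first_order[OF G.analytic_height t(1), of u] G.deriv_height[OF t(1), of u] by simp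
  note I = interior_height(1,2)[OF e t(1) _ c this]
  have nl: "\<not> (\<exists>r>0. \<forall>q\<in>\<Gamma>. dist (\<gamma> e t) q < r \<longrightarrow> u \<bullet> \<gamma> e t \<le> u \<bullet> q)" using I(2) by simp
  then show "\<gamma> e t \<notin> minima u" unfolding minima_def by blast
  have "lower_degree \<Gamma> (\<gamma> e t) u = 1" using I(1) by simp
  then show "weight \<Gamma> (\<gamma> e t) u = 0" unfolding weight_def by (simp only: nl if_False)
qed

lemma interior_critical:
  assumes u: "good u" and e: "e \<in> E" and t: "t \<in> crit e u"
  shows "weight \<Gamma> (\<gamma> e t) u = 1" "\<gamma> e t \<in> minima u \<longleftrightarrow> u \<bullet> acc e t > 0"
    "u \<bullet> acc e t > 0 \<Longrightarrow> \<exists>r>0. \<forall>q\<in>\<Gamma>. dist (\<gamma> e t) q < r \<longrightarrow> q \<noteq> \<gamma> e t \<longrightarrow> u \<bullet> \<gamma> e t < u \<bullet> q"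
proof -
  interpret G: regular_semialgebraic_arc "\<gamma> e" by (rule \<gamma>_arc[OF e])
  have t01: "t \<in> {0<..<1}" and z: "u \<bullet> vel e t = 0" using t by (auto simp: crit_def)
  have c: "u \<bullet> acc e t / 2 \<noteq> 0" using u e t01 z unfolding good_def by auto
  have lim: "((\<lambda>s. (u \<bullet> \<gamma> e s - u \<bullet> \<gamma> e t) / (s - t) ^ 2) \<longlongrightarrow> u \<bullet> acc e t / 2) (at t)"
    using analytic_ioo_second_order[OF G.analytic_height t01, of u] G.deriv_height[OF t01, of u] G.deriv2_height[OF t01, of u] z by simp
  note I = interior_height[OF e t01 _ c lim]
  have loc: "(\<exists>r>0. \<forall>q\<in>\<Gamma>. dist (\<gamma> e t) q < r \<longrightarrow> u \<bullet> \<gamma> e t \<le> u \<bullet> q) \<longleftrightarrow> u \<bullet> acc e t > 0" using I(2) by simp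
  have p\<Gamma>: "\<gamma> e t \<in> \<Gamma>" using half_in_edge[of "(e, False)" t] e t01 edge_sub[OF e] by (auto simp: half_def)
  show "\<gamma> e t \<in> minima u \<longleftrightarrow> u \<bullet> acc e t > 0" unfolding minima_def using loc p\<Gamma> by blast
  have ld: "u \<bullet> acc e t < 0 \<Longrightarrow> lower_degree \<Gamma> (\<gamma> e t) u = 2" using I(1) by simp
  show "weight \<Gamma> (\<gamma> e t) u = 1"
  proof (cases "u \<bullet> acc e t > 0")
    case True
    then show ?thesis unfolding weight_def by (simp only: loc if_True)
  next
    case False
    then have "u \<bullet> acc e t < 0" using c by simp
    from ld[OF this] show ?thesis unfolding weight_def by (simp only: loc False if_False)
  qed
  show "\<exists>r>0. \<forall>q\<in>\<Gamma>. dist (\<gamma> e t) q < r \<longrightarrow> q \<noteq> \<gamma> e t \<longrightarrow> u \<bullet> \<gamma> e t < u \<bullet> q" if "u \<bullet> acc e t > 0"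
    by (rule I(3)) (use that in auto)
qed

text \<open>At a minimum the lower degree is 0, and the correction 2 turns \<open>0 - 1\<close> into the weight 1.\<close>

lemma vertex_weight:
  assumes u: "good u" and v: "v \<in> V"
  shows "weight \<Gamma> v u = int (card (halves v \<inter> descending u)) - 1 + (if v \<in> minima u then 2 else 0)"
    and "v \<in> minima u \<longleftrightarrow> halves v \<inter> descending u = {}"
proof -
  show m: "v \<in> minima u \<longleftrightarrow> halves v \<inter> descending u = {}"
    unfolding minima_def using vertex_local_min[OF u v] v V_sub by blast
  show "weight \<Gamma> v u = int (card (halves v \<inter> descending u)) - 1 + (if v \<in> minima u then 2 else 0)"
    unfolding weight_def vertex_local_min[OF u v] vertex_lower_degree[OF u v] m by simp
qed

lemma minima_strict:
  assumes u: "good u" and p: "p \<in> minima u"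
  shows "\<exists>r>0. \<forall>q\<in>\<Gamma>. dist p q < r \<longrightarrow> q \<noteq> p \<longrightarrow> u \<bullet> p < u \<bullet> q"
proof (cases "p \<in> V")
  case True
  then show ?thesis using vertex_strict[OF u True] vertex_weight(2)[OF u True] p by blast
next
  case False
  then obtain e where e: "e \<in> E" "p \<in> e" using p Union_E by (auto simp: minima_def)
  then obtain t where t: "t \<in> {0<..<1}" "p = \<gamma> e t" using edge[OF e(1)] by blast
  then have "t \<in> crit e u" using interior_noncritical(2)[OF u e(1) t(1)] p by blast
  from interior_critical(2,3)[OF u e(1) this] show ?thesis using p t(2) by blast
qed

lemma disjoint_parts:
  assumes "e \<in> E" "e' \<in> E" "e \<noteq> e'" "A \<subseteq> {0<..<1}" "B \<subseteq> {0<..<1}"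
  shows "\<gamma> e ` A \<inter> \<gamma> e' ` B = {}" "V \<inter> \<gamma> e ` A = {}"
proof -
  have "\<gamma> e ` A \<subseteq> \<gamma> e ` {0<..<1}" "\<gamma> e' ` B \<subseteq> \<gamma> e' ` {0<..<1}" using assms by blast+
  then have "\<gamma> e ` A \<subseteq> e" "\<gamma> e' ` B \<subseteq> e'" using edge[OF assms(1)] edge[OF assms(2)] by metis+
  then show "\<gamma> e ` A \<inter> \<gamma> e' ` B = {}" "V \<inter> \<gamma> e ` A = {}"
    using edge_disjoint[OF assms(1-3)] edge_V[OF assms(1)] by blast+
qed

lemma V_edge_part: "e \<in> E \<Longrightarrow> A \<subseteq> {0<..<1} \<Longrightarrow> V \<inter> \<gamma> e ` A = {}"
  using edge[of e] edge_V[of e] image_mono[of A "{0<..<1}" "\<gamma> e"] by blast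

lemma inj_edge: "e \<in> E \<Longrightarrow> A \<subseteq> {0<..<1} \<Longrightarrow> inj_on (\<gamma> e) A"
  using half_inj[of "(e, False)"] unfolding half_F by (auto elim!: inj_on_subset)

lemma sum_over_pieces:
  fixes f :: "real^3 \<Rightarrow> 'b::comm_monoid_add"
  assumes W: "W \<subseteq> V" and A: "\<And>e. e \<in> E \<Longrightarrow> A e \<subseteq> {0<..<1}" "\<And>e. e \<in> E \<Longrightarrow> finite (A e)"
  shows "sum f (W \<union> (\<Union>e\<in>E. \<gamma> e ` A e)) = sum f W + (\<Sum>e\<in>E. \<Sum>t\<in>A e. f (\<gamma> e t))"
proof -
  have "sum f (W \<union> (\<Union>e\<in>E. \<gamma> e ` A e)) = sum f W + sum f (\<Union>e\<in>E. \<gamma> e ` A e)"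
  proof (rule sum.union_disjoint)
    show "finite W" using W finite_V finite_subset by blast
    show "finite (\<Union>e\<in>E. \<gamma> e ` A e)" using finite_E A by auto
    show "W \<inter> (\<Union>e\<in>E. \<gamma> e ` A e) = {}" using V_edge_part A(1) W by blast
  qed
  also have "sum f (\<Union>e\<in>E. \<gamma> e ` A e) = (\<Sum>e\<in>E. sum f (\<gamma> e ` A e))"
    using finite_E A disjoint_parts(1) by (intro sum.UNION_disjoint) auto
  also have "\<dots> = (\<Sum>e\<in>E. \<Sum>t\<in>A e. f (\<gamma> e t))"
    by (intro sum.cong refl) (simp add: sum.reindex[OF inj_edge[OF _ A(1)]])
  finally show ?thesis .
qed

lemma card_descending:
  "int (card (descending u)) = (\<Sum>e\<in>E. (if u \<bullet> direction (e, False) < 0 then 1 else 0) + (if u \<bullet> direction (e, True) < 0 then 1 else 0))"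
  "card (descending u) = (\<Sum>v\<in>V. card (halves v \<inter> descending u))"
proof -
  let ?D = "\<lambda>e. {x\<in>{(e, False), (e, True)}. u \<bullet> direction x < 0}"
  have eq: "descending u = (\<Union>e\<in>E. ?D e)"
  proof (intro equalityI subsetI)
    fix x assume "x \<in> descending u"
    then have "fst x \<in> E" "u \<bullet> direction x < 0" by (auto simp: descending_def)
    moreover have "x \<in> {(fst x, False), (fst x, True)}" by (cases x) auto
    ultimately show "x \<in> (\<Union>e\<in>E. ?D e)" by blast
  qed (auto simp: descending_def)
  have "card (descending u) = (\<Sum>e\<in>E. card (?D e))"
    unfolding eq using finite_E by (intro card_UN_disjoint) auto
  moreover have "int (card (?D e)) = (if u \<bullet> direction (e, False) < 0 then 1 else 0) + (if u \<bullet> direction (e, True) < 0 then 1 else 0)" for e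
  proof -
    have "?D e = (if u \<bullet> direction (e, False) < 0 then {(e, False)} else {}) \<union> (if u \<bullet> direction (e, True) < 0 then {(e, True)} else {})"
      by (intro equalityI subsetI) (auto split: if_splits)
    then show ?thesis by simp
  qed
  ultimately show "int (card (descending u)) = (\<Sum>e\<in>E. (if u \<bullet> direction (e, False) < 0 then 1 else 0) + (if u \<bullet> direction (e, True) < 0 then 1 else 0))"
    by simp
  have eqV: "descending u = (\<Union>v\<in>V. halves v \<inter> descending u)"
    using half_0_V by (auto simp: descending_def halves_def)
  have "card (\<Union>v\<in>V. halves v \<inter> descending u) = (\<Sum>v\<in>V. card (halves v \<inter> descending u))"
    using finite_V finite_halves by (intro card_UN_disjoint) (auto simp: halves_def)
  then show "card (descending u) = (\<Sum>v\<in>V. card (halves v \<inter> descending u))" using eqV by simp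
qed

lemma minima_decomposition:
  assumes u: "good u"
  shows "minima u = (V \<inter> minima u) \<union> (\<Union>e\<in>E. \<gamma> e ` {t\<in>crit e u. u \<bullet> acc e t > 0})"
proof (intro equalityI subsetI)
  fix p assume p: "p \<in> minima u"
  show "p \<in> (V \<inter> minima u) \<union> (\<Union>e\<in>E. \<gamma> e ` {t\<in>crit e u. u \<bullet> acc e t > 0})"
  proof (cases "p \<in> V")
    case False
    then obtain e where e: "e \<in> E" "p \<in> e" using p Union_E by (auto simp: minima_def)
    then obtain t where t: "t \<in> {0<..<1}" "p = \<gamma> e t" using edge[OF e(1)] by blast
    then have "t \<in> crit e u" using interior_noncritical(2)[OF u e(1) t(1)] p by blast
    then show ?thesis using interior_critical(2)[OF u e(1)] p t(2) e(1) by blast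
  qed (use p in blast)
next
  fix p assume "p \<in> (V \<inter> minima u) \<union> (\<Union>e\<in>E. \<gamma> e ` {t\<in>crit e u. u \<bullet> acc e t > 0})"
  then show "p \<in> minima u" using interior_critical(2)[OF u] by blast
qed

text \<open>The descending half edges enter twice with opposite signs: at the vertices through the lower degrees, and on the
  edges through \<open>edge_count\<close>. After cancellation the number of edges minus the number of vertices is
  left.\<close>

theorem total_weight_minima:
  assumes u: "good u"
  shows "finite (minima u)" "total_weight \<Gamma> u = 2 * int (card (minima u)) - 1 + int (first_betti \<Gamma>)"
proof -
  let ?mins = "\<lambda>e. {t\<in>crit e u. u \<bullet> acc e t > 0}"
  have crit01: "crit e u \<subseteq> {0<..<1}" for e by (auto simp: crit_def)
  have fin: "finite (crit e u)" "finite (?mins e)" if "e \<in> E" for e using crit_finite[OF u that] by auto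
  show finM: "finite (minima u)"
    by (subst minima_decomposition[OF u]) (use finite_V finite_E fin in auto)
  have cardM: "int (card (minima u)) = int (card (V \<inter> minima u)) + (\<Sum>e\<in>E. int (card (?mins e)))"
  proof -
    have "(\<Sum>p\<in>minima u. 1::int) = (\<Sum>p\<in>V \<inter> minima u. 1) + (\<Sum>e\<in>E. \<Sum>t\<in>?mins e. 1)"
      by (subst minima_decomposition[OF u], rule sum_over_pieces) (use crit01 fin in auto)
    then show ?thesis by simp
  qed
  let ?S = "V \<union> (\<Union>e\<in>E. \<gamma> e ` crit e u)"
  have tw: "total_weight \<Gamma> u = (\<Sum>p\<in>?S. weight \<Gamma> p u)"
    unfolding total_weight_def
  proof (rule sum.mono_neutral_left)
    show "finite ?S" using finite_V finite_E fin by auto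
    show "{p. p \<in> \<Gamma> \<and> weight \<Gamma> p u \<noteq> 0} \<subseteq> ?S"
    proof clarify
      fix p assume p: "p \<in> \<Gamma>" "weight \<Gamma> p u \<noteq> 0" "p \<notin> (\<Union>e\<in>E. \<gamma> e ` crit e u)"
      show "p \<in> V"
      proof (rule ccontr)
        assume "p \<notin> V"
        then obtain e where e: "e \<in> E" "p \<in> e" using p(1) Union_E by blast
        then obtain t where t: "t \<in> {0<..<1}" "p = \<gamma> e t" using edge[OF e(1)] by blast
        then have "t \<notin> crit e u" using p(3) e(1) by blast
        then show False using interior_noncritical(1)[OF u e(1) t(1)] p(2) t(2) by simp
      qed
    qed
    have "\<gamma> e t \<in> \<Gamma>" if "e \<in> E" "t \<in> crit e u" for e t
    proof -
      have "t \<in> {0<..<1}" using crit01[of e] that(2) by blast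
      then have "\<gamma> e t \<in> e" using half_in_edge[of "(e, False)" t] that(1) by (simp add: half_def)
      then show ?thesis using edge_sub[OF that(1)] by blast
    qed
    then have "?S \<subseteq> \<Gamma>" using V_sub by auto
    then show "\<forall>p\<in>?S - {p. p \<in> \<Gamma> \<and> weight \<Gamma> p u \<noteq> 0}. weight \<Gamma> p u = 0" by blast
  qed
  also have "\<dots> = (\<Sum>v\<in>V. weight \<Gamma> v u) + (\<Sum>e\<in>E. \<Sum>t\<in>crit e u. weight \<Gamma> (\<gamma> e t) u)"
    by (rule sum_over_pieces) (use crit01 fin in auto)
  also have "(\<Sum>e\<in>E. \<Sum>t\<in>crit e u. weight \<Gamma> (\<gamma> e t) u) = (\<Sum>e\<in>E. int (card (crit e u)))"
    using interior_critical(1)[OF u] by simp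
  also have "(\<Sum>v\<in>V. weight \<Gamma> v u) = (\<Sum>v\<in>V. int (card (halves v \<inter> descending u)) - 1 + (if v \<in> minima u then 2 else 0))"
    using vertex_weight(1)[OF u] by simp
  also have "\<dots> = int (card (descending u)) - int (card V) + 2 * int (card (V \<inter> minima u))"
    using finite_V by (simp add: sum.distrib sum_subtractf card_descending(2) sum.If_cases Int_def)
  finally have W: "total_weight \<Gamma> u = int (card (descending u)) - int (card V) + 2 * int (card (V \<inter> minima u)) + (\<Sum>e\<in>E. int (card (crit e u)))" .
  have ec: "int (card (crit e u)) = 2 * int (card (?mins e)) -
      ((if u \<bullet> direction (e, False) < 0 then 1 else 0) + (if u \<bullet> direction (e, True) < 0 then 1 else 0) - 1)" if e: "e \<in> E" for e
  proof -
    have nz: "u \<bullet> direction (e, b) \<noteq> 0" for b using u e unfolding good_def by auto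
    have ac: "u \<bullet> acc e t \<noteq> 0" if "t \<in> crit e u" for t using u e that unfolding good_def crit_def by auto
    have "(\<Sum>t\<in>crit e u. sgn (u \<bullet> acc e t)) = (\<Sum>t\<in>crit e u. 2 * (if u \<bullet> acc e t > 0 then 1 else 0) - 1)"
      using ac by (intro sum.cong) (auto simp: sgn_if)
    also have "\<dots> = 2 * real (card (?mins e)) - real (card (crit e u))"
      using fin(1)[OF e] by (simp add: sum_subtractf sum_distrib_left[symmetric] sum.If_cases Int_def)
    finally have "2 * (2 * real (card (?mins e)) - real (card (crit e u))) = - sgn (u \<bullet> direction (e, True)) - sgn (u \<bullet> direction (e, False))"
      using edge_count[OF u e] by simp
    then have "real_of_int (int (card (crit e u))) = real_of_int (2 * int (card (?mins e)) -
      ((if u \<bullet> direction (e, False) < 0 then 1 else 0) + (if u \<bullet> direction (e, True) < 0 then 1 else 0) - 1))"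
      using nz[of True] nz[of False] by (auto simp: sgn_if split: if_splits)
    then show ?thesis by linarith
  qed
  have "(\<Sum>e\<in>E. int (card (crit e u))) = (\<Sum>e\<in>E. 2 * int (card (?mins e)) -
      ((if u \<bullet> direction (e, False) < 0 then 1 else 0) + (if u \<bullet> direction (e, True) < 0 then 1 else 0) - 1))"
    by (intro sum.cong refl ec)
  also have "\<dots> = 2 * (\<Sum>e\<in>E. int (card (?mins e))) - int (card (descending u)) + int (card E)"
    unfolding card_descending(1) sum_subtractf sum_distrib_left by simp
  finally show "total_weight \<Gamma> u = 2 * int (card (minima u)) - 1 + int (first_betti \<Gamma>)"
    using W cardM first_betti_graph by simp
qed

lemma compact_\<Gamma>: "compact \<Gamma>" using graph by (simp add: semialgebraic_graph_def)

lemma minima_nonempty: "minima u \<noteq> {}"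
proof -
  have "continuous_on \<Gamma> (\<lambda>q. u \<bullet> q)" by (intro continuous_intros)
  from continuous_attains_inf[OF compact_\<Gamma> nonempty this] obtain p where "p \<in> \<Gamma>" "\<forall>q\<in>\<Gamma>. u \<bullet> p \<le> u \<bullet> q" by blast
  then have "p \<in> minima u" unfolding minima_def by (auto intro: exI[of _ 1])
  then show ?thesis by blast
qed

lemma card_minima_ge_1: "good u \<Longrightarrow> card (minima u) \<ge> 1"
  using total_weight_minima(1)[of u] minima_nonempty[of u] by (simp add: Suc_le_eq card_gt_0_iff)

lemma card_minima_bounded: "\<exists>N. \<forall>u. good u \<longrightarrow> card (minima u) \<le> N"
proof -
  obtain N where N: "\<forall>u. good u \<longrightarrow> (\<forall>e\<in>E. card (crit e u) \<le> N)" using crit_bounded by blast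
  have "card (minima u) \<le> card V + card E * N" if u: "good u" for u
  proof -
    have "card (minima u) \<le> card (V \<inter> minima u) + card (\<Union>e\<in>E. \<gamma> e ` {t\<in>crit e u. u \<bullet> acc e t > 0})"
      by (subst minima_decomposition[OF u]) (rule card_Un_le)
    also have "card (V \<inter> minima u) \<le> card V" using finite_V by (intro card_mono) auto
    also have "card (\<Union>e\<in>E. \<gamma> e ` {t\<in>crit e u. u \<bullet> acc e t > 0}) \<le> (\<Sum>e\<in>E. card (\<gamma> e ` {t\<in>crit e u. u \<bullet> acc e t > 0}))"
      by (rule card_UN_le[OF finite_E])
    also have "\<dots> \<le> (\<Sum>e\<in>E. N)"
    proof (rule sum_mono)
      fix e assume e: "e \<in> E"
      have "card (\<gamma> e ` {t\<in>crit e u. u \<bullet> acc e t > 0}) \<le> card {t\<in>crit e u. u \<bullet> acc e t > 0}"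
        using crit_finite[OF u e] by (intro card_image_le) auto
      also have "\<dots> \<le> card (crit e u)" using crit_finite[OF u e] by (intro card_mono) auto
      also have "\<dots> \<le> N" using N u e by blast
      finally show "card (\<gamma> e ` {t\<in>crit e u. u \<bullet> acc e t > 0}) \<le> N" .
    qed
    finally show ?thesis by simp
  qed
  then show ?thesis by blast
qed

text \<open>On the sphere of radius \<open>r\<close> around \<open>p\<close> the height exceeds that of \<open>p\<close> by
  some \<open>\<eta>\<close>. A direction closer to \<open>u\<close> than \<open>\<eta> / r\<close> changes height
  differences between \<open>p\<close> and that sphere by less than \<open>\<eta>\<close>, so its minimum on the
  closed ball is attained in the interior.\<close>

lemma strict_minimum_persists:
  assumes p: "p \<in> \<Gamma>" and r: "r > 0" "\<And>q. q \<in> \<Gamma> \<Longrightarrow> dist p q \<le> r \<Longrightarrow> q \<noteq> p \<Longrightarrow> u \<bullet> p < u \<bullet> q"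
  shows "\<exists>\<epsilon>>0. \<forall>w. dist w u < \<epsilon> \<longrightarrow> (\<exists>m\<in>minima w. dist p m < r)"
proof -
  let ?C = "\<Gamma> \<inter> sphere p r"
  have compC: "compact ?C" using compact_\<Gamma> by (intro compact_Int) auto
  have "\<exists>\<eta>>0. \<forall>q\<in>?C. u \<bullet> q - u \<bullet> p \<ge> \<eta>"
  proof (cases "?C = {}")
    case True then show ?thesis by (intro exI[of _ 1]) auto
  next
    case False
    have "continuous_on ?C (\<lambda>q. u \<bullet> q - u \<bullet> p)" by (intro continuous_intros)
    from continuous_attains_inf[OF compC False this] obtain q where q: "q \<in> ?C" "\<forall>y\<in>?C. u \<bullet> q - u \<bullet> p \<le> u \<bullet> y - u \<bullet> p" by blast
    have "u \<bullet> p < u \<bullet> q" using r(2)[of q] q(1) r(1) by auto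
    then show ?thesis using q(2) by (intro exI[of _ "u \<bullet> q - u \<bullet> p"]) auto
  qed
  then obtain \<eta> where \<eta>: "\<eta> > 0" "\<And>q. q \<in> ?C \<Longrightarrow> u \<bullet> q - u \<bullet> p \<ge> \<eta>" by blast
  show ?thesis
  proof (intro exI[of _ "\<eta> / r"] conjI allI impI)
    show "\<eta> / r > 0" using \<eta> r by simp
    fix w assume w: "dist w u < \<eta> / r"
    let ?B = "\<Gamma> \<inter> cball p r"
    have "compact ?B" using compact_\<Gamma> by (intro compact_Int) auto
    moreover have "p \<in> ?B" using p r(1) by simp
    moreover have "continuous_on ?B (\<lambda>q. w \<bullet> q)" by (intro continuous_intros)
    ultimately obtain m where m: "m \<in> ?B" "\<forall>q\<in>?B. w \<bullet> m \<le> w \<bullet> q"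
      using continuous_attains_inf[of ?B "\<lambda>q. w \<bullet> q"] by blast
    have "dist p m \<noteq> r"
    proof
      assume "dist p m = r"
      then have "u \<bullet> m - u \<bullet> p \<ge> \<eta>" using m(1) by (intro \<eta>(2)) simp
      moreover have "\<bar>(w - u) \<bullet> (m - p)\<bar> \<le> norm (w - u) * norm (m - p)" by (rule Cauchy_Schwarz_ineq2)
      moreover have "norm (w - u) * norm (m - p) < \<eta>"
        using w \<open>dist p m = r\<close> r(1) by (simp add: dist_norm norm_minus_commute pos_less_divide_eq)
      moreover have "w \<bullet> m - w \<bullet> p = (u \<bullet> m - u \<bullet> p) + (w - u) \<bullet> (m - p)" by (simp add: inner_diff_left inner_diff_right)
      ultimately have "w \<bullet> m - w \<bullet> p > 0" by linarith
      moreover have "w \<bullet> m \<le> w \<bullet> p" using m(2) \<open>p \<in> ?B\<close> by blast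
      ultimately show False by simp
    qed
    then have lt: "dist p m < r" using m(1) by simp
    have "w \<bullet> m \<le> w \<bullet> q" if "q \<in> \<Gamma>" "dist m q < r - dist p m" for q
    proof -
      have "dist p q \<le> r" using that(2) dist_triangle[of p q m] by simp
      then show ?thesis using m(2) that(1) by simp
    qed
    then have "m \<in> minima w" unfolding minima_def using m(1) lt by (auto intro!: exI[of _ "r - dist p m"])
    then show "\<exists>m\<in>minima w. dist p m < r" using lt by blast
  qed
qed

text \<open>Local minima for a nondegenerate direction are strict and finite in number, so they have disjoint
  neighbourhoods, and a nearby direction has a local minimum in each of them.\<close>

lemma card_minima_lower_semicontinuous:
  assumes u: "good u"
  shows "\<exists>\<epsilon>>0. \<forall>w. good w \<longrightarrow> dist w u < \<epsilon> \<longrightarrow> card (minima u) \<le> card (minima w)"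
proof -
  let ?M = "minima u"
  have finM: "finite ?M" by (rule total_weight_minima(1)[OF u])
  let ?P = "\<lambda>p r. (\<forall>q\<in>\<Gamma>. dist p q \<le> r \<longrightarrow> q \<noteq> p \<longrightarrow> u \<bullet> p < u \<bullet> q) \<and> (\<forall>p'\<in>?M. p' \<noteq> p \<longrightarrow> 2 * r < dist p p')"
  have "\<exists>r>0. \<forall>p\<in>?M. ?P p r"
  proof (rule finite_uniform_positive[OF finM])
    fix p assume p: "p \<in> ?M"
    obtain r1 where r1: "r1 > 0" "\<forall>q\<in>\<Gamma>. dist p q < r1 \<longrightarrow> q \<noteq> p \<longrightarrow> u \<bullet> p < u \<bullet> q"
      using minima_strict[OF u p] by blast
    have "closed (?M - {p})" using finM by (intro finite_imp_closed) auto
    from closed_avoid[OF this, of p] obtain r2 where r2: "r2 > 0" "\<forall>q. dist p q < r2 \<longrightarrow> q \<notin> ?M - {p}" by blast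
    let ?r = "min r1 r2 / 3"
    have "?r > 0" "?r < r1" "2 * ?r < r2" using r1(1) r2(1) by auto
    moreover have "?P p ?r"
    proof (intro conjI ballI impI)
      show "u \<bullet> p < u \<bullet> q" if "q \<in> \<Gamma>" "dist p q \<le> ?r" "q \<noteq> p" for q
        using r1(2) that \<open>?r < r1\<close> by (meson le_less_trans)
      show "2 * ?r < dist p p'" if "p' \<in> ?M" "p' \<noteq> p" for p'
        using r2(2) that \<open>2 * ?r < r2\<close> by (metis DiffI empty_iff insert_iff less_le_trans not_le)
    qed
    ultimately show "\<exists>r>0. ?P p r" by blast
  next
    fix p and r r' :: real assume P: "?P p r" and r: "0 < r'" "r' \<le> r"
    show "?P p r'"
    proof (intro conjI ballI impI)
      show "u \<bullet> p < u \<bullet> q" if "q \<in> \<Gamma>" "dist p q \<le> r'" "q \<noteq> p" for q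
        using P that r by (meson order_trans)
      show "2 * r' < dist p p'" if "p' \<in> ?M" "p' \<noteq> p" for p'
      proof -
        have "2 * r < dist p p'" using P that by blast
        then show ?thesis using r(2) by linarith
      qed
    qed
  qed
  then obtain r where r: "r > 0" "\<forall>p\<in>?M. ?P p r" by blast
  have "\<exists>\<epsilon>>0. \<forall>p\<in>?M. \<forall>w. dist w u < \<epsilon> \<longrightarrow> (\<exists>m\<in>minima w. dist p m < r)"
  proof (rule finite_uniform_positive[OF finM])
    fix p assume p: "p \<in> ?M"
    show "\<exists>\<epsilon>>0. \<forall>w. dist w u < \<epsilon> \<longrightarrow> (\<exists>m\<in>minima w. dist p m < r)"
    proof (rule strict_minimum_persists)
      show "p \<in> \<Gamma>" using p by (simp add: minima_def)
      show "u \<bullet> p < u \<bullet> q" if "q \<in> \<Gamma>" "dist p q \<le> r" "q \<noteq> p" for q using bspec[OF r(2) p] that by blast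
    qed (rule r(1))
  next
    fix p and \<epsilon> \<epsilon>' :: real
    assume "\<forall>w. dist w u < \<epsilon> \<longrightarrow> (\<exists>m\<in>minima w. dist p m < r)" "\<epsilon>' \<le> \<epsilon>"
    then show "\<forall>w. dist w u < \<epsilon>' \<longrightarrow> (\<exists>m\<in>minima w. dist p m < r)" by (meson less_le_trans)
  qed
  then obtain \<epsilon> where \<epsilon>: "\<epsilon> > 0" "\<forall>p\<in>?M. \<forall>w. dist w u < \<epsilon> \<longrightarrow> (\<exists>m\<in>minima w. dist p m < r)" by blast
  have "card ?M \<le> card (minima w)" if w: "good w" "dist w u < \<epsilon>" for w
  proof -
    have "\<forall>p\<in>?M. \<exists>m. m \<in> minima w \<and> dist p m < r" using \<epsilon>(2) w(2) by blast
    then obtain f where f: "\<forall>p\<in>?M. f p \<in> minima w \<and> dist p (f p) < r" by (rule bchoice[THEN exE])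
    show ?thesis
    proof (rule card_inj_on_le[of f])
      show "inj_on f ?M"
      proof (rule inj_onI)
        fix p p' assume p: "p \<in> ?M" "p' \<in> ?M" "f p = f p'"
        show "p = p'"
        proof (rule ccontr)
          assume "p \<noteq> p'"
          then have "p' \<noteq> p" by simp
          then have "2 * r < dist p p'" using bspec[OF r(2) p(1)] p(2) by blast
          moreover have "dist p p' \<le> dist p (f p) + dist p' (f p')"
            using dist_triangle[of p p' "f p"] p(3) by (simp add: dist_commute)
          moreover have "dist p (f p) < r" "dist p' (f p') < r" using f p by blast+
          ultimately show False by linarith
        qed
      qed
      show "f ` ?M \<subseteq> minima w" using f by blast
      show "finite (minima w)" by (rule total_weight_minima(1)[OF w(1)])
    qed
  qed
  then show ?thesis using \<epsilon>(1) by blast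
qed

end

section \<open>Area on the sphere\<close>

lemma sgn_measurable:
  "sgn \<in> restrict_space lborel (cball 0 1 - {0}) \<rightarrow>\<^sub>M restrict_space borel (sphere 0 (1::real) :: (real^3) set)"
proof (rule measurable_restrict_space2)
  show "sgn \<in> space (restrict_space lborel (cball 0 1 - {0})) \<rightarrow> sphere 0 (1::real)"
    by (auto simp: space_restrict_space norm_sgn)
  have "continuous_on (- {0}) (sgn :: real^3 \<Rightarrow> real^3)" by (intro continuous_intros) auto
  then have "continuous_on (cball 0 1 - {0}) (sgn :: real^3 \<Rightarrow> real^3)" by (rule continuous_on_subset) auto
  then have "sgn \<in> borel_measurable (restrict_space borel (cball 0 1 - {0::real^3}))" by (rule borel_measurable_continuous_on_restrict)
  moreover have "sets (restrict_space lborel (cball 0 1 - {0::real^3})) = sets (restrict_space borel (cball 0 1 - {0}))"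
    by (intro sets_restrict_space_cong) simp
  ultimately show "sgn \<in> borel_measurable (restrict_space lborel (cball 0 1 - {0::real^3}))"
    using measurable_cong_sets by blast
qed

lemma space_sphere_area: "space sphere_area = sphere 0 1"
  by (simp add: sphere_area_def space_scale_measure space_restrict_space)

lemma sets_sphere_area: "sets sphere_area = sets (restrict_space borel (sphere 0 1))"
  by (simp add: sphere_area_def)

lemma in_sets_sphere_area: "A \<in> sets borel \<Longrightarrow> A \<subseteq> sphere 0 1 \<Longrightarrow> A \<in> sets sphere_area"
  by (simp add: sets_sphere_area sets_restrict_space_iff)

lemma emeasure_sphere_area:
  assumes A: "A \<in> sets borel" "A \<subseteq> sphere 0 1"
  shows "emeasure sphere_area A = 3 * emeasure lborel {x \<in> cball 0 1 - {0}. sgn x \<in> A}"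
proof -
  have A': "A \<in> sets (restrict_space borel (sphere 0 1))" using A by (simp add: sets_restrict_space_iff)
  have "emeasure sphere_area A = 3 * emeasure (restrict_space lborel (cball 0 1 - {0})) (sgn -` A \<inter> space (restrict_space lborel (cball 0 1 - {0})))"
    unfolding sphere_area_def by (simp add: emeasure_distr[OF sgn_measurable A'])
  also have "emeasure (restrict_space lborel (cball 0 1 - {0})) (sgn -` A \<inter> space (restrict_space lborel (cball 0 1 - {0})))
      = emeasure lborel (sgn -` A \<inter> space (restrict_space lborel (cball 0 1 - {0})))"
    by (rule emeasure_restrict_space) (auto simp: space_restrict_space)
  also have "sgn -` A \<inter> space (restrict_space lborel (cball 0 1 - {0})) = {x \<in> cball 0 1 - {0}. sgn x \<in> A}"
    by (auto simp: space_restrict_space)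
  finally show ?thesis .
qed

lemma emeasure_sphere_area_space: "emeasure sphere_area (sphere 0 1) = ennreal (4 * pi)"
proof -
  have eq: "{x \<in> cball 0 1 - {0::real^3}. sgn x \<in> sphere 0 1} = cball 0 1 - {0}"
    by (auto simp: norm_sgn)
  have "emeasure lborel (cball 0 1 - {0::real^3}) = emeasure lborel (cball (0::real^3) 1)"
    by (rule emeasure_Diff_null_set) auto
  also have "\<dots> = ennreal (4/3 * pi)"
    by (simp add: emeasure_cball unit_ball_vol_3)
  finally have "emeasure lborel {x \<in> cball 0 1 - {0::real^3}. sgn x \<in> sphere 0 1} = ennreal (4/3 * pi)"
    unfolding eq .
  then have "emeasure sphere_area (sphere 0 1) = 3 * ennreal (4/3 * pi)"
    using emeasure_sphere_area[of "sphere 0 1"] by simp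
  also have "\<dots> = ennreal (4 * pi)"
    by (subst ennreal_numeral[symmetric], subst ennreal_mult[symmetric]) auto
  finally show ?thesis .
qed

lemma finite_sphere_area: "finite_measure sphere_area"
  by (rule finite_measureI) (simp add: space_sphere_area emeasure_sphere_area_space)

lemma measure_sphere_area_space: "measure sphere_area (sphere 0 1) = 4 * pi"
  by (simp add: measure_def emeasure_sphere_area_space)

text \<open>The cone over the set contains a nonempty open set, for instance around \<open>u / 2\<close>.\<close>

lemma sphere_area_open_pos:
  assumes "u \<in> sphere 0 1" "\<epsilon> > 0"
  shows "emeasure sphere_area {w \<in> sphere 0 1. dist w u < \<epsilon>} \<noteq> 0"
proof
  let ?A = "{w \<in> sphere 0 1. dist w u < \<epsilon>}"
  have Aeq: "?A = sphere 0 1 \<inter> ball u \<epsilon>" by (auto simp: dist_commute)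
  have Ab: "?A \<in> sets borel" unfolding Aeq by auto
  assume "emeasure sphere_area ?A = 0"
  then have z: "emeasure lborel {x \<in> cball 0 1 - {0}. sgn x \<in> ?A} = 0"
  proof -
    have "?A \<subseteq> sphere 0 1" by blast
    from emeasure_sphere_area[OF Ab this]
    have "3 * emeasure lborel {x \<in> cball 0 1 - {0}. sgn x \<in> ?A} = 0"
      by (simp only: \<open>emeasure sphere_area ?A = 0\<close>)
    then show ?thesis by (simp only: mult_eq_0_iff) simp
    qed
  let ?O = "{x \<in> ball 0 1 - {0}. sgn x \<in> ball u \<epsilon>}"
  have "continuous_on (ball 0 1 - {0}) (sgn :: real^3 \<Rightarrow> real^3)" by (intro continuous_intros) auto
  then have op: "open ?O"
    using continuous_open_preimage[of "ball 0 1 - {0}" sgn "ball u \<epsilon>"]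
    by (simp add: open_Diff Int_def vimage_def conj_commute)
  have sub: "?O \<subseteq> {x \<in> cball 0 1 - {0}. sgn x \<in> ?A}"
    by (auto simp: norm_sgn dist_commute)
  have meas: "{x \<in> cball 0 1 - {0}. sgn x \<in> ?A} \<in> sets lborel"
  proof -
    have "sgn -` ?A \<inter> space (restrict_space lborel (cball 0 1 - {0})) \<in> sets (restrict_space lborel (cball 0 1 - {0}))"
      by (rule measurable_sets[OF sgn_measurable]) (use Ab in \<open>auto simp: sets_restrict_space_iff\<close>)
    moreover have "sgn -` ?A \<inter> space (restrict_space lborel (cball 0 1 - {0})) = {x \<in> cball 0 1 - {0}. sgn x \<in> ?A}"
      by (auto simp: space_restrict_space)
    ultimately show ?thesis by (auto simp: sets_restrict_space_iff)
  qed
  have "emeasure lborel ?O = 0" using emeasure_mono[OF sub meas] z by simp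
  then have "?O \<in> null_sets lborel" using op by auto
  then have "negligible ?O" by (simp add: negligible_iff_null_sets null_sets_completionI)
  moreover have "(1/2) *\<^sub>R u \<in> ?O" using assms by (auto simp: sgn_scaleR sgn_div_norm)
  ultimately show False using open_not_negligible[OF op] by blast
qed

section \<open>Degenerate directions\<close>

lemma negligible_finite_UN:
  "finite I \<Longrightarrow> (\<And>i. i \<in> I \<Longrightarrow> negligible (A i)) \<Longrightarrow> negligible (\<Union>i\<in>I. A i)"
  by (rule negligible_Union) auto

context regular_semialgebraic_arc
begin

text \<open>The vectors orthogonal to \<open>v\<close> are the products \<open>v \<times> y\<close>. Since \<open>y\<close>
  may be altered by multiples of \<open>v\<close>, its coordinate \<open>i\<close> can be made 0, which leaves two
  free parameters.\<close>

lemma orthogonal_as_cross3: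
  fixes x v :: "real^3"
  assumes "x \<bullet> v = 0" and ijk: "i \<noteq> j" "i \<noteq> k" "j \<noteq> (k::3)" and vi: "v $ i \<noteq> 0"
  shows "\<exists>a b. x = cross3 v (a *\<^sub>R axis j 1 + b *\<^sub>R axis k 1)"
proof -
  have v0: "v \<noteq> 0" using vi by auto
  define y where "y = (1 / (v \<bullet> v)) *\<^sub>R cross3 x v"
  have "cross3 v (cross3 x v) = (v \<bullet> v) *\<^sub>R x - (v \<bullet> x) *\<^sub>R v" by (simp add: Lagrange)
  then have x: "x = cross3 v y" using assms(1) v0 by (simp add: y_def cross_mult_right inner_commute)
  define z where "z = y - (y $ i / v $ i) *\<^sub>R v"
  have "cross3 v z = x" by (simp add: z_def x Cross3.right_diff_distrib cross_mult_right cross_refl)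
  moreover have "z $ i = 0" using vi by (simp add: z_def)
  moreover have "z = z $ j *\<^sub>R axis j 1 + z $ k *\<^sub>R axis k 1"
    unfolding vec_eq_iff
  proof
    fix l
    consider "l = i" | "l = j" | "l = k" using UNIV_3_distinct[OF ijk] by blast
    then show "z $ l = (z $ j *\<^sub>R axis j 1 + z $ k *\<^sub>R axis k 1) $ l"
      using ijk \<open>z $ i = 0\<close> by cases (auto simp: axis_def)
  qed
  ultimately show ?thesis by metis
qed

text \<open>Sard's theorem for \<open>F (t, a, b) = vel t \<times> (a e\<^sub>j + b e\<^sub>k)\<close>, whose values are the
  vectors orthogonal to \<open>vel t\<close>. If \<open>F\<close> is also orthogonal to \<open>acc t\<close> at a
  point, then the derivative of \<open>F\<close> takes all its values orthogonal to \<open>vel t\<close> and has rank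
  at most 2 there; hence degenerate vectors are critical values.\<close>

lemma negligible_degenerate_part:
  assumes ijk: "i \<noteq> j" "i \<noteq> k" "j \<noteq> (k::3)"
  shows "negligible {x. \<exists>t\<in>{0<..<1}. vel t $ i \<noteq> 0 \<and> x \<bullet> vel t = 0 \<and> x \<bullet> acc t = 0}"
proof -
  define y :: "real^3 \<Rightarrow> real^3" where "y s = s $ 2 *\<^sub>R axis j 1 + s $ 3 *\<^sub>R axis k 1" for s
  define F where "F s = cross3 (vel (s $ 1)) (y s)" for s :: "real^3"
  define F' where "F' s h = cross3 (vel (s $ 1)) (y h) + cross3 (h $ 1 *\<^sub>R acc (s $ 1)) (y s)" for s h :: "real^3"
  define S where "S = {s :: real^3. s $ 1 \<in> {0<..<1} \<and> F s \<bullet> acc (s $ 1) = 0}"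
  have "negligible (F ` S)"
  proof (rule baby_Sard[where f' = F'])
    fix s assume s: "s \<in> S"
    then have t: "s $ 1 \<in> {0<..<1}" by (simp add: S_def)
    have v: "(vel has_derivative (\<lambda>h. h *\<^sub>R acc (s $ 1))) (at (s $ 1))"
      using has_acc[OF t] by (simp add: has_vector_derivative_def)
    have "((\<lambda>s::real^3. s $ 1) has_derivative (\<lambda>h. h $ 1)) (at s)"
      by (intro bounded_linear_imp_has_derivative bounded_linear_vec_nth)
    from has_derivative_compose[OF this v]
    have 1: "((\<lambda>s. vel (s $ 1)) has_derivative (\<lambda>h. h $ 1 *\<^sub>R acc (s $ 1))) (at s)" .
    have 2: "(y has_derivative y) (at s)"
    proof -
      have "bounded_linear y" unfolding y_def
        by (intro bounded_linear_add bounded_linear_compose[OF bounded_linear_scaleR_left bounded_linear_vec_nth])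
      then show ?thesis by (rule bounded_linear_imp_has_derivative)
    qed
    have "bounded_bilinear (cross3 :: real^3 \<Rightarrow> _)" using bilinear_cross bilinear_conv_bounded_bilinear by blast
    from bounded_bilinear.FDERIV[OF this 1 2]
    show "(F has_derivative F' s) (at s within S)"
      unfolding F_def F'_def by (rule has_derivative_at_withinI)
    have ort: "F' s h \<bullet> vel (s $ 1) = 0" for h
    proof -
      have "cross3 (acc (s $ 1)) (y s) \<bullet> vel (s $ 1) = - (cross3 (vel (s $ 1)) (y s) \<bullet> acc (s $ 1))"
        by (simp add: cross3_simps)
      also have "\<dots> = 0" using s by (simp add: S_def F_def)
      finally show ?thesis unfolding F'_def
        by (simp add: inner_left_distrib cross_mult_left) (simp add: cross3_simps)
    qed
    have lin: "linear (F' s)"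
      using \<open>(F has_derivative F' s) (at s within S)\<close> has_derivative_linear by blast
    show "rank (matrix (F' s)) < CARD(3)"
    proof -
      have "rank (matrix (F' s)) \<noteq> CARD(3)"
      proof
        assume "rank (matrix (F' s)) = CARD(3)"
        then have "surj ((*v) (matrix (F' s)))" using full_rank_surjective by blast
        then obtain h where "matrix (F' s) *v h = vel (s $ 1)" unfolding surj_def by metis
        then have "F' s h = vel (s $ 1)" using matrix_works[OF lin[unfolded linear_matrix_vector_mul_eq[symmetric]]] lin by (simp add: matrix_works)
        then show False using ort[of h] vel_nonzero[OF t] by simp
      qed
      moreover have "rank (matrix (F' s)) \<le> CARD(3)" using rank_bound[of "matrix (F' s)"] by simp
      ultimately show ?thesis by simp
    qed
  qed simp
  moreover have "{x. \<exists>t\<in>{0<..<1}. vel t $ i \<noteq> 0 \<and> x \<bullet> vel t = 0 \<and> x \<bullet> acc t = 0} \<subseteq> F ` S"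
  proof clarify
    fix x t assume t: "t \<in> {0<..<1}" "vel t $ i \<noteq> 0" "x \<bullet> vel t = 0" "x \<bullet> acc t = 0"
    obtain a b where x: "x = cross3 (vel t) (a *\<^sub>R axis j 1 + b *\<^sub>R axis k 1)"
      using orthogonal_as_cross3[OF t(3) ijk t(2)] by blast
    have F: "F (vector [t, a, b]) = x" unfolding F_def y_def by (simp add: x)
    have "vector [t, a, b] \<in> S" using t F by (simp add: S_def)
    then have "F (vector [t, a, b]) \<in> F ` S" by (rule imageI)
    then show "x \<in> F ` S" by (simp only: F)
  qed
  ultimately show ?thesis by (rule negligible_subset)
qed

lemma negligible_degenerate: "negligible {x. \<exists>t\<in>{0<..<1}. x \<bullet> vel t = 0 \<and> x \<bullet> acc t = 0}"
proof -
  have "negligible (\<Union>i\<in>UNIV. {x. \<exists>t\<in>{0<..<1}. vel t $ i \<noteq> 0 \<and> x \<bullet> vel t = 0 \<and> x \<bullet> acc t = 0})"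
  proof (intro negligible_finite_UN finite)
    fix i :: 3
    obtain j k where "i \<noteq> j" "i \<noteq> k" "j \<noteq> (k::3)" using ex_distinct_3 by blast
    then show "negligible {x. \<exists>t\<in>{0<..<1}. vel t $ i \<noteq> 0 \<and> x \<bullet> vel t = 0 \<and> x \<bullet> acc t = 0}"
      by (rule negligible_degenerate_part)
  qed
  then show ?thesis
  proof (rule negligible_subset)
    show "{x. \<exists>t\<in>{0<..<1}. x \<bullet> vel t = 0 \<and> x \<bullet> acc t = 0}
        \<subseteq> (\<Union>i\<in>UNIV. {x. \<exists>t\<in>{0<..<1}. vel t $ i \<noteq> 0 \<and> x \<bullet> vel t = 0 \<and> x \<bullet> acc t = 0})"
    proof clarify
      fix x t assume t: "t \<in> {0<..<1::real}" "x \<bullet> vel t = 0" "x \<bullet> acc t = 0"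
      obtain i where "vel t $ i \<noteq> 0" using vel_nonzero[OF t(1)] by (auto simp: vec_eq_iff)
      then show "x \<in> (\<Union>i\<in>UNIV. {x. \<exists>t\<in>{0<..<1}. vel t $ i \<noteq> 0 \<and> x \<bullet> vel t = 0 \<and> x \<bullet> acc t = 0})"
        using t by blast
    qed
  qed
qed

text \<open>For parameters in a compact interval the set is a projection along a compact factor, hence closed; the open
  interval is a countable union of compact ones.\<close>

lemma borel_degenerate: "{x. \<exists>t\<in>{0<..<1}. x \<bullet> vel t = 0 \<and> x \<bullet> acc t = 0} \<in> sets borel"
proof -
  let ?I = "\<lambda>n::nat. {inverse (real (n + 2))..1 - inverse (real (n + 2))}"
  let ?C = "\<lambda>n. {x. \<exists>t. t \<in> ?I n \<and> (t, x) \<in> {p \<in> ?I n \<times> UNIV. (snd p \<bullet> vel (fst p), snd p \<bullet> acc (fst p)) \<in> {(0, 0)}}}"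
  have I: "?I n \<subseteq> {0<..<1}" for n
  proof
    fix t assume t: "t \<in> ?I n"
    have "inverse (real (n + 2)) > 0" by simp
    then show "t \<in> {0<..<1}" using t by (metis atLeastAtMost_iff diff_gt_0_iff_gt diff_add_cancel greaterThanLessThan_iff le_diff_eq less_le_trans add_less_cancel_left add.commute less_add_same_cancel1 order_le_less_trans)
  qed
  have "closed (?C n)" for n
  proof (rule closed_compact_projection)
    show "compact (?I n)" by simp
    have cv: "continuous_on (?I n) vel" "continuous_on (?I n) acc"
      using isCont_vel isCont_acc I[of n] by (auto intro!: continuous_at_imp_continuous_on)
    have "continuous_on (?I n \<times> UNIV) (\<lambda>p. (snd p \<bullet> vel (fst p), snd p \<bullet> acc (fst p)))"
      by (intro continuous_intros continuous_on_compose2[OF cv(1)] continuous_on_compose2[OF cv(2)]) auto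
    from continuous_closed_preimage[OF this closed_Times[OF closed_real_atLeastAtMost closed_UNIV] closed_singleton, of "(0,0)"]
    show "closed {p \<in> ?I n \<times> (UNIV :: (real^3) set). (snd p \<bullet> vel (fst p), snd p \<bullet> acc (fst p)) \<in> {(0, 0)}}"
      by (simp add: Int_def vimage_def conj_commute)
  qed
  then have "(\<Union>n. ?C n) \<in> sets borel" by (intro sets.countable_UN) auto
  moreover have "{x. \<exists>t\<in>{0<..<1}. x \<bullet> vel t = 0 \<and> x \<bullet> acc t = 0} = (\<Union>n. ?C n)"
  proof (intro equalityI subsetI)
    fix x assume "x \<in> {x. \<exists>t\<in>{0<..<1}. x \<bullet> vel t = 0 \<and> x \<bullet> acc t = 0}"
    then obtain t where t: "t \<in> {0<..<1}" "x \<bullet> vel t = 0" "x \<bullet> acc t = 0" by blast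
    then have "min t (1 - t) > 0" by auto
    then obtain n where n: "inverse (real (Suc n)) < min t (1 - t)" using reals_Archimedean by blast
    have "inverse (real (n + 2)) \<le> inverse (real (Suc n))" by (intro le_imp_inverse_le) auto
    moreover have "inverse (real (Suc n)) < t" "inverse (real (Suc n)) < 1 - t" using n by linarith+
    ultimately have "t \<in> ?I n" unfolding atLeastAtMost_iff by linarith
    then show "x \<in> (\<Union>n. ?C n)" using t by auto
  next
    fix x assume "x \<in> (\<Union>n. ?C n)"
    then show "x \<in> {x. \<exists>t\<in>{0<..<1}. x \<bullet> vel t = 0 \<and> x \<bullet> acc t = 0}" using I by fastforce
  qed
  ultimately show ?thesis by simp
qed

end

context semialg_graph
begin

text \<open>A cone in the whole space, so that its Lebesgue measure controls the area of its trace on the sphere.\<close>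

definition bad :: "(real^3) set" where
  "bad = (\<Union>e\<in>E. {x. \<exists>t\<in>{0<..<1}. x \<bullet> vel e t = 0 \<and> x \<bullet> acc e t = 0}) \<union> (\<Union>y\<in>E \<times> UNIV. {x. x \<bullet> direction y = 0})"

lemma good_iff: "good u \<longleftrightarrow> u \<in> sphere 0 1 \<and> u \<notin> bad"
  unfolding good_def bad_def by (auto simp: mem_Times_iff)

lemma borel_bad: "bad \<in> sets borel"
proof -
  have "{x. \<exists>t\<in>{0<..<1}. x \<bullet> vel e t = 0 \<and> x \<bullet> acc e t = 0} \<in> sets borel" if "e \<in> E" for e
    by (rule regular_semialgebraic_arc.borel_degenerate[OF \<gamma>_arc[OF that]])
  moreover have "{x. x \<bullet> direction y = 0} \<in> sets borel" for y
  proof -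
    have "closed {x. x \<bullet> direction y = 0}" by (intro closed_Collect_eq continuous_intros)
    then show ?thesis by simp
  qed
  ultimately show ?thesis unfolding bad_def using finite_E by (intro sets.Un sets.finite_UN) auto
qed

lemma negligible_bad: "negligible bad"
proof -
  have "negligible {x. \<exists>t\<in>{0<..<1}. x \<bullet> vel e t = 0 \<and> x \<bullet> acc e t = 0}" if "e \<in> E" for e
    by (rule regular_semialgebraic_arc.negligible_degenerate[OF \<gamma>_arc[OF that]])
  moreover have "negligible {x. x \<bullet> direction y = 0}" if "fst y \<in> E" for y
  proof -
    have "direction y \<noteq> 0" using direction(1)[OF that] by auto
    then have "negligible {x. direction y \<bullet> x = 0}" by (intro negligible_hyperplane) auto
    then show ?thesis by (simp add: inner_commute)
  qed
  ultimately show ?thesis unfolding bad_def using finite_E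
    by (intro negligible_Un negligible_finite_UN) (auto simp: mem_Times_iff)
qed

lemma bad_cone: "x \<noteq> 0 \<Longrightarrow> sgn x \<in> bad \<Longrightarrow> x \<in> bad"
  unfolding bad_def by (auto simp: sgn_div_norm)

lemma good_set: "{u. good u} = sphere 0 1 - bad" by (auto simp: good_iff)

lemma good_borel: "{u. good u} \<in> sets borel"
  unfolding good_set using borel_bad by (intro sets.Diff) auto

lemma good_measurable: "{u. good u} \<in> sets sphere_area"
  by (rule in_sets_sphere_area[OF good_borel]) (auto simp: good_iff)

lemma AE_good: "AE u in sphere_area. good u"
proof (rule AE_I)
  let ?B = "sphere 0 1 \<inter> bad"
  have B: "?B \<in> sets borel" using borel_bad by auto
  show "{u \<in> space sphere_area. \<not> good u} \<subseteq> ?B" by (auto simp: space_sphere_area good_iff)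
  show "?B \<in> sets sphere_area" by (rule in_sets_sphere_area[OF B]) auto
  have "bad \<in> null_sets lebesgue" using negligible_bad negligible_iff_null_sets by blast
  then have "bad \<in> null_sets lborel" using borel_bad by (simp add: null_sets_completion_iff)
  then have z: "emeasure lborel bad = 0" by (rule null_setsD1)
  have "{x \<in> cball 0 1 - {0}. sgn x \<in> ?B} \<subseteq> bad" using bad_cone by auto
  then have "emeasure lborel {x \<in> cball 0 1 - {0}. sgn x \<in> ?B} \<le> emeasure lborel bad"
    by (rule emeasure_mono) (use borel_bad in simp)
  then have "emeasure lborel {x \<in> cball 0 1 - {0}. sgn x \<in> ?B} = 0" unfolding z by simp
  then show "emeasure sphere_area ?B = 0" using emeasure_sphere_area[OF B] by simp
qed

text \<open>The difference between the weight and its smallest possible value, extended by 0 to the degenerate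
  directions.\<close>

definition excess :: "real^3 \<Rightarrow> real" where
  "excess u = indicator {u. good u} u * (2 * (real (card (minima u)) - 1))"

lemma excess_nonneg: "excess u \<ge> 0"
  using card_minima_ge_1[of u] by (auto simp: excess_def indicator_def)

lemma excess_good: "good u \<Longrightarrow> excess u = 2 * (real (card (minima u)) - 1)"
  by (simp add: excess_def)

text \<open>By lower semicontinuity the set is relatively open in the set of nondegenerate directions.\<close>

lemma borel_card_minima: "{u. good u \<and> c \<le> real (card (minima u))} \<in> sets borel"
proof -
  let ?A = "{u. good u \<and> c \<le> real (card (minima u))}"
  have "\<forall>u\<in>?A. \<exists>\<epsilon>>0. \<forall>w. good w \<longrightarrow> dist w u < \<epsilon> \<longrightarrow> card (minima u) \<le> card (minima w)"
    using card_minima_lower_semicontinuous by blast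
  then obtain \<epsilon> where \<epsilon>: "\<forall>u\<in>?A. \<epsilon> u > 0 \<and> (\<forall>w. good w \<longrightarrow> dist w u < \<epsilon> u \<longrightarrow> card (minima u) \<le> card (minima w))"
    by (rule bchoice[THEN exE])
  have eq: "?A = {u. good u} \<inter> (\<Union>u\<in>?A. ball u (\<epsilon> u))"
  proof (intro equalityI subsetI)
    fix u assume u: "u \<in> ?A"
    then have "u \<in> ball u (\<epsilon> u)" using \<epsilon> by simp
    then show "u \<in> {u. good u} \<inter> (\<Union>u\<in>?A. ball u (\<epsilon> u))" using u by blast
  next
    fix w assume "w \<in> {u. good u} \<inter> (\<Union>u\<in>?A. ball u (\<epsilon> u))"
    then obtain u where u: "u \<in> ?A" "w \<in> ball u (\<epsilon> u)" and w: "good w" by blast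
    then have "card (minima u) \<le> card (minima w)" using \<epsilon> by (auto simp: dist_commute)
    then show "w \<in> ?A" using u(1) w by auto
  qed
  have "open (\<Union>u\<in>?A. ball u (\<epsilon> u))" by (intro open_UN) auto
  then have "(\<Union>u\<in>?A. ball u (\<epsilon> u)) \<in> sets borel" by (rule borel_open)
  from sets.Int[OF good_borel this] show ?thesis by (subst eq)
qed

lemma excess_measurable: "excess \<in> borel_measurable sphere_area"
proof (subst borel_measurable_iff_ge, intro allI)
  fix c :: real
  show "{u \<in> space sphere_area. c \<le> excess u} \<in> sets sphere_area"
  proof (cases "c \<le> 0")
    case True
    then have "{u \<in> space sphere_area. c \<le> excess u} = space sphere_area"
      using excess_nonneg order_trans by blast
    then show ?thesis by simp
  next
    case False
    then have eq: "{u \<in> space sphere_area. c \<le> excess u} = {u. good u \<and> c / 2 + 1 \<le> real (card (minima u))}"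
      by (auto simp: space_sphere_area excess_def indicator_def good_iff field_simps split: if_splits)
    show ?thesis unfolding eq
      by (rule in_sets_sphere_area[OF borel_card_minima]) (auto simp: good_iff)
  qed
qed

lemma excess_integrable: "integrable sphere_area excess"
proof -
  interpret finite_measure sphere_area by (rule finite_sphere_area)
  obtain N where N: "\<And>u. good u \<Longrightarrow> card (minima u) \<le> N" using card_minima_bounded by blast
  show ?thesis
  proof (rule integrable_const_bound[where B = "2 * real N"])
    have "norm (excess u) \<le> 2 * real N" for u
    proof (cases "good u")
      case True
      then have "real (card (minima u)) \<le> real N" using N by simp
      then show ?thesis using excess_nonneg[of u] excess_good[OF True] by simp
    qed (simp add: excess_def)
    then show "AE u in sphere_area. norm (excess u) \<le> 2 * real N" by simp
  qed (rule excess_measurable)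
qed

text \<open>The sphere has area \<open>4 * pi\<close> and almost every direction is nondegenerate.\<close>

lemma total_curvature_excess:
  "total_curvature \<Gamma> V E = 1 + real (first_betti \<Gamma>) + (LINT u|sphere_area. excess u) / (4 * pi)"
proof -
  interpret finite_measure sphere_area by (rule finite_sphere_area)
  let ?b = "1 + real (first_betti \<Gamma>)"
  have eq: "indicator {u. nondegenerate \<Gamma> V E u} u *\<^sub>R real_of_int (total_weight \<Gamma> u) = indicator {u. good u} u * ?b + excess u" for u
    by (cases "good u") (auto simp: nondegenerate_iff_good total_weight_minima(2) excess_def)
  have int1: "integrable sphere_area (\<lambda>u. indicator {u. good u} u * ?b)"
    using good_measurable by (intro integrable_mult_left integrable_real_indicator) (auto simp: emeasure_eq_measure)
  have "(LINT u|sphere_area. indicator {u. good u} u * ?b + excess u) = (LINT u|sphere_area. indicator {u. good u} u * ?b) + (LINT u|sphere_area. excess u)"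
    by (rule Bochner_Integration.integral_add[OF int1 excess_integrable])
  also have "(LINT u|sphere_area. indicator {u. good u} u * ?b) = (LINT u|sphere_area. ?b)"
    using AE_good int1 by (intro integral_cong_AE) auto
  also have "\<dots> = 4 * pi * ?b" by (simp add: space_sphere_area measure_sphere_area_space)
  finally have "(LINT u:{u. nondegenerate \<Gamma> V E u}|sphere_area. real_of_int (total_weight \<Gamma> u)) = 4 * pi * ?b + (LINT u|sphere_area. excess u)"
    unfolding set_lebesgue_integral_def eq .
  then show ?thesis unfolding total_curvature_def by (simp add: field_simps)
qed

text \<open>An integral of a nonnegative function vanishes only if the function does almost everywhere. If some
  nondegenerate direction had positive excess, then so would all nondegenerate directions near it, and these make up a
  set of positive area.\<close>

lemma tight_iff_excess: "tight \<Gamma> V E \<longleftrightarrow> (LINT u|sphere_area. excess u) = 0"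
proof -
  have tight: "tight \<Gamma> V E \<longleftrightarrow> (\<forall>u. good u \<longrightarrow> card (minima u) = 1)"
    unfolding tight_def nondegenerate_iff_good using total_weight_minima(2) by auto
  have int0: "(LINT u|sphere_area. excess u) = 0 \<longleftrightarrow> (AE u in sphere_area. excess u = 0)"
    by (rule integral_nonneg_eq_0_iff_AE[OF excess_integrable]) (simp add: excess_nonneg)
  show ?thesis unfolding int0
  proof
    assume "tight \<Gamma> V E"
    then have "excess u = 0" for u using tight by (auto simp: excess_def indicator_def)
    then show "AE u in sphere_area. excess u = 0" by simp
  next
    assume ae: "AE u in sphere_area. excess u = 0"
    show "tight \<Gamma> V E" unfolding tight
    proof (intro allI impI, rule ccontr)
      fix u assume u: "good u" and "card (minima u) \<noteq> 1"
      then have u2: "card (minima u) > 1" using card_minima_ge_1[OF u] by simp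
      obtain \<epsilon> where \<epsilon>: "\<epsilon> > 0" "\<forall>w. good w \<longrightarrow> dist w u < \<epsilon> \<longrightarrow> card (minima u) \<le> card (minima w)"
        using card_minima_lower_semicontinuous[OF u] by blast
      let ?A = "{w \<in> sphere 0 1. dist w u < \<epsilon>}"
      have "?A = sphere 0 1 \<inter> ball u \<epsilon>" by (auto simp: dist_commute)
      then have A: "?A \<in> sets sphere_area" by (intro in_sets_sphere_area) auto
      have "AE w in sphere_area. w \<notin> ?A"
        using ae AE_good
      proof eventually_elim
        case (elim w)
        then show ?case using \<epsilon>(2) u2 excess_good[of w] by fastforce
      qed
      then have "emeasure sphere_area ?A = 0"
        using AE_iff_measurable[OF A, of "\<lambda>w. w \<notin> ?A"] by (auto simp: space_sphere_area)
      moreover have "u \<in> sphere 0 1" using u by (simp add: good_iff)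
      ultimately show False using sphere_area_open_pos[of u \<epsilon>] \<epsilon>(1) by blast
    qed
  qed
qed

end

theorem corollary2p2:
  fixes \<Gamma> V :: "(real^3) set" and E :: "(real^3) set set"
  assumes "semialgebraic_graph \<Gamma> V E"
  shows "total_curvature \<Gamma> V E \<ge> 1 + real (first_betti \<Gamma>) \<and>
         (total_curvature \<Gamma> V E = 1 + real (first_betti \<Gamma>) \<longleftrightarrow> tight \<Gamma> V E)"
proof -
  have "\<forall>e\<in>E. \<exists>g. edge_param V g e"
    using assms unfolding semialgebraic_graph_def open_edge_def by blast
  then obtain \<gamma> where "\<forall>e\<in>E. edge_param V (\<gamma> e) e" by (rule bchoice[THEN exE])
  then interpret semialg_graph \<Gamma> V E \<gamma> using assms by unfold_locales auto
  have "(LINT u|sphere_area. excess u) \<ge> 0" by (intro Bochner_Integration.integral_nonneg excess_nonneg)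
  then show ?thesis unfolding total_curvature_excess tight_iff_excess by simp
qed

end
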